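(* There exist a constant $C_{\alpha,\beta,\gamma,\eta}>0$ and a constant $C>0$ independent of $k$ such that for every $T\in\mathcal{T}_H$, every $v\in V_H$ and every integer $k\ge 5$, the corrector $\phi_T\in V_{\mathrm f}$ of $v$ associated with $T$ satisfies $$\| \nabla \phi_{T} \|_{U^k_c(T)} + \| \nabla_{\boldsymbol\tau} \phi_{T} \|_{\Gamma\cap U^k_c(T)} \leq C_{\alpha,\beta,\gamma,\eta} \exp(-Ck)\, \bigl(\|\nabla v\|_T+\|\nabla_{\boldsymbol\tau} v\|_{\Gamma_T}\bigr).$$
   Context: Domain and interface. $\Omega\subset\mathbb{R}^2$ is a polygonal domain and $\Gamma\subset\overline\Omega$ is a smooth curve separating $\Omega$ into two subdomains, or more generally a finite union $\Gamma=\bigcup_i\Gamma_i$ of smooth curves which may intersect one another and may end inside $\Omega$ (be immersed). $\nabla_{\boldsymbol\tau}$ is the tangential gradient along $\Gamma$. $(\cdot,\cdot)_\omega$ and $\|\cdot\|_\omega$ are the $L^2(\omega)$ inner product and norm; on subsets of $\Gamma$ they are taken with respect to arc length. $V=H^1_0(\Omega)\cap H^1(\Gamma)$ is the space of functions in $H^1_0(\Omega)$ whose trace on $\Gamma$ is in $H^1(\Gamma)$; for a union of curves, the trace is required to be in $H^1(\Gamma_i)$ for every $i$ and continuous on $\Gamma$. Both $\Omega$ and $\Gamma$ are fixed. Bilinear form. $A$ on $\Omega$ and $A_\Gamma$ on $\Gamma$ are measurable scalar coefficients with $0<\alpha\le A\le\beta<\infty$ a.e. on $\Omega$ and $\alpha\le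 A_\Gamma\le\beta$ a.e. on $\Gamma$. Set $a(u,v)=(A\nabla u,\nabla v)_\Omega+(A_\Gamma\nabla_{\boldsymbol\tau}u,\nabla_{\boldsymbol\tau}v)_\Gamma$. Mesh. $\mathcal{T}_H$ is a quasi-uniform conforming triangulation of $\Omega$ into closed shape-regular triangles with mesh size parameter $H$, and $\gamma$ is a constant with $\max_{T\in\mathcal{T}_H}H/d_T\le\gamma$ and $\max_{T,T'\in\mathcal{T}_H}d_{T'}/d_T\le\gamma$, where $d_T$ is the diameter of the inscribed circle of $T$. $V_H$ is the space of continuous piecewise linear functions on $\mathcal{T}_H$ vanishing on $\partial\Omega$. For $T\in\mathcal{T}_H$, $\Gamma_T=\Gamma\cap T$. Patches. For $\omega\subset\overline\Omega$, $U(\omega)=\bigcup\{T\in\mathcal{T}_H: T\cap\omega\ne\emptyset\}$, $U^0(\omega)=\omega$, $U^k(\omega)=U(U^{k-1}(\omega))$. Also $U_\Gamma(T)=U(T)\cap\Gamma$ and $U^k_c(T)=\overline{\Omega\setminus U^k(T)}$. Interpolation operator. $\mathcal{I}_H:V\to V_H$ is a linear interpolation operator that is a projection onto $V_H$, and there is a constant independent of $H$, written $C_\gamma$, such that for all $v\in V$ and $T\in\mathcal{T}_H$: $\|v-\mathcal{I}_Hv\|_T+\|v-\mathcal{I}_Hv\|_{\Gamma_T}\le C_\gamma H(\|\nabla v\|_{U(T)}+\|\nabla_{\boldsymbol\tau}v\|_{U_\Gamma(T)})$ and $\|\nabla\mathcal{I}_Hv\|_T+\|\nabla_{\boldsymbol\tau}\mathcal{I}_Hv\|_{\Gamma_T}\le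 C_\gamma(\|\nabla v\|_{U(T)}+\|\nabla_{\boldsymbol\tau}v\|_{U_\Gamma(T)})$. Correctors. $V_{\mathrm f}=\{v\in V:\mathcal{I}_Hv=0\}$. For $v\in V_H$ and $T\in\mathcal{T}_H$, the corrector $\phi_T\in V_{\mathrm f}$ (depending on $v$) is the solution of $a(\phi_T,w)=\int_T A\nabla v\cdot\nabla w+\int_{\Gamma_T}A_\Gamma\nabla_{\boldsymbol\tau}v\cdot\nabla_{\boldsymbol\tau}w$ for all $w\in V_{\mathrm f}$. Cutoff functions. For each $T$ and $k$, $\eta_T^k:\Omega\to[0,1]$ is a Lipschitz function equal to $0$ in $U^k(T)$ and $1$ in $U^{k+1}_c(T)$, with $\|\nabla\eta_T^k\|_{L^\infty(\Omega)}\le C_\eta H^{-1}$, where $C_\eta$ is independent of $T,k,H$ (e.g. $\eta_T^k$ continuous piecewise linear on $\mathcal{T}_H$ with nodal values $0$ in $U^k(T)$ and $1$ in $U_c^{k+1}(T)$). Constants. Subscripts indicate dependence: $C_{\alpha,\beta,\gamma,\eta}$ depends only on $\alpha,\beta,\gamma,C_\eta$ (and on the constant $C_\gamma$ of the interpolation operator, and on the fixed $\Omega,\Gamma$). The constant $C$ in the exponent may depend on the same quantities. Neither constant depends on $k,H,T,v$. *)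

theory Defs
  imports "HOL-Analysis.Analysis"
begin

primrec Ck :: "nat \<Rightarrow> ('a::real_normed_vector \<Rightarrow> 'b::real_normed_vector) \<Rightarrow> bool" where
  "Ck 0 f \<longleftrightarrow> continuous_on UNIV f"
| "Ck (Suc k) f \<longleftrightarrow> (\<forall>x. f differentiable (at x)) \<and>
     (\<forall>h. Ck k (\<lambda>x. frechet_derivative f (at x) h))"

definition smooth :: "('a::real_normed_vector \<Rightarrow> 'b::real_normed_vector) \<Rightarrow> bool" where
  "smooth f \<longleftrightarrow> (\<forall>k. Ck k f)"

definition test_function :: "'a::euclidean_space set \<Rightarrow> ('a \<Rightarrow> real) \<Rightarrow> bool" where
  "test_function \<Omega> \<psi> \<longleftrightarrow> smooth \<psi> \<and>
     compact (closure {x. \<psi> x \<noteq> 0}) \<and> closure {x. \<psi> x \<noteq> 0} \<subseteq> \<Omega>"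

definition square_integrable :: "'a measure \<Rightarrow> ('a \<Rightarrow> 'b::euclidean_space) \<Rightarrow> bool" where
  "square_integrable M f \<longleftrightarrow> f \<in> borel_measurable M \<and> integrable M (\<lambda>x. (norm (f x))\<^sup>2)"

definition L2_norm :: "'a measure \<Rightarrow> ('a \<Rightarrow> 'b::euclidean_space) \<Rightarrow> real" where
  "L2_norm M f = sqrt (LINT x|M. (norm (f x))\<^sup>2)"

definition locally_integrable :: "'a::euclidean_space set \<Rightarrow> ('a \<Rightarrow> 'b::euclidean_space) \<Rightarrow> bool" where
  "locally_integrable \<Omega> f \<longleftrightarrow> (\<forall>K. compact K \<longrightarrow> K \<subseteq> \<Omega> \<longrightarrow> f absolutely_integrable_on K)"

definition weak_gradient :: "'a::euclidean_space set \<Rightarrow> ('a \<Rightarrow> real) \<Rightarrow> ('a \<Rightarrow> 'a) \<Rightarrow> bool" where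
  "weak_gradient \<Omega> u g \<longleftrightarrow> locally_integrable \<Omega> u \<and> locally_integrable \<Omega> g \<and>
     (\<forall>\<psi>. test_function \<Omega> \<psi> \<longrightarrow> (\<forall>b\<in>Basis.
        (LINT x|lebesgue_on \<Omega>. u x * frechet_derivative \<psi> (at x) b) =
        - (LINT x|lebesgue_on \<Omega>. (g x \<bullet> b) * \<psi> x)))"

text \<open>Weak gradients are unique only almost everywhere; a representative is chosen, and it is
  only ever used inside integrals and almost-everywhere statements.\<close>

definition grad :: "'a::euclidean_space set \<Rightarrow> ('a \<Rightarrow> real) \<Rightarrow> 'a \<Rightarrow> 'a" where
  "grad \<Omega> u = (SOME g. weak_gradient \<Omega> u g)"

definition H1 :: "'a::euclidean_space set \<Rightarrow> ('a \<Rightarrow> real) set" where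
  "H1 \<Omega> = {u. square_integrable (lebesgue_on \<Omega>) u \<and>
     (\<exists>g. weak_gradient \<Omega> u g \<and> square_integrable (lebesgue_on \<Omega>) g)}"

definition H1_norm :: "'a::euclidean_space set \<Rightarrow> ('a \<Rightarrow> real) \<Rightarrow> real" where
  "H1_norm \<Omega> u = sqrt ((L2_norm (lebesgue_on \<Omega>) u)\<^sup>2 + (L2_norm (lebesgue_on \<Omega>) (grad \<Omega> u))\<^sup>2)"

definition H10 :: "'a::euclidean_space set \<Rightarrow> ('a \<Rightarrow> real) set" where
  "H10 \<Omega> = {u \<in> H1 \<Omega>. \<exists>\<psi>::nat \<Rightarrow> 'a \<Rightarrow> real. (\<forall>n. test_function \<Omega> (\<psi> n)) \<and>
     (\<lambda>n. H1_norm \<Omega> (\<lambda>x. \<psi> n x - u x)) \<longlonglongrightarrow> 0}"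

text \<open>The condition \<open>interior (closure \<Omega>) = \<Omega>\<close> excludes slits and punctures, which a
  triangulation by closed triangles does not see.\<close>

definition polygonal_domain :: "(real^2) set \<Rightarrow> bool" where
  "polygonal_domain \<Omega> \<longleftrightarrow> open \<Omega> \<and> connected \<Omega> \<and> bounded \<Omega> \<and> \<Omega> \<noteq> {} \<and>
     interior (closure \<Omega>) = \<Omega> \<and>
     (\<exists>S. finite S \<and> frontier \<Omega> = (\<Union>(a, b)\<in>S. closed_segment a b))"

text \<open>A curve is a pair of its length and an arc length parametrisation, smooth up to the
  endpoints. It is either a simple arc or a simple closed curve, which is then smooth also at its
  base point. The interface is the union of a list of such curves.\<close>

type_synonym curve = "real \<times> (real \<Rightarrow> real^2)"

definition smooth_curve :: "curve \<Rightarrow> bool" where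
  "smooth_curve C \<longleftrightarrow> (case C of (L, c) \<Rightarrow> 0 < L \<and> smooth c \<and>
     (\<forall>s\<in>{0..L}. norm (vector_derivative c (at s)) = 1) \<and>
     (inj_on c {0..L} \<or> (inj_on c {0..<L} \<and> (\<forall>s. c (s + L) = c s))))"

definition curve_image :: "curve \<Rightarrow> (real^2) set" where
  "curve_image C = (case C of (L, c) \<Rightarrow> c ` {0..L})"

definition interface :: "curve list \<Rightarrow> (real^2) set" where
  "interface \<Gamma> = (\<Union>C\<in>set \<Gamma>. curve_image C)"

text \<open>Arc length on the union of the curves, as a measure on the plane concentrated on
  \<open>interface \<Gamma>\<close>. Points that lie on an earlier curve are skipped, so that an overlap of positive
  length is counted once: this is the length measure of the point set \<open>interface \<Gamma>\<close>. Taking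
  all sets with Lebesgue measurable preimages, not only Borel sets, makes it complete.\<close>

definition arc_params :: "curve list \<Rightarrow> nat \<Rightarrow> (real^2) set \<Rightarrow> real set" where
  "arc_params \<Gamma> i B = (case \<Gamma> ! i of (L, c) \<Rightarrow>
     {s\<in>{0..L}. c s \<in> B \<and> c s \<notin> interface (take i \<Gamma>)})"

definition arc_length :: "curve list \<Rightarrow> (real^2) measure" where
  "arc_length \<Gamma> = measure_of UNIV {B. \<forall>i<length \<Gamma>. arc_params \<Gamma> i B \<in> sets lebesgue}
     (\<lambda>B. \<Sum>i<length \<Gamma>. emeasure lebesgue (arc_params \<Gamma> i B))"

text \<open>The tangential gradient is the weak arc length derivative times the unit tangent. At a point
  on several curves it is taken along the first one, as in \<^const>\<open>arc_length\<close>; on an overlap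
  the result is the same along each of the curves, almost everywhere.\<close>

definition tgrad :: "curve list \<Rightarrow> (real^2 \<Rightarrow> real) \<Rightarrow> real^2 \<Rightarrow> real^2" where
  "tgrad \<Gamma> u x = (case hd (filter (\<lambda>C. x \<in> curve_image C) \<Gamma>) of (L, c) \<Rightarrow>
     let s = (SOME s. s \<in> {0..L} \<and> c s = x)
     in grad {0<..<L} (u \<circ> c) s *\<^sub>R vector_derivative c (at s))"

text \<open>The trace on the interface of a function in \<open>H10 \<Omega>\<close>: the extension by continuity, from test
  functions in the \<open>H1\<close> norm to square integrable functions, of the restriction map.\<close>

definition is_trace :: "(real^2) set \<Rightarrow> curve list \<Rightarrow> (real^2 \<Rightarrow> real) \<Rightarrow> (real^2 \<Rightarrow> real) \<Rightarrow> bool" where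
  "is_trace \<Omega> \<Gamma> u g \<longleftrightarrow> square_integrable (arc_length \<Gamma>) g \<and>
     (\<exists>\<psi>::nat \<Rightarrow> real^2 \<Rightarrow> real. (\<forall>n. test_function \<Omega> (\<psi> n)) \<and>
        (\<lambda>n. H1_norm \<Omega> (\<lambda>x. \<psi> n x - u x)) \<longlonglongrightarrow> 0 \<and>
        (\<lambda>n. L2_norm (arc_length \<Gamma>) (\<lambda>x. \<psi> n x - g x)) \<longlonglongrightarrow> 0)"

text \<open>The space \<open>H10 \<Omega> \<inter> H1 \<Gamma>\<close>. Elements of \<open>H10 \<Omega>\<close> matter only up to null sets of the plane,
  such as the interface. We use this freedom to let each element carry its trace: the members of
  \<open>V\<close> are those representatives whose values on the interface are the continuous version of the
  trace. Two members that agree almost everywhere in \<open>\<Omega>\<close> then agree on the interface.\<close>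

definition V :: "(real^2) set \<Rightarrow> curve list \<Rightarrow> (real^2 \<Rightarrow> real) set" where
  "V \<Omega> \<Gamma> = {u \<in> H10 \<Omega>. is_trace \<Omega> \<Gamma> u u \<and> continuous_on (interface \<Gamma>) u \<and>
     (\<forall>(L, c)\<in>set \<Gamma>. u \<circ> c \<in> H1 {0<..<L})}"

definition dnorm :: "(real^2) set \<Rightarrow> (real^2) set \<Rightarrow> (real^2 \<Rightarrow> 'b::euclidean_space) \<Rightarrow> real" where
  "dnorm \<Omega> \<omega> f = L2_norm (lebesgue_on (\<Omega> \<inter> \<omega>)) f"

definition gnorm :: "curve list \<Rightarrow> (real^2) set \<Rightarrow> (real^2 \<Rightarrow> 'b::euclidean_space) \<Rightarrow> real" where
  "gnorm \<Gamma> \<omega> f = L2_norm (restrict_space (arc_length \<Gamma>) (interface \<Gamma> \<inter> \<omega>)) f"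

definition form_on :: "(real^2) set \<Rightarrow> curve list \<Rightarrow> (real^2 \<Rightarrow> real) \<Rightarrow> (real^2 \<Rightarrow> real) \<Rightarrow>
    (real^2) set \<Rightarrow> (real^2 \<Rightarrow> real) \<Rightarrow> (real^2 \<Rightarrow> real) \<Rightarrow> real" where
  "form_on \<Omega> \<Gamma> A A\<^sub>\<Gamma> \<omega> u w =
     (LINT x|lebesgue_on (\<Omega> \<inter> \<omega>). A x * (grad \<Omega> u x \<bullet> grad \<Omega> w x)) +
     (LINT x|restrict_space (arc_length \<Gamma>) (interface \<Gamma> \<inter> \<omega>). A\<^sub>\<Gamma> x * (tgrad \<Gamma> u x \<bullet> tgrad \<Gamma> w x))"

definition bilinear_form :: "(real^2) set \<Rightarrow> curve list \<Rightarrow> (real^2 \<Rightarrow> real) \<Rightarrow> (real^2 \<Rightarrow> real) \<Rightarrow>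
    (real^2 \<Rightarrow> real) \<Rightarrow> (real^2 \<Rightarrow> real) \<Rightarrow> real" where
  "bilinear_form \<Omega> \<Gamma> A A\<^sub>\<Gamma> u w = form_on \<Omega> \<Gamma> A A\<^sub>\<Gamma> (closure \<Omega>) u w"

definition coefficients :: "(real^2) set \<Rightarrow> curve list \<Rightarrow> real \<Rightarrow> real \<Rightarrow>
    (real^2 \<Rightarrow> real) \<Rightarrow> (real^2 \<Rightarrow> real) \<Rightarrow> bool" where
  "coefficients \<Omega> \<Gamma> \<alpha> \<beta> A A\<^sub>\<Gamma> \<longleftrightarrow>
     A \<in> borel_measurable (lebesgue_on \<Omega>) \<and> (AE x in lebesgue_on \<Omega>. \<alpha> \<le> A x \<and> A x \<le> \<beta>) \<and>
     A\<^sub>\<Gamma> \<in> borel_measurable (arc_length \<Gamma>) \<and> (AE x in arc_length \<Gamma>. \<alpha> \<le> A\<^sub>\<Gamma> x \<and> A\<^sub>\<Gamma> x \<le> \<beta>)"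

text \<open>The inscribed circle of a triangle bounds the largest disc contained in it.\<close>

definition incircle_diameter :: "(real^2) set \<Rightarrow> real" where
  "incircle_diameter T = Sup {2 * r |r x. 0 \<le> r \<and> cball x r \<subseteq> T}"

text \<open>Faces of a 2-simplex are the empty set, its vertices, its edges and itself, so
  \<^const>\<open>triangulation\<close> expresses conformity. Together with \<open>diameter T \<le> H\<close>, the bound
  \<open>H \<le> \<gamma> * incircle_diameter T\<close> gives shape regularity.\<close>

definition mesh :: "(real^2) set \<Rightarrow> real \<Rightarrow> real \<Rightarrow> (real^2) set set \<Rightarrow> bool" where
  "mesh \<Omega> \<gamma> H \<T> \<longleftrightarrow> triangulation \<T> \<and> (\<forall>T\<in>\<T>. 2 simplex T) \<and> \<Union>\<T> = closure \<Omega> \<and>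
     0 < H \<and> (\<forall>T\<in>\<T>. diameter T \<le> H) \<and>
     (\<forall>T\<in>\<T>. H / incircle_diameter T \<le> \<gamma>) \<and>
     (\<forall>T\<in>\<T>. \<forall>T'\<in>\<T>. incircle_diameter T' / incircle_diameter T \<le> \<gamma>)"

text \<open>Finite element functions are extended by zero outside \<open>\<Omega>\<close>.\<close>

definition VH :: "(real^2) set \<Rightarrow> (real^2) set set \<Rightarrow> (real^2 \<Rightarrow> real) set" where
  "VH \<Omega> \<T> = {v. continuous_on (closure \<Omega>) v \<and>
     (\<forall>T\<in>\<T>. \<exists>a b. \<forall>x\<in>T. v x = a \<bullet> x + b) \<and> (\<forall>x. x \<notin> \<Omega> \<longrightarrow> v x = 0)}"

definition patch :: "(real^2) set set \<Rightarrow> (real^2) set \<Rightarrow> (real^2) set" where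
  "patch \<T> \<omega> = \<Union>{T\<in>\<T>. T \<inter> \<omega> \<noteq> {}}"

definition patch_iter :: "(real^2) set set \<Rightarrow> nat \<Rightarrow> (real^2) set \<Rightarrow> (real^2) set" where
  "patch_iter \<T> k = patch \<T> ^^ k"

definition far :: "(real^2) set \<Rightarrow> (real^2) set set \<Rightarrow> nat \<Rightarrow> (real^2) set \<Rightarrow> (real^2) set" where
  "far \<Omega> \<T> k T = closure (\<Omega> - patch_iter \<T> k T)"

text \<open>An operator that satisfies these conditions respects equality almost everywhere in \<open>\<Omega>\<close>:
  the estimates bound the difference of the images by the gradients of the difference.\<close>

definition interpolation :: "(real^2) set \<Rightarrow> curve list \<Rightarrow> real \<Rightarrow> real \<Rightarrow> (real^2) set set \<Rightarrow>
    ((real^2 \<Rightarrow> real) \<Rightarrow> (real^2 \<Rightarrow> real)) \<Rightarrow> bool" where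
  "interpolation \<Omega> \<Gamma> C\<^sub>I H \<T> I \<longleftrightarrow>
     (\<forall>v\<in>V \<Omega> \<Gamma>. I v \<in> VH \<Omega> \<T>) \<and>
     (\<forall>u\<in>V \<Omega> \<Gamma>. \<forall>v\<in>V \<Omega> \<Gamma>. I (\<lambda>x. u x + v x) = (\<lambda>x. I u x + I v x)) \<and>
     (\<forall>r. \<forall>v\<in>V \<Omega> \<Gamma>. I (\<lambda>x. r * v x) = (\<lambda>x. r * I v x)) \<and>
     (\<forall>v\<in>VH \<Omega> \<T>. I v = v) \<and>
     (\<forall>v\<in>V \<Omega> \<Gamma>. \<forall>T\<in>\<T>.
        dnorm \<Omega> T (\<lambda>x. v x - I v x) + gnorm \<Gamma> T (\<lambda>x. v x - I v x)
          \<le> C\<^sub>I * H * (dnorm \<Omega> (patch \<T> T) (grad \<Omega> v) + gnorm \<Gamma> (patch \<T> T) (tgrad \<Gamma> v)) \<and>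
        dnorm \<Omega> T (grad \<Omega> (I v)) + gnorm \<Gamma> T (tgrad \<Gamma> (I v))
          \<le> C\<^sub>I * (dnorm \<Omega> (patch \<T> T) (grad \<Omega> v) + gnorm \<Gamma> (patch \<T> T) (tgrad \<Gamma> v)))"

definition Vf :: "(real^2) set \<Rightarrow> curve list \<Rightarrow> ((real^2 \<Rightarrow> real) \<Rightarrow> (real^2 \<Rightarrow> real)) \<Rightarrow>
    (real^2 \<Rightarrow> real) set" where
  "Vf \<Omega> \<Gamma> I = {v \<in> V \<Omega> \<Gamma>. I v = (\<lambda>x. 0)}"

definition corrector :: "(real^2) set \<Rightarrow> curve list \<Rightarrow> (real^2 \<Rightarrow> real) \<Rightarrow> (real^2 \<Rightarrow> real) \<Rightarrow>
    ((real^2 \<Rightarrow> real) \<Rightarrow> (real^2 \<Rightarrow> real)) \<Rightarrow> (real^2 \<Rightarrow> real) \<Rightarrow> (real^2) set \<Rightarrow>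
    (real^2 \<Rightarrow> real) \<Rightarrow> bool" where
  "corrector \<Omega> \<Gamma> A A\<^sub>\<Gamma> I v T \<phi> \<longleftrightarrow> \<phi> \<in> Vf \<Omega> \<Gamma> I \<and>
     (\<forall>w\<in>Vf \<Omega> \<Gamma> I. bilinear_form \<Omega> \<Gamma> A A\<^sub>\<Gamma> \<phi> w = form_on \<Omega> \<Gamma> A A\<^sub>\<Gamma> T v w)"

definition cutoff :: "(real^2) set \<Rightarrow> real \<Rightarrow> real \<Rightarrow> (real^2) set set \<Rightarrow> (real^2) set \<Rightarrow> nat \<Rightarrow>
    (real^2 \<Rightarrow> real) \<Rightarrow> bool" where
  "cutoff \<Omega> C\<^sub>\<eta> H \<T> T k \<eta> \<longleftrightarrow>
     (\<forall>x\<in>\<Omega>. 0 \<le> \<eta> x \<and> \<eta> x \<le> 1) \<and> (\<exists>K. K-lipschitz_on \<Omega> \<eta>) \<and>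
     (\<forall>x\<in>\<Omega> \<inter> patch_iter \<T> k T. \<eta> x = 0) \<and> (\<forall>x\<in>\<Omega> \<inter> far \<Omega> \<T> (k + 1) T. \<eta> x = 1) \<and>
     (\<exists>g. weak_gradient \<Omega> \<eta> g \<and> (AE x in lebesgue_on \<Omega>. norm (g x) \<le> C\<^sub>\<eta> / H))"

end

theory Submission
  imports Defs "HOL-Computational_Algebra.Polynomial"
begin

text \<open>Let \<open>\<eta>\<close> be the cutoff that vanishes on \<open>U\<^sup>k(T)\<close>. The function \<open>w = \<eta>\<phi> - I(\<eta>\<phi>)\<close> is admissible in the
  corrector equation for \<open>\<phi>\<close> and has no gradient on \<open>T\<close>, so \<open>a(\<phi>, w) = 0\<close>. Outside a ring of a few layers of
  triangles around \<open>U\<^sup>k(T)\<close> the gradient of \<open>w\<close> is \<open>0\<close> (inside) or that of \<open>\<phi>\<close> (outside), since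
  \<open>I\<phi> = 0\<close>. On the ring all terms are bounded by the energy of \<open>\<phi>\<close> on a slightly larger ring: the factor \<open>1/H\<close>
  from the gradient of \<open>\<eta>\<close> is compensated by the estimate of \<open>\<phi> = \<phi> - I\<phi>\<close>, and shape regularity bounds the
  number of neighbours of a triangle. Hence the energy \<open>e j\<close> of \<open>\<phi>\<close> outside \<open>U\<^sup>j(T)\<close> satisfies
  \<open>e (j + 11) \<le> c * (e j - e (j + 11))\<close>, which gives geometric decay.

  The work is in showing that \<open>\<eta>\<phi>\<close> and finite element functions belong to \<open>V\<close>, that is, in the
  product rule for weak and tangential gradients and in approximation by test functions; the bound
  on the gradient of \<open>\<eta>\<close> reaches the interface only through a Lipschitz estimate on small balls,
  because the interface is a null set of the plane.\<close>

section \<open>Smooth functions and mollifiers\<close>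

text \<open>Locality of \<open>I\<close> is read off its estimates: a function without gradient on
  the patch of a triangle has an image without gradient on that triangle. With the cutoff between
  layers j + 5 and j + 6, the gradient of \<open>I (\<eta>\<phi>)\<close> lives on triangles that
  miss layer j + 2 and meet layer j + 7. Bounding it there involves patches of neighbours, which
  widens the ring to j and j + 9, and two more layers separate that ring from the far region: hence
  11.

  Membership in \<open>V\<close> asks for one sequence of test functions that converges in H1 and,
  on the null set \<open>interface \<Gamma>\<close>, in L2. Such sequences are therefore constructed
  only for continuous functions with compact support and bounded weak gradient: values converge
  uniformly, which serves both measures, and gradients stay bounded and converge in L1, hence in L2.
  Other functions are first brought into this form, by a product with a test function or by
  truncation at small heights.

  Weak derivatives of arbitrary Lipschitz functions are constructed only on the line, along the
  curves. In the plane the gradient is given (cutoff) or explicit (finite elements).\<close>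

lemma Ck_Suc_imp_Ck: "Ck (Suc k) f \<Longrightarrow> Ck k f"
proof (induction k arbitrary: f)
  case 0
  then show ?case
    by (simp add: continuous_at_imp_continuous_on differentiable_imp_continuous_within)
next
  case (Suc k)
  then show ?case by (metis Ck.simps(2))
qed

lemma Ck_const [simp]: "Ck k (\<lambda>x. c)"
  by (induction k arbitrary: c) (auto simp: frechet_derivative_const)

lemma Ck_bounded_linear:
  assumes "bounded_linear f"
  shows "Ck k f"
proof (cases k)
  case 0
  then show ?thesis
    using assms by (simp add: linear_continuous_on)
next
  case (Suc k)
  have d: "(f has_derivative f) (at x)" for x
    using assms by (rule bounded_linear_imp_has_derivative)
  then have "frechet_derivative f (at x) = f" for x
    by (metis frechet_derivative_at)
  then show ?thesis
    using d Suc by (simp add: differentiableI[OF d])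
qed

lemma frechet_derivative_eqI:
  assumes "(f has_derivative f') (at x)"
  shows "frechet_derivative f (at x) = f'"
  using frechet_derivative_at[OF assms] by simp

lemma Ck_add:
  assumes "Ck k f" "Ck k g"
  shows "Ck k (\<lambda>x. f x + g x)"
  using assms
proof (induction k arbitrary: f g)
  case 0
  then show ?case by (auto intro: continuous_intros)
next
  case (Suc k)
  have "frechet_derivative (\<lambda>x. f x + g x) (at x) =
     (\<lambda>h. frechet_derivative f (at x) h + frechet_derivative g (at x) h)" for x
    using Suc.prems
    by (intro frechet_derivative_eqI has_derivative_add) (auto simp: frechet_derivative_works[symmetric])
  then show ?case
    using Suc by auto
qed

lemma Ck_mult:
  fixes f g :: "'a::real_normed_vector \<Rightarrow> real"
  assumes "Ck k f" "Ck k g"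
  shows "Ck k (\<lambda>x. f x * g x)"
  using assms
proof (induction k arbitrary: f g)
  case 0
  then show ?case by (auto intro: continuous_intros)
next
  case (Suc k)
  have "frechet_derivative (\<lambda>x. f x * g x) (at x) =
     (\<lambda>h. f x * frechet_derivative g (at x) h + frechet_derivative f (at x) h * g x)" for x
    using Suc.prems
    by (intro frechet_derivative_eqI has_derivative_mult) (auto simp: frechet_derivative_works[symmetric])
  \<comment> \<open>The product rule also contains the undifferentiated factors, which is why
    \<open>Ck (Suc k)\<close> has to imply \<open>Ck k\<close>.\<close>
  moreover have "Ck k (\<lambda>x. f x * frechet_derivative g (at x) h + frechet_derivative f (at x) h * g x)" for h
    using Suc.prems Ck_Suc_imp_Ck[OF Suc.prems(1)] Ck_Suc_imp_Ck[OF Suc.prems(2)]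
    by (intro Ck_add Suc.IH) simp_all
  ultimately show ?case
    using Suc.prems by auto
qed

lemma Ck_sum:
  "(\<And>i. i \<in> I \<Longrightarrow> Ck k (f i)) \<Longrightarrow> Ck k (\<lambda>x. \<Sum>i\<in>I. f i x)"
  by (induction I rule: infinite_finite_induct) (simp_all add: Ck_add)

lemma smooth_Suc:
  assumes "smooth f"
  shows "f differentiable (at x)" "Ck k (\<lambda>x. frechet_derivative f (at x) h)"
proof -
  have "Ck (Suc k) f" using assms unfolding smooth_def by (rule spec)
  then show "f differentiable (at x)" "Ck k (\<lambda>x. frechet_derivative f (at x) h)"
    by simp_all
qed

lemma smooth_frechet_derivative:
  "smooth f \<Longrightarrow> smooth (\<lambda>x. frechet_derivative f (at x) h)"
  unfolding smooth_def[of "\<lambda>x. frechet_derivative f (at x) h"] by (simp add: smooth_Suc)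

lemmas smooth_differentiable = smooth_Suc(1)

lemma smooth_continuous: "smooth f \<Longrightarrow> continuous_on S f"
  by (simp add: continuous_at_imp_continuous_on differentiable_imp_continuous_within smooth_differentiable)

lemma smooth_has_derivative:
  "smooth f \<Longrightarrow> (f has_derivative frechet_derivative f (at x)) (at x)"
  using smooth_differentiable[of f x] by (simp add: frechet_derivative_works)

text \<open>The outer function is real, so the chain rule produces a scalar product of derivatives
  and \<open>Ck_mult\<close> closes the induction. \<open>g\<close> varies in the induction because
  it is replaced by its derivative while \<open>f\<close> stays.\<close>

lemma Ck_compose_real:
  fixes g :: "real \<Rightarrow> real" and f :: "'a::real_normed_vector \<Rightarrow> real"
  assumes "smooth g" "Ck k f"
  shows "Ck k (\<lambda>x. g (f x))"
  using assms
proof (induction k arbitrary: g)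
  case 0
  then show ?case
    using continuous_on_compose2[OF smooth_continuous[OF 0(1), of UNIV], of UNIV f] by auto
next
  case (Suc k)
  let ?g' = "\<lambda>y. frechet_derivative g (at y) 1"
  have lin: "frechet_derivative g (at y) h = h * ?g' y" for y h
    using linear_scale[OF linear_frechet_derivative[OF smooth_differentiable[OF Suc.prems(1), of y]], of h 1]
    by simp
  have d: "((\<lambda>x. g (f x)) has_derivative (\<lambda>h. frechet_derivative g (at (f x)) (frechet_derivative f (at x) h))) (at x)" for x
    using Suc.prems(2)
    by (intro has_derivative_compose[OF _ smooth_has_derivative[OF Suc.prems(1)]])
      (auto simp: frechet_derivative_works[symmetric])
  have "Ck k (\<lambda>x. ?g' (f x))" if "Ck k f"
    using Suc.IH smooth_frechet_derivative[OF Suc.prems(1)] that by blast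
  then have "Ck k (\<lambda>x. frechet_derivative f (at x) h * ?g' (f x))" for h
    using Suc.prems(2) Ck_Suc_imp_Ck[OF Suc.prems(2)] by (intro Ck_mult) auto
  then show ?case
    unfolding Ck.simps frechet_derivative_eqI[OF d] lin[of _ "frechet_derivative f _ _"]
    using differentiableI[OF d] by simp
qed

lemma smooth_const: "smooth (\<lambda>x. c)"
  by (simp add: smooth_def)

lemma smooth_add: "smooth f \<Longrightarrow> smooth g \<Longrightarrow> smooth (\<lambda>x. f x + g x)"
  by (simp add: smooth_def Ck_add)

lemma smooth_mult:
  fixes f g :: "'a::real_normed_vector \<Rightarrow> real"
  shows "smooth f \<Longrightarrow> smooth g \<Longrightarrow> smooth (\<lambda>x. f x * g x)"
  by (simp add: smooth_def Ck_mult)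

text \<open>The class of functions \<open>p(1/t) exp(-1/t)\<close> with polynomial \<open>p\<close>, extended by zero to \<open>t \<le> 0\<close>,
  is closed under differentiation, so its members are smooth.\<close>

definition exp_poly :: "real poly \<Rightarrow> real \<Rightarrow> real" where
  "exp_poly p t = (if t > 0 then poly p (1 / t) * exp (- (1 / t)) else 0)"

lemma tendsto_poly_mult_exp_neg:
  fixes p :: "real poly"
  shows "((\<lambda>x. poly p x * exp (- x)) \<longlongrightarrow> 0) at_top"
proof -
  have "((\<lambda>x. \<Sum>i\<le>degree p. coeff p i * (x ^ i / exp x)) \<longlongrightarrow> (\<Sum>i\<le>degree p. coeff p i * 0)) at_top"
    by (intro tendsto_intros tendsto_power_div_exp_0)
  then show ?thesis
    by (simp add: poly_altdef exp_minus sum_distrib_right divide_inverse mult.assoc)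
qed

text \<open>With \<open>x = 1 / t\<close> one has \<open>dx/dt = - x^2\<close>, and the derivative
  of \<open>p x * exp (- x)\<close> in \<open>x\<close> is \<open>(p' - p) x * exp (- x)\<close>;
  their product explains the polynomial.\<close>

lemma exp_poly_has_derivative:
  "(exp_poly p has_real_derivative exp_poly ([:0, 0, 1:] * (p - pderiv p)) t) (at t)"
proof -
  consider "t > 0" | "t < 0" | "t = 0" by linarith
  then show ?thesis
  proof cases
    case 1
    have "((\<lambda>t. poly p (1 / t) * exp (- (1 / t))) has_real_derivative
        exp_poly ([:0, 0, 1:] * (p - pderiv p)) t) (at t)"
      using 1 unfolding exp_poly_def
      by (auto intro!: derivative_eq_intros poly_DERIV[THEN DERIV_chain2] simp: field_simps power2_eq_square)
    moreover have ev: "\<forall>\<^sub>F x in nhds t. exp_poly p x = poly p (1 / x) * exp (- (1 / x))"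
      using eventually_nhds_in_open[of "{0<..}" t] 1
      by (auto simp: exp_poly_def elim!: eventually_mono)
    ultimately show ?thesis
      using DERIV_cong_ev[OF refl ev refl] by simp
  next
    case 2
    have "((\<lambda>t. 0::real) has_real_derivative 0) (at t)" by simp
    moreover have ev: "\<forall>\<^sub>F x in nhds t. exp_poly p x = 0"
      using eventually_nhds_in_open[of "{..<0}" t] 2
      by (auto simp: exp_poly_def elim!: eventually_mono)
    ultimately show ?thesis
      using DERIV_cong_ev[OF refl ev refl, of 0] 2 by (simp add: exp_poly_def[of _ t])
  next
    case 3
    have right: "((\<lambda>h. exp_poly p h / h) \<longlongrightarrow> 0) (at_right 0)"
    proof -
      \<comment> \<open>The difference quotient at \<open>0\<close> is
        \<open>x * p x * exp (- x)\<close> with \<open>x = 1 / h\<close>; \<open>pCons 0\<close> is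
        multiplication by \<open>x\<close>.\<close>
      have "((\<lambda>x. poly (pCons 0 p) x * exp (- x)) \<longlongrightarrow> 0) at_top"
        by (rule tendsto_poly_mult_exp_neg)
      then have "((\<lambda>h. poly (pCons 0 p) (inverse h) * exp (- inverse h)) \<longlongrightarrow> 0) (at_right 0)"
        by (rule filterlim_compose[OF _ filterlim_inverse_at_top_right])
      moreover have "\<forall>\<^sub>F h in at_right (0::real). poly (pCons 0 p) (inverse h) * exp (- inverse h) = exp_poly p h / h"
        using eventually_at_right_less[of 0]
        by eventually_elim (auto simp: exp_poly_def divide_inverse)
      ultimately show ?thesis
        by (rule Lim_transform_eventually)
    qed
    have left: "((\<lambda>h. exp_poly p h / h) \<longlongrightarrow> 0) (at_left 0)"
    proof -
      have "\<forall>\<^sub>F h in at_left (0::real). 0 = exp_poly p h / h"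
        by (auto simp: exp_poly_def eventually_at_filter)
      then show ?thesis
        by (rule Lim_transform_eventually[OF tendsto_const])
    qed
    show ?thesis
      using 3 filterlim_split_at[OF left right] by (simp add: DERIV_def exp_poly_def)
  qed
qed

lemma smooth_exp_poly: "smooth (exp_poly p)"
proof -
  have d: "(exp_poly p has_derivative (\<lambda>h. exp_poly ([:0, 0, 1:] * (p - pderiv p)) t * h)) (at t)" for t p
    using exp_poly_has_derivative[of p t] by (simp add: has_field_derivative_def)
  have "Ck k (exp_poly p)" for k
  proof (induction k arbitrary: p)
    case 0
    then show ?case
      by (auto intro: continuous_at_imp_continuous_on has_derivative_continuous[OF d])
  next
    case (Suc k)
    have "Ck k (\<lambda>t. exp_poly ([:0, 0, 1:] * (p - pderiv p)) t * h)" for h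
      using Suc by (intro Ck_mult) auto
    then show ?case
      using differentiableI[OF d] by (simp only: Ck.simps frechet_derivative_eqI[OF d] simp_thms)
  qed
  then show ?thesis unfolding smooth_def by blast
qed

lemma test_function_continuous: "test_function \<Omega> \<psi> \<Longrightarrow> continuous_on S \<psi>"
  by (simp add: test_function_def smooth_continuous)

lemma test_function_outside: "test_function \<Omega> \<psi> \<Longrightarrow> x \<notin> \<Omega> \<Longrightarrow> \<psi> x = 0"
  using closure_subset[of "{x. \<psi> x \<noteq> 0}"] by (auto simp: test_function_def)

lemma test_functionI:
  assumes "smooth \<psi>" "compact K" "K \<subseteq> \<Omega>" "\<And>x. x \<notin> K \<Longrightarrow> \<psi> x = 0"
  shows "test_function \<Omega> \<psi>"
proof -
  have "closure {x. \<psi> x \<noteq> 0} \<subseteq> K"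
    using assms by (intro closure_minimal) (auto intro: compact_imp_closed)
  moreover from this have "compact (closure {x. \<psi> x \<noteq> 0})"
    using assms(2) compact_Int_closed[OF assms(2) closed_closure] by (metis inf.absorb2)
  ultimately show ?thesis
    using assms unfolding test_function_def by auto
qed

lemma test_function_mono: "test_function \<Omega> \<psi> \<Longrightarrow> \<Omega> \<subseteq> \<Omega>' \<Longrightarrow> test_function \<Omega>' \<psi>"
  by (auto simp: test_function_def)

text \<open>Off its closed support a function vanishes on an open set, hence so do its derivatives.
  One compact set thus serves for both.\<close>

lemma test_function_support:
  assumes "test_function \<Omega> \<psi>"
  obtains K where "compact K" "K \<subseteq> \<Omega>" "\<And>x. x \<notin> K \<Longrightarrow> \<psi> x = 0"
    "\<And>x h. x \<notin> K \<Longrightarrow> frechet_derivative \<psi> (at x) h = 0"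
proof
  let ?K = "closure {x. \<psi> x \<noteq> 0}"
  show "compact ?K" "?K \<subseteq> \<Omega>" using assms by (auto simp: test_function_def)
  show zero: "\<psi> x = 0" if "x \<notin> ?K" for x
    using that subsetD[OF closure_subset, of x "{x. \<psi> x \<noteq> 0}"] by (metis mem_Collect_eq)
  show "frechet_derivative \<psi> (at x) h = 0" if x: "x \<notin> ?K" for x h
  proof -
    have "(\<psi> has_derivative (\<lambda>h. 0)) (at x)"
    proof (rule has_derivative_transform_within_open)
      show "((\<lambda>x. 0) has_derivative (\<lambda>h. 0)) (at x)" by simp
      show "open (- ?K)" by (simp add: open_Compl)
      show "x \<in> - ?K" using x by simp
      show "\<And>y. y \<in> - ?K \<Longrightarrow> 0 = \<psi> y" using zero by (metis ComplD)
    qed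
    then show ?thesis by (simp add: frechet_derivative_eqI)
  qed
qed

lemma test_function_add:
  assumes "test_function \<Omega> f" "test_function \<Omega> g"
  shows "test_function \<Omega> (\<lambda>x. f x + g x)"
proof -
  obtain K where "compact K" "K \<subseteq> \<Omega>" "\<And>x. x \<notin> K \<Longrightarrow> f x = 0"
    by (rule test_function_support[OF assms(1)]) blast
  moreover obtain L where "compact L" "L \<subseteq> \<Omega>" "\<And>x. x \<notin> L \<Longrightarrow> g x = 0"
    by (rule test_function_support[OF assms(2)]) blast
  ultimately show ?thesis
    using assms by (intro test_functionI[of _ "K \<union> L"]) (auto simp: test_function_def intro: smooth_add)
qed

lemma test_function_mult_smooth:
  assumes "test_function \<Omega> f" "smooth g"
  shows "test_function \<Omega> (\<lambda>x. f x * g x)"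
proof -
  obtain K where "compact K" "K \<subseteq> \<Omega>" "\<And>x. x \<notin> K \<Longrightarrow> f x = 0"
    by (rule test_function_support[OF assms(1)]) blast
  then show ?thesis
    using assms by (intro test_functionI[of _ "K"]) (auto simp: test_function_def intro: smooth_mult)
qed

lemma test_function_frechet_derivative:
  assumes "test_function \<Omega> f"
  shows "test_function \<Omega> (\<lambda>x. frechet_derivative f (at x) h)"
proof -
  obtain K where "compact K" "K \<subseteq> \<Omega>" "\<And>x h. x \<notin> K \<Longrightarrow> frechet_derivative f (at x) h = 0"
    by (rule test_function_support[OF assms(1)]) blast
  then show ?thesis
    using assms by (intro test_functionI[of _ "K"]) (auto simp: test_function_def intro: smooth_frechet_derivative)
qed

text \<open>The norm is not smooth at \<open>0\<close>, but its square is a polynomial in the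
  coordinates; the bump function is built from the square.\<close>

lemma smooth_inner_self: "smooth (\<lambda>x::'a::euclidean_space. x \<bullet> x)"
proof -
  have "Ck k (\<lambda>x::'a. \<Sum>b\<in>Basis. (x \<bullet> b) * (x \<bullet> b))" for k
    by (intro Ck_sum Ck_mult Ck_bounded_linear bounded_linear_inner_left)
  then have "smooth (\<lambda>x::'a. \<Sum>b\<in>Basis. (x \<bullet> b) * (x \<bullet> b))"
    unfolding smooth_def by blast
  then show ?thesis
    by (subst euclidean_inner)
qed

lemma continuous_compact_support_integrable:
  fixes f :: "'a::euclidean_space \<Rightarrow> real"
  assumes "continuous_on UNIV f" "compact K" "\<And>x. x \<notin> K \<Longrightarrow> f x = 0"
  shows "integrable lborel f"
proof -
  have "integrable lborel (\<lambda>x. indicator K x *\<^sub>R f x)"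
    by (rule borel_integrable_compact[OF assms(2) continuous_on_subset[OF assms(1)]]) simp
  moreover have "(\<lambda>x. indicator K x *\<^sub>R f x) = f"
    using assms(3) by (auto simp: indicator_def fun_eq_iff)
  ultimately show ?thesis by simp
qed

lemma mollifier_exists:
  fixes e :: real
  assumes "0 < e"
  obtains \<rho> :: "'a::euclidean_space \<Rightarrow> real" where "test_function UNIV \<rho>" "\<And>x. 0 \<le> \<rho> x"
    "\<And>x. e \<le> norm x \<Longrightarrow> \<rho> x = 0" "integrable lborel \<rho>" "(LINT x|lborel. \<rho> x) = 1"
proof -
  \<comment> \<open>The profile \<open>exp (- 1 / t)\<close> at \<open>t = e^2 - norm x ^ 2\<close>:
    positive exactly on the open ball of radius \<open>e\<close>.\<close>
  define B where "B = (\<lambda>x::'a. exp_poly 1 (e\<^sup>2 + (-1) * (x \<bullet> x)))"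
  have sm: "smooth B"
  proof -
    have "Ck k (\<lambda>x::'a. e\<^sup>2 + (-1) * (x \<bullet> x))" for k
      using smooth_inner_self[where 'a='a] by (intro Ck_add[OF Ck_const] Ck_mult[OF Ck_const]) (simp add: smooth_def)
    then show ?thesis
      unfolding smooth_def B_def using Ck_compose_real[OF smooth_exp_poly] by blast
  qed
  have supp: "B x = 0" if "e \<le> norm x" for x
    using that assms power_mono[of e "norm x" 2] unfolding B_def exp_poly_def
    by (auto simp: power2_norm_eq_inner)
  have nn: "0 \<le> B x" for x unfolding B_def exp_poly_def by auto
  have supp': "B x = 0" if "x \<notin> cball 0 e" for x using supp that by auto
  have cont: "continuous_on UNIV B" using sm smooth_continuous by blast
  have int: "integrable lborel B"
    using continuous_compact_support_integrable[OF cont compact_cball supp'] .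
  have pos: "B x > 0" if "x \<in> ball 0 e" for x
  proof -
    have "(norm x)\<^sup>2 < e\<^sup>2" using that by (intro power_strict_mono) auto
    then show ?thesis by (auto simp: B_def exp_poly_def power2_norm_eq_inner)
  qed
  \<comment> \<open>A nonnegative function with integral zero vanishes almost everywhere, whereas
    \<open>B\<close> is positive on a ball, which has positive measure.\<close>
  have ne: "(LINT x|lborel. B x) \<noteq> 0"
  proof
    assume "(LINT x|lborel. B x) = 0"
    then have "AE x in lborel. B x = 0"
      using integral_nonneg_eq_0_iff_AE[OF int] nn by simp
    then have "AE x in lborel. x \<notin> ball (0::'a) e" by eventually_elim (use pos in force)
    then have "emeasure lborel (ball (0::'a) e) = 0"
      by (subst (asm) AE_iff_measurable[OF _ refl]) (auto simp: ball_def)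
    moreover have "emeasure lborel (ball (0::'a) e) = ennreal (unit_ball_vol (real DIM('a)) * e ^ DIM('a))"
      using assms by (intro emeasure_ball) simp
    moreover have "unit_ball_vol (real DIM('a)) * e ^ DIM('a) > 0"
      using assms by (simp add: unit_ball_vol_pos)
    ultimately show False by (metis ennreal_eq_0_iff not_le)
  qed
  define c where "c = inverse (LINT x|lborel. B x)"
  have "c \<ge> 0" using Bochner_Integration.integral_nonneg[of lborel B] nn by (simp add: c_def)
  show ?thesis
  proof (rule that)
    show "test_function UNIV (\<lambda>x. B x * c)"
      using sm supp' by (intro test_functionI[of _ "cball 0 e"] smooth_mult smooth_const) auto
  qed (use nn \<open>c \<ge> 0\<close> supp int ne in \<open>auto simp: c_def\<close>)
qed

section \<open>Translations and reflections of Lebesgue measure\<close>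

lemma lborel_distr_minus:
  fixes t :: "'a::euclidean_space"
  shows "distr lborel borel (\<lambda>x. t - x) = lborel"
  by (subst (2) lborel_affine[of "-1" t]) (auto simp: density_1)

lemma integrable_lborel_shift:
  fixes f :: "'a::euclidean_space \<Rightarrow> real"
  assumes "integrable lborel f"
  shows "integrable lborel (\<lambda>x. f (x - h))"
proof -
  have "integrable (distr lborel borel ((+) (- h))) f"
    using assms by (simp only: lborel_distr_plus)
  then show ?thesis
    using borel_measurable_integrable[OF assms] by (subst (asm) integrable_distr_eq) auto
qed

lemma integral_lborel_shift:
  fixes f :: "'a::euclidean_space \<Rightarrow> real"
  assumes "f \<in> borel_measurable borel"
  shows "(LINT x|lborel. f (x - h)) = (LINT x|lborel. f x)"
proof -
  have "(LINT x|lborel. f x) = (LINT x|distr lborel borel ((+) (- h)). f x)"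
    by (simp only: lborel_distr_plus)
  then show ?thesis by (simp add: integral_distr assms)
qed

lemma integrable_lborel_reflect:
  fixes f :: "'a::euclidean_space \<Rightarrow> real"
  assumes "integrable lborel f"
  shows "integrable lborel (\<lambda>x. f (t - x))"
proof -
  have "integrable (distr lborel borel (\<lambda>x. t - x)) f"
    using assms by (simp only: lborel_distr_minus)
  then show ?thesis
    using borel_measurable_integrable[OF assms] by (subst (asm) integrable_distr_eq) auto
qed

lemma integral_lborel_reflect:
  fixes f :: "'a::euclidean_space \<Rightarrow> real"
  assumes "f \<in> borel_measurable borel"
  shows "(LINT x|lborel. f (t - x)) = (LINT x|lborel. f x)"
proof -
  have "(LINT x|lborel. f x) = (LINT x|distr lborel borel (\<lambda>x. t - x). f x)"
    by (simp only: lborel_distr_minus)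
  then show ?thesis by (simp add: integral_distr assms)
qed

section \<open>Mollification\<close>

text \<open>The modulus of continuity of translations in L1. The L1 error of a mollification is at
  most an average of it, see \<open>conv_L1_lborel\<close>.\<close>

definition shift_dist :: "('a::euclidean_space \<Rightarrow> real) \<Rightarrow> 'a \<Rightarrow> real" where
  "shift_dist f h = (LINT x|lborel. \<bar>f (x - h) - f x\<bar>)"

text \<open>By translation invariance the error of the approximation is paid twice, once at
  \<open>x\<close> and once at \<open>x - h\<close>. Functions whose \<open>shift_dist\<close> tends
  to zero therefore form a closed set in L1.\<close>

lemma shift_dist_approx:
  fixes f g :: "'a::euclidean_space \<Rightarrow> real"
  assumes f: "integrable lborel f" and g: "integrable lborel g"
  shows "shift_dist f h \<le> shift_dist g h + 2 * (LINT x|lborel. \<bar>f x - g x\<bar>)"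
proof -
  have d: "integrable lborel (\<lambda>x. \<bar>f x - g x\<bar>)" using f g by auto
  note i = f g integrable_lborel_shift[OF f] integrable_lborel_shift[OF g] d integrable_lborel_shift[OF d]
  have "shift_dist f h \<le> (LINT x|lborel. (\<bar>g (x - h) - g x\<bar> + \<bar>f x - g x\<bar>) + \<bar>f (x - h) - g (x - h)\<bar>)"
    unfolding shift_dist_def using i by (intro integral_mono) auto
  also have "\<dots> = shift_dist g h + (LINT x|lborel. \<bar>f x - g x\<bar>) + (LINT x|lborel. \<bar>f (x - h) - g (x - h)\<bar>)"
    unfolding shift_dist_def using i by (subst Bochner_Integration.integral_add) auto
  also have "(LINT x|lborel. \<bar>f (x - h) - g (x - h)\<bar>) = (LINT x|lborel. \<bar>f x - g x\<bar>)"
    using integral_lborel_shift[of "\<lambda>x. \<bar>f x - g x\<bar>" h] d by (simp add: borel_measurable_integrable)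
  finally show ?thesis by simp
qed

lemma shift_dist_nonneg: "0 \<le> shift_dist f h"
  unfolding shift_dist_def by (simp add: Bochner_Integration.integral_nonneg)

lemma shift_dist_tendsto_approx:
  fixes f :: "'a::euclidean_space \<Rightarrow> real"
  assumes f: "integrable lborel f"
    and app: "\<And>e. e > 0 \<Longrightarrow> \<exists>g. integrable lborel g \<and> (shift_dist g \<longlongrightarrow> 0) (at 0) \<and>
      (LINT x|lborel. \<bar>f x - g x\<bar>) < e"
  shows "(shift_dist f \<longlongrightarrow> 0) (at 0)"
proof (rule tendstoI)
  fix e :: real assume "e > 0"
  then obtain g where g: "integrable lborel g" "(shift_dist g \<longlongrightarrow> 0) (at 0)"
      "(LINT x|lborel. \<bar>f x - g x\<bar>) < e / 4"
    using app[of "e / 4"] by auto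
  have "\<forall>\<^sub>F h in at 0. dist (shift_dist g h) 0 < e / 2"
    using g(2) \<open>e > 0\<close> by (intro tendstoD) auto
  then show "\<forall>\<^sub>F h in at 0. dist (shift_dist f h) 0 < e"
  proof eventually_elim
    case (elim h)
    then show ?case
      using shift_dist_approx[OF f g(1), of h] g(3) shift_dist_nonneg[of f h] shift_dist_nonneg[of g h] by auto
  qed
qed

text \<open>At a point of the open set \<open>U\<close> the loss
  \<open>indicator U x - indicator U (x - h)\<close> vanishes once \<open>h\<close> is small, and
  its positive part is dominated by \<open>indicator U\<close>. Gain and loss have equal integrals
  by translation invariance, so the distance is twice the loss.\<close>

lemma shift_dist_open:
  fixes U :: "'a::euclidean_space set"
  assumes U: "open U" "emeasure lborel U < \<infinity>"
  shows "(shift_dist (indicator U) \<longlongrightarrow> 0) (at 0)"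
  unfolding tendsto_at_iff_sequentially
proof (intro allI impI, unfold comp_def)
  fix X :: "nat \<Rightarrow> 'a" assume X: "\<forall>i. X i \<in> UNIV - {0}" "X \<longlonglongrightarrow> 0"
  have [measurable]: "U \<in> sets borel" using U by auto
  have iU: "integrable lborel (indicator U :: 'a \<Rightarrow> real)"
    using U by (intro integrable_real_indicator) auto
  define P where "P = (\<lambda>h x. max 0 (indicator U x - indicator U (x - h)) :: real)"
  have sU: "integrable lborel (\<lambda>x. indicator U (x - h) :: real)" for h
    using integrable_lborel_shift[OF iU] .
  have iP: "integrable lborel (P h)" for h
    unfolding P_def using iU sU by (intro integrable_max) auto
  have eq: "shift_dist (indicator U) h = 2 * (LINT x|lborel. P h x)" for h
  proof -
    have "shift_dist (indicator U) h =
        (LINT x|lborel. 2 * P h x + (indicator U (x - h) - indicator U x))"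
      unfolding shift_dist_def P_def by (intro Bochner_Integration.integral_cong) (auto simp: indicator_def)
    also have "\<dots> = 2 * (LINT x|lborel. P h x) + ((LINT x|lborel. indicator U (x - h)) - (LINT x|lborel. indicator U x))"
      using iP iU sU by simp
    also have "(LINT x|lborel. indicator U (x - h)) = (LINT x|lborel. indicator U x :: real)"
      by (rule integral_lborel_shift) auto
    finally show ?thesis by simp
  qed
  have "(\<lambda>n. LINT x|lborel. P (X n) x) \<longlonglongrightarrow> (LINT x::'a|lborel. 0)"
  proof (rule integral_dominated_convergence[where w = "indicator U"])
    show "AE x in lborel. (\<lambda>n. P (X n) x) \<longlonglongrightarrow> 0"
    proof (intro AE_I2)
      fix x :: 'a
      show "(\<lambda>n. P (X n) x) \<longlonglongrightarrow> 0"
      proof (cases "x \<in> U")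
        case True
        have "(\<lambda>n. x - X n) \<longlonglongrightarrow> x - 0" by (intro tendsto_intros X)
        then have "\<forall>\<^sub>F n in sequentially. x - X n \<in> U"
          using U(1) True by (intro topological_tendstoD) auto
        then have "\<forall>\<^sub>F n in sequentially. P (X n) x = 0"
          by eventually_elim (use True in \<open>auto simp: P_def\<close>)
        then show ?thesis by (rule tendsto_eventually)
      next
        case False
        then have "P (X n) x = 0" for n by (auto simp: P_def indicator_def)
        then show ?thesis by simp
      qed
    qed
  qed (use iP iU in \<open>auto simp: P_def indicator_def\<close>)
  then have "(\<lambda>n. 2 * (LINT x|lborel. P (X n) x)) \<longlonglongrightarrow> 2 * 0"
    by (intro tendsto_intros) simp
  then show "(\<lambda>n. shift_dist (indicator U) (X n)) \<longlonglongrightarrow> 0"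
    by (simp add: eq)
qed

text \<open>Induction over integrable functions. A set of finite measure is approximated from
  outside by an open set, where \<open>shift_dist_open\<close> applies; sums obey the triangle
  inequality, and limits are covered by \<open>shift_dist_tendsto_approx\<close>.\<close>

lemma shift_dist_tendsto:
  fixes f :: "'a::euclidean_space \<Rightarrow> real"
  assumes "integrable lborel f"
  shows "(shift_dist f \<longlongrightarrow> 0) (at 0)"
  using assms
proof (induction rule: integrable_induct)
  case (base A c)
  have scale: "shift_dist (\<lambda>x. g x *\<^sub>R c) = (\<lambda>h. \<bar>c\<bar> * shift_dist g h)" for g :: "'a \<Rightarrow> real"
  proof
    fix h
    have "\<bar>g (x - h) *\<^sub>R c - g x *\<^sub>R c\<bar> = \<bar>c\<bar> * \<bar>g (x - h) - g x\<bar>" for x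
      by (simp add: abs_mult[symmetric] algebra_simps)
    then show "shift_dist (\<lambda>x. g x *\<^sub>R c) h = \<bar>c\<bar> * shift_dist g h"
      unfolding shift_dist_def by simp
  qed
  have "(shift_dist (indicator A) \<longlongrightarrow> 0) (at 0)"
  proof (rule shift_dist_tendsto_approx)
    show "integrable lborel (indicator A :: 'a \<Rightarrow> real)"
      using base by (intro integrable_real_indicator) auto
    fix e :: real assume "e > 0"
    have A: "A \<in> sets lebesgue" "emeasure lebesgue A < \<infinity>" using base by auto
    obtain U where U: "open U" "A \<subseteq> U" "U - A \<in> lmeasurable" "emeasure lebesgue (U - A) < ennreal e"
      using sets_lebesgue_outer_open[OF A(1) \<open>e > 0\<close>] by blast
    have bU: "U \<in> sets lborel" "U - A \<in> sets lborel" using U(1) base by auto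
    have "emeasure lborel U \<le> emeasure lborel A + emeasure lborel (U - A)"
      using emeasure_subadditive[of A lborel "U - A"] base bU U(2) by (auto simp: Un_absorb1)
    also have "\<dots> < \<infinity>"
    proof -
      have "emeasure lborel (U - A) < \<infinity>"
        using U(4) bU ennreal_less_top[of e] by (simp add: less_trans)
      then show ?thesis using base by simp
    qed
    finally have fU: "emeasure lborel U < \<infinity>" .
    have "(LINT x|lborel. \<bar>indicator A x - indicator U x\<bar>) = (LINT x|lborel. indicator (U - A) x :: real)"
      using U(2) by (intro Bochner_Integration.integral_cong) (auto simp: indicator_def)
    also have "\<dots> = measure lborel (U - A)" using bU by simp
    also have "\<dots> < e"
    proof -
      have *: "emeasure lborel (U - A) < ennreal e" using U(4) bU by simp
      then show ?thesis
        using less_trans[OF * ennreal_less_top] emeasure_eq_ennreal_measure[of lborel "U - A"]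
        by (metis ennreal_less_iff measure_nonneg less_irrefl)
    qed
    finally show "\<exists>g. integrable lborel g \<and> (shift_dist g \<longlongrightarrow> 0) (at 0) \<and>
        (LINT x|lborel. \<bar>indicator A x - g x\<bar>) < e"
      using shift_dist_open[OF U(1) fU] fU bU
      by (intro exI[of _ "indicator U"] conjI integrable_real_indicator) auto
  qed
  then show ?case
    unfolding scale using tendsto_mult_right_zero by blast
next
  case (add f g)
  have "shift_dist (\<lambda>x. f x + g x) h \<le> shift_dist f h + shift_dist g h" for h
  proof -
    note i = add.hyps integrable_lborel_shift[OF add.hyps(1)] integrable_lborel_shift[OF add.hyps(2)]
    have "shift_dist (\<lambda>x. f x + g x) h \<le> (LINT x|lborel. \<bar>f (x - h) - f x\<bar> + \<bar>g (x - h) - g x\<bar>)"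
      unfolding shift_dist_def using i by (intro integral_mono) auto
    also have "\<dots> = shift_dist f h + shift_dist g h"
      unfolding shift_dist_def using i by (subst Bochner_Integration.integral_add) auto
    finally show ?thesis .
  qed
  then show ?case
    by (intro tendsto_sandwich[OF _ _ tendsto_const tendsto_add_zero[OF add.IH]])
      (auto simp: shift_dist_nonneg)
next
  case (lim f s)
  show ?case
  proof (rule shift_dist_tendsto_approx)
    show "integrable lborel f" using lim by simp
    fix e :: real assume "e > 0"
    have fm: "f \<in> borel_measurable lborel" using lim by auto
    have "(\<lambda>n. LINT x|lborel. \<bar>f x - s n x\<bar>) \<longlonglongrightarrow> (LINT x::'a|lborel. 0)"
    proof (rule integral_dominated_convergence[where w = "\<lambda>x. 3 * norm (f x)"])
      show "AE x in lborel. (\<lambda>n. \<bar>f x - s n x\<bar>) \<longlonglongrightarrow> 0"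
      proof (intro AE_I2)
        fix x :: 'a
        have "(\<lambda>n. \<bar>f x - s n x\<bar>) \<longlonglongrightarrow> \<bar>f x - f x\<bar>"
          using lim(2)[of x] by (intro tendsto_intros) auto
        then show "(\<lambda>n. \<bar>f x - s n x\<bar>) \<longlonglongrightarrow> 0" by simp
      qed
      show "AE x in lborel. norm \<bar>f x - s n x\<bar> \<le> 3 * norm (f x)" for n
      proof (intro AE_I2)
        fix x :: 'a
        have "norm (s n x) \<le> 2 * norm (f x)" using lim(3)[of x n] by simp
        then show "norm \<bar>f x - s n x\<bar> \<le> 3 * norm (f x)" by simp
      qed
    qed (use lim fm in auto)
    then have "\<forall>\<^sub>F n in sequentially. (LINT x|lborel. \<bar>f x - s n x\<bar>) < e"
      using order_tendstoD(2)[of _ 0 sequentially e] \<open>e > 0\<close> by simp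
    then obtain n where "(LINT x|lborel. \<bar>f x - s n x\<bar>) < e"
      using eventually_happens'[OF sequentially_bot] by blast
    then show "\<exists>g. integrable lborel g \<and> (shift_dist g \<longlongrightarrow> 0) (at 0) \<and> (LINT x|lborel. \<bar>f x - g x\<bar>) < e"
      using lim(1,5) lim.IH by blast
  qed
qed

text \<open>The integral is over \<open>lebesgue\<close> because weak gradients, which are among the
  functions to be smoothed, are only known to be Lebesgue measurable.\<close>

definition conv :: "('a::euclidean_space \<Rightarrow> real) \<Rightarrow> ('a \<Rightarrow> real) \<Rightarrow> 'a \<Rightarrow> real" where
  "conv \<rho> f x = (LINT y|lebesgue. \<rho> (x - y) * f y)"

lemma test_function_bounded:
  assumes "test_function \<Omega> \<rho>"
  obtains B where "0 \<le> B" "\<And>x. \<bar>\<rho> x\<bar> \<le> B"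
proof -
  obtain K where K: "compact K" "\<And>x. x \<notin> K \<Longrightarrow> \<rho> x = 0"
    by (rule test_function_support[OF assms]) blast
  have "bounded (\<rho> ` K)"
    by (intro compact_imp_bounded compact_continuous_image K test_function_continuous[OF assms])
  then obtain B where "B > 0" "\<forall>y\<in>\<rho> ` K. norm y \<le> B" unfolding bounded_pos by blast
  then show ?thesis
    using K(2) by (intro that[of B]) force+
qed

lemma compact_support_uniformly_continuous:
  fixes F :: "'a::euclidean_space \<Rightarrow> real"
  assumes cont: "continuous_on UNIV F" and K: "compact K" "\<And>x. x \<notin> K \<Longrightarrow> F x = 0" and "0 < e"
  obtains d where "0 < d" "\<And>x y. norm (x - y) < d \<Longrightarrow> \<bar>F x - F y\<bar> < e"
proof -
  obtain R where R: "K \<subseteq> cball 0 R" using bounded_subset_ballD[OF compact_imp_bounded[OF K(1)]] ball_subset_cball by blast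
  have "uniformly_continuous_on (cball 0 (R + 1)) F"
    by (intro compact_uniformly_continuous continuous_on_subset[OF cont] compact_cball) auto
  from this[unfolded uniformly_continuous_on_def, rule_format, OF \<open>0 < e\<close>]
  obtain d where d: "d > 0" "\<And>x y. x \<in> cball 0 (R + 1) \<Longrightarrow> y \<in> cball 0 (R + 1) \<Longrightarrow> dist y x < d \<Longrightarrow> dist (F y) (F x) < e"
    by blast
  show ?thesis
  \<comment> \<open>A distance of at most 1 places both points in the larger ball as soon as one of
    them lies in \<open>K\<close>; otherwise both values are \<open>0\<close>.\<close>
  proof (rule that[of "min d 1"])
    fix x y :: 'a assume xy: "norm (x - y) < min d 1"
    show "\<bar>F x - F y\<bar> < e"
    proof (cases "x \<in> K \<or> y \<in> K")
      case True
      then have "norm x \<le> R + 1" "norm y \<le> R + 1"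
        using R xy norm_triangle_ineq2[of x y] norm_triangle_ineq2[of y x] norm_minus_commute[of x y] by auto
      then show ?thesis using d(2)[of y x] xy by (auto simp: dist_norm)
    next
      case False
      then show ?thesis using K \<open>0 < e\<close> by simp
    qed
  qed (use d in auto)
qed

lemma test_function_uniformly_continuous:
  assumes "test_function \<Omega> \<rho>" "0 < e"
  obtains d where "0 < d" "\<And>x y. norm (x - y) < d \<Longrightarrow> \<bar>\<rho> x - \<rho> y\<bar> < e"
proof -
  obtain K where K: "compact K" "\<And>x. x \<notin> K \<Longrightarrow> \<rho> x = 0"
    by (rule test_function_support[OF assms(1)]) blast
  show ?thesis
  proof (rule compact_support_uniformly_continuous[OF test_function_continuous[OF assms(1)] K assms(2)])
    fix d assume d: "0 < d" "\<And>x y. norm (x - y) < d \<Longrightarrow> \<bar>\<rho> x - \<rho> y\<bar> < e"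
    show thesis by (rule that[OF d])
  qed
qed

lemma conv_integrable:
  assumes \<rho>: "test_function \<Omega> \<rho>" and f: "integrable lebesgue f"
  shows "integrable lebesgue (\<lambda>y. \<rho> (x - y) * f y)"
proof -
  obtain B where B: "0 \<le> B" "\<And>x. \<bar>\<rho> x\<bar> \<le> B" using test_function_bounded[OF \<rho>] by blast
  have c: "continuous_on UNIV (\<lambda>y. \<rho> (x - y))"
    by (intro continuous_on_compose2[OF test_function_continuous[OF \<rho>, of UNIV]] continuous_intros) auto
  have [measurable]: "f \<in> borel_measurable lebesgue" "(\<lambda>y. \<rho> (x - y)) \<in> borel_measurable lebesgue"
    using f borel_measurable_continuous_onI[OF c] by (auto intro: measurable_completion)
  show ?thesis
  proof (rule Bochner_Integration.integrable_bound)
    show "integrable lebesgue (\<lambda>y. B * norm (f y))" using f by auto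
    show "AE y in lebesgue. norm (\<rho> (x - y) * f y) \<le> norm (B * norm (f y))"
      using B by (auto simp: abs_mult intro!: mult_right_mono)
  qed measurable
qed

lemma sum_Basis_linear:
  fixes L :: "'a::euclidean_space \<Rightarrow> 'b::real_vector"
  assumes "linear L"
  shows "L h = (\<Sum>b\<in>Basis. (h \<bullet> b) *\<^sub>R L b)"
proof -
  have "L h = L (\<Sum>b\<in>Basis. (h \<bullet> b) *\<^sub>R b)"
    by (simp only: euclidean_representation)
  also have "\<dots> = (\<Sum>b\<in>Basis. (h \<bullet> b) *\<^sub>R L b)"
    by (simp add: linear_sum[OF assms] linear_scale[OF assms])
  finally show ?thesis .
qed

text \<open>The point of the estimate is its uniformity in \<open>z\<close>: the remainder can be
  integrated against any integrable function when a convolution is differentiated.\<close>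

lemma test_function_uniform_derivative:
  fixes \<rho> :: "'a::euclidean_space \<Rightarrow> real"
  assumes \<rho>: "test_function \<Omega> \<rho>" and "0 < e"
  obtains d where "0 < d" "\<And>z h. norm h < d \<Longrightarrow>
    \<bar>\<rho> (z + h) - \<rho> z - frechet_derivative \<rho> (at z) h\<bar> \<le> e * norm h"
proof -
  define e' where "e' = e / DIM('a)"
  have e': "e' > 0" using \<open>0 < e\<close> by (simp add: e'_def)
  have sm: "smooth \<rho>" using \<rho> by (simp add: test_function_def)
  have "\<exists>d>0. \<forall>x y. norm (x - y) < d \<longrightarrow> \<bar>frechet_derivative \<rho> (at x) b - frechet_derivative \<rho> (at y) b\<bar> < e'" for b
    using test_function_uniformly_continuous[OF test_function_frechet_derivative[OF \<rho>] e'] by metis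
  then obtain d where d: "\<And>b. d b > 0"
    "\<And>b x y. norm (x - y) < d b \<Longrightarrow> \<bar>frechet_derivative \<rho> (at x) b - frechet_derivative \<rho> (at y) b\<bar> < e'"
    by metis
  define D where "D = Min (d ` (Basis :: 'a set))"
  have D: "D > 0" "\<And>b. b \<in> Basis \<Longrightarrow> D \<le> d b"
    using d(1) by (auto simp: D_def)
  show ?thesis
  proof (rule that[OF D(1)])
    fix z h :: 'a assume h: "norm h < D"
    let ?S = "ball z D"
    have on: "onorm (frechet_derivative \<rho> (at x) - frechet_derivative \<rho> (at z)) \<le> e" if "x \<in> ?S" for x
    proof (rule onorm_bound)
      fix k :: 'a
      let ?L = "frechet_derivative \<rho> (at x) - frechet_derivative \<rho> (at z)"
      have lin: "linear ?L"
        using smooth_differentiable[OF sm] linear_frechet_derivative linear_compose_sub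
        by (metis (no_types, lifting) ext fun_diff_def)
      have "norm (?L k) = norm (\<Sum>b\<in>Basis. (k \<bullet> b) *\<^sub>R ?L b)"
        using sum_Basis_linear[OF lin, of k] by simp
      also have "\<dots> \<le> (\<Sum>b\<in>(Basis::'a set). norm k * e')"
      proof (intro sum_norm_le)
        fix b :: 'a assume b: "b \<in> Basis"
        have "norm (x - z) < d b" using D(2)[OF b] that by (simp add: dist_norm norm_minus_commute)
        then have "\<bar>?L b\<bar> \<le> e'" using d(2)[of x z b] by simp
        then show "norm ((k \<bullet> b) *\<^sub>R ?L b) \<le> norm k * e'"
          using Basis_le_norm[OF b, of k] by (auto simp: abs_mult intro!: mult_mono)
      qed
      also have "\<dots> = e * norm k" by (simp add: e'_def)
      finally show "norm (?L k) \<le> e * norm k" .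
    qed (use \<open>0 < e\<close> in auto)
    have "norm (\<rho> (z + h) - \<rho> z - frechet_derivative \<rho> (at z) (z + h - z)) \<le> norm (z + h - z) * e"
    proof (rule differentiable_bound_linearization[where S = ?S and f' = "\<lambda>x. frechet_derivative \<rho> (at x)"])
      show "z + t *\<^sub>R (z + h - z) \<in> ball z D" if "t \<in> {0..1}" for t
      proof -
        have "norm (t *\<^sub>R h) \<le> 1 * norm h" using that by (simp add: mult_left_le_one_le)
        then show ?thesis using h by (simp add: dist_norm)
      qed
      show "(\<rho> has_derivative frechet_derivative \<rho> (at x)) (at x within ball z D)" for x
        using smooth_has_derivative[OF sm] has_derivative_at_withinI by blast
    qed (use on D(1) in auto)
    then show "\<bar>\<rho> (z + h) - \<rho> z - frechet_derivative \<rho> (at z) h\<bar> \<le> e * norm h"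
      by (simp add: mult.commute)
  qed
qed

text \<open>The derivative falls on \<open>\<rho>\<close>, so nothing but integrability is asked of
  \<open>f\<close>. Since the derivative of \<open>\<rho>\<close> is again a test function, the
  argument iterates in \<open>smooth_conv\<close>.\<close>

lemma conv_has_derivative:
  fixes f :: "'a::euclidean_space \<Rightarrow> real"
  assumes \<rho>: "test_function \<Omega> \<rho>" and f: "integrable lebesgue f"
  shows "(conv \<rho> f has_derivative (\<lambda>h. conv (\<lambda>z. frechet_derivative \<rho> (at z) h) f x)) (at x)"
  unfolding has_derivative_at_alt
proof (intro conjI allI impI)
  have sm: "smooth \<rho>" using \<rho> by (simp add: test_function_def)
  note lin = linear_frechet_derivative[OF smooth_differentiable[OF sm]]
  note int = conv_integrable[OF test_function_frechet_derivative[OF \<rho>] f]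
  have "linear (\<lambda>h. conv (\<lambda>z. frechet_derivative \<rho> (at z) h) f x)"
    by (intro linearI)
      (simp_all add: conv_def linear_add[OF lin] linear_scale[OF lin] distrib_right int
         Bochner_Integration.integral_add mult.assoc)
  then show "bounded_linear (\<lambda>h. conv (\<lambda>z. frechet_derivative \<rho> (at z) h) f x)"
    by (simp add: linear_conv_bounded_linear)
  fix e :: real assume "0 < e"
  define N where "N = (LINT y|lebesgue. \<bar>f y\<bar>)"
  have N: "N \<ge> 0" unfolding N_def by (simp add: Bochner_Integration.integral_nonneg)
  \<comment> \<open>The summand 1 keeps \<open>e'\<close> positive when \<open>f\<close> vanishes
    almost everywhere.\<close>
  define e' where "e' = e / (N + 1)"
  have e': "e' > 0" "e' * N \<le> e"
    using \<open>0 < e\<close> N by (auto simp: e'_def field_simps)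
  obtain d where d: "0 < d" "\<And>z h. norm h < d \<Longrightarrow>
    \<bar>\<rho> (z + h) - \<rho> z - frechet_derivative \<rho> (at z) h\<bar> \<le> e' * norm h"
    using test_function_uniform_derivative[OF \<rho> e'(1)] by metis
  have "norm (conv \<rho> f y - conv \<rho> f x - conv (\<lambda>z. frechet_derivative \<rho> (at z) (y - x)) f x) \<le> e * norm (y - x)"
    if y: "norm (y - x) < d" for y
  proof -
    have "conv \<rho> f y - conv \<rho> f x - conv (\<lambda>z. frechet_derivative \<rho> (at z) (y - x)) f x =
        (LINT t|lebesgue. (\<rho> (y - t) - \<rho> (x - t) - frechet_derivative \<rho> (at (x - t)) (y - x)) * f t)"
      unfolding conv_def left_diff_distrib
      using conv_integrable[OF \<rho> f] int by simp
    also have "norm \<dots> \<le> (LINT t|lebesgue. (e' * norm (y - x)) * \<bar>f t\<bar>)"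
    proof (rule order_trans[OF integral_norm_bound integral_mono])
      show "integrable lebesgue (\<lambda>t. norm ((\<rho> (y - t) - \<rho> (x - t) - frechet_derivative \<rho> (at (x - t)) (y - x)) * f t))"
        unfolding left_diff_distrib using conv_integrable[OF \<rho> f] int by auto
      show "norm ((\<rho> (y - t) - \<rho> (x - t) - frechet_derivative \<rho> (at (x - t)) (y - x)) * f t) \<le> (e' * norm (y - x)) * \<bar>f t\<bar>" for t
        using d(2)[OF y, of "x - t"] by (simp add: abs_mult mult_right_mono)
    qed (use f in auto)
    also have "\<dots> = (e' * N) * norm (y - x)" by (simp add: N_def)
    also have "\<dots> \<le> e * norm (y - x)" using e'(2) by (intro mult_right_mono) auto
    finally show ?thesis .
  qed
  then show "\<exists>d>0. \<forall>y. norm (y - x) < d \<longrightarrow> norm (conv \<rho> f y - conv \<rho> f x -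
      conv (\<lambda>z. frechet_derivative \<rho> (at z) (y - x)) f x) \<le> e * norm (y - x)"
    using d(1) by blast
qed

lemma smooth_conv:
  fixes f :: "'a::euclidean_space \<Rightarrow> real"
  assumes \<rho>: "test_function \<Omega> \<rho>" and f: "integrable lebesgue f"
  shows "smooth (conv \<rho> f)"
proof -
  have "Ck k (conv \<rho> f)" for k
    using \<rho>
  proof (induction k arbitrary: \<rho>)
    case 0
    then show ?case
      using has_derivative_continuous[OF conv_has_derivative[OF 0 f]] by (simp add: continuous_at_imp_continuous_on)
  next
    case (Suc k)
    have "Ck k (conv (\<lambda>z. frechet_derivative \<rho> (at z) h) f)" for h
      using Suc test_function_frechet_derivative by blast
    then show ?case
      using differentiableI[OF conv_has_derivative[OF Suc.prems f]]
      by (simp add: frechet_derivative_eqI[OF conv_has_derivative[OF Suc.prems f]])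
  qed
  then show ?thesis unfolding smooth_def by blast
qed

definition mollifier :: "real \<Rightarrow> ('a::euclidean_space \<Rightarrow> real) \<Rightarrow> bool" where
  "mollifier d \<rho> \<longleftrightarrow> test_function UNIV \<rho> \<and> (\<forall>x. 0 \<le> \<rho> x) \<and> (\<forall>x. d \<le> norm x \<longrightarrow> \<rho> x = 0) \<and>
     integrable lborel \<rho> \<and> (LINT x|lborel. \<rho> x) = 1"

lemma mollifierE:
  fixes d :: real
  assumes "0 < d"
  obtains \<rho> :: "'a::euclidean_space \<Rightarrow> real" where "mollifier d \<rho>"
  using mollifier_exists[OF assms] unfolding mollifier_def by metis

lemma mollifier_reflect:
  fixes \<rho> :: "'a::euclidean_space \<Rightarrow> real"
  assumes "mollifier d \<rho>"
  shows "integrable lebesgue (\<lambda>y. \<rho> (x - y))" "(LINT y|lebesgue. \<rho> (x - y)) = 1"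
proof -
  have i: "integrable lborel \<rho>" and 1: "(LINT x|lborel. \<rho> x) = 1" using assms by (auto simp: mollifier_def)
  have j: "integrable lborel (\<lambda>y. \<rho> (x - y))" using integrable_lborel_reflect[OF i] .
  then have m: "(\<lambda>y. \<rho> (x - y)) \<in> borel_measurable lborel" by (rule borel_measurable_integrable)
  show "integrable lebesgue (\<lambda>y. \<rho> (x - y))"
    using j by (simp add: integrable_completion[OF m])
  show "(LINT y|lebesgue. \<rho> (x - y)) = 1"
    using integral_lborel_reflect[of \<rho> x] borel_measurable_integrable[OF i] 1
    by (simp add: integral_completion[OF m])
qed

text \<open>\<open>conv \<rho> f x\<close> is a weighted average of the values of \<open>f\<close>
  at distance less than \<open>d\<close> from \<open>x\<close>. The lemma is used with
  \<open>c = f x\<close> for uniform closeness, with \<open>c = 0\<close> for bounds and with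
  \<open>e = 0\<close> for the support.\<close>

lemma conv_near:
  fixes f :: "'a::euclidean_space \<Rightarrow> real"
  assumes \<rho>: "mollifier d \<rho>" and f: "integrable lebesgue f"
    and e: "\<And>y. norm (x - y) < d \<Longrightarrow> \<bar>f y - c\<bar> \<le> e"
  shows "\<bar>conv \<rho> f x - c\<bar> \<le> e"
proof -
  have t: "test_function UNIV \<rho>" and z: "\<And>x. d \<le> norm x \<Longrightarrow> \<rho> x = 0" and nn: "\<And>x. 0 \<le> \<rho> x"
    using \<rho> by (auto simp: mollifier_def)
  have eq: "conv \<rho> f x - c = (LINT y|lebesgue. \<rho> (x - y) * f y - c * \<rho> (x - y))"
    using conv_integrable[OF t f] mollifier_reflect[OF \<rho>, of x] by (simp add: conv_def)
  have "norm (conv \<rho> f x - c) \<le> (LINT y|lebesgue. e * \<rho> (x - y))"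
    unfolding eq
  proof (rule order_trans[OF integral_norm_bound integral_mono])
    show "norm (\<rho> (x - y) * f y - c * \<rho> (x - y)) \<le> e * \<rho> (x - y)" for y
    proof (cases "norm (x - y) < d")
      case True
      have "norm (\<rho> (x - y) * f y - c * \<rho> (x - y)) = \<bar>f y - c\<bar> * \<rho> (x - y)"
      proof -
        have "\<rho> (x - y) * f y - c * \<rho> (x - y) = (f y - c) * \<rho> (x - y)" by (simp add: algebra_simps)
        then show ?thesis using nn[of "x - y"] by (simp add: abs_mult)
      qed
      then show ?thesis using e[OF True] nn by (simp add: mult_right_mono)
    qed (simp add: z)
  qed (use conv_integrable[OF t f] mollifier_reflect[OF \<rho>, of x] in auto)
  then show ?thesis using mollifier_reflect[OF \<rho>, of x] by simp
qed

text \<open>At \<open>x\<close> the error is at most the average of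
  \<open>\<bar>f (x - y) - f x\<bar>\<close> with weight \<open>\<rho> y\<close>. Exchanging the
  integrals turns this into the average of \<open>shift_dist f y\<close> over the support of
  \<open>\<rho>\<close>.\<close>

lemma conv_L1_lborel:
  fixes f :: "'a::euclidean_space \<Rightarrow> real"
  assumes \<rho>: "mollifier d \<rho>" and f: "integrable lborel f" and "0 \<le> e"
    and e: "\<And>h. norm h < d \<Longrightarrow> shift_dist f h \<le> e"
  shows "(\<integral>\<^sup>+x. ennreal \<bar>conv \<rho> f x - f x\<bar> \<partial>lborel) \<le> ennreal e"
proof -
  have t: "test_function UNIV \<rho>" and z: "\<And>x. d \<le> norm x \<Longrightarrow> \<rho> x = 0" and nn: "\<And>x. 0 \<le> \<rho> x"
    and i: "integrable lborel \<rho>" and one: "(LINT x|lborel. \<rho> x) = 1"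
    using \<rho> by (auto simp: mollifier_def)
  have [measurable]: "f \<in> borel_measurable borel" "\<rho> \<in> borel_measurable borel"
    using borel_measurable_integrable[OF f] borel_measurable_integrable[OF i] by auto
  have fl: "integrable lebesgue f" using f by (simp add: integrable_completion)
  have bound: "ennreal \<bar>conv \<rho> f x - f x\<bar> \<le> (\<integral>\<^sup>+y. ennreal (\<rho> y * \<bar>f (x - y) - f x\<bar>) \<partial>lborel)" for x
  proof -
    have j: "integrable lborel (\<lambda>y. \<rho> (x - y) * f y)"
      using conv_integrable[OF t fl, of x] by (subst (asm) integrable_completion) auto
    have j': "integrable lborel (\<lambda>y. \<rho> y * f (x - y))"
      using integrable_lborel_reflect[OF j, of x] by simp
    have "conv \<rho> f x = (LINT y|lborel. \<rho> (x - y) * f y)"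
      unfolding conv_def by (rule integral_completion) simp
    also have "\<dots> = (LINT y|lborel. \<rho> y * f (x - y))"
      using integral_lborel_reflect[of "\<lambda>y. \<rho> (x - y) * f y" x] by simp
    finally have "conv \<rho> f x - f x = (LINT y|lborel. \<rho> y * f (x - y) - f x * \<rho> y)"
      using j' i one by simp
    also have "ennreal (norm \<dots>) \<le> (\<integral>\<^sup>+y. norm (\<rho> y * f (x - y) - f x * \<rho> y) \<partial>lborel)"
      using j' i by (intro integral_norm_bound_ennreal) auto
    also have "\<dots> = (\<integral>\<^sup>+y. ennreal (\<rho> y * \<bar>f (x - y) - f x\<bar>) \<partial>lborel)"
    proof (intro nn_integral_cong arg_cong[where f = ennreal])
      fix y
      have "\<rho> y * f (x - y) - f x * \<rho> y = \<rho> y * (f (x - y) - f x)" by (simp add: algebra_simps)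
      then show "norm (\<rho> y * f (x - y) - f x * \<rho> y) = \<rho> y * \<bar>f (x - y) - f x\<bar>"
        using nn[of y] by (simp add: abs_mult)
    qed
    finally show ?thesis by simp
  qed
  have "(\<integral>\<^sup>+x. ennreal \<bar>conv \<rho> f x - f x\<bar> \<partial>lborel) \<le>
      (\<integral>\<^sup>+x. \<integral>\<^sup>+y. ennreal (\<rho> y * \<bar>f (x - y) - f x\<bar>) \<partial>lborel \<partial>lborel)"
    by (intro nn_integral_mono bound)
  also have "\<dots> = (\<integral>\<^sup>+y. \<integral>\<^sup>+x. ennreal (\<rho> y * \<bar>f (x - y) - f x\<bar>) \<partial>lborel \<partial>lborel)"
    by (rule lborel_pair.Fubini') simp
  also have "\<dots> \<le> (\<integral>\<^sup>+y. ennreal (\<rho> y) * ennreal e \<partial>lborel)"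
  proof (intro nn_integral_mono)
    fix y :: 'a
    have "(\<integral>\<^sup>+x. ennreal (\<rho> y * \<bar>f (x - y) - f x\<bar>) \<partial>lborel) = ennreal (\<rho> y) * (\<integral>\<^sup>+x. ennreal \<bar>f (x - y) - f x\<bar> \<partial>lborel)"
      using nn by (simp add: ennreal_mult nn_integral_cmult)
    also have "(\<integral>\<^sup>+x. ennreal \<bar>f (x - y) - f x\<bar> \<partial>lborel) = ennreal (shift_dist f y)"
      unfolding shift_dist_def using f integrable_lborel_shift[OF f, of y]
      by (intro nn_integral_eq_integral) auto
    also have "ennreal (\<rho> y) * \<dots> \<le> ennreal (\<rho> y) * ennreal e"
      using e[of y] z[of y] by (cases "norm y < d") (auto intro: mult_left_mono ennreal_leI)
    finally show "(\<integral>\<^sup>+x. ennreal (\<rho> y * \<bar>f (x - y) - f x\<bar>) \<partial>lborel) \<le> ennreal (\<rho> y) * ennreal e" .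
  qed
  also have "\<dots> = (\<integral>\<^sup>+y. ennreal (\<rho> y) \<partial>lborel) * ennreal e"
    by (simp add: nn_integral_multc)
  also have "(\<integral>\<^sup>+y. ennreal (\<rho> y) \<partial>lborel) = 1"
    using nn_integral_eq_integral[OF i] nn one by simp
  finally show ?thesis by simp
qed

lemma conv_cong_AE:
  assumes "test_function \<Omega> \<rho>" "integrable lebesgue f" "integrable lebesgue g" "AE x in lebesgue. f x = g x"
  shows "conv \<rho> f = conv \<rho> g"
proof
  fix x
  show "conv \<rho> f x = conv \<rho> g x"
    unfolding conv_def
    using conv_integrable[OF assms(1,2), of x] conv_integrable[OF assms(1,3), of x] assms(4)
    by (intro integral_cong_AE) auto
qed

text \<open>The exchange of integrals needs Borel measurability, so \<open>f\<close> is replaced by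
  a Borel function that agrees with it almost everywhere; its mollifications are the same
  functions.\<close>

lemma conv_L1:
  fixes f :: "'a::euclidean_space \<Rightarrow> real"
  assumes f: "integrable lebesgue f" and "0 < e"
  obtains d where "0 < d" "\<And>r \<rho>. r \<le> d \<Longrightarrow> mollifier r \<rho> \<Longrightarrow>
     integrable lebesgue (\<lambda>x. conv \<rho> f x - f x) \<and> (LINT x|lebesgue. \<bar>conv \<rho> f x - f x\<bar>) \<le> e"
proof -
  obtain g where g: "g \<in> borel_measurable lborel" "AE x in lborel. f x = g x"
    using completion_ex_borel_measurable_real[of f lborel] f by auto
  then have ae: "AE x in lebesgue. f x = g x" by (simp add: AE_completion)
  have gl: "integrable lebesgue g"
    using f ae g(1) measurable_completion[OF g(1)] integrable_cong_AE[of f lebesgue g] by auto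
  then have gi: "integrable lborel g" using g(1) by (simp add: integrable_completion)
  have "\<forall>\<^sub>F h in at 0. shift_dist g h < e"
    using order_tendstoD(2)[OF shift_dist_tendsto[OF gi] \<open>0 < e\<close>] .
  then obtain d where d: "0 < d" "\<And>h. h \<noteq> 0 \<Longrightarrow> norm h < d \<Longrightarrow> shift_dist g h < e"
    unfolding eventually_at by auto
  have d': "shift_dist g h \<le> e" if "norm h < d" for h
    using d(2)[of h] that \<open>0 < e\<close> by (cases "h = 0") (auto simp: shift_dist_def)
  show ?thesis
  proof (rule that[OF d(1)])
    fix r :: real and \<rho> :: "'a \<Rightarrow> real" assume r: "r \<le> d" and \<rho>: "mollifier r \<rho>"
    have t: "test_function UNIV \<rho>" using \<rho> by (simp add: mollifier_def)
    have ceq: "conv \<rho> f = conv \<rho> g" by (rule conv_cong_AE[OF t f gl ae])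
    have le: "(\<integral>\<^sup>+x. ennreal \<bar>conv \<rho> g x - g x\<bar> \<partial>lborel) \<le> ennreal e"
      using d' r \<open>0 < e\<close> by (intro conv_L1_lborel[OF \<rho> gi]) auto
    have cm: "conv \<rho> g \<in> borel_measurable borel"
      using smooth_continuous[OF smooth_conv[OF t gl], of UNIV] by (rule borel_measurable_continuous_onI)
    have i: "integrable lborel (\<lambda>x. conv \<rho> g x - g x)"
      using le cm g(1) by (intro integrableI_bounded) (auto simp: le_less_trans)
    have il: "integrable lebesgue (\<lambda>x. conv \<rho> g x - g x)"
      using i cm g(1) by (subst integrable_completion) auto
    have fm: "f \<in> borel_measurable lebesgue" "g \<in> borel_measurable lebesgue" "conv \<rho> g \<in> borel_measurable lebesgue"
      using f gl measurable_completion[of "conv \<rho> g" lborel borel] cm by auto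
    have ae2: "AE x in lebesgue. conv \<rho> f x - f x = conv \<rho> g x - g x"
      using ae by eventually_elim (simp add: ceq)
    have 1: "integrable lebesgue (\<lambda>x. conv \<rho> f x - f x)"
      using il ae2 fm ceq by (subst integrable_cong_AE[of _ _ "\<lambda>x. conv \<rho> g x - g x"]) auto
    have "(LINT x|lebesgue. \<bar>conv \<rho> f x - f x\<bar>) = (LINT x|lebesgue. \<bar>conv \<rho> g x - g x\<bar>)"
      using ae2 fm ceq by (intro integral_cong_AE) auto
    also have "\<dots> = (LINT x|lborel. \<bar>conv \<rho> g x - g x\<bar>)"
      using cm g(1) by (intro integral_completion) auto
    also have "\<dots> \<le> e"
    proof -
      have "ennreal (LINT x|lborel. \<bar>conv \<rho> g x - g x\<bar>) \<le> ennreal e"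
        using le nn_integral_eq_integral[of lborel "\<lambda>x. \<bar>conv \<rho> g x - g x\<bar>"] i by auto
      then show ?thesis using \<open>0 < e\<close> by simp
    qed
    finally show "integrable lebesgue (\<lambda>x. conv \<rho> f x - f x) \<and> (LINT x|lebesgue. \<bar>conv \<rho> f x - f x\<bar>) \<le> e"
      using 1 by simp
  qed
qed

section \<open>Weak gradients\<close>

lemma integral_lebesgue_on_support:
  fixes f :: "'a::euclidean_space \<Rightarrow> real"
  assumes "\<Omega> \<in> sets lebesgue" "\<And>x. x \<notin> \<Omega> \<Longrightarrow> f x = 0"
  shows "(LINT x|lebesgue_on \<Omega>. f x) = (LINT x|lebesgue. f x)"
proof -
  have "(\<lambda>x. indicator \<Omega> x *\<^sub>R f x) = f" using assms(2) by (auto simp: indicator_def fun_eq_iff)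
  then show ?thesis using assms(1) by (subst integral_restrict_space) auto
qed

lemma AE_lebesgue_on:
  assumes "\<Omega> \<in> sets lebesgue"
  shows "(AE x in lebesgue_on \<Omega>. P x) \<longleftrightarrow> (AE x in lebesgue. x \<in> \<Omega> \<longrightarrow> P x)"
  using assms by (subst AE_restrict_space_iff) auto

lemma open_sets_lebesgue [intro]: "open S \<Longrightarrow> S \<in> sets lebesgue"
  by (simp add: borel_open sets_completionI_sets)

text \<open>Test functions and their derivatives vanish off \<open>\<Omega>\<close>, so the defining
  identity can be written with integrals over the whole space. This frees all later computations
  from restricted measures.\<close>

lemma weak_gradientD:
  fixes u :: "'a::euclidean_space \<Rightarrow> real"
  assumes "weak_gradient \<Omega> u g" "open \<Omega>" "test_function \<Omega> \<psi>" "b \<in> Basis"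
  shows "(LINT x|lebesgue. u x * frechet_derivative \<psi> (at x) b) = - (LINT x|lebesgue. (g x \<bullet> b) * \<psi> x)"
proof -
  have "(LINT x|lebesgue_on \<Omega>. u x * frechet_derivative \<psi> (at x) b) = - (LINT x|lebesgue_on \<Omega>. (g x \<bullet> b) * \<psi> x)"
    using assms unfolding weak_gradient_def by blast
  then show ?thesis
    using assms(2) test_function_outside[OF assms(3)]
      test_function_outside[OF test_function_frechet_derivative[OF assms(3)]]
    by (simp add: integral_lebesgue_on_support open_sets_lebesgue)
qed

lemma weak_gradientI:
  fixes u :: "'a::euclidean_space \<Rightarrow> real"
  assumes "open \<Omega>" "locally_integrable \<Omega> u" "locally_integrable \<Omega> g"
    and "\<And>\<psi> b. test_function \<Omega> \<psi> \<Longrightarrow> b \<in> Basis \<Longrightarrow>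
      (LINT x|lebesgue. u x * frechet_derivative \<psi> (at x) b) = - (LINT x|lebesgue. (g x \<bullet> b) * \<psi> x)"
  shows "weak_gradient \<Omega> u g"
  unfolding weak_gradient_def
proof (intro conjI allI impI ballI)
  fix \<psi> b assume \<psi>: "test_function \<Omega> \<psi>" and b: "b \<in> (Basis :: 'a set)"
  show "(LINT x|lebesgue_on \<Omega>. u x * frechet_derivative \<psi> (at x) b) = - (LINT x|lebesgue_on \<Omega>. (g x \<bullet> b) * \<psi> x)"
    using assms(1) assms(4)[OF \<psi> b] test_function_outside[OF \<psi>]
      test_function_outside[OF test_function_frechet_derivative[OF \<psi>]]
    by (simp add: integral_lebesgue_on_support open_sets_lebesgue)
qed (use assms in auto)

lemma locally_integrable_mono: "locally_integrable \<Omega> f \<Longrightarrow> S \<subseteq> \<Omega> \<Longrightarrow> locally_integrable S f"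
  unfolding locally_integrable_def by blast

lemma weak_gradient_mono:
  assumes "weak_gradient \<Omega> u g" "open \<Omega>" "open S" "S \<subseteq> \<Omega>"
  shows "weak_gradient S u g"
proof (rule weak_gradientI[OF assms(3)])
  show "locally_integrable S u" "locally_integrable S g"
    using assms(1) unfolding weak_gradient_def by (auto intro: locally_integrable_mono[OF _ assms(4)])
qed (rule weak_gradientD[OF assms(1,2) test_function_mono[OF _ assms(4)]])

section \<open>Weak gradients and mollification\<close>

lemma smooth_reflect:
  fixes f :: "'a::real_normed_vector \<Rightarrow> 'b::real_normed_vector"
  assumes "smooth f"
  shows "smooth (\<lambda>y. f (x - y))"
    and "frechet_derivative (\<lambda>y. f (x - y)) (at y) h = - frechet_derivative f (at (x - y)) h"
proof -
  have d: "((\<lambda>y. f (x - y)) has_derivative (\<lambda>h. frechet_derivative f (at (x - y)) (- h))) (at y)" if "smooth f"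
    for f :: "'a \<Rightarrow> 'b" and y
    by (rule has_derivative_compose[OF _ smooth_has_derivative[OF that]]) (auto intro!: derivative_eq_intros)
  have m: "frechet_derivative f (at z) (- h) = - frechet_derivative f (at z) h" if "smooth f"
    for f :: "'a \<Rightarrow> 'b" and z h
    using linear_neg[OF linear_frechet_derivative[OF smooth_differentiable[OF that]]] .
  show "frechet_derivative (\<lambda>y. f (x - y)) (at y) h = - frechet_derivative f (at (x - y)) h"
    using frechet_derivative_eqI[OF d[OF assms]] m[OF assms] by simp
  have "Ck k (\<lambda>y. f (x - y))" if "smooth f" for k and f :: "'a \<Rightarrow> 'b"
    using that
  proof (induction k arbitrary: f)
    case 0
    show ?case
      using has_derivative_continuous[OF d[OF 0]] by (simp add: continuous_at_imp_continuous_on)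
  next
    case (Suc k)
    have "Ck k (\<lambda>y. frechet_derivative f (at (x - y)) (- h))" for h
      using Suc.IH[OF smooth_frechet_derivative[OF Suc.prems]] .
    then show ?case
      using differentiableI[OF d[OF Suc.prems]] by (simp add: frechet_derivative_eqI[OF d[OF Suc.prems]])
  qed
  then show "smooth (\<lambda>y. f (x - y))" using assms unfolding smooth_def by blast
qed

text \<open>This is the link between convolutions and weak gradients: the kernel of the convolution
  at \<open>x\<close>, as a function of the integration variable, is an admissible test
  function.\<close>

lemma mollifier_reflect_test:
  fixes \<rho> :: "'a::euclidean_space \<Rightarrow> real"
  assumes "mollifier d \<rho>" "cball x d \<subseteq> \<Omega>"
  shows "test_function \<Omega> (\<lambda>y. \<rho> (x - y))"
proof (rule test_functionI[where K = "cball x d"])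
  show "smooth (\<lambda>y. \<rho> (x - y))"
    using assms smooth_reflect(1) by (auto simp: mollifier_def test_function_def)
qed (use assms in \<open>auto simp: mollifier_def dist_norm\<close>)

lemma mollifier_derivative_outside:
  fixes \<rho> :: "'a::euclidean_space \<Rightarrow> real"
  assumes "mollifier d \<rho>" "d < norm z"
  shows "frechet_derivative \<rho> (at z) h = 0"
proof -
  have "(\<rho> has_derivative (\<lambda>h. 0)) (at z)"
  proof (rule has_derivative_transform_within_open)
    show "((\<lambda>x. 0) has_derivative (\<lambda>h. 0)) (at z)" by simp
    show "open (- cball (0::'a) d)" by (simp add: open_Compl)
  qed (use assms in \<open>auto simp: mollifier_def\<close>)
  then show ?thesis by (simp add: frechet_derivative_eqI)
qed

text \<open>The weak gradient is tested with the reflected mollifier. The kernel vanishes off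
  \<open>cball x d\<close>, so the globally integrable \<open>f\<close> and the field
  \<open>G\<close> need to agree with \<open>u\<close> and \<open>g\<close> only there.\<close>

lemma weak_gradient_conv:
  fixes u :: "'a::euclidean_space \<Rightarrow> real"
  assumes w: "weak_gradient \<Omega> u g" "open \<Omega>" and \<rho>: "mollifier d \<rho>" and x: "cball x d \<subseteq> \<Omega>"
    and f: "integrable lebesgue f" "\<And>y. y \<in> cball x d \<Longrightarrow> f y = u y" and b: "b \<in> Basis"
    and G: "\<And>y. y \<in> cball x d \<Longrightarrow> G y = g y"
  shows "frechet_derivative (conv \<rho> f) (at x) b = conv \<rho> (\<lambda>y. G y \<bullet> b) x"
proof -
  have t: "test_function UNIV \<rho>" and sm: "smooth \<rho>" using \<rho> by (auto simp: mollifier_def test_function_def)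
  have "frechet_derivative (conv \<rho> f) (at x) b = (LINT y|lebesgue. frechet_derivative \<rho> (at (x - y)) b * f y)"
    by (simp add: frechet_derivative_eqI[OF conv_has_derivative[OF t f(1)]] conv_def)
  also have "\<dots> = (LINT y|lebesgue. - (u y * frechet_derivative (\<lambda>y. \<rho> (x - y)) (at y) b))"
  proof (intro Bochner_Integration.integral_cong refl)
    fix y
    show "frechet_derivative \<rho> (at (x - y)) b * f y = - (u y * frechet_derivative (\<lambda>y. \<rho> (x - y)) (at y) b)"
      unfolding smooth_reflect(2)[OF sm]
      using f(2)[of y] mollifier_derivative_outside[OF \<rho>, of "x - y" b]
      by (cases "y \<in> cball x d") (auto simp: dist_norm)
  qed
  also have "\<dots> = (LINT y|lebesgue. (g y \<bullet> b) * \<rho> (x - y))"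
    using weak_gradientD[OF w mollifier_reflect_test[OF \<rho> x] b] by simp
  also have "\<dots> = conv \<rho> (\<lambda>y. G y \<bullet> b) x"
    unfolding conv_def
  proof (intro Bochner_Integration.integral_cong refl)
    fix y
    show "(g y \<bullet> b) * \<rho> (x - y) = \<rho> (x - y) * (G y \<bullet> b)"
      using G[of y] \<rho> by (cases "y \<in> cball x d") (auto simp: dist_norm mollifier_def)
  qed
  finally show ?thesis .
qed

text \<open>A set that is negligible near each of its points is negligible, by the Lindelof
  property. Statements almost everywhere may therefore be proved on small balls, which leave room
  for mollification.\<close>

lemma AE_lebesgue_locally:
  fixes \<Omega> :: "'a::euclidean_space set"
  assumes "\<And>x. x \<in> \<Omega> \<Longrightarrow> \<exists>r>0. AE y in lebesgue. y \<in> ball x r \<longrightarrow> P y"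
  shows "AE y in lebesgue. y \<in> \<Omega> \<longrightarrow> P y"
proof -
  let ?S = "{x \<in> \<Omega>. \<not> P x}"
  have "negligible ?S"
    unfolding locally_negligible_alt[of ?S]
  proof (intro ballI)
    fix x assume "x \<in> ?S"
    then obtain r where r: "r > 0" "AE y in lebesgue. y \<in> ball x r \<longrightarrow> P y" using assms by blast
    from AE_E[OF r(2)] obtain N where N: "{y \<in> space lebesgue. \<not> (y \<in> ball x r \<longrightarrow> P y)} \<subseteq> N"
        "emeasure lebesgue N = 0" "N \<in> sets lebesgue"
      by blast
    then have N': "negligible N" by (simp add: negligible_iff_null_sets null_setsI)
    have "negligible (?S \<inter> ball x r)"
      by (rule negligible_subset[of N]) (use N N' in auto)
    then show "\<exists>U. openin (top_of_set ?S) U \<and> x \<in> U \<and> negligible U"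
      using r(1) \<open>x \<in> ?S\<close> by (intro exI[of _ "?S \<inter> ball x r"]) (auto intro: openin_open_Int)
  qed
  then have "?S \<in> null_sets lebesgue" by (simp add: negligible_iff_null_sets)
  then show ?thesis by (rule AE_I') auto
qed

lemma locally_integrable_cball:
  fixes f :: "'a::euclidean_space \<Rightarrow> 'b::euclidean_space"
  assumes "locally_integrable \<Omega> f" "cball x r \<subseteq> \<Omega>"
  shows "integrable lebesgue (\<lambda>y. indicator (cball x r) y *\<^sub>R f y)"
  using assms unfolding locally_integrable_def set_integrable_def by (metis compact_cball)

text \<open>Mollification turns the integrals against translates of a bump function into a convolution,
  which is nonnegative and converges to \<open>h\<close> in \<open>L\<^sup>1\<close>.\<close>

lemma fundamental_lemma_nonneg:
  fixes h :: "'a::euclidean_space \<Rightarrow> real"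
  assumes "open \<Omega>" and loc: "locally_integrable \<Omega> h"
    and pos: "\<And>\<psi>. test_function \<Omega> \<psi> \<Longrightarrow> (\<And>x. 0 \<le> \<psi> x) \<Longrightarrow> 0 \<le> (LINT x|lebesgue. h x * \<psi> x)"
  shows "AE x in lebesgue. x \<in> \<Omega> \<longrightarrow> 0 \<le> h x"
proof (rule AE_lebesgue_locally)
  fix x0 assume "x0 \<in> \<Omega>"
  then obtain R where R: "R > 0" "cball x0 R \<subseteq> \<Omega>" using assms(1) open_contains_cball by blast
  define r where "r = R / 2"
  have r: "r > 0" "cball x0 (2 * r) \<subseteq> \<Omega>" using R by (auto simp: r_def)
  define f where "f = (\<lambda>y. indicator (cball x0 (2 * r)) y *\<^sub>R h y)"
  have f: "integrable lebesgue f" unfolding f_def by (rule locally_integrable_cball[OF loc r(2)])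
  \<comment> \<open>\<open>n\<close> is the negative part of \<open>f\<close> on the smaller ball.
    There \<open>conv \<rho> f\<close> is nonnegative, so \<open>n\<close> is at most the distance
    between \<open>f\<close> and \<open>conv \<rho> f\<close>, whose integral is small.\<close>
  define n where "n = (\<lambda>x. indicator (ball x0 r) x *\<^sub>R max 0 (- f x))"
  have bm: "ball x0 r \<in> sets lebesgue" by auto
  have n: "integrable lebesgue n" unfolding n_def using f by (intro integrable_mult_indicator[OF bm]) auto
  have n0: "0 \<le> n x" for x by (simp add: n_def)
  have "(LINT x|lebesgue. n x) \<le> e" if "e > 0" for e
  proof -
    obtain d where d: "0 < d" "\<And>r \<rho>. r \<le> d \<Longrightarrow> mollifier r \<rho> \<Longrightarrow>
       integrable lebesgue (\<lambda>x. conv \<rho> f x - f x) \<and> (LINT x|lebesgue. \<bar>conv \<rho> f x - f x\<bar>) \<le> e"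
      using conv_L1[OF f \<open>e > 0\<close>] by metis
    define \<delta> where "\<delta> = min d r"
    have \<delta>: "0 < \<delta>" "\<delta> \<le> d" "\<delta> \<le> r" using d r by (auto simp: \<delta>_def)
    obtain \<rho> :: "'a \<Rightarrow> real" where \<rho>: "mollifier \<delta> \<rho>" using mollifierE[OF \<delta>(1)] .
    have nn: "0 \<le> \<rho> y" for y using \<rho> by (simp add: mollifier_def)
    have ge: "0 \<le> conv \<rho> f x" if "x \<in> ball x0 r" for x
    proof -
      have sub: "cball x \<delta> \<subseteq> cball x0 (2 * r)"
      proof
        fix y assume "y \<in> cball x \<delta>"
        then show "y \<in> cball x0 (2 * r)" using that \<delta>(3) dist_triangle[of x0 y x] by simp
      qed
      have t: "test_function \<Omega> (\<lambda>y. \<rho> (x - y))"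
        using mollifier_reflect_test[OF \<rho>] sub r(2) by blast
      have "conv \<rho> f x = (LINT y|lebesgue. h y * \<rho> (x - y))"
        unfolding conv_def
      proof (intro Bochner_Integration.integral_cong refl)
        fix y
        show "\<rho> (x - y) * f y = h y * \<rho> (x - y)"
        proof (cases "y \<in> cball x \<delta>")
          case True
          then show ?thesis using sub by (auto simp: f_def)
        next
          case False
          then have "\<rho> (x - y) = 0" using \<rho> by (auto simp: mollifier_def dist_norm)
          then show ?thesis by simp
        qed
      qed
      then show ?thesis using pos[OF t] nn by simp
    qed
    have "(LINT x|lebesgue. n x) \<le> (LINT x|lebesgue. \<bar>conv \<rho> f x - f x\<bar>)"
    proof (rule integral_mono[OF n])
      show "n x \<le> \<bar>conv \<rho> f x - f x\<bar>" for x
        using ge[of x] by (auto simp: n_def indicator_def)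
    qed (use d(2)[OF \<delta>(2) \<rho>] in auto)
    also have "\<dots> \<le> e" using d(2)[OF \<delta>(2) \<rho>] by simp
    finally show ?thesis .
  qed
  then have "(LINT x|lebesgue. n x) \<le> 0" by (rule field_le_epsilon[of _ 0, simplified])
  then have "(LINT x|lebesgue. n x) = 0"
    by (intro antisym Bochner_Integration.integral_nonneg) (use n0 in auto)
  then have "AE x in lebesgue. n x = 0"
    using integral_nonneg_eq_0_iff_AE[OF n] n0 by simp
  then have "AE x in lebesgue. x \<in> ball x0 r \<longrightarrow> 0 \<le> h x"
  proof eventually_elim
    case (elim x)
    show ?case
    proof
      assume x: "x \<in> ball x0 r"
      then have "f x = h x" using r(1) by (auto simp: f_def indicator_def)
      then show "0 \<le> h x" using elim x by (auto simp: n_def)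
    qed
  qed
  then show "\<exists>r>0. AE y in lebesgue. y \<in> ball x0 r \<longrightarrow> 0 \<le> h y" using r(1) by blast
qed

section \<open>Local integrability and uniqueness of weak gradients\<close>

lemma borel_measurable_lebesgue_continuous:
  fixes f :: "'a::euclidean_space \<Rightarrow> 'b::metric_space"
  assumes "continuous_on UNIV f"
  shows "f \<in> borel_measurable lebesgue"
  using borel_measurable_continuous_onI[OF assms] by (intro measurable_completion) simp

lemma integrable_lebesgue_continuous:
  fixes f :: "'a::euclidean_space \<Rightarrow> real"
  assumes "continuous_on UNIV f" "compact K" "\<And>x. x \<notin> K \<Longrightarrow> f x = 0"
  shows "integrable lebesgue f"
  using continuous_compact_support_integrable[OF assms] integrable_completion[of f lborel]
    borel_measurable_continuous_onI[OF assms(1)] by simp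

lemma integral_lebesgue_shift:
  fixes f :: "'a::euclidean_space \<Rightarrow> real"
  assumes "continuous_on UNIV f"
  shows "(LINT x|lebesgue. f (x - h)) = (LINT x|lebesgue. f x)"
proof -
  have [measurable]: "f \<in> borel_measurable borel" using assms by (rule borel_measurable_continuous_onI)
  have "(LINT x|lebesgue. f (x - h)) = (LINT x|lborel. f (x - h))" by (rule integral_completion) simp
  also have "\<dots> = (LINT x|lborel. f x)" by (rule integral_lborel_shift) simp
  also have "\<dots> = (LINT x|lebesgue. f x)" by (rule integral_completion[symmetric]) simp
  finally show ?thesis .
qed

lemma weak_gradient_locally_integrable:
  assumes "weak_gradient \<Omega> u g"
  shows "locally_integrable \<Omega> u" "locally_integrable \<Omega> g"
  by (rule assms[unfolded weak_gradient_def, THEN conjunct1],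
      rule assms[unfolded weak_gradient_def, THEN conjunct2, THEN conjunct1])

lemma locally_integrable_mult:
  fixes f \<phi> :: "'a::euclidean_space \<Rightarrow> real"
  assumes f: "locally_integrable \<Omega> f" and K: "compact K" "K \<subseteq> \<Omega>" and \<phi>: "\<phi> \<in> borel_measurable lebesgue"
    "\<And>x. x \<in> K \<Longrightarrow> \<bar>\<phi> x\<bar> \<le> B" "\<And>x. x \<notin> K \<Longrightarrow> \<phi> x = 0"
  shows "integrable lebesgue (\<lambda>x. f x * \<phi> x)"
proof -
  have i: "integrable lebesgue (\<lambda>x. indicator K x *\<^sub>R f x)"
    using f K by (simp add: locally_integrable_def set_integrable_def)
  have eq: "(\<lambda>x. f x * \<phi> x) = (\<lambda>x. (indicator K x *\<^sub>R f x) * \<phi> x)"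
    using \<phi>(3) by (auto simp: indicator_def fun_eq_iff)
  show ?thesis
    unfolding eq
  proof (rule Bochner_Integration.integrable_bound)
    show "integrable lebesgue (\<lambda>x. \<bar>B\<bar> * norm (indicator K x *\<^sub>R f x))" using i by auto
    show "(\<lambda>x. (indicator K x *\<^sub>R f x) * \<phi> x) \<in> borel_measurable lebesgue"
      using borel_measurable_integrable[OF i] \<phi>(1) by (rule borel_measurable_times)
    show "AE x in lebesgue. norm ((indicator K x *\<^sub>R f x) * \<phi> x) \<le> norm (\<bar>B\<bar> * norm (indicator K x *\<^sub>R f x))"
    proof (intro AE_I2)
      fix x
      show "norm ((indicator K x *\<^sub>R f x) * \<phi> x) \<le> norm (\<bar>B\<bar> * norm (indicator K x *\<^sub>R f x))"
      proof (cases "x \<in> K")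
        case True
        then have "\<bar>f x\<bar> * \<bar>\<phi> x\<bar> \<le> \<bar>f x\<bar> * \<bar>B\<bar>" using \<phi>(2)[OF True] by (intro mult_left_mono) auto
        then show ?thesis using True by (simp add: abs_mult mult.commute)
      qed simp
    qed
  qed
qed

lemma locally_integrable_mult_test:
  fixes f \<psi> :: "'a::euclidean_space \<Rightarrow> real"
  assumes f: "locally_integrable \<Omega> f" and \<psi>: "test_function \<Omega> \<psi>"
  shows "integrable lebesgue (\<lambda>x. f x * \<psi> x)"
proof -
  obtain K where K: "compact K" "K \<subseteq> \<Omega>" "\<And>x. x \<notin> K \<Longrightarrow> \<psi> x = 0"
    by (rule test_function_support[OF \<psi>]) blast
  obtain B where "0 \<le> B" "\<And>x. \<bar>\<psi> x\<bar> \<le> B" using test_function_bounded[OF \<psi>] by blast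
  then show ?thesis
    using K borel_measurable_lebesgue_continuous[OF test_function_continuous[OF \<psi>]]
    by (intro locally_integrable_mult[OF f K(1,2)]) auto
qed

lemma locally_integrable_inner:
  fixes g :: "'a::euclidean_space \<Rightarrow> 'b::euclidean_space"
  assumes "locally_integrable \<Omega> g"
  shows "locally_integrable \<Omega> (\<lambda>x. g x \<bullet> b)"
  unfolding locally_integrable_def set_integrable_def
proof (intro allI impI)
  fix K assume "compact K" "K \<subseteq> \<Omega>"
  then have "integrable lebesgue (\<lambda>x. indicator K x *\<^sub>R g x)"
    using assms by (simp add: locally_integrable_def set_integrable_def)
  then have "integrable lebesgue (\<lambda>x. (indicator K x *\<^sub>R g x) \<bullet> b)" by (rule integrable_inner_left)
  then show "integrable lebesgue (\<lambda>x. indicator K x *\<^sub>R (g x \<bullet> b))" by simp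
qed

lemma locally_integrable_add:
  fixes f g :: "'a::euclidean_space \<Rightarrow> 'b::euclidean_space"
  assumes "locally_integrable \<Omega> f" "locally_integrable \<Omega> g"
  shows "locally_integrable \<Omega> (\<lambda>x. f x + g x)"
  unfolding locally_integrable_def
proof (intro allI impI)
  fix K assume "compact K" "K \<subseteq> \<Omega>"
  then show "set_integrable lebesgue K (\<lambda>x. f x + g x)"
    using assms set_integral_add(1)[of lebesgue K f g] by (simp add: locally_integrable_def)
qed

lemma locally_integrable_scaleR:
  fixes f :: "'a::euclidean_space \<Rightarrow> 'b::euclidean_space"
  assumes "locally_integrable \<Omega> f"
  shows "locally_integrable \<Omega> (\<lambda>x. c *\<^sub>R f x)"
  unfolding locally_integrable_def set_integrable_def
proof (intro allI impI)
  fix K assume "compact K" "K \<subseteq> \<Omega>"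
  then have "integrable lebesgue (\<lambda>x. indicator K x *\<^sub>R f x)"
    using assms by (simp add: locally_integrable_def set_integrable_def)
  then have "integrable lebesgue (\<lambda>x. c *\<^sub>R (indicator K x *\<^sub>R f x))"
    by (rule integrable_scaleR_right)
  then show "integrable lebesgue (\<lambda>x. indicator K x *\<^sub>R (c *\<^sub>R f x))"
    by (simp add: mult.commute)
qed

lemma locally_integrable_bounded:
  fixes f :: "'a::euclidean_space \<Rightarrow> 'b::euclidean_space"
  assumes "f \<in> borel_measurable lebesgue" "\<And>K. compact K \<Longrightarrow> K \<subseteq> \<Omega> \<Longrightarrow> \<exists>B. \<forall>x\<in>K. norm (f x) \<le> B"
  shows "locally_integrable \<Omega> f"
  unfolding locally_integrable_def set_integrable_def
proof (intro allI impI)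
  fix K assume K: "compact K" "K \<subseteq> \<Omega>"
  from assms(2)[OF K] obtain B where B: "\<And>x. x \<in> K \<Longrightarrow> norm (f x) \<le> B" by blast
  have Km: "K \<in> lmeasurable" using K(1) by (rule lmeasurable_compact)
  show "integrable lebesgue (\<lambda>x. indicator K x *\<^sub>R f x)"
  proof (rule Bochner_Integration.integrable_bound)
    show "integrable lebesgue (\<lambda>x. indicator K x *\<^sub>R B)"
      using Km by (intro integrable_scaleR_left integrable_real_indicator) (auto simp: fmeasurable_def)
    show "(\<lambda>x. indicator K x *\<^sub>R f x) \<in> borel_measurable lebesgue"
      using assms(1) Km by (intro borel_measurable_scaleR) (auto simp: fmeasurable_def)
    show "AE x in lebesgue. norm (indicator K x *\<^sub>R f x) \<le> norm (indicator K x *\<^sub>R B)"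
      using B by (intro AE_I2) (auto simp: indicator_def intro: order_trans[OF _ abs_ge_self])
  qed
qed

text \<open>The components of two weak gradients have the same integrals against test functions. The
  one-sided fundamental lemma is applied to both of their differences.\<close>

lemma weak_gradient_unique:
  fixes u :: "'a::euclidean_space \<Rightarrow> real"
  assumes "weak_gradient \<Omega> u g" "weak_gradient \<Omega> u g'" "open \<Omega>"
  shows "AE x in lebesgue. x \<in> \<Omega> \<longrightarrow> g x = g' x"
proof -
  have le: "AE x in lebesgue. x \<in> \<Omega> \<longrightarrow> 0 \<le> g1 x \<bullet> b - g2 x \<bullet> b"
    if w: "weak_gradient \<Omega> u g1" "weak_gradient \<Omega> u g2" and b: "b \<in> Basis" for g1 g2 :: "'a \<Rightarrow> 'a" and b
  proof (rule fundamental_lemma_nonneg[OF assms(3)])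
    have l: "locally_integrable \<Omega> (\<lambda>x. g1 x \<bullet> b)" "locally_integrable \<Omega> (\<lambda>x. g2 x \<bullet> b)"
      by (simp_all only: locally_integrable_inner[OF weak_gradient_locally_integrable(2)[OF w(1)]]
          locally_integrable_inner[OF weak_gradient_locally_integrable(2)[OF w(2)]])
    show "locally_integrable \<Omega> (\<lambda>x. g1 x \<bullet> b - g2 x \<bullet> b)"
      using locally_integrable_add[OF l(1) locally_integrable_scaleR[OF l(2), of "-1"]] by simp
    fix \<psi> :: "'a \<Rightarrow> real" assume \<psi>: "test_function \<Omega> \<psi>"
    have "(LINT x|lebesgue. (g1 x \<bullet> b - g2 x \<bullet> b) * \<psi> x) = 0"
      unfolding left_diff_distrib
      using weak_gradientD[OF w(1) assms(3) \<psi> b] weak_gradientD[OF w(2) assms(3) \<psi> b]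
        locally_integrable_mult_test[OF l(1) \<psi>] locally_integrable_mult_test[OF l(2) \<psi>] by simp
    then show "0 \<le> (LINT x|lebesgue. (g1 x \<bullet> b - g2 x \<bullet> b) * \<psi> x)" by simp
  qed
  have "AE x in lebesgue. \<forall>b\<in>Basis. x \<in> \<Omega> \<longrightarrow> 0 \<le> g x \<bullet> b - g' x \<bullet> b"
    using le[OF assms(1,2)] by (intro AE_finite_allI) auto
  moreover have "AE x in lebesgue. \<forall>b\<in>Basis. x \<in> \<Omega> \<longrightarrow> 0 \<le> g' x \<bullet> b - g x \<bullet> b"
    using le[OF assms(2,1)] by (intro AE_finite_allI) auto
  ultimately show ?thesis
  proof eventually_elim
    case (elim x)
    show ?case
    proof
      assume x: "x \<in> \<Omega>"
      show "g x = g' x"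
      proof (rule euclidean_eqI)
        fix b :: 'a assume "b \<in> Basis"
        then have "0 \<le> g x \<bullet> b - g' x \<bullet> b" "0 \<le> g' x \<bullet> b - g x \<bullet> b"
          using bspec[OF elim(1)] bspec[OF elim(2)] x by simp_all
        then show "g x \<bullet> b = g' x \<bullet> b" by simp
      qed
    qed
  qed
qed

lemma weak_gradient_cong:
  fixes u :: "'a::euclidean_space \<Rightarrow> real"
  assumes w: "weak_gradient \<Omega> u g" and eq: "\<And>x. x \<in> \<Omega> \<Longrightarrow> u x = v x" "\<And>x. x \<in> \<Omega> \<Longrightarrow> g x = h x" and "open \<Omega>"
  shows "weak_gradient \<Omega> v h"
proof -
  have cong: "locally_integrable \<Omega> f \<longleftrightarrow> locally_integrable \<Omega> f'" if "\<And>x. x \<in> \<Omega> \<Longrightarrow> f x = f' x"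
    for f f' :: "'a \<Rightarrow> 'c::euclidean_space"
    unfolding locally_integrable_def
    using that by (intro all_cong1 imp_cong refl set_integrable_cong) auto
  show ?thesis
  proof (rule weak_gradientI[OF assms(4)])
    show "locally_integrable \<Omega> v" "locally_integrable \<Omega> h"
      using weak_gradient_locally_integrable[OF w] cong[of u v] cong[of g h] eq by simp_all
    fix \<psi> :: "'a \<Rightarrow> real" and b :: 'a assume \<psi>: "test_function \<Omega> \<psi>" and b: "b \<in> Basis"
    have "(LINT x|lebesgue. u x * frechet_derivative \<psi> (at x) b) = (LINT x|lebesgue. v x * frechet_derivative \<psi> (at x) b)"
    proof (intro Bochner_Integration.integral_cong refl)
      fix x
      show "u x * frechet_derivative \<psi> (at x) b = v x * frechet_derivative \<psi> (at x) b"
        using eq(1) test_function_outside[OF test_function_frechet_derivative[OF \<psi>], of x b]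
        by (cases "x \<in> \<Omega>") auto
    qed
    moreover have "(LINT x|lebesgue. (g x \<bullet> b) * \<psi> x) = (LINT x|lebesgue. (h x \<bullet> b) * \<psi> x)"
    proof (intro Bochner_Integration.integral_cong refl)
      fix x
      show "(g x \<bullet> b) * \<psi> x = (h x \<bullet> b) * \<psi> x"
        using eq(2) test_function_outside[OF \<psi>, of x] by (cases "x \<in> \<Omega>") auto
    qed
    ultimately show "(LINT x|lebesgue. v x * frechet_derivative \<psi> (at x) b) = - (LINT x|lebesgue. (h x \<bullet> b) * \<psi> x)"
      using weak_gradientD[OF w assms(4) \<psi> b] by simp
  qed
qed

lemma weak_gradient_add:
  fixes u v :: "'a::euclidean_space \<Rightarrow> real"
  assumes u: "weak_gradient \<Omega> u g" and v: "weak_gradient \<Omega> v h" and "open \<Omega>"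
  shows "weak_gradient \<Omega> (\<lambda>x. u x + v x) (\<lambda>x. g x + h x)"
proof (rule weak_gradientI[OF assms(3)])
  have l: "locally_integrable \<Omega> u" "locally_integrable \<Omega> g" "locally_integrable \<Omega> v" "locally_integrable \<Omega> h"
    using weak_gradient_locally_integrable[OF u] weak_gradient_locally_integrable[OF v] by simp_all
  then show "locally_integrable \<Omega> (\<lambda>x. u x + v x)" "locally_integrable \<Omega> (\<lambda>x. g x + h x)"
    by (simp_all add: locally_integrable_add)
  fix \<psi> :: "'a \<Rightarrow> real" and b :: 'a assume \<psi>: "test_function \<Omega> \<psi>" and b: "b \<in> Basis"
  show "(LINT x|lebesgue. (u x + v x) * frechet_derivative \<psi> (at x) b) = - (LINT x|lebesgue. ((g x + h x) \<bullet> b) * \<psi> x)"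
    unfolding inner_add_left distrib_right
    using weak_gradientD[OF u assms(3) \<psi> b] weak_gradientD[OF v assms(3) \<psi> b]
      locally_integrable_mult_test[OF l(1) test_function_frechet_derivative[OF \<psi>]]
      locally_integrable_mult_test[OF l(3) test_function_frechet_derivative[OF \<psi>]]
      locally_integrable_mult_test[OF locally_integrable_inner[OF l(2)] \<psi>]
      locally_integrable_mult_test[OF locally_integrable_inner[OF l(4)] \<psi>]
    by simp
qed

lemma weak_gradient_scale:
  fixes u :: "'a::euclidean_space \<Rightarrow> real"
  assumes u: "weak_gradient \<Omega> u g" and "open \<Omega>"
  shows "weak_gradient \<Omega> (\<lambda>x. c * u x) (\<lambda>x. c *\<^sub>R g x)"
proof (rule weak_gradientI[OF assms(2)])
  show "locally_integrable \<Omega> (\<lambda>x. c * u x)" "locally_integrable \<Omega> (\<lambda>x. c *\<^sub>R g x)"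
    using weak_gradient_locally_integrable[OF u] locally_integrable_scaleR[of \<Omega> u c] locally_integrable_scaleR[of \<Omega> g c]
    by simp_all
  fix \<psi> :: "'a \<Rightarrow> real" and b :: 'a assume \<psi>: "test_function \<Omega> \<psi>" and b: "b \<in> Basis"
  show "(LINT x|lebesgue. c * u x * frechet_derivative \<psi> (at x) b) = - (LINT x|lebesgue. ((c *\<^sub>R g x) \<bullet> b) * \<psi> x)"
    using weak_gradientD[OF u assms(2) \<psi> b] by (simp add: mult.assoc)
qed

section \<open>Weak gradients of Lipschitz functions and of products\<close>

text \<open>The classical gradient as a vector field, so that it can be compared with weak
  gradients; \<open>frechet_derivative\<close> is a linear map instead.\<close>

definition cgrad :: "('a::euclidean_space \<Rightarrow> real) \<Rightarrow> 'a \<Rightarrow> 'a" where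
  "cgrad \<psi> x = (\<Sum>b\<in>Basis. frechet_derivative \<psi> (at x) b *\<^sub>R b)"

lemma cgrad_inner:
  assumes "smooth \<psi>"
  shows "cgrad \<psi> x \<bullet> h = frechet_derivative \<psi> (at x) h"
  unfolding cgrad_def inner_sum_left
    sum_Basis_linear[OF linear_frechet_derivative[OF smooth_differentiable[OF assms]], of x h]
  by (intro sum.cong refl) (simp add: inner_commute)

lemma cgrad_continuous:
  assumes "smooth \<psi>"
  shows "continuous_on UNIV (cgrad \<psi>)"
  unfolding cgrad_def[abs_def]
  by (intro continuous_intros smooth_continuous smooth_frechet_derivative assms)

text \<open>Discrete integration by parts: translation invariance moves the difference quotient from
  \<open>f\<close> to \<open>\<psi>\<close>, where it converges and is dominated. The shift of
  \<open>f\<close> is backwards so that the quotient of \<open>\<psi>\<close> is forwards, which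
  accounts for the absence of a sign in the limit.\<close>

lemma difference_quotient_limit:
  fixes f \<psi> :: "'a::euclidean_space \<Rightarrow> real"
  assumes f: "L-lipschitz_on UNIV f" and \<psi>: "test_function UNIV \<psi>" and b: "norm b = 1"
  defines "t \<equiv> \<lambda>n. 1 / real (Suc n)"
  shows "(\<lambda>n. LINT x|lebesgue. (f (x - t n *\<^sub>R b) - f x) / t n * \<psi> x) \<longlonglongrightarrow>
     (LINT x|lebesgue. f x * frechet_derivative \<psi> (at x) b)"
proof -
  have sm: "smooth \<psi>" using \<psi> by (simp add: test_function_def)
  have t: "0 < t n" "t n \<le> 1" for n by (auto simp: t_def)
  have t0: "t \<longlonglongrightarrow> 0" unfolding t_def using LIMSEQ_inverse_real_of_nat by (simp add: inverse_eq_divide)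
  have cf: "continuous_on UNIV f" using f by (rule lipschitz_on_continuous_on)
  have c\<psi>: "continuous_on UNIV \<psi>" using \<psi> by (rule test_function_continuous)
  have cfs: "continuous_on UNIV (\<lambda>x. f (x + v))" for v
    by (intro continuous_on_compose2[OF cf] continuous_intros) auto
  have c\<psi>s: "continuous_on UNIV (\<lambda>x. \<psi> (x + v))" for v
    by (intro continuous_on_compose2[OF c\<psi>] continuous_intros) auto
  obtain K where K: "compact K" "\<And>x. x \<notin> K \<Longrightarrow> \<psi> x = 0" "\<And>x h. x \<notin> K \<Longrightarrow> frechet_derivative \<psi> (at x) h = 0"
    by (rule test_function_support[OF \<psi>]) blast
  \<comment> \<open>All shifts have length at most 1, so the shifted test functions share the
    support \<open>K1\<close>, which gives the dominating function.\<close>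
  define K1 where "K1 = {x + y |x y. x \<in> K \<and> y \<in> cball 0 1}"
  have K1: "compact K1" unfolding K1_def using K(1) by (intro compact_sums) auto
  have K1s: "\<psi> (x + s *\<^sub>R b) = 0" if "x \<notin> K1" "\<bar>s\<bar> \<le> 1" for x s
  proof (rule K(2), rule notI)
    assume "x + s *\<^sub>R b \<in> K"
    moreover have "x = (x + s *\<^sub>R b) + (- s *\<^sub>R b)" by simp
    moreover have "- s *\<^sub>R b \<in> cball 0 1" using that b by simp
    ultimately show False using that(1) unfolding K1_def by blast
  qed
  have K1s0: "\<psi> x = 0" if "x \<notin> K1" for x using K1s[OF that, of 0] by simp
  have eq: "(LINT x|lebesgue. (f (x - t n *\<^sub>R b) - f x) / t n * \<psi> x) =
      (LINT x|lebesgue. f x * ((\<psi> (x + t n *\<^sub>R b) - \<psi> x) / t n))" for n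
  proof -
    let ?v = "t n *\<^sub>R b"
    have i1: "integrable lebesgue (\<lambda>x. f x * \<psi> (x + ?v))"
      using K1s[of _ "t n"] t[of n]
      by (intro integrable_lebesgue_continuous[OF _ K1] continuous_on_mult cf c\<psi>s) auto
    have i2: "integrable lebesgue (\<lambda>x. f (x + (- ?v)) * \<psi> x)"
      using K(2) by (intro integrable_lebesgue_continuous[OF _ K(1)] continuous_on_mult cfs c\<psi>) auto
    have i3: "integrable lebesgue (\<lambda>x. f x * \<psi> x)"
      using K(2) by (intro integrable_lebesgue_continuous[OF _ K(1)] continuous_on_mult cf c\<psi>) auto
    have "(LINT x|lebesgue. f (x - ?v) * \<psi> x) = (LINT x|lebesgue. f x * \<psi> (x + ?v))"
      using integral_lebesgue_shift[of "\<lambda>x. f x * \<psi> (x + ?v)" ?v] cf c\<psi>s by (simp add: continuous_on_mult)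
    moreover have "(LINT x|lebesgue. (f (x - ?v) - f x) / t n * \<psi> x) =
       ((LINT x|lebesgue. f (x - ?v) * \<psi> x) - (LINT x|lebesgue. f x * \<psi> x)) / t n"
      using i2 i3 by (simp add: left_diff_distrib diff_divide_distrib)
    moreover have "(LINT x|lebesgue. f x * ((\<psi> (x + ?v) - \<psi> x) / t n)) =
       ((LINT x|lebesgue. f x * \<psi> (x + ?v)) - (LINT x|lebesgue. f x * \<psi> x)) / t n"
      using i1 i3 by (simp add: right_diff_distrib diff_divide_distrib)
    ultimately show ?thesis by (simp only:)
  qed
  obtain M where M: "\<And>x. \<bar>frechet_derivative \<psi> (at x) b\<bar> \<le> M"
    using test_function_bounded[OF test_function_frechet_derivative[OF \<psi>, of b]] by metis
  have "M \<ge> 0" using M[of 0] by simp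
  have \<psi>lip: "\<bar>\<psi> (x + s *\<^sub>R b) - \<psi> x\<bar> \<le> M * s" if "0 \<le> s" for x s
  proof -
    have d: "((\<lambda>r. \<psi> (x + r *\<^sub>R b)) has_derivative (\<lambda>h. frechet_derivative \<psi> (at (x + r *\<^sub>R b)) (h *\<^sub>R b))) (at r within S)" for r S
      by (rule has_derivative_compose[OF _ smooth_has_derivative[OF sm]]) (auto intro!: derivative_eq_intros)
    have "norm (\<psi> (x + s *\<^sub>R b) - \<psi> (x + 0 *\<^sub>R b)) \<le> M * norm (s - 0)"
    proof (rule differentiable_bound[OF convex_UNIV d])
      fix r :: real
      show "onorm (\<lambda>h. frechet_derivative \<psi> (at (x + r *\<^sub>R b)) (h *\<^sub>R b)) \<le> M"
      proof (rule onorm_bound[OF \<open>M \<ge> 0\<close>])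
        fix h :: real
        show "norm (frechet_derivative \<psi> (at (x + r *\<^sub>R b)) (h *\<^sub>R b)) \<le> M * norm h"
          using mult_left_mono[OF M[of "x + r *\<^sub>R b"], of "\<bar>h\<bar>"]
          by (simp add: linear_scale[OF linear_frechet_derivative[OF smooth_differentiable[OF sm]]] abs_mult mult.commute)
      qed
    qed auto
    then show ?thesis using that by simp
  qed
  have "bounded (f ` K1)" by (intro compact_imp_bounded compact_continuous_image K1 continuous_on_subset[OF cf]) auto
  then obtain N where N: "\<And>x. x \<in> K1 \<Longrightarrow> \<bar>f x\<bar> \<le> N" "N > 0" unfolding bounded_pos by auto
  have "(\<lambda>n. LINT x|lebesgue. f x * ((\<psi> (x + t n *\<^sub>R b) - \<psi> x) / t n)) \<longlonglongrightarrow>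
     (LINT x|lebesgue. f x * frechet_derivative \<psi> (at x) b)"
  proof (rule integral_dominated_convergence[where w = "\<lambda>x. indicator K1 x *\<^sub>R (N * M)"])
    show "(\<lambda>x. f x * frechet_derivative \<psi> (at x) b) \<in> borel_measurable lebesgue"
      by (intro borel_measurable_lebesgue_continuous continuous_on_mult cf smooth_continuous smooth_frechet_derivative sm)
    show "(\<lambda>x. f x * ((\<psi> (x + t n *\<^sub>R b) - \<psi> x) / t n)) \<in> borel_measurable lebesgue" for n
      using t[of n] by (intro borel_measurable_lebesgue_continuous continuous_on_mult cf continuous_on_divide continuous_on_diff c\<psi>s c\<psi> continuous_on_const) auto
    show "integrable lebesgue (\<lambda>x. indicator K1 x *\<^sub>R (N * M))"
      using lmeasurable_compact[OF K1] by (intro integrable_scaleR_left integrable_real_indicator) (auto simp: fmeasurable_def)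
    show "AE x in lebesgue. (\<lambda>n. f x * ((\<psi> (x + t n *\<^sub>R b) - \<psi> x) / t n)) \<longlonglongrightarrow> f x * frechet_derivative \<psi> (at x) b"
    proof (intro AE_I2 tendsto_mult tendsto_const)
      fix x
      have d: "((\<lambda>r. \<psi> (x + r *\<^sub>R b)) has_derivative (\<lambda>h. frechet_derivative \<psi> (at (x + 0 *\<^sub>R b)) (h *\<^sub>R b))) (at 0)"
        by (rule has_derivative_compose[OF _ smooth_has_derivative[OF sm]]) (auto intro!: derivative_eq_intros)
      then have "((\<lambda>r. \<psi> (x + r *\<^sub>R b)) has_field_derivative frechet_derivative \<psi> (at x) b) (at 0)"
        unfolding has_field_derivative_def
        by (rule has_derivative_eq_rhs)
          (simp add: fun_eq_iff linear_scale[OF linear_frechet_derivative[OF smooth_differentiable[OF sm]]] mult.commute)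
      then have "((\<lambda>h. (\<psi> (x + h *\<^sub>R b) - \<psi> x) / h) \<longlongrightarrow> frechet_derivative \<psi> (at x) b) (at 0)"
        by (simp add: DERIV_def)
      moreover have "filterlim t (at 0) sequentially"
        using t0 t(1) by (auto simp: filterlim_at less_imp_neq[symmetric])
      ultimately show "(\<lambda>n. (\<psi> (x + t n *\<^sub>R b) - \<psi> x) / t n) \<longlonglongrightarrow> frechet_derivative \<psi> (at x) b"
        by (rule filterlim_compose)
    qed
    show "AE x in lebesgue. norm (f x * ((\<psi> (x + t n *\<^sub>R b) - \<psi> x) / t n)) \<le> indicator K1 x *\<^sub>R (N * M)" for n
    proof (intro AE_I2)
      fix x
      show "norm (f x * ((\<psi> (x + t n *\<^sub>R b) - \<psi> x) / t n)) \<le> indicator K1 x *\<^sub>R (N * M)"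
      proof (cases "x \<in> K1")
        case True
        have "\<bar>(\<psi> (x + t n *\<^sub>R b) - \<psi> x) / t n\<bar> \<le> M"
          using \<psi>lip[of "t n" x] t(1)[of n] by (simp add: field_simps abs_divide)
        then have "\<bar>f x\<bar> * \<bar>(\<psi> (x + t n *\<^sub>R b) - \<psi> x) / t n\<bar> \<le> N * M"
          using N(1)[OF True] N(2) by (intro mult_mono) auto
        then show ?thesis using True by (simp add: abs_mult)
      next
        case False
        then show ?thesis using K1s[OF False, of "t n"] K1s0[OF False] t[of n] by simp
      qed
    qed
  qed
  then show ?thesis by (simp only: eq)
qed

text \<open>The integrals of the difference quotients of \<open>f\<close> have two limits: the one
  of \<open>difference_quotient_limit\<close>, and by dominated convergence, with the Lipschitz
  constant as bound, the integral of the classical derivative. Equating them is the weak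
  identity.\<close>

lemma weak_gradient_lipschitz:
  fixes f :: "'a::euclidean_space \<Rightarrow> real"
  assumes f: "L-lipschitz_on UNIV f" and "open \<Omega>" and G: "G \<in> borel_measurable lebesgue" "\<And>x. norm (G x) \<le> B"
    and d: "AE x in lebesgue. x \<in> \<Omega> \<longrightarrow> (f has_derivative (\<lambda>h. G x \<bullet> h)) (at x)"
  shows "weak_gradient \<Omega> f G"
proof (rule weak_gradientI[OF assms(2)])
  have cf: "continuous_on UNIV f" using f by (rule lipschitz_on_continuous_on)
  have L: "\<bar>f x - f y\<bar> \<le> L * norm (x - y)" for x y
    using lipschitz_onD[OF f, of x y] by (simp add: dist_norm)
  show "locally_integrable \<Omega> f"
  proof (rule locally_integrable_bounded)
    show "f \<in> borel_measurable lebesgue" using cf by (rule borel_measurable_lebesgue_continuous)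
    fix K :: "'a set" assume "compact K"
    then have "bounded (f ` K)" by (intro compact_imp_bounded compact_continuous_image continuous_on_subset[OF cf]) auto
    then show "\<exists>B. \<forall>x\<in>K. norm (f x) \<le> B" unfolding bounded_iff by auto
  qed
  show lG: "locally_integrable \<Omega> G"
    using G by (intro locally_integrable_bounded) auto
  fix \<psi> :: "'a \<Rightarrow> real" and b :: 'a assume \<psi>: "test_function \<Omega> \<psi>" and b: "b \<in> Basis"
  have nb: "norm b = 1" using b by simp
  define t where "t n = 1 / real (Suc n)" for n
  have t: "0 < t n" for n by (simp add: t_def)
  have t0: "t \<longlonglongrightarrow> 0" unfolding t_def using LIMSEQ_inverse_real_of_nat by (simp add: inverse_eq_divide)
  have lim1: "(\<lambda>n. LINT x|lebesgue. (f (x - t n *\<^sub>R b) - f x) / t n * \<psi> x) \<longlonglongrightarrow>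
     (LINT x|lebesgue. f x * frechet_derivative \<psi> (at x) b)"
    unfolding t_def using difference_quotient_limit[OF f test_function_mono[OF \<psi>] nb] by simp
  have c\<psi>: "continuous_on UNIV \<psi>" using \<psi> by (rule test_function_continuous)
  obtain K where K: "compact K" "K \<subseteq> \<Omega>" "\<And>x. x \<notin> K \<Longrightarrow> \<psi> x = 0"
    by (rule test_function_support[OF \<psi>]) blast
  have lim2: "(\<lambda>n. LINT x|lebesgue. (f (x - t n *\<^sub>R b) - f x) / t n * \<psi> x) \<longlonglongrightarrow>
     (LINT x|lebesgue. - (G x \<bullet> b) * \<psi> x)"
  proof (rule integral_dominated_convergence[where w = "\<lambda>x. L * \<bar>\<psi> x\<bar>"])
    show "(\<lambda>x. - (G x \<bullet> b) * \<psi> x) \<in> borel_measurable lebesgue"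
      using borel_measurable_integrable[OF locally_integrable_mult_test[OF locally_integrable_inner[OF lG] \<psi>], of b]
      by simp
    show "(\<lambda>x. (f (x - t n *\<^sub>R b) - f x) / t n * \<psi> x) \<in> borel_measurable lebesgue" for n
      using t[of n]
      by (intro borel_measurable_lebesgue_continuous continuous_on_mult c\<psi> continuous_on_divide continuous_on_diff cf
          continuous_on_const continuous_on_compose2[OF cf] continuous_on_id) auto
    show "integrable lebesgue (\<lambda>x. L * \<bar>\<psi> x\<bar>)"
      using K integrable_lebesgue_continuous[OF c\<psi> K(1,3)] by simp
    show "AE x in lebesgue. (\<lambda>n. (f (x - t n *\<^sub>R b) - f x) / t n * \<psi> x) \<longlonglongrightarrow> - (G x \<bullet> b) * \<psi> x"
      using d
    proof eventually_elim
      case (elim x)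
      show ?case
      proof (cases "x \<in> \<Omega>")
        case True
        then have dx: "(f has_derivative (\<lambda>h. G x \<bullet> h)) (at (x - 0 *\<^sub>R b))" using elim by simp
        have "((\<lambda>r. f (x - r *\<^sub>R b)) has_derivative (\<lambda>h. G x \<bullet> - (h *\<^sub>R b))) (at 0)"
          by (rule has_derivative_compose[where f = "\<lambda>r. x - r *\<^sub>R b" and g = f and x = 0, OF _ dx])
            (auto intro!: derivative_eq_intros)
        then have "((\<lambda>r. f (x - r *\<^sub>R b)) has_field_derivative - (G x \<bullet> b)) (at 0)"
          unfolding has_field_derivative_def
          by (rule has_derivative_eq_rhs) (simp add: fun_eq_iff mult.commute)
        then have "((\<lambda>h. (f (x - h *\<^sub>R b) - f x) / h) \<longlongrightarrow> - (G x \<bullet> b)) (at 0)"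
          by (simp add: DERIV_def)
        moreover have "filterlim t (at 0) sequentially"
          using t0 t by (auto simp: filterlim_at less_imp_neq[symmetric])
        ultimately have "(\<lambda>n. (f (x - t n *\<^sub>R b) - f x) / t n) \<longlonglongrightarrow> - (G x \<bullet> b)"
          by (rule filterlim_compose)
        then show ?thesis by (intro tendsto_mult tendsto_const)
      next
        case False
        then show ?thesis using test_function_outside[OF \<psi>] by simp
      qed
    qed
    show "AE x in lebesgue. norm ((f (x - t n *\<^sub>R b) - f x) / t n * \<psi> x) \<le> L * \<bar>\<psi> x\<bar>" for n
    proof (intro AE_I2)
      fix x
      have "\<bar>(f (x - t n *\<^sub>R b) - f x) / t n\<bar> \<le> L"
        using L[of "x - t n *\<^sub>R b" x] t[of n] nb by (simp add: field_simps abs_divide)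
      then show "norm ((f (x - t n *\<^sub>R b) - f x) / t n * \<psi> x) \<le> L * \<bar>\<psi> x\<bar>"
        by (simp only: real_norm_def abs_mult) (rule mult_right_mono, auto)
    qed
  qed
  show "(LINT x|lebesgue. f x * frechet_derivative \<psi> (at x) b) = - (LINT x|lebesgue. (G x \<bullet> b) * \<psi> x)"
    using LIMSEQ_unique[OF lim1 lim2] by simp
qed

lemma test_function_lipschitz:
  fixes \<psi> :: "'a::euclidean_space \<Rightarrow> real"
  assumes \<psi>: "test_function \<Omega> \<psi>"
  obtains L where "L-lipschitz_on UNIV \<psi>" "\<And>x. norm (cgrad \<psi> x) \<le> L"
proof -
  have sm: "smooth \<psi>" using \<psi> by (simp add: test_function_def)
  have "\<exists>M. \<forall>x. \<bar>frechet_derivative \<psi> (at x) b\<bar> \<le> M" for b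
    using test_function_bounded[OF test_function_frechet_derivative[OF \<psi>, of b]] by metis
  then obtain M where M: "\<And>b x. \<bar>frechet_derivative \<psi> (at x) b\<bar> \<le> M b" by metis
  define L where "L = (\<Sum>b\<in>(Basis::'a set). M b)"
  have Lb: "norm (cgrad \<psi> x) \<le> L" for x
    unfolding cgrad_def L_def by (rule sum_norm_le) (simp add: M)
  have L0: "0 \<le> L" using order_trans[OF norm_ge_zero Lb] .
  have "L-lipschitz_on UNIV \<psi>"
  proof (rule lipschitz_onI[OF _ L0])
    fix x y :: 'a
    have "norm (\<psi> x - \<psi> y) \<le> L * norm (x - y)"
    proof (rule differentiable_bound[OF convex_UNIV])
      show "(\<psi> has_derivative (\<lambda>h. cgrad \<psi> z \<bullet> h)) (at z within UNIV)" for z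
        using smooth_has_derivative[OF sm, of z] by (simp add: cgrad_inner[OF sm])
      show "onorm (\<lambda>h. cgrad \<psi> z \<bullet> h) \<le> L" for z
      proof (rule onorm_bound[OF L0])
        fix h :: 'a
        have "norm (cgrad \<psi> z \<bullet> h) \<le> norm (cgrad \<psi> z) * norm h" by (simp add: Cauchy_Schwarz_ineq2)
        also have "\<dots> \<le> L * norm h" using Lb by (simp add: mult_right_mono)
        finally show "norm (cgrad \<psi> z \<bullet> h) \<le> L * norm h" .
      qed
    qed auto
    then show "dist (\<psi> x) (\<psi> y) \<le> L * dist x y" by (simp add: dist_norm)
  qed
  then show ?thesis using Lb that by blast
qed

lemma weak_gradient_test_function:
  fixes \<psi> :: "'a::euclidean_space \<Rightarrow> real"
  assumes \<psi>: "test_function S \<psi>" and "open \<Omega>"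
  shows "weak_gradient \<Omega> \<psi> (cgrad \<psi>)"
proof -
  have sm: "smooth \<psi>" using \<psi> by (simp add: test_function_def)
  obtain L where L: "L-lipschitz_on UNIV \<psi>" "\<And>x. norm (cgrad \<psi> x) \<le> L"
    using test_function_lipschitz[OF \<psi>] by blast
  have "(\<psi> has_derivative (\<lambda>h. cgrad \<psi> x \<bullet> h)) (at x)" for x
    using smooth_has_derivative[OF sm, of x] by (simp add: cgrad_inner[OF sm])
  then show ?thesis
    using L assms(2) borel_measurable_lebesgue_continuous[OF cgrad_continuous[OF sm]]
    by (intro weak_gradient_lipschitz[OF L(1)]) auto
qed

text \<open>Difference quotients are bounded by \<open>L\<close>, and in the limit so is the weak
  derivative, as a functional on nonnegative test functions. The fundamental lemma for
  \<open>L + g x \<bullet> b\<close> and \<open>L - g x \<bullet> b\<close> makes this pointwise.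
  The lemma is applied along the curves, where the single component is the whole derivative.\<close>

lemma weak_gradient_lipschitz_bound:
  fixes f :: "'a::euclidean_space \<Rightarrow> real"
  assumes f: "L-lipschitz_on UNIV f" and w: "weak_gradient \<Omega> f g" "open \<Omega>"
  shows "AE x in lebesgue. x \<in> \<Omega> \<longrightarrow> (\<forall>b\<in>Basis. \<bar>g x \<bullet> b\<bar> \<le> L)"
proof -
  have Lf: "\<bar>f x - f y\<bar> \<le> L * norm (x - y)" for x y
    using lipschitz_onD[OF f, of x y] by (simp add: dist_norm)
  have lg: "locally_integrable \<Omega> (\<lambda>x. g x \<bullet> b)" for b
    using locally_integrable_inner[OF weak_gradient_locally_integrable(2)[OF w(1)]] .
  have lc: "locally_integrable \<Omega> (\<lambda>x. L)" by (rule locally_integrable_bounded) auto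
  \<comment> \<open>\<open>s\<close> is the sign with which the component of \<open>g\<close>
    enters; both signs together give the absolute value.\<close>
  have main: "AE x in lebesgue. x \<in> \<Omega> \<longrightarrow> 0 \<le> L + s * (g x \<bullet> b)" if b: "b \<in> Basis" and s: "\<bar>s\<bar> = 1" for b s
  proof (rule fundamental_lemma_nonneg[OF w(2)])
    have nb: "norm b = 1" using b by simp
    show "locally_integrable \<Omega> (\<lambda>x. L + s * (g x \<bullet> b))"
      using locally_integrable_add[OF lc locally_integrable_scaleR[OF lg, of s b]] by simp
    fix \<psi> :: "'a \<Rightarrow> real" assume \<psi>: "test_function \<Omega> \<psi>" and nn: "\<And>x. 0 \<le> \<psi> x"
    define t where "t n = 1 / real (Suc n)" for n
    have t: "0 < t n" for n by (simp add: t_def)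
    have lim: "(\<lambda>n. LINT x|lebesgue. (f (x - t n *\<^sub>R b) - f x) / t n * \<psi> x) \<longlonglongrightarrow>
       (LINT x|lebesgue. f x * frechet_derivative \<psi> (at x) b)"
      unfolding t_def using difference_quotient_limit[OF f test_function_mono[OF \<psi>] nb] by simp
    have i\<psi>: "integrable lebesgue (\<lambda>x. L * \<psi> x)"
      using locally_integrable_mult_test[OF lc \<psi>] .
    have "\<bar>LINT x|lebesgue. (f (x - t n *\<^sub>R b) - f x) / t n * \<psi> x\<bar> \<le> (LINT x|lebesgue. L * \<psi> x)" for n
    proof (rule integral_abs_bound_integral)
      have cf: "continuous_on UNIV f" using f by (rule lipschitz_on_continuous_on)
      obtain K where K: "compact K" "K \<subseteq> \<Omega>" "\<And>x. x \<notin> K \<Longrightarrow> \<psi> x = 0"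
        by (rule test_function_support[OF \<psi>]) blast
      show "integrable lebesgue (\<lambda>x. (f (x - t n *\<^sub>R b) - f x) / t n * \<psi> x)"
        using t[of n] K(3) test_function_continuous[OF \<psi>]
        by (intro integrable_lebesgue_continuous[OF _ K(1)] continuous_on_mult continuous_on_divide continuous_on_diff cf
          continuous_on_const continuous_on_compose2[OF cf] continuous_on_id) auto
      fix x
      have "\<bar>(f (x - t n *\<^sub>R b) - f x) / t n\<bar> \<le> L"
        using Lf[of "x - t n *\<^sub>R b" x] t[of n] nb by (simp add: field_simps abs_divide)
      then have "\<bar>(f (x - t n *\<^sub>R b) - f x) / t n\<bar> * \<bar>\<psi> x\<bar> \<le> L * \<bar>\<psi> x\<bar>"
        by (rule mult_right_mono) simp
      then show "\<bar>(f (x - t n *\<^sub>R b) - f x) / t n * \<psi> x\<bar> \<le> L * \<psi> x"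
        by (simp only: abs_mult abs_of_nonneg[OF nn])
    qed (use i\<psi> in auto)
    then have le: "\<bar>LINT x|lebesgue. f x * frechet_derivative \<psi> (at x) b\<bar> \<le> (LINT x|lebesgue. L * \<psi> x)"
      using tendsto_rabs[OF lim] by (intro LIMSEQ_le_const2[of _ _ "LINT x|lebesgue. L * \<psi> x"]) auto
    have "(LINT x|lebesgue. (L + s * (g x \<bullet> b)) * \<psi> x) = (LINT x|lebesgue. L * \<psi> x) + s * (LINT x|lebesgue. (g x \<bullet> b) * \<psi> x)"
      unfolding distrib_right mult.assoc using locally_integrable_mult_test[OF lg \<psi>] i\<psi> by simp
    also have "\<bar>s * (LINT x|lebesgue. (g x \<bullet> b) * \<psi> x)\<bar> \<le> (LINT x|lebesgue. L * \<psi> x)"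
      using le weak_gradientD[OF w \<psi> b] s by (simp add: abs_mult)
    then have "0 \<le> (LINT x|lebesgue. L * \<psi> x) + s * (LINT x|lebesgue. (g x \<bullet> b) * \<psi> x)" by linarith
    finally show "0 \<le> (LINT x|lebesgue. (L + s * (g x \<bullet> b)) * \<psi> x)" by simp
  qed
  have a1: "AE x in lebesgue. \<forall>b\<in>Basis. x \<in> \<Omega> \<longrightarrow> 0 \<le> L + 1 * (g x \<bullet> b)"
    by (rule AE_finite_allI[OF finite_Basis main]) auto
  have a2: "AE x in lebesgue. \<forall>b\<in>Basis. x \<in> \<Omega> \<longrightarrow> 0 \<le> L + (-1) * (g x \<bullet> b)"
    by (rule AE_finite_allI[OF finite_Basis main]) auto
  from a1 a2 show ?thesis
  proof eventually_elim
    case (elim x)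
    show ?case
    proof (intro impI ballI)
      fix b :: 'a assume "x \<in> \<Omega>" "b \<in> Basis"
      then show "\<bar>g x \<bullet> b\<bar> \<le> L" using bspec[OF elim(1), of b] bspec[OF elim(2), of b] by simp
    qed
  qed
qed

text \<open>Weak gradients are tested in basis directions only. All directions are needed to bound
  the derivative by the Euclidean norm of the gradient without a dimensional factor.\<close>

lemma weak_gradient_conv_direction:
  fixes u :: "'a::euclidean_space \<Rightarrow> real"
  assumes w: "weak_gradient \<Omega> u g" "open \<Omega>" and \<rho>: "mollifier d \<rho>" and x: "cball x d \<subseteq> \<Omega>"
    and f: "integrable lebesgue f" "\<And>y. y \<in> cball x d \<Longrightarrow> f y = u y"
    and G: "\<And>y. y \<in> cball x d \<Longrightarrow> G y = g y" "integrable lebesgue G"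
  shows "frechet_derivative (conv \<rho> f) (at x) h = conv \<rho> (\<lambda>y. G y \<bullet> h) x"
proof -
  have t: "test_function UNIV \<rho>" using \<rho> by (auto simp: mollifier_def)
  have "frechet_derivative (conv \<rho> f) (at x) h = (\<Sum>b\<in>Basis. (h \<bullet> b) *\<^sub>R frechet_derivative (conv \<rho> f) (at x) b)"
    by (rule sum_Basis_linear[OF linear_frechet_derivative[OF smooth_differentiable[OF smooth_conv[OF t f(1)]]]])
  also have "\<dots> = (\<Sum>b\<in>Basis. (h \<bullet> b) * conv \<rho> (\<lambda>y. G y \<bullet> b) x)"
    using weak_gradient_conv[OF w \<rho> x f _ G(1)] by (intro sum.cong) auto
  also have "\<dots> = (LINT y|lebesgue. (\<Sum>b\<in>Basis. (h \<bullet> b) * (\<rho> (x - y) * (G y \<bullet> b))))"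
    unfolding conv_def using conv_integrable[OF t integrable_inner_left[OF G(2)]]
    by (subst Bochner_Integration.integral_sum) auto
  also have "\<dots> = conv \<rho> (\<lambda>y. G y \<bullet> h) x"
    unfolding conv_def
  proof (intro Bochner_Integration.integral_cong refl)
    fix y
    show "(\<Sum>b\<in>Basis. (h \<bullet> b) * (\<rho> (x - y) * (G y \<bullet> b))) = \<rho> (x - y) * (G y \<bullet> h)"
      unfolding euclidean_inner[of "G y" h] sum_distrib_left by (intro sum.cong) auto
  qed
  finally show ?thesis .
qed

text \<open>A mollification of \<open>f\<close> has the mollified gradient, which is bounded by
  \<open>M\<close>, so it is \<open>M\<close>-Lipschitz on the convex ball; at each point its values
  tend to those of the continuous \<open>f\<close>. The conclusion holds at every point and thus can
  be used on curves.\<close>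

lemma bounded_weak_gradient_lipschitz:
  fixes f :: "'a::euclidean_space \<Rightarrow> real"
  assumes w: "weak_gradient \<Omega> f g" "open \<Omega>" and bound: "AE x in lebesgue. x \<in> \<Omega> \<longrightarrow> norm (g x) \<le> M"
    and "0 \<le> M" and cont: "continuous_on \<Omega> f" and r: "0 < r" "cball x0 (2 * r) \<subseteq> \<Omega>"
  shows "M-lipschitz_on (ball x0 r) f"
proof (rule lipschitz_onI[OF _ \<open>0 \<le> M\<close>])
  fix x y assume x: "x \<in> ball x0 r" and y: "y \<in> ball x0 r"
  define F where "F = (\<lambda>z. indicator (cball x0 (2 * r)) z *\<^sub>R f z)"
  define G where "G = (\<lambda>z. indicator (cball x0 (2 * r)) z *\<^sub>R g z)"
  have iF: "integrable lebesgue F"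
    unfolding F_def by (rule locally_integrable_cball[OF weak_gradient_locally_integrable(1)[OF w(1)] r(2)])
  have iG: "integrable lebesgue G"
    unfolding G_def by (rule locally_integrable_cball[OF weak_gradient_locally_integrable(2)[OF w(1)] r(2)])
  \<comment> \<open>The bound on the gradient holds almost everywhere, but \<open>conv_near\<close>
    asks for it at every point; \<open>G'\<close> is changed on a null set to this end.\<close>
  define G' where "G' = (\<lambda>z. if norm (G z) \<le> M then G z else 0)"
  have mG: "G \<in> borel_measurable lebesgue" using iG by auto
  have mG': "G' \<in> borel_measurable lebesgue" unfolding G'_def using mG by measurable
  have ae: "AE z in lebesgue. G z = G' z"
    using bound by eventually_elim (use r(2) \<open>0 \<le> M\<close> in \<open>auto simp: G'_def G_def indicator_def\<close>)
  have iG': "integrable lebesgue G'" using integrable_cong_AE_imp[OF iG mG' ] ae by auto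
  have conveq: "conv \<rho> (\<lambda>y. G y \<bullet> h) = conv \<rho> (\<lambda>y. G' y \<bullet> h)" if "test_function UNIV \<rho>" for \<rho> h
  proof (rule conv_cong_AE[OF that])
    show "AE z in lebesgue. G z \<bullet> h = G' z \<bullet> h" using ae by eventually_elim simp
  qed (use iG iG' in auto)
  have *: "\<bar>f x - f y\<bar> \<le> M * norm (x - y) + 2 * e" if "0 < e" for e
  proof -
    have near: "\<exists>d>0. \<forall>w. norm (z - w) < d \<longrightarrow> \<bar>F w - f z\<bar> \<le> e" if z: "z \<in> ball x0 r" for z
    proof -
      have zb: "z \<in> ball x0 (2 * r)" using z r(1) by auto
      have "isCont f z"
        using cont w(2) r(2) zb by (meson continuous_on_eq_continuous_at ball_subset_cball subset_iff)
      then obtain d where d: "d > 0" "\<And>w. dist w z < d \<Longrightarrow> dist (f w) (f z) < e"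
        using \<open>0 < e\<close> unfolding continuous_at_eps_delta by blast
      obtain d' where d': "d' > 0" "ball z d' \<subseteq> ball x0 (2 * r)" using zb open_ball open_contains_ball by metis
      show ?thesis
      proof (intro exI[of _ "min d d'"] conjI allI impI)
        fix w assume wz: "norm (z - w) < min d d'"
        then have "w \<in> ball z d'" by (simp add: dist_norm)
        then have "w \<in> cball x0 (2 * r)" using d'(2) ball_subset_cball by blast
        then have "F w = f w" by (simp add: F_def)
        moreover have "dist (f w) (f z) < e" using wz by (intro d(2)) (simp add: dist_norm norm_minus_commute)
        ultimately show "\<bar>F w - f z\<bar> \<le> e" by (simp add: dist_real_def)
      qed (use d d' in auto)
    qed
    obtain dx where dx: "dx > 0" "\<And>w. norm (x - w) < dx \<Longrightarrow> \<bar>F w - f x\<bar> \<le> e" using near[OF x] by blast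
    obtain dy where dy: "dy > 0" "\<And>w. norm (y - w) < dy \<Longrightarrow> \<bar>F w - f y\<bar> \<le> e" using near[OF y] by blast
    define d where "d = min r (min dx dy)"
    have d: "0 < d" "d \<le> r" "d \<le> dx" "d \<le> dy" using r dx dy by (auto simp: d_def)
    obtain \<rho> :: "'a \<Rightarrow> real" where \<rho>: "mollifier d \<rho>" using mollifierE[OF d(1)] .
    have t: "test_function UNIV \<rho>" using \<rho> by (simp add: mollifier_def)
    have 1: "\<bar>conv \<rho> F x - f x\<bar> \<le> e" using dx(2) d by (intro conv_near[OF \<rho> iF]) auto
    have 2: "\<bar>conv \<rho> F y - f y\<bar> \<le> e" using dy(2) d by (intro conv_near[OF \<rho> iF]) auto
    have "norm (conv \<rho> F x - conv \<rho> F y) \<le> M * norm (x - y)"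
    proof (rule differentiable_bound[OF convex_ball])
      fix z assume z: "z \<in> ball x0 r"
      show "(conv \<rho> F has_derivative frechet_derivative (conv \<rho> F) (at z)) (at z within ball x0 r)"
        using smooth_has_derivative[OF smooth_conv[OF t iF]] by (rule has_derivative_at_withinI)
      have sub: "cball z d \<subseteq> cball x0 (2 * r)"
      proof
        fix v assume "v \<in> cball z d"
        then show "v \<in> cball x0 (2 * r)" using z d(2) dist_triangle[of x0 v z] by simp
      qed
      show "onorm (frechet_derivative (conv \<rho> F) (at z)) \<le> M"
      proof (rule onorm_bound[OF \<open>0 \<le> M\<close>])
        fix h :: 'a
        have "frechet_derivative (conv \<rho> F) (at z) h = conv \<rho> (\<lambda>y. G y \<bullet> h) z"
          using sub r(2) iG iF by (intro weak_gradient_conv_direction[OF w \<rho>]) (auto simp: F_def G_def)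
        also have "\<dots> = conv \<rho> (\<lambda>y. G' y \<bullet> h) z" by (simp add: conveq[OF t])
        finally have eq: "frechet_derivative (conv \<rho> F) (at z) h = conv \<rho> (\<lambda>y. G' y \<bullet> h) z" .
        have "\<bar>conv \<rho> (\<lambda>y. G' y \<bullet> h) z - 0\<bar> \<le> M * norm h"
        proof (rule conv_near[OF \<rho> integrable_inner_left[OF iG']])
          fix v
          have "\<bar>G' v \<bullet> h\<bar> \<le> norm (G' v) * norm h" by (rule Cauchy_Schwarz_ineq2)
          also have "\<dots> \<le> M * norm h" using \<open>0 \<le> M\<close> by (intro mult_right_mono) (auto simp: G'_def)
          finally show "\<bar>G' v \<bullet> h - 0\<bar> \<le> M * norm h" by simp
        qed
        then show "norm (frechet_derivative (conv \<rho> F) (at z) h) \<le> M * norm h" by (simp add: eq)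
      qed
    qed (use x y in auto)
    then show ?thesis using 1 2 by simp
  qed
  have "\<bar>f x - f y\<bar> \<le> M * norm (x - y)"
  proof (rule field_le_epsilon)
    fix e :: real assume "0 < e"
    then show "\<bar>f x - f y\<bar> \<le> M * norm (x - y) + e" using *[of "e / 2"] by simp
  qed
  then show "dist (f x) (f y) \<le> M * dist x y" by (simp add: dist_norm)
qed

text \<open>One mollification provides every kind of closeness that is needed later. Uniform
  closeness of the values also controls them on the interface; for the gradients a common bound and
  L1 closeness replace an L2 theory of mollification.\<close>

lemma test_function_approx:
  fixes F :: "'a::euclidean_space \<Rightarrow> real"
  assumes "open \<Omega>" and K: "compact K" "K \<subseteq> \<Omega>" and F: "continuous_on UNIV F" "\<And>x. x \<notin> K \<Longrightarrow> F x = 0"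
    and w: "weak_gradient \<Omega> F G" and G: "AE x in lebesgue. norm (G x) \<le> B" "\<And>x. x \<notin> K \<Longrightarrow> G x = 0"
    and "0 \<le> B" "0 < e"
  obtains \<phi> where "test_function \<Omega> \<phi>" "\<And>x. \<bar>\<phi> x - F x\<bar> \<le> e" "\<And>x. norm (cgrad \<phi> x) \<le> B"
    "integrable lebesgue (\<lambda>x. norm (cgrad \<phi> x - G x))" "(LINT x|lebesgue. norm (cgrad \<phi> x - G x)) \<le> e"
proof -
  have iG: "integrable lebesgue G"
  proof -
    have "integrable lebesgue (\<lambda>x. indicator K x *\<^sub>R G x)"
      using weak_gradient_locally_integrable(2)[OF w] K by (simp add: locally_integrable_def set_integrable_def)
    moreover have "(\<lambda>x. indicator K x *\<^sub>R G x) = G" using G(2) by (auto simp: indicator_def fun_eq_iff)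
    ultimately show ?thesis by simp
  qed
  have iF: "integrable lebesgue F" using F K by (rule_tac integrable_lebesgue_continuous)
  define G' where "G' = (\<lambda>z. if norm (G z) \<le> B then G z else 0)"
  have mG: "G \<in> borel_measurable lebesgue" using iG by auto
  have mG': "G' \<in> borel_measurable lebesgue" unfolding G'_def using mG by measurable
  have ae: "AE z in lebesgue. G z = G' z"
    using G(1) by eventually_elim (auto simp: G'_def)
  have iG': "integrable lebesgue G'" using integrable_cong_AE_imp[OF iG mG'] ae by auto
  have conveq: "conv \<rho> (\<lambda>y. G y \<bullet> h) = conv \<rho> (\<lambda>y. G' y \<bullet> h)" if "test_function UNIV \<rho>" for \<rho> h
  proof (rule conv_cong_AE[OF that])
    show "AE z in lebesgue. G z \<bullet> h = G' z \<bullet> h" using ae by eventually_elim simp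
  qed (use iG iG' in auto)
  obtain r where r: "0 < r" "(\<Union>x\<in>K. cball x r) \<subseteq> \<Omega>"
    using compact_subset_open_imp_cball_epsilon_subset[OF K(1) assms(1) K(2)] by metis
  obtain d1 where d1: "0 < d1" "\<And>x y. norm (x - y) < d1 \<Longrightarrow> \<bar>F x - F y\<bar> < e"
    using compact_support_uniformly_continuous[OF F(1) K(1) F(2) \<open>0 < e\<close>] by metis
  \<comment> \<open>The norm of a vector is at most the sum of the absolute values of its
    components, each of which gets an equal share of \<open>e\<close>.\<close>
  define e' where "e' = e / DIM('a)"
  have e': "e' > 0" using \<open>0 < e\<close> by (simp add: e'_def)
  have "\<forall>b. \<exists>d>0. \<forall>r \<rho>. r \<le> d \<longrightarrow> mollifier r \<rho> \<longrightarrow>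
     integrable lebesgue (\<lambda>x. conv \<rho> (\<lambda>y. G y \<bullet> b) x - G x \<bullet> b) \<and>
     (LINT x|lebesgue. \<bar>conv \<rho> (\<lambda>y. G y \<bullet> b) x - G x \<bullet> b\<bar>) \<le> e'"
    by (rule allI, rule conv_L1[OF integrable_inner_left[OF iG] e']) blast
  from choice[OF this] obtain d2 where d2: "\<And>b. 0 < d2 b" "\<And>b r \<rho>. r \<le> d2 b \<Longrightarrow> mollifier r \<rho> \<Longrightarrow>
     integrable lebesgue (\<lambda>x. conv \<rho> (\<lambda>y. G y \<bullet> b) x - G x \<bullet> b) \<and>
     (LINT x|lebesgue. \<bar>conv \<rho> (\<lambda>y. G y \<bullet> b) x - G x \<bullet> b\<bar>) \<le> e'"
    by blast
  define D where "D = Min (d2 ` (Basis :: 'a set))"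
  have D: "D > 0" "\<And>b. b \<in> Basis \<Longrightarrow> D \<le> d2 b"
    using d2(1) by (auto simp: D_def)
  \<comment> \<open>Half of \<open>r\<close> because a point of \<open>K'\<close> is within
    \<open>d\<close> of \<open>K\<close>, and its own ball of radius \<open>d\<close> still has to
    lie in \<open>\<Omega>\<close>.\<close>
  define d where "d = min (r / 2) (min d1 D)"
  have d: "0 < d" "2 * d \<le> r" "d \<le> d1" "d \<le> D" using r d1 D by (auto simp: d_def)
  obtain \<rho> :: "'a \<Rightarrow> real" where \<rho>: "mollifier d \<rho>" using mollifierE[OF d(1)] .
  have t: "test_function UNIV \<rho>" using \<rho> by (simp add: mollifier_def)
  define \<phi> where "\<phi> = conv \<rho> F"
  have sm: "smooth \<phi>" unfolding \<phi>_def by (rule smooth_conv[OF t iF])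
  define K' where "K' = {x + y |x y. x \<in> K \<and> y \<in> cball 0 d}"
  have K': "compact K'" unfolding K'_def using K(1) by (intro compact_sums) auto
  have K'I: "x \<in> K'" if "y \<in> K" "norm (x - y) \<le> d" for x y
  proof -
    have "x = y + (x - y)" by simp
    moreover have "x - y \<in> cball 0 d" using that by simp
    ultimately show ?thesis using that(1) unfolding K'_def by blast
  qed
  have sub: "cball x d \<subseteq> \<Omega>" if "x \<in> K'" for x
  proof
    fix z assume z: "z \<in> cball x d"
    from that obtain y v where "x = y + v" "y \<in> K" "norm v \<le> d" unfolding K'_def by auto
    then have "dist y z \<le> r" using z d(2) dist_triangle[of y z x] by (simp add: dist_norm)
    then show "z \<in> \<Omega>" using \<open>y \<in> K\<close> subsetD[OF r(2), of z] by auto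
  qed
  have K'\<Omega>: "K' \<subseteq> \<Omega>" using sub d(1) by (meson centre_in_cball less_imp_le subset_iff)
  have \<phi>0: "\<phi> x = 0" if "x \<notin> K'" for x
  proof -
    have "\<bar>conv \<rho> F x - 0\<bar> \<le> 0"
    proof (rule conv_near[OF \<rho> iF])
      fix y assume "norm (x - y) < d"
      then have "y \<notin> K" using K'I[of y x] that by auto
      then show "\<bar>F y - 0\<bar> \<le> 0" using F(2) by simp
    qed
    then show ?thesis by (simp add: \<phi>_def)
  qed
  have t\<phi>: "test_function \<Omega> \<phi>" using \<phi>0 by (rule test_functionI[OF sm K' K'\<Omega>])
  have fd: "frechet_derivative \<phi> (at x) h = conv \<rho> (\<lambda>y. G y \<bullet> h) x" for x h
  proof (cases "x \<in> K'")
    case True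
    show ?thesis
      unfolding \<phi>_def using sub[OF True] by (intro weak_gradient_conv_direction[OF w assms(1) \<rho> _ iF _ _ iG]) auto
  next
    case False
    have "\<bar>conv \<rho> (\<lambda>y. G y \<bullet> h) x - 0\<bar> \<le> 0"
    proof (rule conv_near[OF \<rho> integrable_inner_left[OF iG]])
      fix y assume "norm (x - y) < d"
      then have "y \<notin> K" using K'I[of y x] False by auto
      then show "\<bar>G y \<bullet> h - 0\<bar> \<le> 0" using G(2) by simp
    qed
    moreover have "(\<phi> has_derivative (\<lambda>h. 0)) (at x)"
    proof (rule has_derivative_transform_within_open)
      show "((\<lambda>x. 0) has_derivative (\<lambda>h. 0)) (at x)" by simp
      show "open (- K')" using K' by (simp add: compact_imp_closed open_Compl)
    qed (use False \<phi>0 in auto)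
    ultimately show ?thesis by (simp add: frechet_derivative_eqI)
  qed
  \<comment> \<open>With the gradient \<open>c\<close> itself as direction, averaging gives
    \<open>norm c * norm c \<le> B * norm c\<close>, so the bound \<open>B\<close> survives
    unchanged.\<close>
  have bound: "norm (cgrad \<phi> x) \<le> B" for x
  proof -
    let ?c = "cgrad \<phi> x"
    have "\<bar>conv \<rho> (\<lambda>y. G' y \<bullet> ?c) x - 0\<bar> \<le> B * norm ?c"
    proof (rule conv_near[OF \<rho> integrable_inner_left[OF iG']])
      fix v
      have "\<bar>G' v \<bullet> ?c\<bar> \<le> norm (G' v) * norm ?c" by (rule Cauchy_Schwarz_ineq2)
      also have "\<dots> \<le> B * norm ?c" using \<open>0 \<le> B\<close> by (intro mult_right_mono) (auto simp: G'_def)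
      finally show "\<bar>G' v \<bullet> ?c - 0\<bar> \<le> B * norm ?c" by simp
    qed
    moreover have "norm ?c * norm ?c = conv \<rho> (\<lambda>y. G' y \<bullet> ?c) x"
      using cgrad_inner[OF sm, of x ?c] by (simp add: fd conveq[OF t] power2_norm_eq_inner[symmetric] power2_eq_square)
    ultimately have "norm ?c * norm ?c \<le> B * norm ?c" by simp
    then show ?thesis using \<open>0 \<le> B\<close> by (cases "norm ?c = 0") (auto simp: mult_le_cancel_right)
  qed
  have cg: "(cgrad \<phi> x - G x) \<bullet> b = conv \<rho> (\<lambda>y. G y \<bullet> b) x - G x \<bullet> b" for x b
    by (simp add: inner_diff_left cgrad_inner[OF sm] fd)
  have ib: "integrable lebesgue (\<lambda>x. \<bar>(cgrad \<phi> x - G x) \<bullet> b\<bar>)"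
    and lb: "(LINT x|lebesgue. \<bar>(cgrad \<phi> x - G x) \<bullet> b\<bar>) \<le> e'" if "b \<in> Basis" for b
    using d2(2)[of d b \<rho>] d(4) D(2)[OF that] \<rho> by (auto simp: cg)
  have isum: "integrable lebesgue (\<lambda>x. \<Sum>b\<in>Basis. \<bar>(cgrad \<phi> x - G x) \<bullet> b\<bar>)"
    using ib by (rule Bochner_Integration.integrable_sum)
  have le: "norm (cgrad \<phi> x - G x) \<le> (\<Sum>b\<in>Basis. \<bar>(cgrad \<phi> x - G x) \<bullet> b\<bar>)" for x by (rule norm_le_l1)
  have i: "integrable lebesgue (\<lambda>x. norm (cgrad \<phi> x - G x))"
  proof (rule Bochner_Integration.integrable_bound[OF isum])
    show "(\<lambda>x. norm (cgrad \<phi> x - G x)) \<in> borel_measurable lebesgue"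
      using borel_measurable_lebesgue_continuous[OF cgrad_continuous[OF sm]] mG by measurable
    show "AE x in lebesgue. norm (norm (cgrad \<phi> x - G x)) \<le> norm (\<Sum>b\<in>Basis. \<bar>(cgrad \<phi> x - G x) \<bullet> b\<bar>)"
    proof (intro AE_I2)
      fix x show "norm (norm (cgrad \<phi> x - G x)) \<le> norm (\<Sum>b\<in>Basis. \<bar>(cgrad \<phi> x - G x) \<bullet> b\<bar>)"
        using order_trans[OF le[of x] abs_ge_self] by (simp only: real_norm_def abs_norm_cancel)
    qed
  qed
  have "(LINT x|lebesgue. norm (cgrad \<phi> x - G x)) \<le> (LINT x|lebesgue. (\<Sum>b\<in>Basis. \<bar>(cgrad \<phi> x - G x) \<bullet> b\<bar>))"
    by (rule integral_mono[OF i isum le])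
  also have "\<dots> = (\<Sum>b\<in>Basis. (LINT x|lebesgue. \<bar>(cgrad \<phi> x - G x) \<bullet> b\<bar>))"
    using ib by (rule Bochner_Integration.integral_sum)
  also have "\<dots> \<le> (\<Sum>b\<in>(Basis::'a set). e')" using lb by (rule sum_mono)
  also have "\<dots> = e" by (simp add: e'_def)
  finally have l: "(LINT x|lebesgue. norm (cgrad \<phi> x - G x)) \<le> e" .
  have near: "\<bar>\<phi> x - F x\<bar> \<le> e" for x
    unfolding \<phi>_def
  proof (rule conv_near[OF \<rho> iF])
    fix y assume "norm (x - y) < d"
    then show "\<bar>F y - F x\<bar> \<le> e" using d1(2)[of y x] d(3) by (simp add: norm_minus_commute)
  qed
  show ?thesis by (rule that[OF t\<phi> near bound i l])
qed

section \<open>The product rule for weak gradients\<close>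

lemma integrable_imp_locally_integrable:
  fixes f :: "'a::euclidean_space \<Rightarrow> 'b::euclidean_space"
  assumes "integrable lebesgue f"
  shows "locally_integrable \<Omega> f"
  unfolding locally_integrable_def set_integrable_def
proof (intro allI impI)
  fix K :: "'a set" assume "compact K"
  then have "K \<in> sets lebesgue" using lmeasurable_compact by (auto simp: fmeasurable_def)
  then show "integrable lebesgue (\<lambda>x. indicator K x *\<^sub>R f x)" using assms by (rule integrable_mult_indicator)
qed

lemma locally_integrable_componentwise:
  fixes g :: "'a::euclidean_space \<Rightarrow> 'b::euclidean_space"
  assumes "\<And>b. b \<in> Basis \<Longrightarrow> locally_integrable \<Omega> (\<lambda>x. g x \<bullet> b)"
  shows "locally_integrable \<Omega> g"
  unfolding locally_integrable_def set_integrable_def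
proof (intro allI impI)
  fix K :: "'a set" assume K: "compact K" "K \<subseteq> \<Omega>"
  have "integrable lebesgue (\<lambda>x. \<Sum>b\<in>Basis. (indicator K x *\<^sub>R (g x \<bullet> b)) *\<^sub>R b)"
    using assms K unfolding locally_integrable_def set_integrable_def
    by (intro Bochner_Integration.integrable_sum integrable_scaleR_left) simp
  moreover have "(\<Sum>b\<in>Basis. (indicator K x *\<^sub>R (g x \<bullet> b)) *\<^sub>R b) = indicator K x *\<^sub>R g x" for x
    unfolding scaleR_scaleR[symmetric] real_scaleR_def[symmetric] scaleR_scaleR
    by (subst (2) euclidean_representation[of "g x", symmetric])
      (simp add: scaleR_sum_right)
  ultimately show "integrable lebesgue (\<lambda>x. indicator K x *\<^sub>R g x)" by simp
qed

text \<open>The product of \<open>\<theta>\<close> with a test function is a test function. Using it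
  in the weak identity for \<open>f\<close> and expanding its classical derivative gives the
  rule.\<close>

lemma weak_gradient_mult_test:
  fixes f :: "'a::euclidean_space \<Rightarrow> real"
  assumes w: "weak_gradient \<Omega> f g" "open \<Omega>" and \<theta>: "test_function \<Omega> \<theta>"
  shows "weak_gradient \<Omega> (\<lambda>x. f x * \<theta> x) (\<lambda>x. \<theta> x *\<^sub>R g x + f x *\<^sub>R cgrad \<theta> x)"
proof (rule weak_gradientI[OF assms(2)])
  note lf = weak_gradient_locally_integrable(1)[OF w(1)]
  note lg = locally_integrable_inner[OF weak_gradient_locally_integrable(2)[OF w(1)]]
  have sm: "smooth \<theta>" using \<theta> by (simp add: test_function_def)
  have i1: "integrable lebesgue (\<lambda>x. f x * \<theta> x)" using locally_integrable_mult_test[OF lf \<theta>] .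
  then show "locally_integrable \<Omega> (\<lambda>x. f x * \<theta> x)" by (rule integrable_imp_locally_integrable)
  show "locally_integrable \<Omega> (\<lambda>x. \<theta> x *\<^sub>R g x + f x *\<^sub>R cgrad \<theta> x)"
  proof (rule locally_integrable_componentwise)
    fix b :: 'a
    have "integrable lebesgue (\<lambda>x. (g x \<bullet> b) * \<theta> x + f x * frechet_derivative \<theta> (at x) b)"
      using locally_integrable_mult_test[OF lg \<theta>] locally_integrable_mult_test[OF lf test_function_frechet_derivative[OF \<theta>]]
      by simp
    then show "locally_integrable \<Omega> (\<lambda>x. (\<theta> x *\<^sub>R g x + f x *\<^sub>R cgrad \<theta> x) \<bullet> b)"
      by (intro integrable_imp_locally_integrable) (simp add: inner_add_left cgrad_inner[OF sm] mult.commute)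
  qed
  fix \<psi> :: "'a \<Rightarrow> real" and b :: 'a assume \<psi>: "test_function \<Omega> \<psi>" and b: "b \<in> Basis"
  have sm\<psi>: "smooth \<psi>" using \<psi> by (simp add: test_function_def)
  have t: "test_function \<Omega> (\<lambda>x. \<theta> x * \<psi> x)" by (rule test_function_mult_smooth[OF \<theta> sm\<psi>])
  have t2: "test_function \<Omega> (\<lambda>x. frechet_derivative \<theta> (at x) b * \<psi> x)"
    by (rule test_function_mult_smooth[OF test_function_frechet_derivative[OF \<theta>] sm\<psi>])
  have fd: "frechet_derivative (\<lambda>x. \<theta> x * \<psi> x) (at x) b =
      \<theta> x * frechet_derivative \<psi> (at x) b + frechet_derivative \<theta> (at x) b * \<psi> x" for x
    using frechet_derivative_eqI[OF has_derivative_mult[OF smooth_has_derivative[OF sm] smooth_has_derivative[OF sm\<psi>]]]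
    by simp
  have "(LINT x|lebesgue. f x * \<theta> x * frechet_derivative \<psi> (at x) b) =
      (LINT x|lebesgue. f x * frechet_derivative (\<lambda>x. \<theta> x * \<psi> x) (at x) b - f x * (frechet_derivative \<theta> (at x) b * \<psi> x))"
    by (intro Bochner_Integration.integral_cong refl) (simp only: fd, simp add: algebra_simps)
  also have "\<dots> = (LINT x|lebesgue. f x * frechet_derivative (\<lambda>x. \<theta> x * \<psi> x) (at x) b) -
      (LINT x|lebesgue. f x * (frechet_derivative \<theta> (at x) b * \<psi> x))"
    using locally_integrable_mult_test[OF lf test_function_frechet_derivative[OF t]] locally_integrable_mult_test[OF lf t2]
    by (rule Bochner_Integration.integral_diff)
  also have "(LINT x|lebesgue. f x * frechet_derivative (\<lambda>x. \<theta> x * \<psi> x) (at x) b) = - (LINT x|lebesgue. (g x \<bullet> b) * (\<theta> x * \<psi> x))"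
    by (rule weak_gradientD[OF w t b])
  also have "- (LINT x|lebesgue. (g x \<bullet> b) * (\<theta> x * \<psi> x)) - (LINT x|lebesgue. f x * (frechet_derivative \<theta> (at x) b * \<psi> x)) =
     - (LINT x|lebesgue. (g x \<bullet> b) * (\<theta> x * \<psi> x) + f x * (frechet_derivative \<theta> (at x) b * \<psi> x))"
    using locally_integrable_mult_test[OF lg t] locally_integrable_mult_test[OF lf t2] by simp
  also have "(LINT x|lebesgue. (g x \<bullet> b) * (\<theta> x * \<psi> x) + f x * (frechet_derivative \<theta> (at x) b * \<psi> x)) =
     (LINT x|lebesgue. ((\<theta> x *\<^sub>R g x + f x *\<^sub>R cgrad \<theta> x) \<bullet> b) * \<psi> x)"
    by (intro Bochner_Integration.integral_cong refl) (simp add: inner_add_left cgrad_inner[OF sm] algebra_simps)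
  finally show "(LINT x|lebesgue. f x * \<theta> x * frechet_derivative \<psi> (at x) b) =
    - (LINT x|lebesgue. ((\<theta> x *\<^sub>R g x + f x *\<^sub>R cgrad \<theta> x) \<bullet> b) * \<psi> x)" .
qed

text \<open>\<open>f\<close> is continuous on \<open>\<Omega>\<close> only. The open sets
  \<open>\<Omega>\<close> and the complement of the support of \<open>\<theta>\<close> cover the
  space, and on the second the product is zero.\<close>

lemma continuous_on_mult_support:
  fixes f \<theta> :: "'a::euclidean_space \<Rightarrow> real"
  assumes f: "continuous_on \<Omega> f" and "open \<Omega>" and \<theta>: "test_function \<Omega> \<theta>"
  shows "continuous_on UNIV (\<lambda>x. f x * \<theta> x)"
proof -
  obtain K where K: "compact K" "K \<subseteq> \<Omega>" "\<And>x. x \<notin> K \<Longrightarrow> \<theta> x = 0"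
    by (rule test_function_support[OF \<theta>]) blast
  have "continuous_on (\<Omega> \<union> - K) (\<lambda>x. f x * \<theta> x)"
  proof (rule continuous_on_open_Un)
    show "continuous_on \<Omega> (\<lambda>x. f x * \<theta> x)" by (intro continuous_on_mult f test_function_continuous[OF \<theta>])
    show "continuous_on (- K) (\<lambda>x. f x * \<theta> x)"
      using K(3) by (subst continuous_on_cong[OF refl, of _ _ "\<lambda>x. 0"]) auto
  qed (use assms K(1) in \<open>auto simp: compact_imp_closed open_Compl\<close>)
  moreover have "\<Omega> \<union> - K = UNIV" using K(2) by auto
  ultimately show ?thesis by simp
qed

lemma eq_0_if_le_inverse:
  fixes x C :: real
  assumes "\<And>n. \<bar>x\<bar> \<le> C / real (Suc n)"
  shows "x = 0"
proof -
  have "(\<lambda>n. C * inverse (real (Suc n))) \<longlonglongrightarrow> C * 0"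
    by (intro tendsto_intros LIMSEQ_inverse_real_of_nat)
  then have "(\<lambda>n. C / real (Suc n)) \<longlonglongrightarrow> 0" by (simp add: divide_inverse)
  then have "\<bar>x\<bar> \<le> 0" using assms by (intro LIMSEQ_le_const) auto
  then show ?thesis by simp
qed

lemma locally_integrable_mult_bounded:
  fixes u h :: "'a::euclidean_space \<Rightarrow> real"
  assumes u: "locally_integrable \<Omega> u" and h: "locally_integrable \<Omega> h"
    and b: "\<And>K. compact K \<Longrightarrow> K \<subseteq> \<Omega> \<Longrightarrow> \<exists>M. AE x in lebesgue. x \<in> K \<longrightarrow> \<bar>h x\<bar> \<le> M"
  shows "locally_integrable \<Omega> (\<lambda>x. u x * h x)"
  unfolding locally_integrable_def set_integrable_def
proof (intro allI impI)
  fix K assume K: "compact K" "K \<subseteq> \<Omega>"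
  have iu: "integrable lebesgue (\<lambda>x. indicator K x *\<^sub>R u x)"
    using u K by (simp add: locally_integrable_def set_integrable_def)
  have ih: "integrable lebesgue (\<lambda>x. indicator K x *\<^sub>R h x)"
    using h K by (simp add: locally_integrable_def set_integrable_def)
  obtain M where M: "AE x in lebesgue. x \<in> K \<longrightarrow> \<bar>h x\<bar> \<le> M" using b[OF K] by blast
  have eq: "(\<lambda>x. indicator K x *\<^sub>R (u x * h x)) = (\<lambda>x. (indicator K x *\<^sub>R u x) * (indicator K x *\<^sub>R h x))"
    by (auto simp: indicator_def fun_eq_iff)
  show "integrable lebesgue (\<lambda>x. indicator K x *\<^sub>R (u x * h x))"
    unfolding eq
  proof (rule Bochner_Integration.integrable_bound)
    show "integrable lebesgue (\<lambda>x. \<bar>M\<bar> * norm (indicator K x *\<^sub>R u x))" using iu by auto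
    show "(\<lambda>x. (indicator K x *\<^sub>R u x) * (indicator K x *\<^sub>R h x)) \<in> borel_measurable lebesgue"
      using borel_measurable_integrable[OF iu] borel_measurable_integrable[OF ih] by (rule borel_measurable_times)
    show "AE x in lebesgue. norm ((indicator K x *\<^sub>R u x) * (indicator K x *\<^sub>R h x)) \<le> norm (\<bar>M\<bar> * norm (indicator K x *\<^sub>R u x))"
      using M
    proof eventually_elim
      case (elim x)
      show ?case
      proof (cases "x \<in> K")
        case True
        then have "\<bar>u x\<bar> * \<bar>h x\<bar> \<le> \<bar>u x\<bar> * \<bar>M\<bar>" using elim by (intro mult_left_mono) auto
        then show ?thesis using True by (simp add: abs_mult mult.commute)
      qed simp
    qed
  qed
qed

lemma locally_integrable_continuous:
  fixes f :: "'a::euclidean_space \<Rightarrow> real"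
  assumes f: "continuous_on \<Omega> f"
  shows "locally_integrable \<Omega> f"
  unfolding locally_integrable_def
proof (intro allI impI)
  fix K assume K: "compact K" "K \<subseteq> \<Omega>"
  have "integrable lborel (\<lambda>x. indicator K x *\<^sub>R f x)"
    by (rule borel_integrable_compact[OF K(1) continuous_on_subset[OF f K(2)]])
  then show "set_integrable lebesgue K f"
    unfolding set_integrable_def by (simp add: integrable_completion borel_measurable_integrable)
qed

text \<open>Neither factor is smooth, so neither can simply be moved to the test function
  \<open>\<theta>\<close>. Instead \<open>F = f * \<theta>\<close>, which has compact support and a
  bounded weak gradient \<open>G\<close>, is shown to be admissible in place of a test function in
  the identity for \<open>u\<close>; expanding \<open>G\<close> then gives the claim.\<close>

lemma weak_gradient_product:
  fixes f u :: "'a::euclidean_space \<Rightarrow> real"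
  assumes "open \<Omega>" and f: "continuous_on \<Omega> f" and wf: "weak_gradient \<Omega> f g"
    and M: "AE x in lebesgue. x \<in> \<Omega> \<longrightarrow> norm (g x) \<le> M" and "0 \<le> M"
    and wu: "weak_gradient \<Omega> u v"
    and u2: "integrable (lebesgue_on \<Omega>) (\<lambda>x. (u x)\<^sup>2)" and v1: "integrable (lebesgue_on \<Omega>) v"
  shows "weak_gradient \<Omega> (\<lambda>x. f x * u x) (\<lambda>x. f x *\<^sub>R v x + u x *\<^sub>R g x)"
proof (rule weak_gradientI[OF assms(1)])
  have \<Omega>m: "\<Omega> \<in> sets lebesgue" using assms(1) by auto
  note lu = weak_gradient_locally_integrable(1)[OF wu]
  note lv = locally_integrable_inner[OF weak_gradient_locally_integrable(2)[OF wu]]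
  note lg = locally_integrable_inner[OF weak_gradient_locally_integrable(2)[OF wf]]
  note lf = locally_integrable_continuous[OF f]
  have bf: "\<exists>M. AE x in lebesgue. x \<in> K \<longrightarrow> \<bar>f x\<bar> \<le> M" if "compact K" "K \<subseteq> \<Omega>" for K
  proof -
    have "bounded (f ` K)" by (intro compact_imp_bounded compact_continuous_image that continuous_on_subset[OF f])
    then show ?thesis unfolding bounded_iff by auto
  qed
  have Mb: "AE x in lebesgue. x \<in> \<Omega> \<longrightarrow> \<bar>g x \<bullet> b\<bar> \<le> M" if "b \<in> Basis" for b
    using M by eventually_elim (use Basis_le_norm[OF that] in \<open>auto intro: order_trans\<close>)
  have bg: "\<exists>M. AE x in lebesgue. x \<in> K \<longrightarrow> \<bar>g x \<bullet> b\<bar> \<le> M" if "compact K" "K \<subseteq> \<Omega>" "b \<in> Basis" for K b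
    using Mb[OF that(3)] that(2) by (intro exI[of _ M]) (auto elim!: eventually_mono)
  show "locally_integrable \<Omega> (\<lambda>x. f x * u x)"
    using locally_integrable_mult_bounded[OF lu lf bf] by (simp add: mult.commute)
  show "locally_integrable \<Omega> (\<lambda>x. f x *\<^sub>R v x + u x *\<^sub>R g x)"
  proof (rule locally_integrable_componentwise)
    fix b :: 'a assume b: "b \<in> Basis"
    show "locally_integrable \<Omega> (\<lambda>x. (f x *\<^sub>R v x + u x *\<^sub>R g x) \<bullet> b)"
      using locally_integrable_add[OF locally_integrable_mult_bounded[OF lv lf bf, of b]
          locally_integrable_mult_bounded[OF lu lg bg[OF _ _ b]]]
      by (simp add: inner_add_left mult.commute)
  qed
  fix \<theta> :: "'a \<Rightarrow> real" and b :: 'a assume \<theta>: "test_function \<Omega> \<theta>" and b: "b \<in> Basis"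
  have sm: "smooth \<theta>" using \<theta> by (simp add: test_function_def)
  obtain K where K: "compact K" "K \<subseteq> \<Omega>" "\<And>x. x \<notin> K \<Longrightarrow> \<theta> x = 0"
      "\<And>x h. x \<notin> K \<Longrightarrow> frechet_derivative \<theta> (at x) h = 0"
    by (rule test_function_support[OF \<theta>]) blast
  define F where "F = (\<lambda>x. f x * \<theta> x)"
  define G where "G = (\<lambda>x. \<theta> x *\<^sub>R g x + f x *\<^sub>R cgrad \<theta> x)"
  have wF: "weak_gradient \<Omega> F G" unfolding F_def G_def by (rule weak_gradient_mult_test[OF wf assms(1) \<theta>])
  have cF: "continuous_on UNIV F" unfolding F_def by (rule continuous_on_mult_support[OF f assms(1) \<theta>])
  have F0: "F x = 0" if "x \<notin> K" for x using K(3)[OF that] by (simp add: F_def)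
  have G0: "G x = 0" if "x \<notin> K" for x using K(3,4)[OF that] by (simp add: G_def cgrad_def)
  have "bounded (f ` K)" by (intro compact_imp_bounded compact_continuous_image K(1) continuous_on_subset[OF f K(2)])
  then obtain Bf where Bf: "Bf > 0" "\<And>x. x \<in> K \<Longrightarrow> \<bar>f x\<bar> \<le> Bf" unfolding bounded_pos by auto
  obtain B\<theta> where B\<theta>: "0 \<le> B\<theta>" "\<And>x. \<bar>\<theta> x\<bar> \<le> B\<theta>" using test_function_bounded[OF \<theta>] by blast
  obtain L where L: "\<And>x. norm (cgrad \<theta> x) \<le> L" using test_function_lipschitz[OF \<theta>] by metis
  have L0: "0 \<le> L" using order_trans[OF norm_ge_zero L] .
  define B where "B = B\<theta> * M + Bf * L"
  have B0: "0 \<le> B" unfolding B_def using B\<theta>(1) Bf(1) L0 \<open>0 \<le> M\<close> by simp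
  have GB: "AE x in lebesgue. norm (G x) \<le> B"
    using M
  proof eventually_elim
    case (elim x)
    show ?case
    proof (cases "x \<in> K")
      case True
      have "norm (G x) \<le> \<bar>\<theta> x\<bar> * norm (g x) + \<bar>f x\<bar> * norm (cgrad \<theta> x)"
        unfolding G_def by (rule norm_triangle_le) simp
      also have "\<dots> \<le> B"
        unfolding B_def using elim True K(2) B\<theta> Bf L L0 \<open>0 \<le> M\<close> by (intro add_mono mult_mono) auto
      finally show ?thesis .
    qed (simp add: G0 B0)
  qed
  have mG: "G \<in> borel_measurable lebesgue"
  proof -
    have "integrable lebesgue (\<lambda>x. indicator K x *\<^sub>R G x)"
      using weak_gradient_locally_integrable(2)[OF wF] K by (simp add: locally_integrable_def set_integrable_def)
    moreover have "(\<lambda>x. indicator K x *\<^sub>R G x) = G" using G0 by (auto simp: indicator_def fun_eq_iff)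
    ultimately show ?thesis by auto
  qed
  have iu2: "integrable lebesgue (\<lambda>x. indicator \<Omega> x *\<^sub>R (u x)\<^sup>2)"
    using u2 \<Omega>m by (simp add: integrable_restrict_space)
  have iv: "integrable lebesgue (\<lambda>x. indicator \<Omega> x *\<^sub>R norm (v x))"
    using integrable_norm[OF v1] \<Omega>m by (simp add: integrable_restrict_space)
  define U where "U = (LINT x|lebesgue. indicator \<Omega> x *\<^sub>R (u x)\<^sup>2)"
  define W where "W = (LINT x|lebesgue. indicator \<Omega> x *\<^sub>R norm (v x))"
  have U0: "0 \<le> U" unfolding U_def by (intro Bochner_Integration.integral_nonneg) simp
  have W0: "0 \<le> W" unfolding W_def by (intro Bochner_Integration.integral_nonneg) simp
  \<comment> \<open>The claim will be \<open>X = Y\<close>: the weak identity of \<open>u\<close>,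
    tested with \<open>F\<close>.\<close>
  define X where "X = - (LINT x|lebesgue. (v x \<bullet> b) * F x)"
  define Y where "Y = (LINT x|lebesgue. u x * (G x \<bullet> b))"
  have iX: "integrable lebesgue (\<lambda>x. (v x \<bullet> b) * F x)"
  proof (rule locally_integrable_mult[OF lv K(1,2)])
    show "F \<in> borel_measurable lebesgue" by (rule borel_measurable_lebesgue_continuous[OF cF])
    show "\<bar>F x\<bar> \<le> Bf * B\<theta>" if "x \<in> K" for x
      unfolding F_def abs_mult using Bf B\<theta> that by (intro mult_mono) auto
  qed (use F0 in auto)
  define G' where "G' = (\<lambda>x. if norm (G x) \<le> B then G x else 0)"
  have aeG: "AE x in lebesgue. G x = G' x" using GB by eventually_elim (simp add: G'_def)
  have iY': "integrable lebesgue (\<lambda>x. u x * (G' x \<bullet> b))"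
  proof (rule locally_integrable_mult[OF lu K(1,2)])
    show "(\<lambda>x. G' x \<bullet> b) \<in> borel_measurable lebesgue" unfolding G'_def using mG by measurable
    show "\<bar>G' x \<bullet> b\<bar> \<le> B" for x
      using B0 Basis_le_norm[OF b, of "G x"] by (auto simp: G'_def)
  qed (use G0 in \<open>auto simp: G'_def\<close>)
  have Y': "Y = (LINT x|lebesgue. u x * (G' x \<bullet> b))"
  proof -
    have "(LINT x|lebesgue. u x * (G x \<bullet> b)) = (LINT x|lebesgue. (indicator K x *\<^sub>R u x) * (G x \<bullet> b))"
      by (intro Bochner_Integration.integral_cong refl) (auto simp: indicator_def G0)
    also have "\<dots> = (LINT x|lebesgue. (indicator K x *\<^sub>R u x) * (G' x \<bullet> b))"
    proof (rule integral_cong_AE)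
      have m: "(\<lambda>x. indicator K x *\<^sub>R u x) \<in> borel_measurable lebesgue"
        using lu K by (intro borel_measurable_integrable) (simp add: locally_integrable_def set_integrable_def)
      show "(\<lambda>x. indicator K x *\<^sub>R u x * (G x \<bullet> b)) \<in> borel_measurable lebesgue"
        using m mG by measurable
      show "(\<lambda>x. indicator K x *\<^sub>R u x * (G' x \<bullet> b)) \<in> borel_measurable lebesgue"
        unfolding G'_def using m mG by measurable
      show "AE x in lebesgue. indicator K x *\<^sub>R u x * (G x \<bullet> b) = indicator K x *\<^sub>R u x * (G' x \<bullet> b)"
        using aeG by eventually_elim simp
    qed
    also have "\<dots> = (LINT x|lebesgue. u x * (G' x \<bullet> b))"
      by (intro Bochner_Integration.integral_cong refl) (auto simp: indicator_def G0 G'_def)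
    finally show ?thesis by (simp add: Y_def)
  qed
  have XY: "\<bar>X - Y\<bar> \<le> (W + U + 2 * B) / real (Suc n)" for n
  proof -
    \<comment> \<open>The approximation is accurate up to \<open>s * s\<close>, because Young's
      inequality below divides the error of the gradients by \<open>s\<close>.\<close>
    define s where "s = 1 / real (Suc n)"
    have s: "0 < s" "s \<le> 1" by (auto simp: s_def)
    have s2: "s * s \<le> s" using s by (simp add: mult_left_le)
    obtain \<phi> where \<phi>: "test_function \<Omega> \<phi>" "\<And>x. \<bar>\<phi> x - F x\<bar> \<le> s * s" "\<And>x. norm (cgrad \<phi> x) \<le> B"
        "integrable lebesgue (\<lambda>x. norm (cgrad \<phi> x - G x))" "(LINT x|lebesgue. norm (cgrad \<phi> x - G x)) \<le> s * s"
      using test_function_approx[OF assms(1) K(1,2) cF F0 wF GB G0 B0, of "s * s"] s(1) by auto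
    have sm\<phi>: "smooth \<phi>" using \<phi>(1) by (simp add: test_function_def)
    have \<phi>0: "\<phi> x = 0" "cgrad \<phi> x = 0" if "x \<notin> \<Omega>" for x
      using test_function_outside[OF \<phi>(1) that] test_function_outside[OF test_function_frechet_derivative[OF \<phi>(1)] that]
      by (auto simp: cgrad_def)
    note fd = cgrad_inner[OF sm\<phi>, symmetric]
    have i1: "integrable lebesgue (\<lambda>x. (v x \<bullet> b) * \<phi> x)" by (rule locally_integrable_mult_test[OF lv \<phi>(1)])
    have i2: "integrable lebesgue (\<lambda>x. u x * (cgrad \<phi> x \<bullet> b))"
      using locally_integrable_mult_test[OF lu test_function_frechet_derivative[OF \<phi>(1)]] by (simp add: fd)
    have eq: "(LINT x|lebesgue. u x * (cgrad \<phi> x \<bullet> b)) = - (LINT x|lebesgue. (v x \<bullet> b) * \<phi> x)"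
      using weak_gradientD[OF wu assms(1) \<phi>(1) b] by (simp add: fd)
    have "\<bar>(LINT x|lebesgue. (v x \<bullet> b) * \<phi> x) - (LINT x|lebesgue. (v x \<bullet> b) * F x)\<bar> =
        \<bar>LINT x|lebesgue. (v x \<bullet> b) * \<phi> x - (v x \<bullet> b) * F x\<bar>"
      using i1 iX by simp
    also have "\<dots> \<le> (LINT x|lebesgue. s * (indicator \<Omega> x *\<^sub>R norm (v x)))"
    proof (rule integral_abs_bound_integral)
      fix x
      show "\<bar>(v x \<bullet> b) * \<phi> x - (v x \<bullet> b) * F x\<bar> \<le> s * (indicator \<Omega> x *\<^sub>R norm (v x))"
      proof (cases "x \<in> \<Omega>")
        case True
        have "\<bar>(v x \<bullet> b) * \<phi> x - (v x \<bullet> b) * F x\<bar> = \<bar>v x \<bullet> b\<bar> * \<bar>\<phi> x - F x\<bar>"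
          by (simp add: abs_mult[symmetric] right_diff_distrib)
        also have "\<dots> \<le> norm (v x) * s"
          using Basis_le_norm[OF b, of "v x"] order_trans[OF \<phi>(2)[of x] s2] by (intro mult_mono) auto
        finally show ?thesis using True by (simp add: mult.commute)
      next
        case False
        then show ?thesis using \<phi>0 F0 K(2) by auto
      qed
    qed (use i1 iX iv in auto)
    also have "\<dots> = s * W" by (simp add: W_def)
    finally have 1: "\<bar>(LINT x|lebesgue. (v x \<bullet> b) * \<phi> x) - (LINT x|lebesgue. (v x \<bullet> b) * F x)\<bar> \<le> s * W" .
    have "\<bar>(LINT x|lebesgue. u x * (cgrad \<phi> x \<bullet> b)) - (LINT x|lebesgue. u x * (G' x \<bullet> b))\<bar> =
        \<bar>LINT x|lebesgue. u x * (cgrad \<phi> x \<bullet> b) - u x * (G' x \<bullet> b)\<bar>"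
      using i2 iY' by simp
    also have "\<dots> \<le> (LINT x|lebesgue. s * (indicator \<Omega> x *\<^sub>R (u x)\<^sup>2) + (2 * B / s) * norm (cgrad \<phi> x - G' x))"
    proof (rule integral_abs_bound_integral)
      have "(\<lambda>x. norm (cgrad \<phi> x - G' x)) \<in> borel_measurable lebesgue"
        unfolding G'_def using mG borel_measurable_lebesgue_continuous[OF cgrad_continuous[OF sm\<phi>]] by measurable
      then have "integrable lebesgue (\<lambda>x. norm (cgrad \<phi> x - G' x))"
        using aeG by (intro integrable_cong_AE_imp[OF \<phi>(4)]) (auto elim!: eventually_mono)
      then show "integrable lebesgue (\<lambda>x. s * (indicator \<Omega> x *\<^sub>R (u x)\<^sup>2) + (2 * B / s) * norm (cgrad \<phi> x - G' x))"
        using iu2 by auto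
      fix x
      show "\<bar>u x * (cgrad \<phi> x \<bullet> b) - u x * (G' x \<bullet> b)\<bar> \<le> s * (indicator \<Omega> x *\<^sub>R (u x)\<^sup>2) + (2 * B / s) * norm (cgrad \<phi> x - G' x)"
      proof (cases "x \<in> \<Omega>")
        case True
        define d where "d = norm (cgrad \<phi> x - G' x)"
        have d0: "0 \<le> d" by (simp add: d_def)
        have "d \<le> norm (cgrad \<phi> x) + norm (G' x)" unfolding d_def by (rule norm_triangle_ineq4)
        also have "\<dots> \<le> 2 * B" using \<phi>(3)[of x] B0 by (auto simp: G'_def)
        finally have dB: "d \<le> 2 * B" .
        have "\<bar>u x * (cgrad \<phi> x \<bullet> b) - u x * (G' x \<bullet> b)\<bar> = \<bar>u x\<bar> * \<bar>(cgrad \<phi> x - G' x) \<bullet> b\<bar>"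
          by (simp add: abs_mult[symmetric] right_diff_distrib inner_diff_left)
        also have "\<dots> \<le> \<bar>u x\<bar> * d"
          unfolding d_def using Basis_le_norm[OF b] by (intro mult_left_mono) auto
        \<comment> \<open>A pointwise Young inequality takes the place of Cauchy-Schwarz for
          integrals. The bound \<open>d \<le> 2 * B\<close> then reduces the square to the L1
          distance of the gradients, which is at most \<open>s * s\<close>.\<close>
        also have "\<dots> \<le> s * (u x)\<^sup>2 + d * d / s"
        proof -
          have "2 * (s * \<bar>u x\<bar> * d) \<le> (s * \<bar>u x\<bar>)\<^sup>2 + d\<^sup>2"
            using sum_squares_bound[of "s * \<bar>u x\<bar>" d] by (simp only: mult.assoc)
          moreover have "0 \<le> s * \<bar>u x\<bar> * d" using s d0 by simp
          ultimately have "s * \<bar>u x\<bar> * d \<le> (s * \<bar>u x\<bar>)\<^sup>2 + d\<^sup>2" by linarith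
          also have "(s * \<bar>u x\<bar>)\<^sup>2 = s * s * (u x)\<^sup>2" by (simp add: power_mult_distrib power2_eq_square)
          finally have "s * (\<bar>u x\<bar> * d) \<le> s * (s * (u x)\<^sup>2 + d * d / s)"
            using s(1) by (simp add: algebra_simps power2_eq_square)
          then show ?thesis using s(1) by (simp add: mult_le_cancel_left_pos)
        qed
        also have "d * d / s \<le> 2 * B * d / s"
          using dB d0 s(1) by (intro divide_right_mono mult_right_mono) auto
        finally show ?thesis using True by (simp add: d_def)
      next
        case False
        then have "G' x = 0" using G0 K(2) by (auto simp: G'_def)
        then show ?thesis using False \<phi>0 by simp
      qed
    qed (use i2 iY' in auto)
    also have "\<dots> = s * U + (2 * B / s) * (LINT x|lebesgue. norm (cgrad \<phi> x - G' x))"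
    proof -
      have "(\<lambda>x. norm (cgrad \<phi> x - G' x)) \<in> borel_measurable lebesgue"
        unfolding G'_def using mG borel_measurable_lebesgue_continuous[OF cgrad_continuous[OF sm\<phi>]] by measurable
      then have "integrable lebesgue (\<lambda>x. norm (cgrad \<phi> x - G' x))"
        using aeG by (intro integrable_cong_AE_imp[OF \<phi>(4)]) (auto elim!: eventually_mono)
      then show ?thesis using iu2 unfolding U_def by simp
    qed
    also have "(LINT x|lebesgue. norm (cgrad \<phi> x - G' x)) = (LINT x|lebesgue. norm (cgrad \<phi> x - G x))"
    proof (rule integral_cong_AE)
      show "(\<lambda>x. norm (cgrad \<phi> x - G' x)) \<in> borel_measurable lebesgue" "(\<lambda>x. norm (cgrad \<phi> x - G x)) \<in> borel_measurable lebesgue"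
        unfolding G'_def using mG borel_measurable_lebesgue_continuous[OF cgrad_continuous[OF sm\<phi>]] by measurable
      show "AE x in lebesgue. norm (cgrad \<phi> x - G' x) = norm (cgrad \<phi> x - G x)"
        using aeG by eventually_elim simp
    qed
    also have "s * U + (2 * B / s) * \<dots> \<le> s * U + (2 * B / s) * (s * s)"
      using \<phi>(5) B0 s(1) by (intro add_left_mono mult_left_mono) auto
    also have "\<dots> = s * U + s * (2 * B)" using s(1) by simp
    finally have 2: "\<bar>(LINT x|lebesgue. u x * (cgrad \<phi> x \<bullet> b)) - Y\<bar> \<le> s * U + s * (2 * B)" unfolding Y' .
    have "\<bar>X - Y\<bar> \<le> s * (W + U + 2 * B)"
      using 1 2 unfolding X_def eq by (simp add: algebra_simps)
    then show ?thesis by (simp add: s_def)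
  qed
  have "X = Y" using eq_0_if_le_inverse[OF XY] by simp
  then have "- (LINT x|lebesgue. (v x \<bullet> b) * F x) = (LINT x|lebesgue. u x * (G' x \<bullet> b))" by (simp add: X_def Y')
  moreover have "(LINT x|lebesgue. u x * (G' x \<bullet> b)) = (LINT x|lebesgue. (f x * u x) * frechet_derivative \<theta> (at x) b)
      + (LINT x|lebesgue. (u x * (g x \<bullet> b)) * \<theta> x)"
  proof -
    have j1: "integrable lebesgue (\<lambda>x. (f x * u x) * frechet_derivative \<theta> (at x) b)"
      using locally_integrable_mult_test[OF locally_integrable_mult_bounded[OF lu lf bf] test_function_frechet_derivative[OF \<theta>]]
      by (simp add: mult.commute)
    have j2: "integrable lebesgue (\<lambda>x. (u x * (g x \<bullet> b)) * \<theta> x)"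
      using locally_integrable_mult_test[OF locally_integrable_mult_bounded[OF lu lg bg[OF _ _ b]] \<theta>] .
    have "Y = (LINT x|lebesgue. (f x * u x) * frechet_derivative \<theta> (at x) b + (u x * (g x \<bullet> b)) * \<theta> x)"
      unfolding Y_def by (intro Bochner_Integration.integral_cong refl)
        (simp add: G_def inner_add_left cgrad_inner[OF sm] algebra_simps)
    then show ?thesis using j1 j2 Y' by simp
  qed
  moreover have "(LINT x|lebesgue. ((f x *\<^sub>R v x + u x *\<^sub>R g x) \<bullet> b) * \<theta> x) =
      (LINT x|lebesgue. (v x \<bullet> b) * F x) + (LINT x|lebesgue. (u x * (g x \<bullet> b)) * \<theta> x)"
  proof -
    have j2: "integrable lebesgue (\<lambda>x. (u x * (g x \<bullet> b)) * \<theta> x)"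
      using locally_integrable_mult_test[OF locally_integrable_mult_bounded[OF lu lg bg[OF _ _ b]] \<theta>] .
    have "(LINT x|lebesgue. ((f x *\<^sub>R v x + u x *\<^sub>R g x) \<bullet> b) * \<theta> x) =
        (LINT x|lebesgue. (v x \<bullet> b) * F x + (u x * (g x \<bullet> b)) * \<theta> x)"
      by (intro Bochner_Integration.integral_cong refl) (simp add: F_def inner_add_left algebra_simps)
    then show ?thesis using iX j2 by simp
  qed
  ultimately show "(LINT x|lebesgue. f x * u x * frechet_derivative \<theta> (at x) b) =
      - (LINT x|lebesgue. ((f x *\<^sub>R v x + u x *\<^sub>R g x) \<bullet> b) * \<theta> x)"
    by linarith
qed

text \<open>Both \<open>F\<close> and \<open>E x = L * x - F x\<close> are nondecreasing, and their
  Stieltjes measures add up to \<open>L\<close> times Lebesgue measure. A Lebesgue null set is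
  therefore null for each of the two.\<close>

lemma lipschitz_stieltjes_absolutely_continuous:
  fixes F :: "real \<Rightarrow> real"
  assumes mono: "\<And>x y. x \<le> y \<Longrightarrow> F x \<le> F y" and L: "L-lipschitz_on UNIV F" and "0 < L"
  shows "absolutely_continuous lborel (interval_measure F)"
proof -
  define E where "E = (\<lambda>x. L * x - F x)"
  have cF: "continuous_on UNIV F" using L by (rule lipschitz_on_continuous_on)
  have cE: "continuous_on UNIV E" unfolding E_def by (intro continuous_intros cF)
  have monoE: "E x \<le> E y" if "x \<le> y" for x y
    using lipschitz_onD[OF L, of x y] that mono[OF that] by (simp add: E_def dist_real_def algebra_simps)
  \<comment> \<open>Lebesgue measure is identified by its values on open intervals, Stieltjes
    measures are given on half-open ones; the endpoint carries no mass by continuity.\<close>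
  have Ioo: "emeasure (interval_measure G) {a<..<b} = ennreal (G b - G a)"
    if "a \<le> b" and mG: "\<And>x y. x \<le> y \<Longrightarrow> G x \<le> G y" and cG: "continuous_on UNIV G" for G :: "real \<Rightarrow> real" and a b
  proof (cases "a = b")
    case False
    have "emeasure (interval_measure G) {b..b} = ennreal (G b - G b)"
      by (rule emeasure_interval_measure_Icc[OF _ mG cG]) auto
    then have b0: "emeasure (interval_measure G) {b} = 0" by simp
    have "emeasure (interval_measure G) {a<..b} = ennreal (G b - G a)"
      using cG by (intro emeasure_interval_measure_Ioc[OF \<open>a \<le> b\<close> mG])
        (auto simp: continuous_on_eq_continuous_within intro: continuous_within_subset)
    moreover have "{a<..b} = {a<..<b} \<union> {b}" using False \<open>a \<le> b\<close> by auto
    moreover have "emeasure (interval_measure G) ({a<..<b} \<union> {b}) = emeasure (interval_measure G) {a<..<b} + emeasure (interval_measure G) {b}"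
      by (rule plus_emeasure[symmetric]) auto
    ultimately show ?thesis using b0 by simp
  qed simp
  define \<mu> where "\<mu> = (\<lambda>A. ennreal (1 / L) * (emeasure (interval_measure F) A + emeasure (interval_measure E) A))"
  define N where "N = measure_of UNIV (sets borel) \<mu>"
  have sN: "sets N = sets borel" unfolding N_def using sets.sigma_sets_eq[of "borel :: real measure"] by (simp add: sets_measure_of_conv)
  have eN: "emeasure N A = \<mu> A" if "A \<in> sets borel" for A
    unfolding N_def
  proof (rule emeasure_measure_of_sigma)
    show "sigma_algebra UNIV (sets (borel :: real measure))" using sets.sigma_algebra_axioms[of "borel :: real measure"] by simp
    show "positive (sets borel) \<mu>" by (simp add: positive_def \<mu>_def)
    show "countably_additive (sets borel) \<mu>"
    proof (unfold countably_additive_def, intro allI impI)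
      fix A :: "nat \<Rightarrow> real set" assume A: "range A \<subseteq> sets borel" "disjoint_family A"
      have "(\<Sum>i. emeasure (interval_measure F) (A i) + emeasure (interval_measure E) (A i)) =
          emeasure (interval_measure F) (\<Union>i. A i) + emeasure (interval_measure E) (\<Union>i. A i)"
        using A by (subst suminf_add[symmetric]) (auto simp: suminf_emeasure)
      then show "(\<Sum>i. \<mu> (A i)) = \<mu> (\<Union>i. A i)" by (simp add: \<mu>_def)
    qed
  qed (use that in auto)
  have "lborel = N"
  proof (rule lborel_eqI[OF _ sN])
    fix l u :: real assume lu: "\<And>b. b \<in> Basis \<Longrightarrow> l \<bullet> b \<le> u \<bullet> b"
    then have "l \<le> u" by simp
    then have "\<mu> {l<..<u} = ennreal (1 / L) * (ennreal (F u - F l) + ennreal (E u - E l))"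
      unfolding \<mu>_def using Ioo[OF _ mono cF] Ioo[OF _ monoE cE] by simp
    also have "\<dots> = ennreal (u - l)"
      using \<open>l \<le> u\<close> mono[of l u] monoE[of l u] \<open>0 < L\<close>
      by (simp add: ennreal_plus[symmetric] ennreal_mult[symmetric] E_def field_simps del: ennreal_plus)
    finally show "emeasure N (box l u) = ennreal (\<Prod>b\<in>Basis. (u - l) \<bullet> b)"
      by (simp add: eN box_real)
  qed
  then have "\<mu> A = 0" if "A \<in> null_sets lborel" for A
    using that eN[of A] by (auto simp: null_sets_def)
  then show ?thesis
    using \<open>0 < L\<close> by (auto simp: absolutely_continuous_def null_sets_def \<mu>_def add_eq_0_iff_both_eq_0)
qed

text \<open>The function \<open>f x + K * x\<close> is nondecreasing, and the density of its Stieltjes measure is its derivative.\<close>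

lemma lipschitz_weak_derivative:
  fixes f :: "real \<Rightarrow> real"
  assumes f: "K-lipschitz_on UNIV f"
  obtains g where "weak_gradient UNIV f g"
proof -
  define L where "L = K + 1"
  have K0: "0 \<le> K" using lipschitz_on_nonneg[OF f] .
  have fL: "\<bar>f x - f y\<bar> \<le> K * \<bar>x - y\<bar>" for x y
    using lipschitz_onD[OF f, of x y] by (simp add: dist_real_def)
  define F where "F = (\<lambda>x. f x + K * x)"
  have cf: "continuous_on UNIV f" using f by (rule lipschitz_on_continuous_on)
  have cF: "continuous_on UNIV F" unfolding F_def by (intro continuous_intros cf)
  have mono: "F x \<le> F y" if "x \<le> y" for x y
    using fL[of x y] that by (simp add: F_def algebra_simps)
  \<comment> \<open>The slopes of \<open>F\<close> lie between \<open>0\<close> and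
    \<open>2 * K\<close>; the summand 1 makes the constant positive, as
    \<open>lipschitz_stieltjes_absolutely_continuous\<close> requires.\<close>
  have LF: "(2 * K + 1)-lipschitz_on UNIV F"
  proof (rule lipschitz_onI)
    fix x y :: real
    have "F x - F y = (f x - f y) + K * (x - y)" by (simp add: F_def algebra_simps)
    then have "\<bar>F x - F y\<bar> \<le> \<bar>f x - f y\<bar> + \<bar>K * (x - y)\<bar>" by (simp only: abs_triangle_ineq)
    also have "\<bar>K * (x - y)\<bar> = K * \<bar>x - y\<bar>" using K0 by (simp add: abs_mult)
    also have "\<bar>f x - f y\<bar> + K * \<bar>x - y\<bar> \<le> (2 * K + 1) * \<bar>x - y\<bar>" using fL[of x y] by (simp add: algebra_simps)
    finally show "dist (F x) (F y) \<le> (2 * K + 1) * dist x y" by (simp add: dist_real_def)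
  qed (use K0 in simp)
  have ac: "absolutely_continuous lborel (interval_measure F)"
    using K0 by (intro lipschitz_stieltjes_absolutely_continuous[OF mono LF]) auto
  obtain D where D: "D \<in> borel_measurable lborel" "density lborel D = interval_measure F"
    using sigma_finite_measure.Radon_Nikodym[OF sigma_finite_lborel ac] by auto
  have [measurable]: "D \<in> borel_measurable borel" using D(1) by simp
  \<comment> \<open>On a bounded interval the density has the finite integral
    \<open>F b - F a\<close>, so it is finite almost everywhere and \<open>enn2real\<close> changes
    it on a null set only.\<close>
  define d where "d = (\<lambda>t. enn2real (D t))"
  have dm[measurable]: "d \<in> borel_measurable borel" unfolding d_def by simp
  have d0: "0 \<le> d t" for t by (simp add: d_def)
  have em: "emeasure (interval_measure F) {a<..b} = ennreal (F b - F a)" if "a \<le> b" for a b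
    using cF by (intro emeasure_interval_measure_Ioc[OF that mono])
      (auto simp: continuous_on_eq_continuous_within intro: continuous_within_subset)
  have nnD: "(\<integral>\<^sup>+t. D t * indicator {a<..b} t \<partial>lborel) = ennreal (F b - F a)" if "a \<le> b" for a b
    using em[OF that] emeasure_density[OF D(1), of "{a<..b}"] D(2) by simp
  have Dd: "AE t in lborel. t \<in> {a<..b} \<longrightarrow> D t = ennreal (d t)" for a b
  proof (cases "a \<le> b")
    case True
    have "AE t in lborel. D t * indicator {a<..b} t \<noteq> \<infinity>"
      using nnD[OF True] by (intro nn_integral_PInf_AE) auto
    then show ?thesis
      by eventually_elim (auto simp: d_def less_top)
  qed auto
  have nnd: "(\<integral>\<^sup>+t. ennreal (indicator {a<..b} t * d t) \<partial>lborel) = ennreal (F b - F a)" if "a \<le> b" for a b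
    unfolding nnD[OF that, symmetric]
    by (rule nn_integral_cong_AE, rule eventually_mono[OF Dd[of a b]]) (auto simp: indicator_def)
  have id: "integrable lborel (\<lambda>t. indicator {a<..b} t * d t)"
    and ld: "a \<le> b \<Longrightarrow> (LINT t|lborel. indicator {a<..b} t * d t) = F b - F a" for a b
  proof -
    have "integrable lborel (\<lambda>t. indicator {a<..b} t * d t) \<and> (LINT t|lborel. indicator {a<..b} t * d t) = F b - F a" if "a \<le> b"
      using nnd[OF that] mono[OF that] d0
      by (subst nn_integral_eq_integrable[symmetric]) auto
    moreover have "integrable lborel (\<lambda>t. indicator {a<..b} t * d t)" if "\<not> a \<le> b" using that by simp
    ultimately show "integrable lborel (\<lambda>t. indicator {a<..b} t * d t)"
      "a \<le> b \<Longrightarrow> (LINT t|lborel. indicator {a<..b} t * d t) = F b - F a" by blast+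
  qed
  have ilc: "locally_integrable UNIV d"
    unfolding locally_integrable_def set_integrable_def
  proof (intro allI impI)
    fix C :: "real set" assume C: "compact C"
    then obtain R where R: "C \<subseteq> ball 0 R" using bounded_subset_ballD[OF compact_imp_bounded] by blast
    have "integrable lebesgue (\<lambda>t. indicator {-R<..R} t * d t)"
      using id by (subst integrable_completion) auto
    moreover have "C \<in> sets lebesgue" using lmeasurable_compact[OF C] by (auto simp: fmeasurable_def)
    ultimately have "integrable lebesgue (\<lambda>t. indicator C t *\<^sub>R (indicator {-R<..R} t * d t))"
      by (intro integrable_mult_indicator)
    moreover have "(\<lambda>t. indicator C t *\<^sub>R (indicator {-R<..R} t * d t)) = (\<lambda>t. indicator C t *\<^sub>R d t)"
      using R by (force simp: indicator_def fun_eq_iff)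
    ultimately show "integrable lebesgue (\<lambda>t. indicator C t *\<^sub>R d t)" by (simp only:)
  qed
  have wF: "weak_gradient UNIV F d"
  proof (rule weak_gradientI[OF open_UNIV locally_integrable_continuous[OF cF] ilc])
    fix \<theta> :: "real \<Rightarrow> real" and b :: real assume \<theta>: "test_function UNIV \<theta>" and "b \<in> Basis"
    then have b: "b = 1" by simp
    have sm: "smooth \<theta>" using \<theta> by (simp add: test_function_def)
    define \<theta>' where "\<theta>' = (\<lambda>s. frechet_derivative \<theta> (at s) 1)"
    have t': "test_function UNIV \<theta>'" unfolding \<theta>'_def by (rule test_function_frechet_derivative[OF \<theta>])
    have c': "continuous_on UNIV \<theta>'" using t' by (rule test_function_continuous)
    have m'[measurable]: "\<theta>' \<in> borel_measurable borel" using c' by (rule borel_measurable_continuous_onI)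
    have cth: "continuous_on UNIV \<theta>" using \<theta> by (rule test_function_continuous)
    have mth[measurable]: "\<theta> \<in> borel_measurable borel" using cth by (rule borel_measurable_continuous_onI)
    have der: "(\<theta> has_real_derivative \<theta>' s) (at s)" for s
    proof -
      have "frechet_derivative \<theta> (at s) h = \<theta>' s * h" for h
        using linear_scale[OF linear_frechet_derivative[OF smooth_differentiable[OF sm]], of s h 1]
        by (simp add: \<theta>'_def)
      then have "frechet_derivative \<theta> (at s) = (*) (\<theta>' s)" by (simp add: fun_eq_iff)
      then show ?thesis using smooth_has_derivative[OF sm, of s] by (simp add: has_field_derivative_def)
    qed
    obtain C where C: "compact C" "\<And>x. x \<notin> C \<Longrightarrow> \<theta> x = 0" "\<And>x h. x \<notin> C \<Longrightarrow> frechet_derivative \<theta> (at x) h = 0"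
      by (rule test_function_support[OF \<theta>]) blast
    obtain R where R: "0 < R" "C \<subseteq> ball 0 R" using bounded_subset_ballD[OF compact_imp_bounded[OF C(1)]] by blast
    have z: "\<theta> s = 0" "\<theta>' s = 0" if "s \<le> -R \<or> R \<le> s" for s
    proof -
      have "s \<notin> C" using R that by force
      then show "\<theta> s = 0" "\<theta>' s = 0" using C by (auto simp: \<theta>'_def)
    qed
    have i': "integrable lborel \<theta>'" using z(2) by (intro continuous_compact_support_integrable[OF c', of "{-R..R}"]) auto
    have tail: "(LINT s|lborel. indicator {t..} s * \<theta>' s) = - \<theta> t" if "-R \<le> t" "t \<le> R" for t
    proof -
      have "(LINT s|lborel. indicator {t..} s * \<theta>' s) = (LINT s|lborel. \<theta>' s * indicator {t..R} s)"
        using z(2) by (intro Bochner_Integration.integral_cong) (auto simp: indicator_def)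
      also have "\<dots> = \<theta> R - \<theta> t"
        using c' der that by (intro integral_FTC_Icc_real) (auto simp: continuous_on_eq_continuous_at)
      finally show ?thesis using z(1)[of R] by simp
    qed
    have full: "(LINT s|lborel. \<theta>' s) = 0"
    proof -
      have "(LINT s|lborel. \<theta>' s) = (LINT s|lborel. indicator {-R..} s * \<theta>' s)"
        using z(2) by (intro Bochner_Integration.integral_cong) (auto simp: indicator_def)
      then show ?thesis using tail[of "-R"] R(1) z(1)[of "-R"] by simp
    qed
    define I where "I = (\<lambda>t. indicator {-R<..R} t * d t)"
    have iI: "integrable lborel I" unfolding I_def by (rule id)
    \<comment> \<open>Integration by parts through Fubini: integrating \<open>Q\<close> in
      \<open>t\<close> first gives \<open>(F s - F (-R)) * \<theta>' s\<close>, in \<open>s\<close>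
      first gives \<open>- (d t * \<theta> t)\<close>. The constant \<open>F (-R)\<close> drops out
      because \<open>\<theta>'\<close> has integral zero.\<close>
    define Q where "Q = (\<lambda>t s. I t * (indicator {t..} s * \<theta>' s))"
    have Qm: "(\<lambda>(t, s). Q t s) \<in> borel_measurable (lborel \<Otimes>\<^sub>M lborel)"
    proof -
      have "(\<lambda>x. indicator {x :: real \<times> real. fst x \<le> snd x} x :: real) \<in> borel_measurable (lborel \<Otimes>\<^sub>M lborel)"
        by measurable
      moreover have "(\<lambda>(t, s). Q t s) = (\<lambda>x. I (fst x) * (indicator {x. fst x \<le> snd x} x * \<theta>' (snd x)))"
        by (auto simp: Q_def indicator_def fun_eq_iff)
      ultimately show ?thesis unfolding I_def by simp
    qed
    have iQ: "integrable (lborel \<Otimes>\<^sub>M lborel) (\<lambda>(t, s). Q t s)"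
    proof (rule lborel_pair.Fubini_integrable[OF Qm])
      have i2: "integrable lborel (\<lambda>s. indicator {t..} s * \<theta>' s)" for t
        using integrable_mult_indicator[OF _ i', of "{t..}"] by simp
      then show "AE t in lborel. integrable lborel (\<lambda>s. case (t, s) of (t, s) \<Rightarrow> Q t s)"
        by (simp add: Q_def)
      show "integrable lborel (\<lambda>t. LINT s|lborel. norm (case (t, s) of (t, s) \<Rightarrow> Q t s))"
      proof (rule Bochner_Integration.integrable_bound)
        show "integrable lborel (\<lambda>t. \<bar>I t\<bar> * (LINT s|lborel. \<bar>\<theta>' s\<bar>))" using iI by auto
        show "(\<lambda>t. LINT s|lborel. norm (case (t, s) of (t, s) \<Rightarrow> Q t s)) \<in> borel_measurable lborel"
          using Qm by (intro lborel.borel_measurable_lebesgue_integral) (simp add: split_beta')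
        show "AE t in lborel. norm (LINT s|lborel. norm (case (t, s) of (t, s) \<Rightarrow> Q t s)) \<le> norm (\<bar>I t\<bar> * (LINT s|lborel. \<bar>\<theta>' s\<bar>))"
        proof (intro AE_I2)
          fix t
          have "(LINT s|lborel. norm (Q t s)) = \<bar>I t\<bar> * (LINT s|lborel. \<bar>indicator {t..} s * \<theta>' s\<bar>)"
            by (simp add: Q_def abs_mult)
          also have "\<dots> \<le> \<bar>I t\<bar> * (LINT s|lborel. \<bar>\<theta>' s\<bar>)"
            using i' i2 by (intro mult_left_mono integral_mono) (auto simp: indicator_def)
          finally show "norm (LINT s|lborel. norm (case (t, s) of (t, s) \<Rightarrow> Q t s)) \<le> norm (\<bar>I t\<bar> * (LINT s|lborel. \<bar>\<theta>' s\<bar>))"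
            by (simp add: Bochner_Integration.integral_nonneg)
        qed
      qed
    qed
    have inner1: "(LINT t|lborel. Q t s) = (F s - F (-R)) * \<theta>' s" for s
    proof (cases "-R \<le> s \<and> s \<le> R")
      case True
      have "(LINT t|lborel. Q t s) = (LINT t|lborel. (indicator {-R<..s} t * d t) * \<theta>' s)"
        using True by (intro Bochner_Integration.integral_cong refl) (auto simp: Q_def I_def indicator_def)
      then show ?thesis using ld[of "-R" s] True by simp
    next
      case False
      then have "\<theta>' s = 0" using z(2)[of s] by linarith
      then show ?thesis by (simp add: Q_def)
    qed
    have inner2: "(LINT s|lborel. Q t s) = - (d t * \<theta> t)" for t
    proof (cases "t \<in> {-R<..R}")
      case True
      then show ?thesis using tail[of t] by (simp add: Q_def I_def)
    next
      case False
      then have "\<theta> t = 0" using z(1)[of t] by auto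
      then show ?thesis using False by (simp add: Q_def I_def)
    qed
    have iF: "integrable lborel (\<lambda>s. F s * \<theta>' s)"
      using z(2) by (intro continuous_compact_support_integrable[of _ "{-R..R}"] continuous_on_mult cF c') auto
    have "(LINT s|lborel. F s * \<theta>' s) = (LINT s|lborel. (F s - F (-R)) * \<theta>' s)"
      using iF i' full by (simp add: left_diff_distrib)
    also have "\<dots> = (LINT s|lborel. LINT t|lborel. Q t s)" by (simp add: inner1)
    also have "\<dots> = (LINT t|lborel. LINT s|lborel. Q t s)" by (rule lborel_pair.Fubini_integral[OF iQ])
    also have "\<dots> = - (LINT t|lborel. d t * \<theta> t)" by (simp add: inner2)
    finally have main: "(LINT s|lborel. F s * \<theta>' s) = - (LINT t|lborel. d t * \<theta> t)" .
    have "(LINT s|lebesgue. F s * \<theta>' s) = (LINT s|lborel. F s * \<theta>' s)"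
      using borel_measurable_continuous_onI[OF cF] by (intro integral_completion) auto
    moreover have "(LINT s|lebesgue. d s * \<theta> s) = (LINT s|lborel. d s * \<theta> s)"
      by (intro integral_completion) auto
    ultimately show "(LINT x|lebesgue. F x * frechet_derivative \<theta> (at x) b) = - (LINT x|lebesgue. d x \<bullet> b * \<theta> x)"
      using main by (simp add: b \<theta>'_def)
  qed
  \<comment> \<open>The linear function that made \<open>F\<close> nondecreasing is removed
    again.\<close>
  have wL: "weak_gradient UNIV (\<lambda>x. - K * x) (\<lambda>x. - K)"
  proof (rule weak_gradient_lipschitz[where L = K and B = K])
    show "K-lipschitz_on UNIV (\<lambda>x. - K * x)"
    proof (rule lipschitz_onI)
      fix x y :: real
      have "- K * x - - K * y = - K * (x - y)" by (simp add: algebra_simps)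
      then show "dist (- K * x) (- K * y) \<le> K * dist x y"
        using K0 by (simp only: dist_real_def abs_mult abs_minus_cancel abs_of_nonneg)
    qed (rule K0)
    show "AE x in lebesgue. x \<in> UNIV \<longrightarrow> ((\<lambda>x. - K * x) has_derivative (\<bullet>) (- K)) (at x)"
      by (intro AE_I2 impI has_derivative_eq_rhs[OF has_derivative_mult_right[OF has_derivative_ident]]) (auto simp: fun_eq_iff)
  qed (use K0 in auto)
  have "weak_gradient UNIV (\<lambda>x. F x + - K * x) (\<lambda>x. d x + - K)"
    by (rule weak_gradient_add[OF wF wL open_UNIV])
  then have "weak_gradient UNIV f (\<lambda>x. d x + - K)"
    by (rule weak_gradient_cong) (auto simp: F_def)
  then show ?thesis by (rule that)
qed

section \<open>Arc length and tangential gradients\<close>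

text \<open>Lebesgue measure is complete, so preimages may be changed on a null set. This is how
  measurability reaches \<open>grad\<close> and \<open>tgrad\<close>, whose values are fixed only
  almost everywhere.\<close>

lemma measurable_AE_lebesgue:
  fixes f g :: "'a::euclidean_space \<Rightarrow> 'b::euclidean_space"
  assumes g: "g \<in> borel_measurable lebesgue" and ae: "AE x in lebesgue. f x = g x"
  shows "f \<in> borel_measurable lebesgue"
proof (rule borel_measurableI)
  fix S :: "'b set" assume "open S"
  from AE_E[OF ae] obtain N where N: "{x \<in> space lebesgue. \<not> f x = g x} \<subseteq> N" "emeasure lebesgue N = 0" "N \<in> sets lebesgue"
    by blast
  have neg: "negligible N" using N by (simp add: negligible_iff_null_sets null_setsI)
  have "f -` S \<inter> space lebesgue = ((g -` S \<inter> space lebesgue) - N) \<union> (f -` S \<inter> N)"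
    using N(1) by auto
  moreover have "g -` S \<inter> space lebesgue \<in> sets lebesgue" by (rule measurable_sets[OF g borel_open[OF \<open>open S\<close>]])
  moreover have "f -` S \<inter> N \<in> sets lebesgue"
    using negligible_subset[OF neg, of "f -` S \<inter> N"] negligible_imp_sets by blast
  ultimately show "f -` S \<inter> space lebesgue \<in> sets lebesgue" using N(3) by (simp only: sets.Un sets.Diff)
qed

lemma nn_integral_sum_measure:
  assumes I: "finite I" and sets: "\<And>i. i \<in> I \<Longrightarrow> sets (M i) = sets N"
    and em: "\<And>A. A \<in> sets N \<Longrightarrow> emeasure N A = (\<Sum>i\<in>I. emeasure (M i) A)"
    and f: "f \<in> borel_measurable N"
  shows "(\<integral>\<^sup>+x. f x \<partial>N) = (\<Sum>i\<in>I. \<integral>\<^sup>+x. f x \<partial>M i)"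
  using f
proof (induction rule: borel_measurable_induct)
  case (cong f g)
  have "(\<integral>\<^sup>+x. f x \<partial>M i) = (\<integral>\<^sup>+x. g x \<partial>M i)" if "i \<in> I" for i
    using cong(3) sets_eq_imp_space_eq[OF sets[OF that]] by (intro nn_integral_cong) auto
  moreover have "(\<integral>\<^sup>+x. f x \<partial>N) = (\<integral>\<^sup>+x. g x \<partial>N)" using cong(3) by (intro nn_integral_cong) auto
  ultimately show ?case using cong(4) by simp
next
  case (set A)
  then show ?case using sets em by (simp add: nn_integral_indicator)
next
  case (mult u c)
  have "u \<in> borel_measurable (M i)" if "i \<in> I" for i
    using mult(2) by (simp only: measurable_cong_sets[OF sets[OF that] refl])
  then show ?case using mult by (simp add: nn_integral_cmult sum_distrib_left)
next
  case (add u v)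
  have "u \<in> borel_measurable (M i)" "v \<in> borel_measurable (M i)" if "i \<in> I" for i
    using add(1,3) by (simp_all only: measurable_cong_sets[OF sets[OF that] refl])
  then show ?case using add by (simp add: nn_integral_add sum.distrib)
next
  case (seq U)
  have m: "U n \<in> borel_measurable (M i)" if "i \<in> I" for i n
    using seq(1)[of n] by (simp only: measurable_cong_sets[OF sets[OF that] refl])
  have "(\<integral>\<^sup>+x. (SUP n. U n) x \<partial>N) = (SUP n. \<integral>\<^sup>+x. U n x \<partial>N)"
    using nn_integral_monotone_convergence_SUP[OF seq(3,1)] by (simp add: image_comp)
  also have "\<dots> = (SUP n. \<Sum>i\<in>I. \<integral>\<^sup>+x. U n x \<partial>M i)" using seq.IH by simp
  also have "\<dots> = (\<Sum>i\<in>I. SUP n. \<integral>\<^sup>+x. U n x \<partial>M i)"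
    using seq(3) by (intro ennreal_SUP_sum) (auto simp: incseq_def le_fun_def intro!: nn_integral_mono)
  also have "\<dots> = (\<Sum>i\<in>I. \<integral>\<^sup>+x. (SUP n. U n) x \<partial>M i)"
    using nn_integral_monotone_convergence_SUP[OF seq(3) m] by (intro sum.cong) (auto simp: image_comp)
  finally show ?case .
qed

text \<open>In the last claim one parameter is interior: even on a closed curve only the two
  endpoints share a point. The choice of a parameter in \<open>tgrad\<close> is thus forced away
  from the endpoints.\<close>

lemma smooth_curve_cases:
  assumes "smooth_curve (L, c)"
  shows "0 < L" "smooth c" "\<And>s. s \<in> {0..L} \<Longrightarrow> norm (vector_derivative c (at s)) = 1"
    "\<And>s t. 0 < s \<Longrightarrow> s < L \<Longrightarrow> t \<in> {0..L} \<Longrightarrow> c s = c t \<Longrightarrow> s = t"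
proof -
  note a = assms[unfolded smooth_curve_def prod.case]
  show "0 < L" "smooth c" "\<And>s. s \<in> {0..L} \<Longrightarrow> norm (vector_derivative c (at s)) = 1" using a by auto
  fix s t assume st: "0 < s" "s < L" "t \<in> {0..L}" "c s = c t"
  from a have "inj_on c {0..L} \<or> (inj_on c {0..<L} \<and> (\<forall>s. c (s + L) = c s))" by blast
  then show "s = t"
  proof
    assume "inj_on c {0..L}"
    then show ?thesis using st by (auto dest: inj_onD)
  next
    assume b: "inj_on c {0..<L} \<and> (\<forall>s. c (s + L) = c s)"
    show ?thesis
    proof (cases "t = L")
      case True
      have "c L = c 0" using b by (metis add_0)
      then have "s = 0" using st True b by (auto dest!: inj_onD[of c "{0..<L}" s 0])
      then show ?thesis using st by simp
    next
      case False
      then show ?thesis using st b by (auto dest: inj_onD)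
    qed
  qed
qed

lemma smooth_curve_lipschitz:
  assumes "smooth_curve (L, c)"
  shows "1-lipschitz_on {0..L} c"
proof (rule lipschitz_onI)
  fix x y assume xy: "x \<in> {0..L}" "y \<in> {0..L}"
  note sm = smooth_curve_cases(2)[OF assms]
  have d: "(c has_derivative (\<lambda>h. h *\<^sub>R vector_derivative c (at s))) (at s within {0..L})" for s
    using smooth_differentiable[OF sm, of s]
    by (simp add: vector_derivative_works[symmetric] has_vector_derivative_def[symmetric] has_vector_derivative_at_within)
  have "norm (c x - c y) \<le> 1 * norm (x - y)"
  proof (rule differentiable_bound[OF _ d])
    fix s assume "s \<in> {0..L}"
    then have "norm (vector_derivative c (at s)) = 1" by (rule smooth_curve_cases(3)[OF assms])
    then show "onorm (\<lambda>h. h *\<^sub>R vector_derivative c (at s)) \<le> 1" by (intro onorm_bound) auto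
  qed (use xy in auto)
  then show "dist (c x) (c y) \<le> 1 * dist x y" by (simp add: dist_norm)
qed simp

lemma compact_interface:
  assumes "\<forall>C\<in>set \<Gamma>. smooth_curve C"
  shows "compact (interface \<Gamma>)"
  unfolding interface_def
proof (rule compact_UN)
  fix C assume C: "C \<in> set \<Gamma>"
  obtain L c where Lc: "C = (L, c)" by fastforce
  have "continuous_on {0..L} c" using smooth_curve_cases(2)[of L c] C Lc assms by (intro smooth_continuous) auto
  then show "compact (curve_image C)" unfolding Lc curve_image_def by (auto intro: compact_continuous_image)
qed simp

section \<open>The arc length measure and integration with respect to it\<close>

abbreviation arc_len :: "curve list \<Rightarrow> nat \<Rightarrow> real" where "arc_len \<Gamma> i \<equiv> fst (\<Gamma> ! i)"
abbreviation arc_map :: "curve list \<Rightarrow> nat \<Rightarrow> real \<Rightarrow> real^2" where "arc_map \<Gamma> i \<equiv> snd (\<Gamma> ! i)"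
abbreviation arc_dom :: "curve list \<Rightarrow> nat \<Rightarrow> real set" where "arc_dom \<Gamma> i \<equiv> arc_params \<Gamma> i UNIV"

lemma arc_params_eq: "arc_params \<Gamma> i B = {s \<in> arc_dom \<Gamma> i. arc_map \<Gamma> i s \<in> B}"
  by (auto simp: arc_params_def case_prod_beta)

lemma arc_dom_eq: "arc_dom \<Gamma> i = {s \<in> {0..arc_len \<Gamma> i}. arc_map \<Gamma> i s \<notin> interface (take i \<Gamma>)}"
  by (auto simp: arc_params_def case_prod_beta)

lemma arc_dom_interface: "i < length \<Gamma> \<Longrightarrow> s \<in> arc_dom \<Gamma> i \<Longrightarrow> arc_map \<Gamma> i s \<in> interface \<Gamma>"
  unfolding interface_def curve_image_def arc_dom_eq
  by (intro UN_I[of "\<Gamma> ! i"]) (auto split: prod.splits)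

locale smooth_interface =
  fixes \<Gamma> :: "curve list"
  assumes smooth_curves: "\<forall>C\<in>set \<Gamma>. smooth_curve C"
begin

lemma curve: "i < length \<Gamma> \<Longrightarrow> smooth_curve (arc_len \<Gamma> i, arc_map \<Gamma> i)"
  using smooth_curves by simp

lemma arc_map_continuous: "i < length \<Gamma> \<Longrightarrow> continuous_on S (arc_map \<Gamma> i)"
  by (rule smooth_continuous[OF smooth_curve_cases(2)[OF curve]])

lemma arc_dom_sets: 
  assumes i: "i < length \<Gamma>"
  shows "arc_dom \<Gamma> i \<in> sets lebesgue"
proof -
  have "closed (interface (take i \<Gamma>))"
    using smooth_curves by (intro compact_imp_closed compact_interface) (auto dest: in_set_takeD)
  then have "open (arc_map \<Gamma> i -` (- interface (take i \<Gamma>)))"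
    using arc_map_continuous[OF i, of UNIV] by (intro open_vimage) auto
  then have "{0..arc_len \<Gamma> i} \<inter> arc_map \<Gamma> i -` (- interface (take i \<Gamma>)) \<in> sets borel" by auto
  moreover have "{0..arc_len \<Gamma> i} \<inter> arc_map \<Gamma> i -` (- interface (take i \<Gamma>)) = arc_dom \<Gamma> i"
    by (auto simp: arc_dom_eq)
  ultimately show ?thesis by (simp add: sets_completionI_sets)
qed

definition arc_sets :: "(real^2) set set" where
  "arc_sets = {B. \<forall>i<length \<Gamma>. arc_params \<Gamma> i B \<in> sets lebesgue}"

lemma sigma_algebra_arc_sets: "sigma_algebra UNIV arc_sets"
  unfolding sigma_algebra_iff2
proof (intro conjI ballI allI impI)
  show "arc_sets \<subseteq> Pow UNIV" "{} \<in> arc_sets" by (auto simp: arc_sets_def arc_params_eq[of \<Gamma> _ "{}"])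
  fix B assume B: "B \<in> arc_sets"
  have "arc_params \<Gamma> i (UNIV - B) = arc_dom \<Gamma> i - arc_params \<Gamma> i B" for i
    by (subst (1 3) arc_params_eq) auto
  then show "UNIV - B \<in> arc_sets" using B arc_dom_sets by (auto simp: arc_sets_def)
next
  fix A :: "nat \<Rightarrow> (real^2) set" assume A: "range A \<subseteq> arc_sets"
  have "arc_params \<Gamma> i (\<Union>n. A n) = (\<Union>n. arc_params \<Gamma> i (A n))" for i
    by (auto simp: arc_params_def case_prod_beta)
  moreover have "arc_params \<Gamma> i (A n) \<in> sets lebesgue" if "i < length \<Gamma>" for i n
    using A that by (auto simp: arc_sets_def)
  ultimately show "(\<Union>n. A n) \<in> arc_sets" by (auto simp: arc_sets_def intro!: sets.countable_UN)
qed

lemma sets_arc_length: "sets (arc_length \<Gamma>) = arc_sets"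
  unfolding arc_length_def arc_sets_def[symmetric] using sigma_algebra.sets_measure_of_eq[OF sigma_algebra_arc_sets] by simp

lemma space_arc_length [simp]: "space (arc_length \<Gamma>) = UNIV"
  unfolding arc_length_def by (rule space_measure_of) simp

lemma emeasure_arc_length:
  assumes "A \<in> arc_sets"
  shows "emeasure (arc_length \<Gamma>) A = (\<Sum>i<length \<Gamma>. emeasure lebesgue (arc_params \<Gamma> i A))"
  unfolding arc_length_def arc_sets_def[symmetric]
proof (rule emeasure_measure_of_sigma[OF sigma_algebra_arc_sets _ _ assms])
  have "arc_params \<Gamma> i {} = {}" for i by (auto simp: arc_params_def case_prod_beta)
  then show "positive arc_sets (\<lambda>B. \<Sum>i<length \<Gamma>. emeasure lebesgue (arc_params \<Gamma> i B))"
    by (simp add: positive_def)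
  show "countably_additive arc_sets (\<lambda>B. \<Sum>i<length \<Gamma>. emeasure lebesgue (arc_params \<Gamma> i B))"
  proof (unfold countably_additive_def, intro allI impI)
    fix A :: "nat \<Rightarrow> (real^2) set" assume A: "range A \<subseteq> arc_sets" "disjoint_family A"
    have "(\<Sum>n. emeasure lebesgue (arc_params \<Gamma> i (A n))) = emeasure lebesgue (arc_params \<Gamma> i (\<Union>n. A n))"
      if i: "i < length \<Gamma>" for i
    proof -
      have "arc_params \<Gamma> i (\<Union>n. A n) = (\<Union>n. arc_params \<Gamma> i (A n))"
        by (auto simp: arc_params_def case_prod_beta)
      moreover have d: "disjoint_family (\<lambda>n. arc_params \<Gamma> i (A n))"
        using A(2) by (fastforce simp: disjoint_family_on_def arc_params_def case_prod_beta)
      moreover have m: "range (\<lambda>n. arc_params \<Gamma> i (A n)) \<subseteq> sets lebesgue"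
        using A(1) i by (auto simp: arc_sets_def)
      ultimately show ?thesis by (simp only: suminf_emeasure[OF m d])
    qed
    then show "(\<Sum>n. \<Sum>i<length \<Gamma>. emeasure lebesgue (arc_params \<Gamma> i (A n))) =
        (\<Sum>i<length \<Gamma>. emeasure lebesgue (arc_params \<Gamma> i (\<Union>n. A n)))"
      by (subst suminf_sum) auto
  qed
qed

lemma arc_measurableI:
  fixes f :: "real^2 \<Rightarrow> 'b::topological_space"
  assumes "\<And>i. i < length \<Gamma> \<Longrightarrow> (\<lambda>s. f (arc_map \<Gamma> i s)) \<in> borel_measurable (lebesgue_on (arc_dom \<Gamma> i))"
  shows "f \<in> borel_measurable (arc_length \<Gamma>)"
proof (rule borel_measurableI)
  fix S :: "'b set" assume S: "open S"
  have "arc_params \<Gamma> i (f -` S) \<in> sets lebesgue" if i: "i < length \<Gamma>" for i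
  proof -
    have "(\<lambda>s. f (arc_map \<Gamma> i s)) -` S \<inter> space (lebesgue_on (arc_dom \<Gamma> i)) \<in> sets (lebesgue_on (arc_dom \<Gamma> i))"
      by (rule measurable_sets[OF assms[OF i] borel_open[OF S]])
    moreover have "(\<lambda>s. f (arc_map \<Gamma> i s)) -` S \<inter> space (lebesgue_on (arc_dom \<Gamma> i)) = arc_params \<Gamma> i (f -` S)"
      by (subst (2) arc_params_eq) (auto simp: space_restrict_space)
    ultimately show ?thesis
      using arc_dom_sets[OF i] by (simp add: sets_restrict_space_iff)
  qed
  then show "f -` S \<inter> space (arc_length \<Gamma>) \<in> sets (arc_length \<Gamma>)"
    by (simp add: sets_arc_length arc_sets_def)
qed

lemma arc_map_measurable:
  assumes i: "i < length \<Gamma>"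
  shows "arc_map \<Gamma> i \<in> measurable (lebesgue_on (arc_dom \<Gamma> i)) (arc_length \<Gamma>)"
proof (rule measurableI)
  fix A assume A: "A \<in> sets (arc_length \<Gamma>)"
  have "arc_map \<Gamma> i -` A \<inter> space (lebesgue_on (arc_dom \<Gamma> i)) = arc_params \<Gamma> i A"
    by (subst (2) arc_params_eq) (auto simp: space_restrict_space)
  moreover have "arc_params \<Gamma> i A \<subseteq> arc_dom \<Gamma> i" by (subst arc_params_eq) auto
  ultimately show "arc_map \<Gamma> i -` A \<inter> space (lebesgue_on (arc_dom \<Gamma> i)) \<in> sets (lebesgue_on (arc_dom \<Gamma> i))"
    using A i arc_dom_sets[OF i] by (simp add: sets_arc_length arc_sets_def sets_restrict_space_iff)
qed simp

lemma borel_arc_sets: "A \<in> sets borel \<Longrightarrow> A \<in> sets (arc_length \<Gamma>)"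
proof -
  assume A: "A \<in> sets borel"
  have "(\<lambda>x. x) \<in> borel_measurable (arc_length \<Gamma>)"
  proof (rule arc_measurableI)
    fix i assume i: "i < length \<Gamma>"
    show "arc_map \<Gamma> i \<in> borel_measurable (lebesgue_on (arc_dom \<Gamma> i))"
      using borel_measurable_lebesgue_continuous[OF arc_map_continuous[OF i]] by (rule measurable_restrict_space1)
  qed
  from measurable_sets[OF this A] show ?thesis by simp
qed

text \<open>\<open>arc_length\<close> is the sum over the curves of the images of Lebesgue measure
  on \<open>arc_dom\<close>, the parameters whose points lie on no earlier curve.\<close>

lemma nn_integral_arc_length:
  assumes f: "f \<in> borel_measurable (arc_length \<Gamma>)"
  shows "(\<integral>\<^sup>+x. f x \<partial>arc_length \<Gamma>) = (\<Sum>i<length \<Gamma>. \<integral>\<^sup>+s. f (arc_map \<Gamma> i s) \<partial>lebesgue_on (arc_dom \<Gamma> i))"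
proof -
  define M where "M i = distr (lebesgue_on (arc_dom \<Gamma> i)) (arc_length \<Gamma>) (arc_map \<Gamma> i)" for i
  have "(\<integral>\<^sup>+x. f x \<partial>arc_length \<Gamma>) = (\<Sum>i<length \<Gamma>. \<integral>\<^sup>+x. f x \<partial>M i)"
  proof (rule nn_integral_sum_measure[OF _ _ _ f])
    fix A assume A: "A \<in> sets (arc_length \<Gamma>)"
    have "emeasure (M i) A = emeasure lebesgue (arc_params \<Gamma> i A)" if i: "i < length \<Gamma>" for i
    proof -
      have "arc_map \<Gamma> i -` A \<inter> space (lebesgue_on (arc_dom \<Gamma> i)) = arc_params \<Gamma> i A"
        by (subst (2) arc_params_eq) (auto simp: space_restrict_space)
      moreover have "emeasure (lebesgue_on (arc_dom \<Gamma> i)) (arc_params \<Gamma> i A) = emeasure lebesgue (arc_params \<Gamma> i A)"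
        using arc_dom_sets[OF i] by (intro emeasure_restrict_space) (auto simp: arc_params_eq[of \<Gamma> i A])
      ultimately show ?thesis
        unfolding M_def by (simp only: emeasure_distr[OF arc_map_measurable[OF i] A])
    qed
    then show "emeasure (arc_length \<Gamma>) A = (\<Sum>i<length \<Gamma>. emeasure (M i) A)"
      using A by (simp add: emeasure_arc_length sets_arc_length)
  qed (auto simp: M_def)
  also have "\<dots> = (\<Sum>i<length \<Gamma>. \<integral>\<^sup>+s. f (arc_map \<Gamma> i s) \<partial>lebesgue_on (arc_dom \<Gamma> i))"
    using f arc_map_measurable by (intro sum.cong refl) (simp add: M_def nn_integral_distr)
  finally show ?thesis .
qed

text \<open>Every set with Lebesgue null preimages is measurable for \<open>arc_length\<close>, by
  completeness; so the exceptional set is measurable whatever \<open>Q\<close> is.\<close>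

lemma AE_arc_length:
  assumes "\<And>i. i < length \<Gamma> \<Longrightarrow> AE s in lebesgue. s \<in> arc_dom \<Gamma> i \<longrightarrow> Q (arc_map \<Gamma> i s)"
  shows "AE x in arc_length \<Gamma>. Q x"
proof -
  have n: "negligible (arc_params \<Gamma> i {x. \<not> Q x})" if i: "i < length \<Gamma>" for i
  proof -
    from AE_E[OF assms[OF i]] obtain N where N: "{s \<in> space lebesgue. \<not> (s \<in> arc_dom \<Gamma> i \<longrightarrow> Q (arc_map \<Gamma> i s))} \<subseteq> N"
        "emeasure lebesgue N = 0" "N \<in> sets lebesgue"
      by blast
    then have "negligible N" by (simp add: negligible_iff_null_sets null_setsI)
    moreover have "arc_params \<Gamma> i {x. \<not> Q x} \<subseteq> N" using N(1) by (subst arc_params_eq) auto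
    ultimately show ?thesis by (rule negligible_subset)
  qed
  then have s: "{x. \<not> Q x} \<in> arc_sets" using negligible_imp_sets by (auto simp: arc_sets_def)
  have "emeasure (arc_length \<Gamma>) {x. \<not> Q x} = (\<Sum>i<length \<Gamma>. 0)"
    unfolding emeasure_arc_length[OF s]
  proof (intro sum.cong refl null_setsD1)
    fix i assume "i \<in> {..<length \<Gamma>}"
    then show "arc_params \<Gamma> i {x. \<not> Q x} \<in> null_sets lebesgue"
      using n[of i] by (simp only: negligible_iff_null_sets lessThan_iff)
  qed
  then show ?thesis using s by (intro AE_I[of _ _ "{x. \<not> Q x}"]) (auto simp: sets_arc_length)
qed

lemma AE_interface: "AE x in arc_length \<Gamma>. x \<in> interface \<Gamma>"
  by (rule AE_arc_length) (auto simp: arc_dom_interface)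

lemma finite_arc_length: "finite_measure (arc_length \<Gamma>)"
proof
  have "emeasure lebesgue (arc_dom \<Gamma> i) < \<infinity>" if i: "i < length \<Gamma>" for i
  proof -
    have "emeasure lebesgue (arc_dom \<Gamma> i) \<le> emeasure lebesgue {0..arc_len \<Gamma> i}"
      by (rule emeasure_mono) (auto simp: arc_dom_eq)
    also have "\<dots> < \<infinity>" by (simp add: emeasure_lborel_Icc_eq)
    finally show ?thesis .
  qed
  moreover have "UNIV \<in> arc_sets" using arc_dom_sets by (auto simp: arc_sets_def)
  ultimately show "emeasure (arc_length \<Gamma>) (space (arc_length \<Gamma>)) \<noteq> \<infinity>"
    by (simp add: emeasure_arc_length less_top[symmetric])
qed

text \<open>A parameter in \<open>arc_dom\<close> belongs to a point on no earlier curve, so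
  \<open>hd\<close> selects curve \<open>i\<close>; an interior parameter is the only one of its
  point, so \<open>SOME\<close> selects \<open>s\<close>.\<close>

lemma tgrad_arc:
  assumes i: "i < length \<Gamma>" and s: "s \<in> arc_dom \<Gamma> i" "0 < s" "s < arc_len \<Gamma> i"
  shows "tgrad \<Gamma> u (arc_map \<Gamma> i s) = grad {0<..<arc_len \<Gamma> i} (u \<circ> arc_map \<Gamma> i) s *\<^sub>R vector_derivative (arc_map \<Gamma> i) (at s)"
proof -
  let ?x = "arc_map \<Gamma> i s"
  have "?x \<in> curve_image (\<Gamma> ! i)"
    using s unfolding arc_dom_eq curve_image_def by (auto split: prod.splits)
  moreover have "filter (\<lambda>C. ?x \<in> curve_image C) (take i \<Gamma>) = []"
    using s(1) unfolding arc_dom_eq interface_def by (auto simp: filter_empty_conv)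
  ultimately have hd: "hd (filter (\<lambda>C. ?x \<in> curve_image C) \<Gamma>) = \<Gamma> ! i"
    by (subst id_take_nth_drop[OF i]) simp
  have "(SOME t. t \<in> {0..arc_len \<Gamma> i} \<and> arc_map \<Gamma> i t = ?x) = s"
  proof (rule some_equality)
    show "t = s" if "t \<in> {0..arc_len \<Gamma> i} \<and> arc_map \<Gamma> i t = ?x" for t
      using smooth_curve_cases(4)[OF curve[OF i] s(2,3), of t] that by simp
  qed (use s in auto)
  then show ?thesis
    unfolding tgrad_def hd by (simp add: case_prod_beta Let_def)
qed

end

section \<open>The space of functions with trace in \<open>H1 \<Gamma>\<close>\<close>

definition sqn :: "'a measure \<Rightarrow> ('a \<Rightarrow> 'b::euclidean_space) \<Rightarrow> real" where
  "sqn M f = (LINT x|M. (norm (f x))\<^sup>2)"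

lemma sqn_nonneg: "0 \<le> sqn M f"
  unfolding sqn_def by (intro Bochner_Integration.integral_nonneg) simp

lemma L2_norm_sqn: "L2_norm M f = sqrt (sqn M f)"
  by (simp add: L2_norm_def sqn_def)

lemma square_integrable_dominated:
  fixes f :: "'a \<Rightarrow> 'b::euclidean_space" and g :: "'a \<Rightarrow> 'c::euclidean_space"
  assumes g: "square_integrable M g" and f: "f \<in> borel_measurable M" and le: "AE x in M. norm (f x) \<le> C * norm (g x)"
  shows "square_integrable M f" "sqn M f \<le> C\<^sup>2 * sqn M g"
proof -
  have ig: "integrable M (\<lambda>x. C\<^sup>2 * (norm (g x))\<^sup>2)" using g by (simp add: square_integrable_def)
  have ae: "AE x in M. (norm (f x))\<^sup>2 \<le> C\<^sup>2 * (norm (g x))\<^sup>2"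
    using le
  proof eventually_elim
    case (elim x)
    then show ?case using power_mono[OF elim, of 2] by (simp add: power_mult_distrib)
  qed
  have i: "integrable M (\<lambda>x. (norm (f x))\<^sup>2)"
  proof (rule Bochner_Integration.integrable_bound[OF ig])
    show "(\<lambda>x. (norm (f x))\<^sup>2) \<in> borel_measurable M" using f by measurable
    show "AE x in M. norm ((norm (f x))\<^sup>2) \<le> norm (C\<^sup>2 * (norm (g x))\<^sup>2)"
      using ae by eventually_elim simp
  qed
  then show "square_integrable M f" using f by (simp add: square_integrable_def)
  have "sqn M f \<le> (LINT x|M. C\<^sup>2 * (norm (g x))\<^sup>2)"
    unfolding sqn_def by (rule integral_mono_AE[OF i ig ae])
  then show "sqn M f \<le> C\<^sup>2 * sqn M g" by (simp add: sqn_def)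
qed

lemma norm_add_sq_le:
  fixes a b :: "'a::real_normed_vector"
  shows "(norm (a + b))\<^sup>2 \<le> 2 * (norm a)\<^sup>2 + 2 * (norm b)\<^sup>2"
proof -
  have "(norm (a + b))\<^sup>2 \<le> (norm a + norm b)\<^sup>2" by (intro power_mono norm_triangle_ineq) simp
  also have "\<dots> \<le> 2 * (norm a)\<^sup>2 + 2 * (norm b)\<^sup>2"
    using sum_squares_bound[of "norm a" "norm b"] by (simp add: power2_sum)
  finally show ?thesis .
qed

lemma square_integrable_add:
  fixes f g :: "'a \<Rightarrow> 'b::euclidean_space"
  assumes f: "square_integrable M f" and g: "square_integrable M g"
  shows "square_integrable M (\<lambda>x. f x + g x)" "sqn M (\<lambda>x. f x + g x) \<le> 2 * sqn M f + 2 * sqn M g"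
proof -
  have i: "integrable M (\<lambda>x. 2 * (norm (f x))\<^sup>2 + 2 * (norm (g x))\<^sup>2)"
    using f g by (simp add: square_integrable_def)
  have m: "(\<lambda>x. f x + g x) \<in> borel_measurable M"
    using f g by (intro borel_measurable_add) (simp_all add: square_integrable_def)
  have i2: "integrable M (\<lambda>x. (norm (f x + g x))\<^sup>2)"
  proof (rule Bochner_Integration.integrable_bound[OF i])
    show "(\<lambda>x. (norm (f x + g x))\<^sup>2) \<in> borel_measurable M" using m by measurable
    show "AE x in M. norm ((norm (f x + g x))\<^sup>2) \<le> norm (2 * (norm (f x))\<^sup>2 + 2 * (norm (g x))\<^sup>2)"
      using norm_add_sq_le by (intro AE_I2) simp
  qed
  then show "square_integrable M (\<lambda>x. f x + g x)" using m by (simp add: square_integrable_def)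
  have "sqn M (\<lambda>x. f x + g x) \<le> (LINT x|M. 2 * (norm (f x))\<^sup>2 + 2 * (norm (g x))\<^sup>2)"
    unfolding sqn_def by (rule integral_mono[OF i2 i norm_add_sq_le])
  then show "sqn M (\<lambda>x. f x + g x) \<le> 2 * sqn M f + 2 * sqn M g"
    using f g by (simp add: sqn_def square_integrable_def)
qed

lemma square_integrable_scale:
  fixes f :: "'a \<Rightarrow> 'b::euclidean_space"
  assumes f: "square_integrable M f"
  shows "square_integrable M (\<lambda>x. c *\<^sub>R f x)" "sqn M (\<lambda>x. c *\<^sub>R f x) = c\<^sup>2 * sqn M f"
  using f by (auto simp: square_integrable_def sqn_def power_mult_distrib)

lemma square_integrable_diff:
  fixes f g :: "'a \<Rightarrow> 'b::euclidean_space"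
  assumes f: "square_integrable M f" and g: "square_integrable M g"
  shows "square_integrable M (\<lambda>x. f x - g x)"
  using square_integrable_add(1)[OF f square_integrable_scale(1)[OF g, of "-1"]] by simp

lemma sqn_cong_AE:
  fixes f g :: "'a \<Rightarrow> 'b::euclidean_space"
  assumes "f \<in> borel_measurable M" "g \<in> borel_measurable M" "AE x in M. f x = g x"
  shows "sqn M f = sqn M g"
  unfolding sqn_def
proof (rule integral_cong_AE)
  show "AE x in M. (norm (f x))\<^sup>2 = (norm (g x))\<^sup>2" using assms(3) by eventually_elim simp
qed (use assms in measurable)

lemma square_integrable_bounded:
  fixes f :: "'a \<Rightarrow> 'b::euclidean_space"
  assumes "finite_measure M" "f \<in> borel_measurable M" "AE x in M. norm (f x) \<le> C" "0 \<le> C"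
  shows "square_integrable M f" "sqn M f \<le> C\<^sup>2 * measure M (space M)"
proof -
  interpret finite_measure M by fact
  have one: "square_integrable M (\<lambda>x. 1 :: real)" by (simp add: square_integrable_def)
  have "AE x in M. norm (f x) \<le> C * norm (1 :: real)" using assms(3) by simp
  note d = square_integrable_dominated[OF one assms(2) this]
  show "square_integrable M f" by (rule d(1))
  show "sqn M f \<le> C\<^sup>2 * measure M (space M)" using d(2) by (simp add: sqn_def)
qed

lemma square_integrable_integrable:
  fixes f :: "'a \<Rightarrow> 'b::euclidean_space"
  assumes "finite_measure M" "square_integrable M f"
  shows "integrable M f"
proof -
  interpret finite_measure M by fact
  have i: "integrable M (\<lambda>x. 1 + (norm (f x))\<^sup>2)" using assms(2) by (simp add: square_integrable_def)
  show ?thesis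
  proof (rule Bochner_Integration.integrable_bound[OF i])
    show "AE x in M. norm (f x) \<le> norm (1 + (norm (f x))\<^sup>2)"
    proof (intro AE_I2)
      fix x
      have "0 \<le> (norm (f x) - 1)\<^sup>2" by simp
      then have "2 * norm (f x) \<le> 1 + (norm (f x))\<^sup>2" by (simp add: power2_diff)
      moreover have "0 \<le> norm (f x)" by simp
      ultimately have "norm (f x) \<le> 1 + (norm (f x))\<^sup>2" by linarith
      then show "norm (f x) \<le> norm (1 + (norm (f x))\<^sup>2)" by (simp add: order_trans[OF _ abs_ge_self])
    qed
  qed (use assms(2) in \<open>simp add: square_integrable_def\<close>)
qed

lemma weak_gradient_measurable:
  fixes u :: "'a::euclidean_space \<Rightarrow> real"
  assumes g: "g \<in> borel_measurable (lebesgue_on \<Omega>)" and "open \<Omega>" and ae: "AE x in lebesgue. x \<in> \<Omega> \<longrightarrow> h x = g x"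
  shows "(h :: 'a \<Rightarrow> 'b::euclidean_space) \<in> borel_measurable (lebesgue_on \<Omega>)"
proof -
  have m: "\<Omega> \<in> sets lebesgue" using assms(2) by auto
  have "(\<lambda>x. indicator \<Omega> x *\<^sub>R g x) \<in> borel_measurable lebesgue"
    using g m by (simp add: borel_measurable_restrict_space_iff)
  moreover have "AE x in lebesgue. indicator \<Omega> x *\<^sub>R h x = indicator \<Omega> x *\<^sub>R g x"
    using ae by eventually_elim (auto simp: indicator_def)
  ultimately have "(\<lambda>x. indicator \<Omega> x *\<^sub>R h x) \<in> borel_measurable lebesgue" by (rule measurable_AE_lebesgue)
  then show ?thesis using m by (simp add: borel_measurable_restrict_space_iff)
qed

lemma grad_weak_gradient: "weak_gradient \<Omega> u g \<Longrightarrow> weak_gradient \<Omega> u (grad \<Omega> u)"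
  unfolding grad_def by (rule someI[of "weak_gradient \<Omega> u"])

lemma grad_AE:
  fixes u :: "'a::euclidean_space \<Rightarrow> real"
  assumes "weak_gradient \<Omega> u g" "open \<Omega>"
  shows "AE x in lebesgue. x \<in> \<Omega> \<longrightarrow> grad \<Omega> u x = g x"
  by (rule weak_gradient_unique[OF grad_weak_gradient[OF assms(1)] assms])

text \<open>\<open>grad\<close> may pick any weak gradient, not the square integrable one in the
  definition of \<open>H1\<close>. The two agree almost everywhere, and completeness transfers
  measurability.\<close>

lemma H1_grad:
  fixes u :: "'a::euclidean_space \<Rightarrow> real"
  assumes "u \<in> H1 \<Omega>" "open \<Omega>"
  shows "weak_gradient \<Omega> u (grad \<Omega> u)" "square_integrable (lebesgue_on \<Omega>) (grad \<Omega> u)"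
    "square_integrable (lebesgue_on \<Omega>) u"
proof -
  obtain g where g: "weak_gradient \<Omega> u g" "square_integrable (lebesgue_on \<Omega>) g"
    and u: "square_integrable (lebesgue_on \<Omega>) u" using assms(1) by (auto simp: H1_def)
  have m: "\<Omega> \<in> sets lebesgue" using assms(2) by auto
  have ae: "AE x in lebesgue_on \<Omega>. grad \<Omega> u x = g x"
    using grad_AE[OF g(1) assms(2)] by (simp add: AE_lebesgue_on[OF m])
  have gm: "grad \<Omega> u \<in> borel_measurable (lebesgue_on \<Omega>)"
    by (rule weak_gradient_measurable[OF _ assms(2) grad_AE[OF g(1) assms(2)]])
      (use g(2) in \<open>simp add: square_integrable_def\<close>)
  show "weak_gradient \<Omega> u (grad \<Omega> u)" by (rule grad_weak_gradient[OF g(1)])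
  show "square_integrable (lebesgue_on \<Omega>) (grad \<Omega> u)"
  proof (rule square_integrable_dominated(1)[OF g(2) gm])
    show "AE x in lebesgue_on \<Omega>. norm (grad \<Omega> u x) \<le> 1 * norm (g x)"
      using ae by eventually_elim simp
  qed
  show "square_integrable (lebesgue_on \<Omega>) u" by (rule u)
qed

lemma sqn_grad:
  fixes u :: "'a::euclidean_space \<Rightarrow> real"
  assumes g: "weak_gradient \<Omega> u g" and "open \<Omega>" and gm: "g \<in> borel_measurable (lebesgue_on \<Omega>)"
  shows "sqn (lebesgue_on \<Omega>) (grad \<Omega> u) = sqn (lebesgue_on \<Omega>) g"
proof (rule sqn_cong_AE)
  have m: "\<Omega> \<in> sets lebesgue" using assms(2) by auto
  show "AE x in lebesgue_on \<Omega>. grad \<Omega> u x = g x"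
    using grad_AE[OF g assms(2)] by (simp add: AE_lebesgue_on[OF m])
  show "grad \<Omega> u \<in> borel_measurable (lebesgue_on \<Omega>)"
    by (rule weak_gradient_measurable[OF gm assms(2) grad_AE[OF g assms(2)]])
qed fact

text \<open>\<open>H1_norm\<close> involves the chosen gradient of the difference. Here it is
  replaced by the difference of \<open>cgrad \<psi>\<close> and any convenient representative
  \<open>g\<close>, the form in which approximations are estimated.\<close>

lemma H1_norm_test:
  fixes u :: "'a::euclidean_space \<Rightarrow> real"
  assumes "weak_gradient \<Omega> u g" "square_integrable (lebesgue_on \<Omega>) g" "open \<Omega>" "test_function \<Omega> \<psi>"
  shows "(H1_norm \<Omega> (\<lambda>x. \<psi> x - u x))\<^sup>2 =
    sqn (lebesgue_on \<Omega>) (\<lambda>x. \<psi> x - u x) + sqn (lebesgue_on \<Omega>) (\<lambda>x. cgrad \<psi> x - g x)"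
proof -
  have sm: "smooth \<psi>" using assms(4) by (simp add: test_function_def)
  have w: "weak_gradient \<Omega> (\<lambda>x. \<psi> x - u x) (\<lambda>x. cgrad \<psi> x - g x)"
    using weak_gradient_add[OF weak_gradient_test_function[OF assms(4,3)] weak_gradient_scale[OF assms(1,3), of "-1"] assms(3)]
    by simp
  have m: "cgrad \<psi> \<in> borel_measurable (lebesgue_on \<Omega>)"
    using borel_measurable_lebesgue_continuous[OF cgrad_continuous[OF sm]] by (rule measurable_restrict_space1)
  have "sqn (lebesgue_on \<Omega>) (grad \<Omega> (\<lambda>x. \<psi> x - u x)) = sqn (lebesgue_on \<Omega>) (\<lambda>x. cgrad \<psi> x - g x)"
    using assms(2) m by (intro sqn_grad[OF w assms(3)]) (auto simp: square_integrable_def)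
  then show ?thesis
    unfolding H1_norm_def L2_norm_sqn by (simp add: sqn_nonneg)
qed

lemma H1_norm_nonneg: "0 \<le> H1_norm \<Omega> u"
  by (simp add: H1_norm_def)

section \<open>Functions in \<open>V\<close> and their approximation by test functions\<close>

locale domain_interface = smooth_interface +
  fixes \<Omega> :: "(real^2) set"
  assumes open_dom: "open \<Omega>" and bounded_dom: "bounded \<Omega>" and interface_closure: "interface \<Gamma> \<subseteq> closure \<Omega>"
begin

abbreviation "M\<^sub>\<Omega> \<equiv> lebesgue_on \<Omega>"
abbreviation "M\<^sub>\<Gamma> \<equiv> arc_length \<Gamma>"

lemma dom_sets: "\<Omega> \<in> sets lebesgue"
  using open_dom by auto

lemma finite_dom: "finite_measure M\<^sub>\<Omega>"
proof
  have "\<Omega> \<in> lmeasurable" using bounded_dom dom_sets by (rule bounded_set_imp_lmeasurable)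
  then show "emeasure M\<^sub>\<Omega> (space M\<^sub>\<Omega>) \<noteq> \<infinity>"
    using dom_sets by (simp add: emeasure_restrict_space space_restrict_space fmeasurable_def)
qed

lemma tgrad_AE:
  assumes i: "i < length \<Gamma>" and w: "weak_gradient {0<..<arc_len \<Gamma> i} (u \<circ> arc_map \<Gamma> i) g"
  shows "AE s in lebesgue. s \<in> arc_dom \<Gamma> i \<longrightarrow>
    0 < s \<and> s < arc_len \<Gamma> i \<and> tgrad \<Gamma> u (arc_map \<Gamma> i s) = g s *\<^sub>R vector_derivative (arc_map \<Gamma> i) (at s)"
proof -
  have n: "{0, arc_len \<Gamma> i} \<in> null_sets lebesgue"
    using negligible_finite[of "{0, arc_len \<Gamma> i}"] by (simp only: negligible_iff_null_sets finite_insert finite.emptyI)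
  have "AE s in lebesgue. s \<notin> {0, arc_len \<Gamma> i}" by (rule AE_not_in[OF n])
  then show ?thesis
    using grad_AE[OF w open_greaterThanLessThan]
  proof eventually_elim
    case (elim s)
    show ?case
    proof
      assume s: "s \<in> arc_dom \<Gamma> i"
      then have "0 < s" "s < arc_len \<Gamma> i" using elim(1) by (auto simp: arc_dom_eq)
      then show "0 < s \<and> s < arc_len \<Gamma> i \<and>
          tgrad \<Gamma> u (arc_map \<Gamma> i s) = g s *\<^sub>R vector_derivative (arc_map \<Gamma> i) (at s)"
        using elim(2) tgrad_arc[OF i s, of u] by simp
    qed
  qed
qed

lemma arc_map_derivative_continuous:
  assumes "i < length \<Gamma>"
  shows "continuous_on UNIV (\<lambda>s. vector_derivative (arc_map \<Gamma> i) (at s))"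
proof -
  have sm: "smooth (arc_map \<Gamma> i)" by (rule smooth_curve_cases(2)[OF curve[OF assms]])
  have "vector_derivative (arc_map \<Gamma> i) (at s) = frechet_derivative (arc_map \<Gamma> i) (at s) 1" for s
    using smooth_differentiable[OF sm, of s]
    by (simp add: frechet_derivative_eqI[of _ "\<lambda>h. h *\<^sub>R vector_derivative (arc_map \<Gamma> i) (at s)"]
        vector_derivative_works has_vector_derivative_def)
  then show ?thesis using smooth_continuous[OF smooth_frechet_derivative[OF sm], of UNIV 1] by simp
qed

text \<open>The tangent has norm one, so along an arc the norm of \<open>tgrad\<close> is that of
  the derivative of \<open>u \<circ> c\<close>. Parameters left out of \<open>arc_dom\<close> only
  decrease the integral.\<close>

lemma tgrad_square_integrable:
  assumes "\<forall>(L, c)\<in>set \<Gamma>. u \<circ> c \<in> H1 {0<..<L}"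
  shows "square_integrable M\<^sub>\<Gamma> (tgrad \<Gamma> u)"
proof -
  define g where "g i = grad {0<..<arc_len \<Gamma> i} (u \<circ> arc_map \<Gamma> i)" for i
  have H: "u \<circ> arc_map \<Gamma> i \<in> H1 {0<..<arc_len \<Gamma> i}" if "i < length \<Gamma>" for i
    using assms nth_mem[OF that] by (auto simp: case_prod_beta)
  note g = H1_grad[OF H open_greaterThanLessThan, folded g_def]
  define G where "G i = (\<lambda>s. indicator {0<..<arc_len \<Gamma> i} s *\<^sub>R g i s)" for i
  have Gm: "G i \<in> borel_measurable lebesgue" and Gi: "integrable lebesgue (\<lambda>s. (norm (G i s))\<^sup>2)" if "i < length \<Gamma>" for i
  proof -
    show "G i \<in> borel_measurable lebesgue"
      using g(2)[OF that] unfolding G_def square_integrable_def by (simp add: borel_measurable_restrict_space_iff)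
    have "integrable lebesgue (\<lambda>s. indicator {0<..<arc_len \<Gamma> i} s *\<^sub>R (norm (g i s))\<^sup>2)"
      using g(2)[OF that] unfolding square_integrable_def by (simp add: integrable_restrict_space)
    moreover have "(\<lambda>s. indicator {0<..<arc_len \<Gamma> i} s *\<^sub>R (norm (g i s))\<^sup>2) = (\<lambda>s. (norm (G i s))\<^sup>2)"
      by (auto simp: G_def indicator_def fun_eq_iff)
    ultimately show "integrable lebesgue (\<lambda>s. (norm (G i s))\<^sup>2)" by simp
  qed
  have ae: "AE s in lebesgue. s \<in> arc_dom \<Gamma> i \<longrightarrow> tgrad \<Gamma> u (arc_map \<Gamma> i s) = G i s *\<^sub>R vector_derivative (arc_map \<Gamma> i) (at s)
      \<and> norm (vector_derivative (arc_map \<Gamma> i) (at s)) = 1"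
    if "i < length \<Gamma>" for i
    using tgrad_AE[OF that g(1)[OF that]]
    by eventually_elim (use smooth_curve_cases(3)[OF curve[OF that]] in \<open>auto simp: G_def indicator_def\<close>)
  have m: "tgrad \<Gamma> u \<in> borel_measurable M\<^sub>\<Gamma>"
  proof (rule arc_measurableI)
    fix i assume i: "i < length \<Gamma>"
    have "(\<lambda>s. G i s *\<^sub>R vector_derivative (arc_map \<Gamma> i) (at s)) \<in> borel_measurable lebesgue"
      by (intro borel_measurable_scaleR Gm[OF i] borel_measurable_lebesgue_continuous arc_map_derivative_continuous[OF i])
    then have "(\<lambda>s. indicator (arc_dom \<Gamma> i) s *\<^sub>R (G i s *\<^sub>R vector_derivative (arc_map \<Gamma> i) (at s))) \<in> borel_measurable lebesgue"
      using arc_dom_sets[OF i] by (intro borel_measurable_scaleR[of "indicator (arc_dom \<Gamma> i)"]) auto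
    moreover have "AE s in lebesgue. indicator (arc_dom \<Gamma> i) s *\<^sub>R tgrad \<Gamma> u (arc_map \<Gamma> i s) =
        indicator (arc_dom \<Gamma> i) s *\<^sub>R (G i s *\<^sub>R vector_derivative (arc_map \<Gamma> i) (at s))"
      using ae[OF i] by eventually_elim (auto simp: indicator_def)
    ultimately have "(\<lambda>s. indicator (arc_dom \<Gamma> i) s *\<^sub>R tgrad \<Gamma> u (arc_map \<Gamma> i s)) \<in> borel_measurable lebesgue"
      by (rule measurable_AE_lebesgue)
    then show "(\<lambda>s. tgrad \<Gamma> u (arc_map \<Gamma> i s)) \<in> borel_measurable (lebesgue_on (arc_dom \<Gamma> i))"
      using arc_dom_sets[OF i] by (simp add: borel_measurable_restrict_space_iff)
  qed
  have "(\<integral>\<^sup>+x. ennreal ((norm (tgrad \<Gamma> u x))\<^sup>2) \<partial>M\<^sub>\<Gamma>) =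
      (\<Sum>i<length \<Gamma>. \<integral>\<^sup>+s. ennreal ((norm (tgrad \<Gamma> u (arc_map \<Gamma> i s)))\<^sup>2) \<partial>lebesgue_on (arc_dom \<Gamma> i))"
    using m by (intro nn_integral_arc_length) measurable
  also have "\<dots> \<le> (\<Sum>i<length \<Gamma>. \<integral>\<^sup>+s. ennreal ((norm (G i s))\<^sup>2) \<partial>lebesgue)"
  proof (rule sum_mono)
    fix i assume "i \<in> {..<length \<Gamma>}"
    then have i: "i < length \<Gamma>" by simp
    have "(\<integral>\<^sup>+s. ennreal ((norm (tgrad \<Gamma> u (arc_map \<Gamma> i s)))\<^sup>2) \<partial>lebesgue_on (arc_dom \<Gamma> i)) =
        (\<integral>\<^sup>+s. ennreal ((norm (tgrad \<Gamma> u (arc_map \<Gamma> i s)))\<^sup>2) * indicator (arc_dom \<Gamma> i) s \<partial>lebesgue)"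
      using arc_dom_sets[OF i] by (intro nn_integral_restrict_space) simp
    also have "\<dots> \<le> (\<integral>\<^sup>+s. ennreal ((norm (G i s))\<^sup>2) \<partial>lebesgue)"
    proof (rule nn_integral_mono_AE)
      show "AE s in lebesgue. ennreal ((norm (tgrad \<Gamma> u (arc_map \<Gamma> i s)))\<^sup>2) * indicator (arc_dom \<Gamma> i) s \<le> ennreal ((norm (G i s))\<^sup>2)"
        using ae[OF i] by eventually_elim (auto simp: indicator_def)
    qed
    finally show "(\<integral>\<^sup>+s. ennreal ((norm (tgrad \<Gamma> u (arc_map \<Gamma> i s)))\<^sup>2) \<partial>lebesgue_on (arc_dom \<Gamma> i)) \<le>
       (\<integral>\<^sup>+s. ennreal ((norm (G i s))\<^sup>2) \<partial>lebesgue)" .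
  qed
  also have "\<dots> < \<infinity>"
    using Gi by (simp add: ennreal_sum_less_top[symmetric] nn_integral_eq_integral)
  finally show ?thesis
    unfolding square_integrable_def using m
    by (intro conjI integrableI_bounded) auto
qed

lemma continuous_interface_measurable:
  fixes u :: "real^2 \<Rightarrow> real"
  assumes "continuous_on (interface \<Gamma>) u"
  shows "u \<in> borel_measurable M\<^sub>\<Gamma>"
proof (rule arc_measurableI)
  fix i assume i: "i < length \<Gamma>"
  have "continuous_on (arc_dom \<Gamma> i) (\<lambda>s. u (arc_map \<Gamma> i s))"
    using arc_dom_interface[OF i] by (intro continuous_on_compose2[OF assms arc_map_continuous[OF i]]) auto
  then show "(\<lambda>s. u (arc_map \<Gamma> i s)) \<in> borel_measurable (lebesgue_on (arc_dom \<Gamma> i))"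
    using arc_dom_sets[OF i] by (rule continuous_imp_measurable_on_sets_lebesgue)
qed

lemma continuous_interface_square_integrable:
  fixes u :: "real^2 \<Rightarrow> real"
  assumes "continuous_on (interface \<Gamma>) u"
  shows "square_integrable M\<^sub>\<Gamma> u"
proof -
  have "bounded (u ` interface \<Gamma>)"
    by (intro compact_imp_bounded compact_continuous_image assms compact_interface smooth_curves)
  then obtain B where B: "B > 0" "\<And>x. x \<in> interface \<Gamma> \<Longrightarrow> \<bar>u x\<bar> \<le> B" unfolding bounded_pos by auto
  have "AE x in M\<^sub>\<Gamma>. norm (u x) \<le> B" using AE_interface by eventually_elim (use B in auto)
  then show ?thesis
    using B by (intro square_integrable_bounded(1)[OF finite_arc_length continuous_interface_measurable[OF assms]]) auto
qed

lemma H1_grad_V: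
  assumes "u \<in> V \<Omega> \<Gamma>"
  shows "weak_gradient \<Omega> u (grad \<Omega> u)" "square_integrable M\<^sub>\<Omega> (grad \<Omega> u)" "square_integrable M\<^sub>\<Omega> u"
    "square_integrable M\<^sub>\<Gamma> (tgrad \<Gamma> u)" "square_integrable M\<^sub>\<Gamma> u"
    "continuous_on (interface \<Gamma>) u" "i < length \<Gamma> \<Longrightarrow> u \<circ> arc_map \<Gamma> i \<in> H1 {0<..<arc_len \<Gamma> i}"
proof -
  have u: "u \<in> H1 \<Omega>" "is_trace \<Omega> \<Gamma> u u" "continuous_on (interface \<Gamma>) u" "\<forall>(L, c)\<in>set \<Gamma>. u \<circ> c \<in> H1 {0<..<L}"
    using assms by (auto simp: V_def H10_def)
  show "weak_gradient \<Omega> u (grad \<Omega> u)" "square_integrable M\<^sub>\<Omega> (grad \<Omega> u)" "square_integrable M\<^sub>\<Omega> u"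
    by (rule H1_grad[OF u(1) open_dom])+
  show "square_integrable M\<^sub>\<Gamma> (tgrad \<Gamma> u)" by (rule tgrad_square_integrable[OF u(4)])
  show "square_integrable M\<^sub>\<Gamma> u" "continuous_on (interface \<Gamma>) u" using u by (auto simp: is_trace_def)
  show "u \<circ> arc_map \<Gamma> i \<in> H1 {0<..<arc_len \<Gamma> i}" if "i < length \<Gamma>"
    using u(4) nth_mem[OF that] by (auto simp: case_prod_beta)
qed

lemma V_approx:
  assumes "u \<in> V \<Omega> \<Gamma>" "0 < e"
  obtains \<psi> where "test_function \<Omega> \<psi>" "sqn M\<^sub>\<Omega> (\<lambda>x. \<psi> x - u x) < e"
    "sqn M\<^sub>\<Omega> (\<lambda>x. cgrad \<psi> x - grad \<Omega> u x) < e" "sqn M\<^sub>\<Gamma> (\<lambda>x. \<psi> x - u x) < e"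
proof -
  have "is_trace \<Omega> \<Gamma> u u" using assms(1) by (simp add: V_def)
  then obtain \<psi> :: "nat \<Rightarrow> real^2 \<Rightarrow> real" where \<psi>: "\<And>n. test_function \<Omega> (\<psi> n)"
      "(\<lambda>n. H1_norm \<Omega> (\<lambda>x. \<psi> n x - u x)) \<longlonglongrightarrow> 0" "(\<lambda>n. L2_norm M\<^sub>\<Gamma> (\<lambda>x. \<psi> n x - u x)) \<longlonglongrightarrow> 0"
    unfolding is_trace_def by blast
  have se: "0 < sqrt e" using assms(2) by simp
  have "\<forall>\<^sub>F n in sequentially. H1_norm \<Omega> (\<lambda>x. \<psi> n x - u x) < sqrt e" "\<forall>\<^sub>F n in sequentially. L2_norm M\<^sub>\<Gamma> (\<lambda>x. \<psi> n x - u x) < sqrt e"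
    using order_tendstoD(2)[OF \<psi>(2) se] order_tendstoD(2)[OF \<psi>(3) se] by auto
  then have "\<forall>\<^sub>F n in sequentially. H1_norm \<Omega> (\<lambda>x. \<psi> n x - u x) < sqrt e \<and> L2_norm M\<^sub>\<Gamma> (\<lambda>x. \<psi> n x - u x) < sqrt e"
    by (rule eventually_conj)
  then obtain n where n: "H1_norm \<Omega> (\<lambda>x. \<psi> n x - u x) < sqrt e" "L2_norm M\<^sub>\<Gamma> (\<lambda>x. \<psi> n x - u x) < sqrt e"
    using eventually_happens'[OF sequentially_bot] by blast
  have "(H1_norm \<Omega> (\<lambda>x. \<psi> n x - u x))\<^sup>2 < (sqrt e)\<^sup>2"
    using n(1) by (intro power_strict_mono H1_norm_nonneg) auto
  then have "sqn M\<^sub>\<Omega> (\<lambda>x. \<psi> n x - u x) + sqn M\<^sub>\<Omega> (\<lambda>x. cgrad (\<psi> n) x - grad \<Omega> u x) < e"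
    using H1_norm_test[OF H1_grad_V(1,2)[OF assms(1)] open_dom \<psi>(1)] assms(2) by simp
  then have "sqn M\<^sub>\<Omega> (\<lambda>x. \<psi> n x - u x) < e" "sqn M\<^sub>\<Omega> (\<lambda>x. cgrad (\<psi> n) x - grad \<Omega> u x) < e"
    using sqn_nonneg[of M\<^sub>\<Omega> "\<lambda>x. \<psi> n x - u x"] sqn_nonneg[of M\<^sub>\<Omega> "\<lambda>x. cgrad (\<psi> n) x - grad \<Omega> u x"] by linarith+
  moreover have "sqn M\<^sub>\<Gamma> (\<lambda>x. \<psi> n x - u x) < e" using n(2) by (simp add: L2_norm_sqn)
  ultimately show ?thesis using that \<psi>(1) by blast
qed

text \<open>\<open>is_trace\<close> asks for convergence in the plane and on the interface along the
  same sequence, so each test function has to be close in all three senses at once. The sequence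
  also proves membership in \<open>H10\<close>.\<close>

lemma VI:
  assumes u: "square_integrable M\<^sub>\<Omega> u" "weak_gradient \<Omega> u g" "square_integrable M\<^sub>\<Omega> g"
    and cont: "continuous_on (interface \<Gamma>) u"
    and H: "\<And>i. i < length \<Gamma> \<Longrightarrow> u \<circ> arc_map \<Gamma> i \<in> H1 {0<..<arc_len \<Gamma> i}"
    and app: "\<And>e. 0 < e \<Longrightarrow> \<exists>\<psi>. test_function \<Omega> \<psi> \<and> sqn M\<^sub>\<Omega> (\<lambda>x. \<psi> x - u x) \<le> e \<and>
      sqn M\<^sub>\<Omega> (\<lambda>x. cgrad \<psi> x - g x) \<le> e \<and> sqn M\<^sub>\<Gamma> (\<lambda>x. \<psi> x - u x) \<le> e"
  shows "u \<in> V \<Omega> \<Gamma>"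
proof -
  have "\<forall>n. \<exists>\<psi>. test_function \<Omega> \<psi> \<and> sqn M\<^sub>\<Omega> (\<lambda>x. \<psi> x - u x) \<le> inverse (real (Suc n)) \<and>
      sqn M\<^sub>\<Omega> (\<lambda>x. cgrad \<psi> x - g x) \<le> inverse (real (Suc n)) \<and> sqn M\<^sub>\<Gamma> (\<lambda>x. \<psi> x - u x) \<le> inverse (real (Suc n))"
    by (intro allI app) simp
  from choice[OF this] obtain \<psi> where \<psi>: "\<And>n. test_function \<Omega> (\<psi> n)"
      "\<And>n. sqn M\<^sub>\<Omega> (\<lambda>x. \<psi> n x - u x) \<le> inverse (real (Suc n))"
      "\<And>n. sqn M\<^sub>\<Omega> (\<lambda>x. cgrad (\<psi> n) x - g x) \<le> inverse (real (Suc n))"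
      "\<And>n. sqn M\<^sub>\<Gamma> (\<lambda>x. \<psi> n x - u x) \<le> inverse (real (Suc n))"
    by blast
  \<comment> \<open>The square of the H1 norm is a sum of two terms of size
    \<open>inverse (real (Suc n))\<close>, hence the factor 2.\<close>
  have z: "(\<lambda>n. sqrt (2 * inverse (real (Suc n)))) \<longlonglongrightarrow> 0"
    using tendsto_real_sqrt[OF tendsto_mult_left[OF LIMSEQ_inverse_real_of_nat, of 2]] by simp
  have h: "(\<lambda>n. H1_norm \<Omega> (\<lambda>x. \<psi> n x - u x)) \<longlonglongrightarrow> 0"
  proof (rule tendsto_sandwich[OF _ _ tendsto_const z])
    have "H1_norm \<Omega> (\<lambda>x. \<psi> n x - u x) \<le> sqrt (2 * inverse (real (Suc n)))" for n
    proof (rule real_le_rsqrt)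
      show "(H1_norm \<Omega> (\<lambda>x. \<psi> n x - u x))\<^sup>2 \<le> 2 * inverse (real (Suc n))"
        using \<psi>(2,3)[of n] unfolding H1_norm_test[OF u(2,3) open_dom \<psi>(1)] by linarith
    qed
    then show "\<forall>\<^sub>F n in sequentially. H1_norm \<Omega> (\<lambda>x. \<psi> n x - u x) \<le> sqrt (2 * inverse (real (Suc n)))" by simp
  qed (simp add: H1_norm_nonneg)
  have l: "(\<lambda>n. L2_norm M\<^sub>\<Gamma> (\<lambda>x. \<psi> n x - u x)) \<longlonglongrightarrow> 0"
  proof (rule tendsto_sandwich[OF _ _ tendsto_const z])
    have "L2_norm M\<^sub>\<Gamma> (\<lambda>x. \<psi> n x - u x) \<le> sqrt (2 * inverse (real (Suc n)))" for n
      unfolding L2_norm_sqn using \<psi>(4)[of n] sqn_nonneg[of M\<^sub>\<Gamma> "\<lambda>x. \<psi> n x - u x"]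
      by (intro real_sqrt_le_mono) (smt (verit))
    then show "\<forall>\<^sub>F n in sequentially. L2_norm M\<^sub>\<Gamma> (\<lambda>x. \<psi> n x - u x) \<le> sqrt (2 * inverse (real (Suc n)))" by simp
  qed (simp add: L2_norm_sqn sqn_nonneg)
  have H1: "u \<in> H1 \<Omega>" using u by (auto simp: H1_def)
  have t: "is_trace \<Omega> \<Gamma> u u"
    unfolding is_trace_def using \<psi>(1) h l continuous_interface_square_integrable[OF cont] by blast
  have H10: "u \<in> H10 \<Omega>" unfolding H10_def using H1 \<psi>(1) h by blast
  have "\<forall>(L, c)\<in>set \<Gamma>. u \<circ> c \<in> H1 {0<..<L}"
    using H by (auto simp: in_set_conv_nth) (metis fst_conv snd_conv)
  then show ?thesis unfolding V_def using H10 t cont by blast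
qed

end

text \<open>Local integrability yields measurability on compact subsets, and an open set is
  exhausted by countably many of them.\<close>

lemma locally_integrable_measurable:
  fixes g :: "'a::euclidean_space \<Rightarrow> 'b::euclidean_space"
  assumes "locally_integrable \<Omega> g" "open \<Omega>"
  shows "g \<in> borel_measurable (lebesgue_on \<Omega>)"
proof -
  obtain C where C: "\<And>n. compact (C n)" "\<And>n. C n \<subseteq> \<Omega>" "\<And>n::nat. C n \<subseteq> interior (C (Suc n))" "(\<Union>n. C n) = \<Omega>"
    using open_Union_compact_subsets[OF assms(2)] by metis
  have inc: "incseq C"
    using C(3) interior_subset by (intro incseq_SucI) blast
  have "(\<lambda>x. indicator \<Omega> x *\<^sub>R g x) \<in> borel_measurable lebesgue"
  proof (rule borel_measurable_LIMSEQ_metric)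
    show "(\<lambda>x. indicator (C n) x *\<^sub>R g x) \<in> borel_measurable lebesgue" for n
      using assms(1) C(1,2)[of n] unfolding locally_integrable_def set_integrable_def by (intro borel_measurable_integrable) simp
    show "(\<lambda>n. indicator (C n) x *\<^sub>R g x) \<longlonglongrightarrow> indicator \<Omega> x *\<^sub>R g x" for x
      using LIMSEQ_indicator_incseq[OF inc, where x = x] C(4) by (intro tendsto_scaleR tendsto_const) simp
  qed
  then show ?thesis using assms(2) by (simp add: borel_measurable_restrict_space_iff open_sets_lebesgue)
qed

lemma H1I:
  assumes "square_integrable (lebesgue_on \<Omega>) u" "weak_gradient \<Omega> u g" "square_integrable (lebesgue_on \<Omega>) g"
  shows "u \<in> H1 \<Omega>"
  unfolding H1_def using assms by blast

lemma H1_add: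
  fixes u v :: "'a::euclidean_space \<Rightarrow> real"
  assumes "u \<in> H1 \<Omega>" "v \<in> H1 \<Omega>" "open \<Omega>"
  shows "(\<lambda>x. u x + v x) \<in> H1 \<Omega>"
  by (rule H1I[OF square_integrable_add(1) weak_gradient_add square_integrable_add(1)])
    (rule H1_grad assms)+

lemma H1_scale:
  fixes u :: "'a::euclidean_space \<Rightarrow> real"
  assumes "u \<in> H1 \<Omega>" "open \<Omega>"
  shows "(\<lambda>x. c * u x) \<in> H1 \<Omega>"
  using square_integrable_scale(1)[OF H1_grad(3)[OF assms], of c] 
  by (intro H1I[OF _ weak_gradient_scale[OF H1_grad(1)[OF assms] assms(2)] square_integrable_scale(1)[OF H1_grad(2)[OF assms]]])
    simp

lemma cgrad_add: "smooth f \<Longrightarrow> smooth g \<Longrightarrow> cgrad (\<lambda>x. f x + g x) x = cgrad f x + cgrad g x"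
  by (simp add: cgrad_def frechet_derivative_eqI[OF has_derivative_add[OF smooth_has_derivative smooth_has_derivative]]
      scaleR_add_left sum.distrib)

lemma cgrad_scale:
  assumes "smooth f"
  shows "cgrad (\<lambda>x. f x * c) x = c *\<^sub>R cgrad f x"
  unfolding cgrad_def frechet_derivative_eqI[OF has_derivative_mult_left[OF smooth_has_derivative[OF assms]]]
  by (simp add: scaleR_sum_right mult.commute)

context domain_interface
begin

lemma test_function_square_integrable:
  assumes "test_function \<Omega> \<psi>"
  shows "square_integrable M\<^sub>\<Omega> \<psi>" "square_integrable M\<^sub>\<Omega> (cgrad \<psi>)" "square_integrable M\<^sub>\<Gamma> \<psi>"
proof -
  have sm: "smooth \<psi>" using assms by (simp add: test_function_def)
  obtain B where B: "0 \<le> B" "\<And>x. \<bar>\<psi> x\<bar> \<le> B" using test_function_bounded[OF assms] by blast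
  obtain L where L: "L-lipschitz_on UNIV \<psi>" "\<And>x. norm (cgrad \<psi> x) \<le> L" using test_function_lipschitz[OF assms] by blast
  have "0 \<le> L" using order_trans[OF norm_ge_zero L(2)] .
  then show "square_integrable M\<^sub>\<Omega> (cgrad \<psi>)"
    using measurable_restrict_space1[OF borel_measurable_lebesgue_continuous[OF cgrad_continuous[OF sm]]] L
    by (intro square_integrable_bounded(1)[OF finite_dom, of _ L]) auto
  show "square_integrable M\<^sub>\<Omega> \<psi>"
    using measurable_restrict_space1[OF borel_measurable_lebesgue_continuous[OF test_function_continuous[OF assms]]] B
    by (intro square_integrable_bounded(1)[OF finite_dom, of _ B]) auto
  show "square_integrable M\<^sub>\<Gamma> \<psi>"
    by (rule continuous_interface_square_integrable[OF test_function_continuous[OF assms]])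
qed

text \<open>Both measures are finite, so the uniform error controls both L2 norms of the values. The
  difference of the gradients is at most \<open>2 * B\<close>, so its square is at most
  \<open>2 * B\<close> times itself and L1 closeness suffices.\<close>

lemma test_approx_sqn:
  assumes K: "compact K" "K \<subseteq> \<Omega>" and F: "continuous_on UNIV F" "\<And>x. x \<notin> K \<Longrightarrow> F x = 0"
    and w: "weak_gradient \<Omega> F G" and G: "AE x in lebesgue. norm (G x) \<le> B" "\<And>x. x \<notin> K \<Longrightarrow> G x = 0"
    and B0: "0 \<le> B" and "0 < e"
  obtains \<psi> where "test_function \<Omega> \<psi>" "sqn M\<^sub>\<Omega> (\<lambda>x. \<psi> x - F x) \<le> e"
    "sqn M\<^sub>\<Omega> (\<lambda>x. cgrad \<psi> x - G x) \<le> e" "sqn M\<^sub>\<Gamma> (\<lambda>x. \<psi> x - F x) \<le> e"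
proof -
  \<comment> \<open>\<open>m\<close> dominates each of the three factors in front of the errors;
    \<open>d \<le> 1\<close> allows \<open>d^2\<close> to be replaced by \<open>d\<close>.\<close>
  define m where "m = measure M\<^sub>\<Omega> (space M\<^sub>\<Omega>) + measure M\<^sub>\<Gamma> (space M\<^sub>\<Gamma>) + 2 * B + 1"
  have m: "0 < m" "measure M\<^sub>\<Omega> (space M\<^sub>\<Omega>) \<le> m" "measure M\<^sub>\<Gamma> (space M\<^sub>\<Gamma>) \<le> m" "2 * B \<le> m"
    using B0 measure_nonneg[of M\<^sub>\<Omega> "space M\<^sub>\<Omega>"] measure_nonneg[of M\<^sub>\<Gamma> "space M\<^sub>\<Gamma>"] unfolding m_def by linarith+
  define d where "d = min 1 (e / m)"
  have d: "0 < d" "d \<le> 1" "d * m \<le> e" using m(1) \<open>0 < e\<close> by (auto simp: d_def min_def field_simps)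
  have dm: "d\<^sup>2 * c \<le> e" if "c \<le> m" for c
  proof -
    have "d\<^sup>2 * c \<le> d\<^sup>2 * m" using that by (intro mult_left_mono) auto
    also have "\<dots> \<le> d * m" using d m(1) by (intro mult_right_mono) (auto simp: power2_eq_square mult_left_le)
    finally show ?thesis using d(3) by simp
  qed
  obtain \<phi> where \<phi>: "test_function \<Omega> \<phi>" "\<And>x. \<bar>\<phi> x - F x\<bar> \<le> d" "\<And>x. norm (cgrad \<phi> x) \<le> B"
    "integrable lebesgue (\<lambda>x. norm (cgrad \<phi> x - G x))" "(LINT x|lebesgue. norm (cgrad \<phi> x - G x)) \<le> d"
    using test_function_approx[OF open_dom K F w G B0 d(1)] by blast
  have c: "continuous_on UNIV (\<lambda>x. \<phi> x - F x)" by (intro continuous_intros test_function_continuous[OF \<phi>(1)] F(1))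
  have "sqn M\<^sub>\<Omega> (\<lambda>x. \<phi> x - F x) \<le> d\<^sup>2 * measure M\<^sub>\<Omega> (space M\<^sub>\<Omega>)"
    using \<phi>(2) d(1) measurable_restrict_space1[OF borel_measurable_lebesgue_continuous[OF c]]
    by (intro square_integrable_bounded(2)[OF finite_dom]) auto
  then have 1: "sqn M\<^sub>\<Omega> (\<lambda>x. \<phi> x - F x) \<le> e" using dm[OF m(2)] by linarith
  have "sqn M\<^sub>\<Gamma> (\<lambda>x. \<phi> x - F x) \<le> d\<^sup>2 * measure M\<^sub>\<Gamma> (space M\<^sub>\<Gamma>)"
    using \<phi>(2) d(1) continuous_interface_measurable[OF continuous_on_subset[OF c]]
    by (intro square_integrable_bounded(2)[OF finite_arc_length]) auto
  then have 2: "sqn M\<^sub>\<Gamma> (\<lambda>x. \<phi> x - F x) \<le> e" using dm[OF m(3)] by linarith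
  let ?n = "\<lambda>x. norm (cgrad \<phi> x - G x)"
  have nm: "?n \<in> borel_measurable lebesgue" using \<phi>(4) by (rule borel_measurable_integrable)
  have ae: "AE x in lebesgue. indicator \<Omega> x *\<^sub>R (?n x)\<^sup>2 \<le> 2 * B * ?n x"
    using G(1)
  proof eventually_elim
    case (elim x)
    have "?n x \<le> 2 * B" using norm_triangle_ineq4[of "cgrad \<phi> x" "G x"] \<phi>(3)[of x] elim by linarith
    then have "?n x * ?n x \<le> 2 * B * ?n x" by (intro mult_right_mono) auto
    then show ?case using B0 by (auto simp: indicator_def power2_eq_square)
  qed
  have i: "integrable lebesgue (\<lambda>x. indicator \<Omega> x *\<^sub>R (?n x)\<^sup>2)"
  proof (rule Bochner_Integration.integrable_bound)
    show "integrable lebesgue (\<lambda>x. 2 * B * ?n x)" using \<phi>(4) by simp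
    show "(\<lambda>x. indicator \<Omega> x *\<^sub>R (?n x)\<^sup>2) \<in> borel_measurable lebesgue"
      using nm dom_sets by (intro borel_measurable_scaleR borel_measurable_power) auto
    show "AE x in lebesgue. norm (indicator \<Omega> x *\<^sub>R (?n x)\<^sup>2) \<le> norm (2 * B * ?n x)"
      using ae by eventually_elim (use B0 in \<open>simp add: abs_mult\<close>)
  qed
  have "sqn M\<^sub>\<Omega> (\<lambda>x. cgrad \<phi> x - G x) = (LINT x|lebesgue. indicator \<Omega> x *\<^sub>R (?n x)\<^sup>2)"
    unfolding sqn_def using dom_sets by (subst integral_restrict_space) auto
  also have "\<dots> \<le> (LINT x|lebesgue. 2 * B * ?n x)" using \<phi>(4) by (intro integral_mono_AE i ae) simp
  also have "\<dots> = 2 * B * (LINT x|lebesgue. ?n x)" by simp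
  also have "\<dots> \<le> m * d" using \<phi>(5) m(4,1) B0 d(1) by (intro mult_mono) (auto intro: Bochner_Integration.integral_nonneg)
  finally have 3: "sqn M\<^sub>\<Omega> (\<lambda>x. cgrad \<phi> x - G x) \<le> e" using d(3) by (simp add: mult.commute)
  show ?thesis by (rule that[OF \<phi>(1) 1 3 2])
qed

text \<open>Two approximations are combined, of \<open>u\<close> by \<open>F\<close> and of
  \<open>F\<close> by a test function. The square of a sum costs a factor 2 for each summand, hence
  the tolerance \<open>e / 4\<close>.\<close>

lemma VI_approx:
  assumes u: "square_integrable M\<^sub>\<Omega> u" "weak_gradient \<Omega> u g" "square_integrable M\<^sub>\<Omega> g"
    and cont: "continuous_on (interface \<Gamma>) u"
    and H: "\<And>i. i < length \<Gamma> \<Longrightarrow> u \<circ> arc_map \<Gamma> i \<in> H1 {0<..<arc_len \<Gamma> i}"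
    and app: "\<And>e. 0 < e \<Longrightarrow> \<exists>F G K B. compact K \<and> K \<subseteq> \<Omega> \<and> continuous_on UNIV F \<and> (\<forall>x. x \<notin> K \<longrightarrow> F x = 0) \<and>
      weak_gradient \<Omega> F G \<and> (AE x in lebesgue. norm (G x) \<le> B) \<and> (\<forall>x. x \<notin> K \<longrightarrow> G x = 0) \<and> 0 \<le> B \<and>
      sqn M\<^sub>\<Omega> (\<lambda>x. F x - u x) \<le> e \<and> sqn M\<^sub>\<Omega> (\<lambda>x. G x - g x) \<le> e \<and> sqn M\<^sub>\<Gamma> (\<lambda>x. F x - u x) \<le> e"
  shows "u \<in> V \<Omega> \<Gamma>"
proof (rule VI[OF u cont H])
  fix e :: real assume "0 < e"
  then have e4: "0 < e / 4" by simp
  from app[OF e4] obtain F G K B where K: "compact K" "K \<subseteq> \<Omega>" and F: "continuous_on UNIV F" "\<And>x. x \<notin> K \<Longrightarrow> F x = 0"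
    and w: "weak_gradient \<Omega> F G" and G: "AE x in lebesgue. norm (G x) \<le> B" "\<And>x. x \<notin> K \<Longrightarrow> G x = 0" and B0: "0 \<le> B"
    and close: "sqn M\<^sub>\<Omega> (\<lambda>x. F x - u x) \<le> e / 4" "sqn M\<^sub>\<Omega> (\<lambda>x. G x - g x) \<le> e / 4" "sqn M\<^sub>\<Gamma> (\<lambda>x. F x - u x) \<le> e / 4"
    by blast
  obtain \<psi> where \<psi>: "test_function \<Omega> \<psi>" "sqn M\<^sub>\<Omega> (\<lambda>x. \<psi> x - F x) \<le> e / 4"
    "sqn M\<^sub>\<Omega> (\<lambda>x. cgrad \<psi> x - G x) \<le> e / 4" "sqn M\<^sub>\<Gamma> (\<lambda>x. \<psi> x - F x) \<le> e / 4"
    by (rule test_approx_sqn[OF K F w G B0 e4])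
  note t = test_function_square_integrable[OF \<psi>(1)]
  have "bounded (F ` K)" by (intro compact_imp_bounded compact_continuous_image K(1) continuous_on_subset[OF F(1)]) auto
  then obtain BF where BF: "BF > 0" "\<And>x. x \<in> K \<Longrightarrow> \<bar>F x\<bar> \<le> BF" unfolding bounded_pos by auto
  have BF': "\<bar>F x\<bar> \<le> BF" for x using BF F(2)[of x] by (cases "x \<in> K") auto
  have sF: "square_integrable M\<^sub>\<Omega> F"
    using BF' BF(1) measurable_restrict_space1[OF borel_measurable_lebesgue_continuous[OF F(1)]]
    by (intro square_integrable_bounded(1)[OF finite_dom]) auto
  have sG: "square_integrable M\<^sub>\<Omega> G"
  proof (rule square_integrable_bounded(1)[OF finite_dom _ _ B0])
    show "G \<in> borel_measurable M\<^sub>\<Omega>"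
      by (rule locally_integrable_measurable[OF weak_gradient_locally_integrable(2)[OF w] open_dom])
    show "AE x in M\<^sub>\<Omega>. norm (G x) \<le> B"
      unfolding AE_lebesgue_on[OF dom_sets] using G(1) by eventually_elim simp
  qed
  have s\<Gamma>: "square_integrable M\<^sub>\<Gamma> F" "square_integrable M\<^sub>\<Gamma> u"
    by (rule continuous_interface_square_integrable, rule continuous_on_subset[OF F(1)], simp)
      (rule continuous_interface_square_integrable[OF cont])
  have tri: "sqn M (\<lambda>x. a x - c x) \<le> e"
    if "square_integrable M a" "square_integrable M b" "square_integrable M c"
      "sqn M (\<lambda>x. a x - b x) \<le> e / 4" "sqn M (\<lambda>x. b x - c x) \<le> e / 4"
    for M :: "(real^2) measure" and a b c :: "real^2 \<Rightarrow> 'b::euclidean_space"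
    using square_integrable_add(2)[OF square_integrable_diff[OF that(1,2)] square_integrable_diff[OF that(2,3)]] that(4,5) by simp
  show "\<exists>\<psi>. test_function \<Omega> \<psi> \<and> sqn M\<^sub>\<Omega> (\<lambda>x. \<psi> x - u x) \<le> e \<and>
      sqn M\<^sub>\<Omega> (\<lambda>x. cgrad \<psi> x - g x) \<le> e \<and> sqn M\<^sub>\<Gamma> (\<lambda>x. \<psi> x - u x) \<le> e"
    using \<psi>(1) tri[OF t(1) sF u(1) \<psi>(2) close(1)] tri[OF t(2) sG u(3) \<psi>(3) close(2)] tri[OF t(3) s\<Gamma> \<psi>(4) close(3)] by blast
qed

lemma V_add:
  assumes u: "u \<in> V \<Omega> \<Gamma>" and v: "v \<in> V \<Omega> \<Gamma>"
  shows "(\<lambda>x. u x + v x) \<in> V \<Omega> \<Gamma>"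
proof (rule VI)
  note hu = H1_grad_V[OF u] and hv = H1_grad_V[OF v]
  show "square_integrable M\<^sub>\<Omega> (\<lambda>x. u x + v x)" "square_integrable M\<^sub>\<Omega> (\<lambda>x. grad \<Omega> u x + grad \<Omega> v x)"
    by (rule square_integrable_add(1)[OF hu(3) hv(3)], rule square_integrable_add(1)[OF hu(2) hv(2)])
  show "weak_gradient \<Omega> (\<lambda>x. u x + v x) (\<lambda>x. grad \<Omega> u x + grad \<Omega> v x)"
    by (rule weak_gradient_add[OF hu(1) hv(1) open_dom])
  show "continuous_on (interface \<Gamma>) (\<lambda>x. u x + v x)" by (rule continuous_on_add[OF hu(6) hv(6)])
  show "(\<lambda>x. u x + v x) \<circ> arc_map \<Gamma> i \<in> H1 {0<..<arc_len \<Gamma> i}" if "i < length \<Gamma>" for i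
    using H1_add[OF hu(7)[OF that] hv(7)[OF that]] by (simp add: o_def)
  fix e :: real assume "0 < e"
  then have e4: "0 < e / 4" by simp
  obtain \<psi> where \<psi>: "test_function \<Omega> \<psi>" "sqn M\<^sub>\<Omega> (\<lambda>x. \<psi> x - u x) < e / 4"
    "sqn M\<^sub>\<Omega> (\<lambda>x. cgrad \<psi> x - grad \<Omega> u x) < e / 4" "sqn M\<^sub>\<Gamma> (\<lambda>x. \<psi> x - u x) < e / 4"
    by (rule V_approx[OF u e4])
  obtain \<theta> where \<theta>: "test_function \<Omega> \<theta>" "sqn M\<^sub>\<Omega> (\<lambda>x. \<theta> x - v x) < e / 4"
    "sqn M\<^sub>\<Omega> (\<lambda>x. cgrad \<theta> x - grad \<Omega> v x) < e / 4" "sqn M\<^sub>\<Gamma> (\<lambda>x. \<theta> x - v x) < e / 4"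
    by (rule V_approx[OF v e4])
  note t1 = test_function_square_integrable[OF \<psi>(1)] and t2 = test_function_square_integrable[OF \<theta>(1)]
  have sm: "smooth \<psi>" "smooth \<theta>" using \<psi>(1) \<theta>(1) by (auto simp: test_function_def)
  have tri: "sqn M (\<lambda>x. (a x + c x) - (b x + d x)) \<le> e"
    if "square_integrable M a" "square_integrable M b" "square_integrable M c" "square_integrable M d"
      "sqn M (\<lambda>x. a x - b x) < e / 4" "sqn M (\<lambda>x. c x - d x) < e / 4"
    for M :: "(real^2) measure" and a b c d :: "real^2 \<Rightarrow> 'b::euclidean_space"
    using square_integrable_add(2)[OF square_integrable_diff[OF that(1,2)] square_integrable_diff[OF that(3,4)]] that(5,6)
    by (simp add: add_diff_add)
  show "\<exists>\<psi>. test_function \<Omega> \<psi> \<and> sqn M\<^sub>\<Omega> (\<lambda>x. \<psi> x - (u x + v x)) \<le> e \<and>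
      sqn M\<^sub>\<Omega> (\<lambda>x. cgrad \<psi> x - (grad \<Omega> u x + grad \<Omega> v x)) \<le> e \<and> sqn M\<^sub>\<Gamma> (\<lambda>x. \<psi> x - (u x + v x)) \<le> e"
    using tri[OF t1(1) hu(3) t2(1) hv(3) \<psi>(2) \<theta>(2)] tri[OF t1(2) hu(2) t2(2) hv(2) \<psi>(3) \<theta>(3)]
      tri[OF t1(3) hu(5) t2(3) hv(5) \<psi>(4) \<theta>(4)] test_function_add[OF \<psi>(1) \<theta>(1)] cgrad_add[OF sm]
    by (intro exI[of _ "\<lambda>x. \<psi> x + \<theta> x"]) simp
qed

lemma V_scale:
  assumes u: "u \<in> V \<Omega> \<Gamma>"
  shows "(\<lambda>x. c * u x) \<in> V \<Omega> \<Gamma>"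
proof (rule VI)
  note hu = H1_grad_V[OF u]
  show "square_integrable M\<^sub>\<Omega> (\<lambda>x. c * u x)" "square_integrable M\<^sub>\<Omega> (\<lambda>x. c *\<^sub>R grad \<Omega> u x)"
    using square_integrable_scale(1)[OF hu(3), of c] square_integrable_scale(1)[OF hu(2), of c] by simp_all
  show "weak_gradient \<Omega> (\<lambda>x. c * u x) (\<lambda>x. c *\<^sub>R grad \<Omega> u x)"
    by (rule weak_gradient_scale[OF hu(1) open_dom])
  show "continuous_on (interface \<Gamma>) (\<lambda>x. c * u x)" by (intro continuous_on_mult continuous_on_const hu(6))
  show "(\<lambda>x. c * u x) \<circ> arc_map \<Gamma> i \<in> H1 {0<..<arc_len \<Gamma> i}" if "i < length \<Gamma>" for i
    using H1_scale[OF hu(7)[OF that]] by (simp add: o_def)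
  fix e :: real assume "0 < e"
  \<comment> \<open>The summand 1 covers \<open>c = 0\<close>.\<close>
  define e' where "e' = e / (c\<^sup>2 + 1)"
  have c0: "0 < c\<^sup>2 + 1" by (simp add: add_nonneg_pos)
  have e': "0 < e'" using \<open>0 < e\<close> c0 by (simp add: e'_def)
  have bd: "c\<^sup>2 * t \<le> e" if "t < e'" for t
  proof -
    have "c\<^sup>2 * t \<le> c\<^sup>2 * e'" using that by (intro mult_left_mono) auto
    also have "\<dots> \<le> (c\<^sup>2 + 1) * e'" using e' by (intro mult_right_mono) auto
    finally show ?thesis using c0 by (simp add: e'_def)
  qed
  obtain \<psi> where \<psi>: "test_function \<Omega> \<psi>" "sqn M\<^sub>\<Omega> (\<lambda>x. \<psi> x - u x) < e'"
    "sqn M\<^sub>\<Omega> (\<lambda>x. cgrad \<psi> x - grad \<Omega> u x) < e'" "sqn M\<^sub>\<Gamma> (\<lambda>x. \<psi> x - u x) < e'"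
    by (rule V_approx[OF u e'])
  note t1 = test_function_square_integrable[OF \<psi>(1)]
  have sm: "smooth \<psi>" using \<psi>(1) by (auto simp: test_function_def)
  have "sqn M\<^sub>\<Omega> (\<lambda>x. \<psi> x * c - c * u x) \<le> e"
    using square_integrable_scale(2)[OF square_integrable_diff[OF t1(1) hu(3)], of c] bd[OF \<psi>(2)] by (simp add: algebra_simps)
  moreover have "sqn M\<^sub>\<Gamma> (\<lambda>x. \<psi> x * c - c * u x) \<le> e"
    using square_integrable_scale(2)[OF square_integrable_diff[OF t1(3) hu(5)], of c] bd[OF \<psi>(4)] by (simp add: algebra_simps)
  moreover have "sqn M\<^sub>\<Omega> (\<lambda>x. cgrad (\<lambda>x. \<psi> x * c) x - c *\<^sub>R grad \<Omega> u x) \<le> e"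
    using square_integrable_scale(2)[OF square_integrable_diff[OF t1(2) hu(2)], of c] bd[OF \<psi>(3)]
    by (simp add: cgrad_scale[OF sm] scaleR_diff_right)
  ultimately show "\<exists>\<psi>. test_function \<Omega> \<psi> \<and> sqn M\<^sub>\<Omega> (\<lambda>x. \<psi> x - c * u x) \<le> e \<and>
      sqn M\<^sub>\<Omega> (\<lambda>x. cgrad \<psi> x - c *\<^sub>R grad \<Omega> u x) \<le> e \<and> sqn M\<^sub>\<Gamma> (\<lambda>x. \<psi> x - c * u x) \<le> e"
    using test_function_mult_smooth[OF \<psi>(1) smooth_const, of c] by (intro exI[of _ "\<lambda>x. \<psi> x * c"]) simp
qed

text \<open>Test functions vanish outside \<open>\<Omega>\<close>, and their L2 limit on the
  interface inherits this. It matters where the interface touches the boundary, since gradients of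
  cutoffs are controlled inside \<open>\<Omega>\<close> only.\<close>

lemma V_boundary:
  assumes u: "u \<in> V \<Omega> \<Gamma>"
  shows "AE x in M\<^sub>\<Gamma>. x \<notin> \<Omega> \<longrightarrow> u x = 0"
proof -
  note hu = H1_grad_V[OF u]
  define f where "f = (\<lambda>x. indicator (- \<Omega>) x *\<^sub>R u x)"
  have om: "- \<Omega> \<in> sets M\<^sub>\<Gamma>" using open_dom by (intro borel_arc_sets) auto
  have fm: "f \<in> borel_measurable M\<^sub>\<Gamma>"
    unfolding f_def using hu(5) om by (intro borel_measurable_scaleR) (auto simp: square_integrable_def)
  have sf: "square_integrable M\<^sub>\<Gamma> f"
    by (rule square_integrable_dominated(1)[OF hu(5) fm, of 1]) (auto simp: f_def indicator_def)
  have le: "sqn M\<^sub>\<Gamma> f \<le> 0 + e" if e: "0 < e" for e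
  proof -
    obtain \<psi> where \<psi>: "test_function \<Omega> \<psi>" "sqn M\<^sub>\<Gamma> (\<lambda>x. \<psi> x - u x) < e"
      using V_approx[OF u e] by blast
    have "sqn M\<^sub>\<Gamma> f \<le> 1\<^sup>2 * sqn M\<^sub>\<Gamma> (\<lambda>x. \<psi> x - u x)"
      using test_function_outside[OF \<psi>(1)]
      by (intro square_integrable_dominated(2)[OF square_integrable_diff[OF test_function_square_integrable(3)[OF \<psi>(1)] hu(5)] fm])
        (auto simp: f_def indicator_def)
    then show ?thesis using \<psi>(2) by simp
  qed
  have "sqn M\<^sub>\<Gamma> f \<le> 0" by (rule field_le_epsilon[OF le])
  then have "sqn M\<^sub>\<Gamma> f = 0" using sqn_nonneg[of M\<^sub>\<Gamma> f] by linarith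
  then have "(LINT x|M\<^sub>\<Gamma>. (norm (f x))\<^sup>2) = 0" unfolding sqn_def .
  then have "AE x in M\<^sub>\<Gamma>. (norm (f x))\<^sup>2 = 0"
    using sf by (subst (asm) integral_nonneg_eq_0_iff_AE) (auto simp: square_integrable_def)
  then show ?thesis by eventually_elim (auto simp: f_def indicator_def)
qed

text \<open>The last claim localises the bound: where \<open>\<eta>\<close> is
  \<open>M\<close>-Lipschitz near the image point, so is its composition with the curve near the
  parameter, because curves have unit speed. A single \<open>d\<close> serves for all
  \<open>U\<close> and \<open>M\<close>.\<close>

lemma arc_lipschitz_derivative:
  assumes i: "i < length \<Gamma>" and \<eta>: "K-lipschitz_on (interface \<Gamma>) \<eta>"
  obtains d where "weak_gradient {0<..<arc_len \<Gamma> i} (\<eta> \<circ> arc_map \<Gamma> i) d"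
    "AE s in lebesgue. s \<in> {0<..<arc_len \<Gamma> i} \<longrightarrow> \<bar>d s\<bar> \<le> K"
    "\<And>U M. (\<And>x. x \<in> U \<Longrightarrow> \<exists>r>0. M-lipschitz_on (ball x r) \<eta>) \<Longrightarrow>
       AE s in lebesgue. s \<in> {0<..<arc_len \<Gamma> i} \<and> arc_map \<Gamma> i s \<in> U \<longrightarrow> \<bar>d s\<bar> \<le> M"
proof -
  define L where "L = arc_len \<Gamma> i"
  define c where "c = arc_map \<Gamma> i"
  have cur: "smooth_curve (L, c)" using curve[OF i] by (simp add: L_def c_def)
  have L0: "0 < L" by (rule smooth_curve_cases(1)[OF cur])
  have cl: "dist (c s) (c t) \<le> dist s t" if "s \<in> {0..L}" "t \<in> {0..L}" for s t
    using lipschitz_onD[OF smooth_curve_lipschitz[OF cur] that] by simp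
  have cI: "c s \<in> interface \<Gamma>" if "s \<in> {0..L}" for s
    unfolding interface_def curve_image_def using that i
    by (intro UN_I[of "\<Gamma> ! i"]) (auto simp: L_def c_def case_prod_beta)
  \<comment> \<open>The results on weak derivatives ask for a Lipschitz function on the whole line.
    Freezing the parameter at the ends of an interval extends the function without increasing its
    constant.\<close>
  define clamp where "clamp a b s = max a (min b s)" for a b s :: real
  have clin: "clamp a b s \<in> {a..b}" if "a \<le> b" for a b s using that by (auto simp: clamp_def)
  have cid: "clamp a b s = s" if "s \<in> {a..b}" for a b s using that by (auto simp: clamp_def)
  have cdist: "dist (clamp a b s) (clamp a b t) \<le> dist s t" for a b s t
    unfolding clamp_def dist_real_def by (auto simp: max_def min_def abs_if)
  have lip: "M-lipschitz_on UNIV (\<lambda>s. \<eta> (c (clamp a b s)))"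
    if ab: "a \<le> b" "0 \<le> a" "b \<le> L" and M: "M-lipschitz_on S \<eta>" "\<And>s. s \<in> {a..b} \<Longrightarrow> c s \<in> S" for a b M S
  proof (rule lipschitz_onI)
    have M0: "0 \<le> M" using M(1) by (rule lipschitz_on_nonneg)
    then show "0 \<le> M" .
    fix s t :: real
    have "dist (\<eta> (c (clamp a b s))) (\<eta> (c (clamp a b t))) \<le> M * dist (c (clamp a b s)) (c (clamp a b t))"
      using M(2)[OF clin[OF ab(1)]] by (intro lipschitz_onD[OF M(1)]) auto
    moreover have "dist (c (clamp a b s)) (c (clamp a b t)) \<le> dist s t"
    proof (rule order_trans[OF cl cdist])
      show "clamp a b s \<in> {0..L}" "clamp a b t \<in> {0..L}"
        using clin[OF ab(1), of s] clin[OF ab(1), of t] ab(2,3) by auto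
    qed
    then have "M * dist (c (clamp a b s)) (c (clamp a b t)) \<le> M * dist s t"
      using M0 by (rule mult_left_mono)
    ultimately show "dist (\<eta> (c (clamp a b s))) (\<eta> (c (clamp a b t))) \<le> M * dist s t"
      by (rule order_trans)
  qed
  have lip0: "K-lipschitz_on UNIV (\<lambda>s. \<eta> (c (clamp 0 L s)))"
    using L0 cI by (intro lip[OF _ _ _ \<eta>]) auto
  obtain d where d: "weak_gradient UNIV (\<lambda>s. \<eta> (c (clamp 0 L s))) d"
    using lipschitz_weak_derivative[OF lip0] by blast
  have d1: "weak_gradient {0<..<L} (\<lambda>s. \<eta> (c (clamp 0 L s))) d"
    by (rule weak_gradient_mono[OF d]) auto
  have w: "weak_gradient {0<..<L} (\<eta> \<circ> c) d"
    by (rule weak_gradient_cong[OF d1]) (auto simp: cid)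
  have k: "AE s in lebesgue. s \<in> {0<..<L} \<longrightarrow> \<bar>d s\<bar> \<le> K"
    using weak_gradient_lipschitz_bound[OF lip0 d1] by (auto elim!: eventually_mono)
  have loc: "AE s in lebesgue. s \<in> {0<..<L} \<and> c s \<in> U \<longrightarrow> \<bar>d s\<bar> \<le> M"
    if U: "\<And>x. x \<in> U \<Longrightarrow> \<exists>r>0. M-lipschitz_on (ball x r) \<eta>" for U M
  proof -
    have "AE s in lebesgue. s \<in> {s. s \<in> {0<..<L} \<and> c s \<in> U} \<longrightarrow> \<bar>d s\<bar> \<le> M"
    proof (rule AE_lebesgue_locally)
      fix s0 assume "s0 \<in> {s. s \<in> {0<..<L} \<and> c s \<in> U}"
      then have s0: "0 < s0" "s0 < L" "c s0 \<in> U" by auto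
      obtain r where r: "0 < r" "M-lipschitz_on (ball (c s0) r) \<eta>" using U[OF s0(3)] by blast
      \<comment> \<open>The interval of radius \<open>\<delta>\<close> stays inside the parameter
        domain and, as \<open>c\<close> does not increase distances, is mapped into the ball on
        which \<open>\<eta>\<close> is \<open>M\<close>-Lipschitz.\<close>
      define \<delta> where "\<delta> = min (r / 2) (min s0 (L - s0))"
      have \<delta>: "0 < \<delta>" "\<delta> < r" "\<delta> \<le> s0" "\<delta> \<le> L - s0" using r s0 by (auto simp: \<delta>_def)
      let ?f = "\<lambda>s. \<eta> (c (clamp (s0 - \<delta>) (s0 + \<delta>) s))"
      have "c s \<in> ball (c s0) r" if "s \<in> {s0 - \<delta>..s0 + \<delta>}" for s
        using cl[of s0 s] that \<delta> s0 by (auto simp: dist_real_def)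
      then have lf: "M-lipschitz_on UNIV ?f"
        using \<delta> by (intro lip[OF _ _ _ r(2)]) auto
      have sub: "ball s0 \<delta> \<subseteq> {0<..<L}" using \<delta> by (auto simp: dist_real_def)
      have "weak_gradient (ball s0 \<delta>) (\<eta> \<circ> c) d" using sub by (intro weak_gradient_mono[OF w]) auto
      then have "weak_gradient (ball s0 \<delta>) ?f d"
      proof (rule weak_gradient_cong)
        fix s assume "s \<in> ball s0 \<delta>"
        then have "s \<in> {s0 - \<delta>..s0 + \<delta>}" by (auto simp: dist_real_def)
        then show "(\<eta> \<circ> c) s = ?f s" by (simp add: cid)
      qed auto
      from weak_gradient_lipschitz_bound[OF lf this open_ball]
      have "AE y in lebesgue. y \<in> ball s0 \<delta> \<longrightarrow> \<bar>d y\<bar> \<le> M" by (auto elim!: eventually_mono)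
      then show "\<exists>r>0. AE y in lebesgue. y \<in> ball s0 r \<longrightarrow> \<bar>d y\<bar> \<le> M" using \<delta>(1) by blast
    qed
    then show ?thesis by simp
  qed
  show ?thesis by (rule that[OF w[unfolded L_def c_def] k[unfolded L_def] loc[unfolded L_def c_def]])
qed

section \<open>Products with Lipschitz functions\<close>

lemma product_weak_gradient:
  assumes \<phi>: "\<phi> \<in> V \<Omega> \<Gamma>" and \<eta>: "K-lipschitz_on (closure \<Omega>) \<eta>"
    and w: "weak_gradient \<Omega> \<eta> g" and M: "AE x in lebesgue. x \<in> \<Omega> \<longrightarrow> norm (g x) \<le> M" "0 \<le> M"
  shows "weak_gradient \<Omega> (\<lambda>x. \<eta> x * \<phi> x) (\<lambda>x. \<eta> x *\<^sub>R grad \<Omega> \<phi> x + \<phi> x *\<^sub>R g x)"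
proof (rule weak_gradient_product[OF open_dom _ w M])
  note h = H1_grad_V[OF \<phi>]
  show "continuous_on \<Omega> \<eta>"
    by (rule continuous_on_subset[OF lipschitz_on_continuous_on[OF \<eta>] closure_subset])
  show "weak_gradient \<Omega> \<phi> (grad \<Omega> \<phi>)" by (rule h(1))
  show "integrable M\<^sub>\<Omega> (\<lambda>x. (\<phi> x)\<^sup>2)" using h(3) by (simp add: square_integrable_def)
  show "integrable M\<^sub>\<Omega> (grad \<Omega> \<phi>)" by (rule square_integrable_integrable[OF finite_dom h(2)])
qed

lemma finite_interval_measure: "finite_measure (lebesgue_on {0<..<L::real})"
proof
  have "{0<..<L} \<in> lmeasurable" by simp
  then show "emeasure (lebesgue_on {0<..<L}) (space (lebesgue_on {0<..<L})) \<noteq> \<infinity>"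
    by (simp add: emeasure_restrict_space space_restrict_space fmeasurable_def)
qed

text \<open>The witness \<open>d\<close> is the derivative of \<open>\<eta>\<close> along the arc.
  The local bound is stated together with it because it has to concern the same \<open>d\<close> as
  the product rule.\<close>

lemma product_arc:
  assumes \<phi>: "\<phi> \<in> V \<Omega> \<Gamma>" and \<eta>: "K-lipschitz_on (closure \<Omega>) \<eta>" and i: "i < length \<Gamma>"
  obtains d where "(\<lambda>x. \<eta> x * \<phi> x) \<circ> arc_map \<Gamma> i \<in> H1 {0<..<arc_len \<Gamma> i}"
    "weak_gradient {0<..<arc_len \<Gamma> i} ((\<lambda>x. \<eta> x * \<phi> x) \<circ> arc_map \<Gamma> i)
       (\<lambda>s. \<eta> (arc_map \<Gamma> i s) *\<^sub>R grad {0<..<arc_len \<Gamma> i} (\<phi> \<circ> arc_map \<Gamma> i) s + \<phi> (arc_map \<Gamma> i s) *\<^sub>R d s)"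
    "AE s in lebesgue. s \<in> {0<..<arc_len \<Gamma> i} \<longrightarrow> \<bar>d s\<bar> \<le> K"
    "\<And>U M. (\<And>x. x \<in> U \<Longrightarrow> \<exists>r>0. M-lipschitz_on (ball x r) \<eta>) \<Longrightarrow>
       AE s in lebesgue. s \<in> {0<..<arc_len \<Gamma> i} \<and> arc_map \<Gamma> i s \<in> U \<longrightarrow> \<bar>d s\<bar> \<le> M"
proof -
  define L where "L = arc_len \<Gamma> i"
  define c where "c = arc_map \<Gamma> i"
  have \<eta>': "K-lipschitz_on (interface \<Gamma>) \<eta>" by (rule lipschitz_on_subset[OF \<eta> interface_closure])
  have K0: "0 \<le> K" by (rule lipschitz_on_nonneg[OF \<eta>])
  obtain d where d: "weak_gradient {0<..<L} (\<eta> \<circ> c) d" "AE s in lebesgue. s \<in> {0<..<L} \<longrightarrow> \<bar>d s\<bar> \<le> K"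
    and loc: "\<And>U M. (\<And>x. x \<in> U \<Longrightarrow> \<exists>r>0. M-lipschitz_on (ball x r) \<eta>) \<Longrightarrow>
       AE s in lebesgue. s \<in> {0<..<L} \<and> c s \<in> U \<longrightarrow> \<bar>d s\<bar> \<le> M"
    unfolding L_def c_def by (rule arc_lipschitz_derivative[OF i \<eta>']) blast
  let ?v = "grad {0<..<L} (\<phi> \<circ> c)"
  have H: "\<phi> \<circ> c \<in> H1 {0<..<L}" unfolding L_def c_def by (rule H1_grad_V(7)[OF \<phi> i])
  note h = H1_grad[OF H open_greaterThanLessThan]
  have cI: "c s \<in> interface \<Gamma>" if "s \<in> {0<..<L}" for s
    unfolding interface_def curve_image_def using that i
    by (intro UN_I[of "\<Gamma> ! i"]) (auto simp: L_def c_def case_prod_beta)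
  have cc: "continuous_on {0<..<L} c" unfolding c_def by (rule arc_map_continuous[OF i])
  have ce: "continuous_on {0<..<L} (\<eta> \<circ> c)"
    unfolding o_def using cI by (intro continuous_on_compose2[OF lipschitz_on_continuous_on[OF \<eta>'] cc]) auto
  have cp: "continuous_on {0<..<L} (\<phi> \<circ> c)"
    unfolding o_def using cI by (intro continuous_on_compose2[OF H1_grad_V(6)[OF \<phi>] cc]) auto
  have w: "weak_gradient {0<..<L} (\<lambda>s. (\<eta> \<circ> c) s * (\<phi> \<circ> c) s) (\<lambda>s. (\<eta> \<circ> c) s *\<^sub>R ?v s + (\<phi> \<circ> c) s *\<^sub>R d s)"
  proof (rule weak_gradient_product[OF open_greaterThanLessThan ce d(1) _ K0 h(1)])
    show "AE s in lebesgue. s \<in> {0<..<L} \<longrightarrow> norm (d s) \<le> K" using d(2) by simp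
    show "integrable (lebesgue_on {0<..<L}) (\<lambda>x. ((\<phi> \<circ> c) x)\<^sup>2)" using h(3) by (simp add: square_integrable_def)
    show "integrable (lebesgue_on {0<..<L}) ?v"
      by (rule square_integrable_integrable[OF finite_interval_measure h(2)])
  qed
  have "bounded (\<eta> ` interface \<Gamma>)"
    by (intro compact_imp_bounded compact_continuous_image lipschitz_on_continuous_on[OF \<eta>'] compact_interface smooth_curves)
  then obtain B where B: "B > 0" "\<And>x. x \<in> interface \<Gamma> \<Longrightarrow> \<bar>\<eta> x\<bar> \<le> B" unfolding bounded_pos by auto
  have Im: "{0<..<L} \<in> sets lebesgue" by auto
  have me: "(\<eta> \<circ> c) \<in> borel_measurable (lebesgue_on {0<..<L})" by (rule continuous_imp_measurable_on_sets_lebesgue[OF ce Im])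
  have mp: "(\<phi> \<circ> c) \<in> borel_measurable (lebesgue_on {0<..<L})" by (rule continuous_imp_measurable_on_sets_lebesgue[OF cp Im])
  have md: "d \<in> borel_measurable (lebesgue_on {0<..<L})"
    by (rule locally_integrable_measurable[OF weak_gradient_locally_integrable(2)[OF d(1)] open_greaterThanLessThan])
  have mv: "?v \<in> borel_measurable (lebesgue_on {0<..<L})" using h(2) by (simp add: square_integrable_def)
  have s1: "square_integrable (lebesgue_on {0<..<L}) (\<lambda>s. (\<eta> \<circ> c) s *\<^sub>R ?v s)"
  proof (rule square_integrable_dominated(1)[OF h(2)])
    show "(\<lambda>s. (\<eta> \<circ> c) s *\<^sub>R ?v s) \<in> borel_measurable (lebesgue_on {0<..<L})" by (rule borel_measurable_scaleR[OF me mv])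
    show "AE s in lebesgue_on {0<..<L}. norm ((\<eta> \<circ> c) s *\<^sub>R ?v s) \<le> B * norm (?v s)"
      unfolding AE_lebesgue_on[OF Im] using B cI by (intro AE_I2) (auto simp: abs_mult intro!: mult_right_mono)
  qed
  have s2: "square_integrable (lebesgue_on {0<..<L}) (\<lambda>s. (\<phi> \<circ> c) s *\<^sub>R d s)"
  proof (rule square_integrable_dominated(1)[OF h(3)])
    show "(\<lambda>s. (\<phi> \<circ> c) s *\<^sub>R d s) \<in> borel_measurable (lebesgue_on {0<..<L})" by (rule borel_measurable_scaleR[OF mp md])
    show "AE s in lebesgue_on {0<..<L}. norm ((\<phi> \<circ> c) s *\<^sub>R d s) \<le> K * norm ((\<phi> \<circ> c) s)"
      unfolding AE_lebesgue_on[OF Im] using d(2)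
      by eventually_elim (auto simp: abs_mult mult.commute intro!: mult_right_mono)
  qed
  have s3: "square_integrable (lebesgue_on {0<..<L}) (\<lambda>s. (\<eta> \<circ> c) s * (\<phi> \<circ> c) s)"
  proof (rule square_integrable_dominated(1)[OF h(3)])
    show "(\<lambda>s. (\<eta> \<circ> c) s * (\<phi> \<circ> c) s) \<in> borel_measurable (lebesgue_on {0<..<L})" by (rule borel_measurable_times[OF me mp])
    show "AE s in lebesgue_on {0<..<L}. norm ((\<eta> \<circ> c) s * (\<phi> \<circ> c) s) \<le> B * norm ((\<phi> \<circ> c) s)"
      unfolding AE_lebesgue_on[OF Im] using B cI by (intro AE_I2) (auto simp: abs_mult intro!: mult_right_mono)
  qed
  have H': "(\<lambda>s. (\<eta> \<circ> c) s * (\<phi> \<circ> c) s) \<in> H1 {0<..<L}"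
    by (rule H1I[OF s3 w square_integrable_add(1)[OF s1 s2]])
  have eq: "(\<lambda>s. (\<eta> \<circ> c) s * (\<phi> \<circ> c) s) = (\<lambda>x. \<eta> x * \<phi> x) \<circ> c" by (simp add: o_def)
  have H'': "(\<lambda>x. \<eta> x * \<phi> x) \<circ> c \<in> H1 {0<..<L}" using H' unfolding eq .
  have w': "weak_gradient {0<..<L} ((\<lambda>x. \<eta> x * \<phi> x) \<circ> c) (\<lambda>s. \<eta> (c s) *\<^sub>R ?v s + \<phi> (c s) *\<^sub>R d s)"
    using w unfolding eq by (simp only: o_apply)
  show ?thesis
    by (rule that[OF H''[unfolded L_def c_def] w'[unfolded L_def c_def] d(2)[unfolded L_def] loc[unfolded L_def c_def]])
qed

text \<open>By the product rule the difference is \<open>\<phi>\<close> times the derivative of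
  \<open>\<eta>\<close> along the arc times a unit vector. The crude constant \<open>K\<close> is
  valid everywhere, the sharper \<open>M\<close> where \<open>\<eta>\<close> is locally
  \<open>M\<close>-Lipschitz.\<close>

lemma product_tgrad:
  assumes \<phi>: "\<phi> \<in> V \<Omega> \<Gamma>" and \<eta>: "K-lipschitz_on (closure \<Omega>) \<eta>"
  shows "AE x in M\<^sub>\<Gamma>. norm (tgrad \<Gamma> (\<lambda>x. \<eta> x * \<phi> x) x - \<eta> x *\<^sub>R tgrad \<Gamma> \<phi> x) \<le> K * \<bar>\<phi> x\<bar>"
    and "(\<And>x. x \<in> U \<Longrightarrow> \<exists>r>0. M-lipschitz_on (ball x r) \<eta>) \<Longrightarrow>
      AE x in M\<^sub>\<Gamma>. x \<in> U \<longrightarrow> norm (tgrad \<Gamma> (\<lambda>x. \<eta> x * \<phi> x) x - \<eta> x *\<^sub>R tgrad \<Gamma> \<phi> x) \<le> M * \<bar>\<phi> x\<bar>"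
proof -
  have main: "AE s in lebesgue. s \<in> arc_dom \<Gamma> i \<longrightarrow> Q (arc_map \<Gamma> i s) \<longrightarrow>
      norm (tgrad \<Gamma> (\<lambda>x. \<eta> x * \<phi> x) (arc_map \<Gamma> i s) - \<eta> (arc_map \<Gamma> i s) *\<^sub>R tgrad \<Gamma> \<phi> (arc_map \<Gamma> i s)) \<le> M * \<bar>\<phi> (arc_map \<Gamma> i s)\<bar>"
    if i: "i < length \<Gamma>"
      and w: "weak_gradient {0<..<arc_len \<Gamma> i} ((\<lambda>x. \<eta> x * \<phi> x) \<circ> arc_map \<Gamma> i)
       (\<lambda>s. \<eta> (arc_map \<Gamma> i s) *\<^sub>R grad {0<..<arc_len \<Gamma> i} (\<phi> \<circ> arc_map \<Gamma> i) s + \<phi> (arc_map \<Gamma> i s) *\<^sub>R d s)"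
      and d: "AE s in lebesgue. s \<in> {0<..<arc_len \<Gamma> i} \<and> Q (arc_map \<Gamma> i s) \<longrightarrow> \<bar>d s\<bar> \<le> M" for i d M Q
    using tgrad_AE[OF i w] tgrad_AE[OF i H1_grad(1)[OF H1_grad_V(7)[OF \<phi> i] open_greaterThanLessThan]] d
  proof eventually_elim
    case (elim s)
    show ?case
    proof (intro impI)
      assume s: "s \<in> arc_dom \<Gamma> i" and q: "Q (arc_map \<Gamma> i s)"
      have s': "0 < s" "s < arc_len \<Gamma> i" using elim(1) s by auto
      have "tgrad \<Gamma> (\<lambda>x. \<eta> x * \<phi> x) (arc_map \<Gamma> i s) - \<eta> (arc_map \<Gamma> i s) *\<^sub>R tgrad \<Gamma> \<phi> (arc_map \<Gamma> i s) =
          (\<phi> (arc_map \<Gamma> i s) * d s) *\<^sub>R vector_derivative (arc_map \<Gamma> i) (at s)"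
        using elim(1,2) s by (simp add: scaleR_add_left)
      also have "norm \<dots> = \<bar>\<phi> (arc_map \<Gamma> i s)\<bar> * \<bar>d s\<bar>"
        using smooth_curve_cases(3)[OF curve[OF i], of s] s' by (simp add: abs_mult)
      also have "\<dots> \<le> M * \<bar>\<phi> (arc_map \<Gamma> i s)\<bar>"
        using elim(3) s' q by (simp add: mult.commute[of M] mult_left_mono)
      finally show "norm (tgrad \<Gamma> (\<lambda>x. \<eta> x * \<phi> x) (arc_map \<Gamma> i s) - \<eta> (arc_map \<Gamma> i s) *\<^sub>R tgrad \<Gamma> \<phi> (arc_map \<Gamma> i s)) \<le> M * \<bar>\<phi> (arc_map \<Gamma> i s)\<bar>" .
    qed
  qed
  show "AE x in M\<^sub>\<Gamma>. norm (tgrad \<Gamma> (\<lambda>x. \<eta> x * \<phi> x) x - \<eta> x *\<^sub>R tgrad \<Gamma> \<phi> x) \<le> K * \<bar>\<phi> x\<bar>"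
  proof (rule AE_arc_length)
    fix i assume i: "i < length \<Gamma>"
    obtain d where d: "weak_gradient {0<..<arc_len \<Gamma> i} ((\<lambda>x. \<eta> x * \<phi> x) \<circ> arc_map \<Gamma> i)
       (\<lambda>s. \<eta> (arc_map \<Gamma> i s) *\<^sub>R grad {0<..<arc_len \<Gamma> i} (\<phi> \<circ> arc_map \<Gamma> i) s + \<phi> (arc_map \<Gamma> i s) *\<^sub>R d s)"
       "AE s in lebesgue. s \<in> {0<..<arc_len \<Gamma> i} \<longrightarrow> \<bar>d s\<bar> \<le> K"
      by (rule product_arc[OF \<phi> \<eta> i])
    have d': "AE s in lebesgue. s \<in> {0<..<arc_len \<Gamma> i} \<and> True \<longrightarrow> \<bar>d s\<bar> \<le> K" using d(2) by simp
    from main[OF i d(1), of "\<lambda>x. True", OF d']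
    show "AE s in lebesgue. s \<in> arc_dom \<Gamma> i \<longrightarrow>
      norm (tgrad \<Gamma> (\<lambda>x. \<eta> x * \<phi> x) (arc_map \<Gamma> i s) - \<eta> (arc_map \<Gamma> i s) *\<^sub>R tgrad \<Gamma> \<phi> (arc_map \<Gamma> i s)) \<le> K * \<bar>\<phi> (arc_map \<Gamma> i s)\<bar>"
      by simp
  qed
  assume U: "\<And>x. x \<in> U \<Longrightarrow> \<exists>r>0. M-lipschitz_on (ball x r) \<eta>"
  show "AE x in M\<^sub>\<Gamma>. x \<in> U \<longrightarrow> norm (tgrad \<Gamma> (\<lambda>x. \<eta> x * \<phi> x) x - \<eta> x *\<^sub>R tgrad \<Gamma> \<phi> x) \<le> M * \<bar>\<phi> x\<bar>"
  proof (rule AE_arc_length)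
    fix i assume i: "i < length \<Gamma>"
    obtain d where d: "weak_gradient {0<..<arc_len \<Gamma> i} ((\<lambda>x. \<eta> x * \<phi> x) \<circ> arc_map \<Gamma> i)
       (\<lambda>s. \<eta> (arc_map \<Gamma> i s) *\<^sub>R grad {0<..<arc_len \<Gamma> i} (\<phi> \<circ> arc_map \<Gamma> i) s + \<phi> (arc_map \<Gamma> i s) *\<^sub>R d s)"
      and loc: "\<And>U M. (\<And>x. x \<in> U \<Longrightarrow> \<exists>r>0. M-lipschitz_on (ball x r) \<eta>) \<Longrightarrow>
       AE s in lebesgue. s \<in> {0<..<arc_len \<Gamma> i} \<and> arc_map \<Gamma> i s \<in> U \<longrightarrow> \<bar>d s\<bar> \<le> M"
      by (rule product_arc[OF \<phi> \<eta> i]) blast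
    show "AE s in lebesgue. s \<in> arc_dom \<Gamma> i \<longrightarrow> arc_map \<Gamma> i s \<in> U \<longrightarrow>
      norm (tgrad \<Gamma> (\<lambda>x. \<eta> x * \<phi> x) (arc_map \<Gamma> i s) - \<eta> (arc_map \<Gamma> i s) *\<^sub>R tgrad \<Gamma> \<phi> (arc_map \<Gamma> i s)) \<le> M * \<bar>\<phi> (arc_map \<Gamma> i s)\<bar>"
      by (rule main[OF i d, of "\<lambda>x. x \<in> U", OF loc[OF U]])
  qed
qed

text \<open>The Lipschitz constant \<open>K\<close> of a cutoff is arbitrary, so it must not enter
  the final estimate. In \<open>\<Omega>\<close> the gradient bound \<open>M\<close> gives local
  Lipschitz estimates; outside, \<open>\<phi>\<close> is zero almost everywhere on the interface and
  even the crude bound with \<open>K\<close> is zero.\<close>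

lemma product_tgrad_bound:
  assumes \<phi>: "\<phi> \<in> V \<Omega> \<Gamma>" and \<eta>: "K-lipschitz_on (closure \<Omega>) \<eta>"
    and w: "weak_gradient \<Omega> \<eta> g" and M: "AE x in lebesgue. x \<in> \<Omega> \<longrightarrow> norm (g x) \<le> M" "0 \<le> M"
  shows "AE x in M\<^sub>\<Gamma>. norm (tgrad \<Gamma> (\<lambda>x. \<eta> x * \<phi> x) x - \<eta> x *\<^sub>R tgrad \<Gamma> \<phi> x) \<le> M * \<bar>\<phi> x\<bar>"
proof -
  have c: "continuous_on \<Omega> \<eta>"
    by (rule continuous_on_subset[OF lipschitz_on_continuous_on[OF \<eta>] closure_subset])
  have loc: "\<exists>r>0. M-lipschitz_on (ball x r) \<eta>" if "x \<in> \<Omega>" for x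
  proof -
    obtain R where R: "R > 0" "cball x R \<subseteq> \<Omega>" using open_dom \<open>x \<in> \<Omega>\<close> open_contains_cball by blast
    then have "M-lipschitz_on (ball x (R / 2)) \<eta>"
      by (intro bounded_weak_gradient_lipschitz[OF w open_dom M c]) auto
    then show ?thesis using R(1) by (intro exI[of _ "R / 2"]) simp
  qed
  have "AE x in M\<^sub>\<Gamma>. x \<in> \<Omega> \<longrightarrow> norm (tgrad \<Gamma> (\<lambda>x. \<eta> x * \<phi> x) x - \<eta> x *\<^sub>R tgrad \<Gamma> \<phi> x) \<le> M * \<bar>\<phi> x\<bar>"
    by (rule product_tgrad(2)[OF \<phi> \<eta>]) (rule loc)
  from product_tgrad(1)[OF \<phi> \<eta>] this V_boundary[OF \<phi>]
  show ?thesis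
  proof eventually_elim
    case (elim x)
    then show ?case by (cases "x \<in> \<Omega>") auto
  qed
qed

text \<open>For a test function \<open>\<psi>\<close> close to \<open>\<phi>\<close>, the product
  \<open>\<eta> * \<psi>\<close> is continuous with compact support in \<open>\<Omega>\<close> and
  has a bounded weak gradient, as \<open>VI_approx\<close> wants. Multiplication by
  \<open>\<eta>\<close> itself could not create compact support.\<close>

lemma product_in_V:
  assumes \<phi>: "\<phi> \<in> V \<Omega> \<Gamma>" and \<eta>: "K-lipschitz_on (closure \<Omega>) \<eta>" "\<And>x. x \<in> closure \<Omega> \<Longrightarrow> \<bar>\<eta> x\<bar> \<le> 1"
    and w: "weak_gradient \<Omega> \<eta> g" and M: "AE x in lebesgue. x \<in> \<Omega> \<longrightarrow> norm (g x) \<le> M" "0 \<le> M"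
  shows "(\<lambda>x. \<eta> x * \<phi> x) \<in> V \<Omega> \<Gamma>"
proof (rule VI_approx)
  note h = H1_grad_V[OF \<phi>]
  have c: "continuous_on \<Omega> \<eta>"
    by (rule continuous_on_subset[OF lipschitz_on_continuous_on[OF \<eta>(1)] closure_subset])
  have \<eta>1: "\<bar>\<eta> x\<bar> \<le> 1" if "x \<in> \<Omega>" for x using \<eta>(2)[of x] that closure_subset by blast
  have m\<eta>: "\<eta> \<in> borel_measurable M\<^sub>\<Omega>" by (rule continuous_imp_measurable_on_sets_lebesgue[OF c dom_sets])
  have mg: "g \<in> borel_measurable M\<^sub>\<Omega>"
    by (rule locally_integrable_measurable[OF weak_gradient_locally_integrable(2)[OF w] open_dom])
  have c\<eta>: "continuous_on (interface \<Gamma>) \<eta>"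
    by (rule continuous_on_subset[OF lipschitz_on_continuous_on[OF \<eta>(1)] interface_closure])
  have sq\<eta>: "square_integrable M\<^sub>\<Omega> (\<lambda>x. \<eta> x *\<^sub>R f x)" "sqn M\<^sub>\<Omega> (\<lambda>x. \<eta> x *\<^sub>R f x) \<le> sqn M\<^sub>\<Omega> f"
    if "square_integrable M\<^sub>\<Omega> f" for f :: "real^2 \<Rightarrow> 'b::euclidean_space"
  proof -
    have m: "(\<lambda>x. \<eta> x *\<^sub>R f x) \<in> borel_measurable M\<^sub>\<Omega>"
      using m\<eta> that by (intro borel_measurable_scaleR) (simp_all add: square_integrable_def)
    have le: "AE x in M\<^sub>\<Omega>. norm (\<eta> x *\<^sub>R f x) \<le> 1 * norm (f x)"
      unfolding AE_lebesgue_on[OF dom_sets] using \<eta>1 by (intro AE_I2) (auto intro: mult_left_le_one_le)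
    show "square_integrable M\<^sub>\<Omega> (\<lambda>x. \<eta> x *\<^sub>R f x)" "sqn M\<^sub>\<Omega> (\<lambda>x. \<eta> x *\<^sub>R f x) \<le> sqn M\<^sub>\<Omega> f"
      using square_integrable_dominated[OF that m le] by simp_all
  qed
  have sqg: "square_integrable M\<^sub>\<Omega> (\<lambda>x. f x *\<^sub>R g x)" "sqn M\<^sub>\<Omega> (\<lambda>x. f x *\<^sub>R g x) \<le> M\<^sup>2 * sqn M\<^sub>\<Omega> f"
    if "square_integrable M\<^sub>\<Omega> f" for f :: "real^2 \<Rightarrow> real"
  proof -
    have m: "(\<lambda>x. f x *\<^sub>R g x) \<in> borel_measurable M\<^sub>\<Omega>"
      using mg that by (intro borel_measurable_scaleR) (simp_all add: square_integrable_def)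
    have le: "AE x in M\<^sub>\<Omega>. norm (f x *\<^sub>R g x) \<le> M * norm (f x)"
      unfolding AE_lebesgue_on[OF dom_sets] using M(1)
      by eventually_elim (auto simp: mult.commute[of M] intro!: mult_left_mono)
    show "square_integrable M\<^sub>\<Omega> (\<lambda>x. f x *\<^sub>R g x)" "sqn M\<^sub>\<Omega> (\<lambda>x. f x *\<^sub>R g x) \<le> M\<^sup>2 * sqn M\<^sub>\<Omega> f"
      using square_integrable_dominated[OF that m le] by simp_all
  qed
  show "square_integrable M\<^sub>\<Omega> (\<lambda>x. \<eta> x * \<phi> x)" using sq\<eta>(1)[OF h(3)] by simp
  show "weak_gradient \<Omega> (\<lambda>x. \<eta> x * \<phi> x) (\<lambda>x. \<eta> x *\<^sub>R grad \<Omega> \<phi> x + \<phi> x *\<^sub>R g x)"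
    by (rule product_weak_gradient[OF \<phi> \<eta>(1) w M])
  show "square_integrable M\<^sub>\<Omega> (\<lambda>x. \<eta> x *\<^sub>R grad \<Omega> \<phi> x + \<phi> x *\<^sub>R g x)"
    by (rule square_integrable_add(1)[OF sq\<eta>(1)[OF h(2)] sqg(1)[OF h(3)]])
  show "continuous_on (interface \<Gamma>) (\<lambda>x. \<eta> x * \<phi> x)" by (rule continuous_on_mult[OF c\<eta> h(6)])
  show "(\<lambda>x. \<eta> x * \<phi> x) \<circ> arc_map \<Gamma> i \<in> H1 {0<..<arc_len \<Gamma> i}" if "i < length \<Gamma>" for i
    by (rule product_arc[OF \<phi> \<eta>(1) that])
  fix e :: real assume "0 < e"
  \<comment> \<open>The gradient error has two parts, with factors \<open>1\<close> for
    \<open>\<eta>\<close> and \<open>M^2\<close> for its gradient; each is doubled by the square of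
    the sum.\<close>
  define e' where "e' = e / (2 + 2 * M\<^sup>2)"
  have c0: "0 < 2 + 2 * M\<^sup>2" by (simp add: add_pos_nonneg)
  have e': "0 < e'" "e' * (2 + 2 * M\<^sup>2) = e" using \<open>0 < e\<close> c0 by (auto simp: e'_def)
  have e'e: "e' \<le> e" using mult_left_mono[of 1 "2 + 2 * M\<^sup>2" e'] e' by simp
  obtain \<psi> where \<psi>: "test_function \<Omega> \<psi>" "sqn M\<^sub>\<Omega> (\<lambda>x. \<psi> x - \<phi> x) < e'"
    "sqn M\<^sub>\<Omega> (\<lambda>x. cgrad \<psi> x - grad \<Omega> \<phi> x) < e'" "sqn M\<^sub>\<Gamma> (\<lambda>x. \<psi> x - \<phi> x) < e'"
    by (rule V_approx[OF \<phi> e'(1)])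
  note t = test_function_square_integrable[OF \<psi>(1)]
  obtain C where C: "compact C" "C \<subseteq> \<Omega>" "\<And>x. x \<notin> C \<Longrightarrow> \<psi> x = 0" "\<And>x h. x \<notin> C \<Longrightarrow> frechet_derivative \<psi> (at x) h = 0"
    by (rule test_function_support[OF \<psi>(1)]) blast
  obtain B where B: "0 \<le> B" "\<And>x. \<bar>\<psi> x\<bar> \<le> B" using test_function_bounded[OF \<psi>(1)] by blast
  obtain L where L: "L-lipschitz_on UNIV \<psi>" "\<And>x. norm (cgrad \<psi> x) \<le> L" using test_function_lipschitz[OF \<psi>(1)] by blast
  have L0: "0 \<le> L" using order_trans[OF norm_ge_zero L(2)] .
  define F where "F = (\<lambda>x. \<eta> x * \<psi> x)"
  define G where "G = (\<lambda>x. \<psi> x *\<^sub>R g x + \<eta> x *\<^sub>R cgrad \<psi> x)"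
  have G0: "G x = 0" if "x \<notin> C" for x using C(3,4)[OF that] by (simp add: G_def cgrad_def)
  have GB: "AE x in lebesgue. norm (G x) \<le> B * M + 1 * L"
    using M(1)
  proof eventually_elim
    case (elim x)
    show ?case
    proof (cases "x \<in> C")
      case True
      then have x: "x \<in> \<Omega>" using C(2) by blast
      have "norm (G x) \<le> \<bar>\<psi> x\<bar> * norm (g x) + \<bar>\<eta> x\<bar> * norm (cgrad \<psi> x)"
        unfolding G_def by (rule norm_triangle_le) simp
      also have "\<dots> \<le> B * M + 1 * L"
        using elim x \<eta>1[OF x] B L(2)[of x] L0 M(2) by (intro add_mono mult_mono) auto
      finally show ?thesis .
    next
      case False
      then show ?thesis using G0 B(1) M(2) L0 by simp
    qed
  qed
  have d1: "sqn M\<^sub>\<Omega> (\<lambda>x. F x - \<eta> x * \<phi> x) \<le> e"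
    using sq\<eta>(2)[OF square_integrable_diff[OF t(1) h(3)]] \<psi>(2) e'e by (simp add: F_def right_diff_distrib)
  have d2: "sqn M\<^sub>\<Omega> (\<lambda>x. G x - (\<eta> x *\<^sub>R grad \<Omega> \<phi> x + \<phi> x *\<^sub>R g x)) \<le> e"
  proof -
    have "sqn M\<^sub>\<Omega> (\<lambda>x. \<eta> x *\<^sub>R (cgrad \<psi> x - grad \<Omega> \<phi> x) + (\<psi> x - \<phi> x) *\<^sub>R g x) \<le>
        2 * sqn M\<^sub>\<Omega> (\<lambda>x. \<eta> x *\<^sub>R (cgrad \<psi> x - grad \<Omega> \<phi> x)) + 2 * sqn M\<^sub>\<Omega> (\<lambda>x. (\<psi> x - \<phi> x) *\<^sub>R g x)"
      by (rule square_integrable_add(2)[OF sq\<eta>(1)[OF square_integrable_diff[OF t(2) h(2)]] sqg(1)[OF square_integrable_diff[OF t(1) h(3)]]])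
    also have "\<dots> \<le> 2 * e' + 2 * (M\<^sup>2 * e')"
    proof -
      have "sqn M\<^sub>\<Omega> (\<lambda>x. \<eta> x *\<^sub>R (cgrad \<psi> x - grad \<Omega> \<phi> x)) \<le> e'"
        using sq\<eta>(2)[OF square_integrable_diff[OF t(2) h(2)]] \<psi>(3) by linarith
      moreover have "M\<^sup>2 * sqn M\<^sub>\<Omega> (\<lambda>x. \<psi> x - \<phi> x) \<le> M\<^sup>2 * e'" using \<psi>(2) by (intro mult_left_mono) auto
      ultimately show ?thesis using sqg(2)[OF square_integrable_diff[OF t(1) h(3)]] by linarith
    qed
    also have "\<dots> = e" using e'(2) by (simp add: algebra_simps)
    also have "(\<lambda>x. \<eta> x *\<^sub>R (cgrad \<psi> x - grad \<Omega> \<phi> x) + (\<psi> x - \<phi> x) *\<^sub>R g x) =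
        (\<lambda>x. G x - (\<eta> x *\<^sub>R grad \<Omega> \<phi> x + \<phi> x *\<^sub>R g x))"
      by (simp add: G_def fun_eq_iff algebra_simps)
    finally show ?thesis .
  qed
  have d3: "sqn M\<^sub>\<Gamma> (\<lambda>x. F x - \<eta> x * \<phi> x) \<le> e"
  proof -
    have "sqn M\<^sub>\<Gamma> (\<lambda>x. \<eta> x * (\<psi> x - \<phi> x)) \<le> 1\<^sup>2 * sqn M\<^sub>\<Gamma> (\<lambda>x. \<psi> x - \<phi> x)"
    proof (rule square_integrable_dominated(2)[OF square_integrable_diff[OF t(3) h(5)]])
      show "(\<lambda>x. \<eta> x * (\<psi> x - \<phi> x)) \<in> borel_measurable M\<^sub>\<Gamma>"
        using square_integrable_diff[OF t(3) h(5)] continuous_interface_measurable[OF c\<eta>]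
        by (intro borel_measurable_times) (simp_all add: square_integrable_def)
      show "AE x in M\<^sub>\<Gamma>. norm (\<eta> x * (\<psi> x - \<phi> x)) \<le> 1 * norm (\<psi> x - \<phi> x)"
        using AE_interface
      proof eventually_elim
        case (elim x)
        then have "\<bar>\<eta> x\<bar> \<le> 1" using \<eta>(2) interface_closure by blast
        then show ?case by (simp add: abs_mult mult_left_le_one_le)
      qed
    qed
    then show ?thesis using \<psi>(4) e'e by (simp add: F_def right_diff_distrib)
  qed
  show "\<exists>F G K B. compact K \<and> K \<subseteq> \<Omega> \<and> continuous_on UNIV F \<and> (\<forall>x. x \<notin> K \<longrightarrow> F x = 0) \<and>
      weak_gradient \<Omega> F G \<and> (AE x in lebesgue. norm (G x) \<le> B) \<and> (\<forall>x. x \<notin> K \<longrightarrow> G x = 0) \<and> 0 \<le> B \<and>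
      sqn M\<^sub>\<Omega> (\<lambda>x. F x - \<eta> x * \<phi> x) \<le> e \<and>
      sqn M\<^sub>\<Omega> (\<lambda>x. G x - (\<eta> x *\<^sub>R grad \<Omega> \<phi> x + \<phi> x *\<^sub>R g x)) \<le> e \<and> sqn M\<^sub>\<Gamma> (\<lambda>x. F x - \<eta> x * \<phi> x) \<le> e"
  proof (rule exI[of _ F], rule exI[of _ G], rule exI[of _ C], rule exI[of _ "B * M + 1 * L"], intro conjI)
    show "continuous_on UNIV F" unfolding F_def by (rule continuous_on_mult_support[OF c open_dom \<psi>(1)])
    show "weak_gradient \<Omega> F G" unfolding F_def G_def by (rule weak_gradient_mult_test[OF w open_dom \<psi>(1)])
    show "0 \<le> B * M + 1 * L" using B(1) M(2) L0 by simp
  qed (use C G0 GB d1 d2 d3 in \<open>auto simp: F_def\<close>)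
qed

text \<open>The condition on level sets, which piecewise linear functions satisfy, is used twice: at
  height \<open>0\<close> it makes the gradient lost by truncation tend to zero, and at the heights
  \<open>t\<close> and \<open>- t\<close> it makes the truncation differentiable almost everywhere
  in spite of its kinks.\<close>

lemma lipschitz_in_V:
  assumes v: "L-lipschitz_on UNIV v" and z: "\<And>x. x \<notin> \<Omega> \<Longrightarrow> v x = 0"
    and G: "G \<in> borel_measurable lebesgue" "\<And>x. norm (G x) \<le> B"
    and d: "AE x in lebesgue. x \<in> \<Omega> \<longrightarrow> (v has_derivative (\<lambda>h. G x \<bullet> h)) (at x)"
    and lev: "\<And>t. AE x in lebesgue. x \<in> \<Omega> \<longrightarrow> v x = t \<longrightarrow> G x = 0"
  shows "v \<in> V \<Omega> \<Gamma>"
proof (rule VI_approx)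
  have cv: "continuous_on UNIV v" by (rule lipschitz_on_continuous_on[OF v])
  have B0: "0 \<le> B" using order_trans[OF norm_ge_zero G(2)] .
  have L0: "0 \<le> L" by (rule lipschitz_on_nonneg[OF v])
  have ball0: "ball 0 1 \<noteq> {}" by simp
  have mv: "v \<in> borel_measurable lebesgue" by (rule borel_measurable_lebesgue_continuous[OF cv])
  have "bounded (v ` closure \<Omega>)"
    using bounded_dom by (intro compact_imp_bounded compact_continuous_image continuous_on_subset[OF cv]) (auto simp: compact_closure)
  then obtain Bv where Bv: "Bv > 0" "\<And>x. x \<in> closure \<Omega> \<Longrightarrow> \<bar>v x\<bar> \<le> Bv" unfolding bounded_pos by auto
  have Bv': "\<bar>v x\<bar> \<le> Bv" for x using Bv z[of x] closure_subset[of \<Omega>] by (cases "x \<in> \<Omega>") auto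
  show "square_integrable M\<^sub>\<Omega> v"
    using Bv' Bv(1) measurable_restrict_space1[OF mv] by (intro square_integrable_bounded(1)[OF finite_dom, of _ Bv]) auto
  show "weak_gradient \<Omega> v G" by (rule weak_gradient_lipschitz[OF v open_dom G d])
  show sG: "square_integrable M\<^sub>\<Omega> G"
    using G B0 measurable_restrict_space1[OF G(1)] by (intro square_integrable_bounded(1)[OF finite_dom, of _ B]) auto
  show "continuous_on (interface \<Gamma>) v" by (rule continuous_on_subset[OF cv]) simp
  show "v \<circ> arc_map \<Gamma> i \<in> H1 {0<..<arc_len \<Gamma> i}" if i: "i < length \<Gamma>" for i
  proof -
    obtain d where d: "weak_gradient {0<..<arc_len \<Gamma> i} (v \<circ> arc_map \<Gamma> i) d"
      "AE s in lebesgue. s \<in> {0<..<arc_len \<Gamma> i} \<longrightarrow> \<bar>d s\<bar> \<le> L"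
      by (rule arc_lipschitz_derivative[OF i lipschitz_on_subset[OF v subset_UNIV]]) blast
    have Im: "{0<..<arc_len \<Gamma> i} \<in> sets lebesgue" by auto
    show ?thesis
    proof (rule H1I[OF _ d(1)])
      have "continuous_on {0<..<arc_len \<Gamma> i} (v \<circ> arc_map \<Gamma> i)"
        unfolding o_def by (rule continuous_on_compose2[OF cv arc_map_continuous[OF i]]) simp
      then have "(v \<circ> arc_map \<Gamma> i) \<in> borel_measurable (lebesgue_on {0<..<arc_len \<Gamma> i})"
        by (rule continuous_imp_measurable_on_sets_lebesgue[OF _ Im])
      then show "square_integrable (lebesgue_on {0<..<arc_len \<Gamma> i}) (v \<circ> arc_map \<Gamma> i)"
        using Bv' Bv(1) by (intro square_integrable_bounded(1)[OF finite_interval_measure, of _ _ Bv]) auto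
      have "AE s in lebesgue_on {0<..<arc_len \<Gamma> i}. norm (d s) \<le> L"
        unfolding AE_lebesgue_on[OF Im] using d(2) by simp
      then show "square_integrable (lebesgue_on {0<..<arc_len \<Gamma> i}) d"
        by (rule square_integrable_bounded(1)[OF finite_interval_measure
              locally_integrable_measurable[OF weak_gradient_locally_integrable(2)[OF d(1)] open_greaterThanLessThan] _ L0])
    qed
  qed
  txt \<open>The function \<open>v\<close> is approximated by its truncations \<open>sgn v * max (\<bar>v\<bar> - t) 0\<close>, which vanish near the
    boundary; \<open>I t\<close> is the part of the gradient that is lost.\<close>
  fix e :: real assume "0 < e"
  define I where "I t = (\<lambda>x. if \<bar>v x\<bar> \<le> t then G x else 0)" for t
  have Im: "I t \<in> borel_measurable M\<^sub>\<Omega>" for t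
    unfolding I_def using measurable_restrict_space1[OF G(1)] measurable_restrict_space1[OF mv] by measurable
  have lim: "(\<lambda>n. LINT x|M\<^sub>\<Omega>. (norm (I (inverse (real (Suc n))) x))\<^sup>2) \<longlonglongrightarrow> (LINT x|M\<^sub>\<Omega>. (0::real))"
  proof (rule integral_dominated_convergence[where w = "\<lambda>x. (norm (G x))\<^sup>2"])
    show "(\<lambda>x. (norm (I (inverse (real (Suc n))) x))\<^sup>2) \<in> borel_measurable M\<^sub>\<Omega>" for n
      using Im by measurable
    show "integrable M\<^sub>\<Omega> (\<lambda>x. (norm (G x))\<^sup>2)" using sG by (simp add: square_integrable_def)
    show "AE x in M\<^sub>\<Omega>. norm ((norm (I (inverse (real (Suc n))) x))\<^sup>2) \<le> (norm (G x))\<^sup>2" for n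
      by (intro AE_I2) (simp add: I_def)
    show "AE x in M\<^sub>\<Omega>. (\<lambda>n. (norm (I (inverse (real (Suc n))) x))\<^sup>2) \<longlonglongrightarrow> 0"
      unfolding AE_lebesgue_on[OF dom_sets] using lev[of 0]
    proof eventually_elim
      case (elim x)
      show ?case
      proof
        assume x: "x \<in> \<Omega>"
        show "(\<lambda>n. (norm (I (inverse (real (Suc n))) x))\<^sup>2) \<longlonglongrightarrow> 0"
        proof (cases "v x = 0")
          case True
          then show ?thesis using elim x by (simp add: I_def)
        next
          case False
          then have "\<forall>\<^sub>F n in sequentially. inverse (real (Suc n)) < \<bar>v x\<bar>"
            using order_tendstoD(2)[OF LIMSEQ_inverse_real_of_nat, of "\<bar>v x\<bar>"] by simp
          then have "\<forall>\<^sub>F n in sequentially. (norm (I (inverse (real (Suc n))) x))\<^sup>2 = 0"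
            by eventually_elim (simp add: I_def)
          then show ?thesis by (rule tendsto_eventually)
        qed
      qed
    qed
  qed simp
  have z1: "(\<lambda>n. (inverse (real (Suc n)))\<^sup>2 * (measure M\<^sub>\<Omega> (space M\<^sub>\<Omega>) + measure M\<^sub>\<Gamma> (space M\<^sub>\<Gamma>))) \<longlonglongrightarrow> 0"
    using tendsto_mult_right[OF tendsto_power[OF LIMSEQ_inverse_real_of_nat, of 2], of "measure M\<^sub>\<Omega> (space M\<^sub>\<Omega>) + measure M\<^sub>\<Gamma> (space M\<^sub>\<Gamma>)"] by simp
  have "\<forall>\<^sub>F n in sequentially. (LINT x|M\<^sub>\<Omega>. (norm (I (inverse (real (Suc n))) x))\<^sup>2) < e \<and>
      (inverse (real (Suc n)))\<^sup>2 * (measure M\<^sub>\<Omega> (space M\<^sub>\<Omega>) + measure M\<^sub>\<Gamma> (space M\<^sub>\<Gamma>)) < e"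
    using order_tendstoD(2)[OF lim, of e] order_tendstoD(2)[OF z1 \<open>0 < e\<close>] \<open>0 < e\<close> by (intro eventually_conj) auto
  then obtain n where n: "(LINT x|M\<^sub>\<Omega>. (norm (I (inverse (real (Suc n))) x))\<^sup>2) < e"
      "(inverse (real (Suc n)))\<^sup>2 * (measure M\<^sub>\<Omega> (space M\<^sub>\<Omega>) + measure M\<^sub>\<Gamma> (space M\<^sub>\<Gamma>)) < e"
    using eventually_happens'[OF sequentially_bot] by blast
  define t where "t = inverse (real (Suc n))"
  have t: "0 < t" by (simp add: t_def)
  define p where "p r = r - max (- t) (min t r)" for r :: real
  have p0: "p r = 0" if "\<bar>r\<bar> \<le> t" for r using that by (auto simp: p_def)
  have plip: "\<bar>p r - p s\<bar> \<le> \<bar>r - s\<bar>" for r s by (auto simp: p_def max_def min_def)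
  have pt: "\<bar>p r - r\<bar> \<le> t" for r using t by (auto simp: p_def max_def min_def)
  define F where "F = (\<lambda>x. p (v x))"
  define F' where "F' = (\<lambda>x. if t < \<bar>v x\<bar> then G x else 0)"
  \<comment> \<open>The support of the truncation is bounded and closed, and it lies in
    \<open>\<Omega>\<close> because \<open>v\<close> vanishes outside while \<open>t\<close> is
    positive.\<close>
  define C where "C = {x. t \<le> \<bar>v x\<bar>}"
  have C\<Omega>: "C \<subseteq> \<Omega>"
  proof
    fix x assume x: "x \<in> C"
    show "x \<in> \<Omega>"
    proof (rule ccontr)
      assume "x \<notin> \<Omega>"
      then show False using z[of x] x t by (simp add: C_def)
    qed
  qed
  have cC: "compact C"
    unfolding compact_eq_bounded_closed
  proof
    show "bounded C" by (rule bounded_subset[OF bounded_dom C\<Omega>])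
    have "closed {x. (\<lambda>x. t) x \<le> (\<lambda>x. \<bar>v x\<bar>) x}" by (intro closed_Collect_le continuous_intros cv)
    then show "closed C" by (simp add: C_def)
  qed
  have lF: "L-lipschitz_on UNIV F"
  proof (rule lipschitz_onI[OF _ L0])
    fix x y
    show "dist (F x) (F y) \<le> L * dist x y"
      using order_trans[OF plip lipschitz_onD[OF v, of x y, unfolded dist_real_def]] by (simp add: F_def dist_real_def)
  qed
  have mF': "F' \<in> borel_measurable lebesgue" unfolding F'_def using G(1) mv by measurable
  have nF': "norm (F' x) \<le> B" for x using G(2) B0 by (simp add: F'_def)
  have wF: "weak_gradient \<Omega> F F'"
  proof (rule weak_gradient_lipschitz[OF lF open_dom mF' nF'])
    show "AE x in lebesgue. x \<in> \<Omega> \<longrightarrow> (F has_derivative (\<lambda>h. F' x \<bullet> h)) (at x)"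
      using d lev[of t] lev[of "- t"]
    proof eventually_elim
      case (elim x)
      show ?case
      proof
        assume x: "x \<in> \<Omega>"
        have dv: "(v has_derivative (\<lambda>h. G x \<bullet> h)) (at x)" using elim(1) x by blast
        consider "t < v x" | "v x < - t" | "\<bar>v x\<bar> < t" | "\<bar>v x\<bar> = t" by linarith
        then show "(F has_derivative (\<lambda>h. F' x \<bullet> h)) (at x)"
        proof cases
          case 1
          have "((\<lambda>x. v x - t) has_derivative (\<lambda>h. G x \<bullet> h)) (at x)" using has_derivative_diff[OF dv has_derivative_const] by simp
          moreover have "open {y. t < v y}" by (intro open_Collect_less continuous_intros cv)
          moreover have "x \<in> {y. t < v y}" using 1 by simp
          moreover have "v y - t = F y" if "y \<in> {y. t < v y}" for y using that t by (simp add: F_def p_def)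
          ultimately have "(F has_derivative (\<lambda>h. G x \<bullet> h)) (at x)"
            by (rule has_derivative_transform_within_open)
          then show ?thesis using 1 t by (simp add: F'_def)
        next
          case 2
          have "((\<lambda>x. v x + t) has_derivative (\<lambda>h. G x \<bullet> h)) (at x)" using has_derivative_add[OF dv has_derivative_const] by simp
          moreover have "open {y. v y < - t}" by (intro open_Collect_less continuous_intros cv)
          moreover have "x \<in> {y. v y < - t}" using 2 by simp
          moreover have "v y + t = F y" if "y \<in> {y. v y < - t}" for y using that t by (simp add: F_def p_def)
          ultimately have "(F has_derivative (\<lambda>h. G x \<bullet> h)) (at x)"
            by (rule has_derivative_transform_within_open)
          then show ?thesis using 2 t by (simp add: F'_def)
        next
          case 3
          have "open {y. \<bar>v y\<bar> < t}" by (intro open_Collect_less continuous_intros cv)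
          moreover have "x \<in> {y. \<bar>v y\<bar> < t}" using 3 by simp
          moreover have "0 = F y" if "y \<in> {y. \<bar>v y\<bar> < t}" for y using that p0[of "v y"] by (simp add: F_def)
          ultimately have "(F has_derivative (\<lambda>h. 0)) (at x)"
            by (rule has_derivative_transform_within_open[OF has_derivative_const])
          then show ?thesis using 3 by (simp add: F'_def)
        next
          \<comment> \<open>The kink of the truncation. The gradient of \<open>v\<close> vanishes
            here, and \<open>p\<close> does not increase distances, so the derivative of
            \<open>F\<close> is zero too.\<close>
          case 4
          then have "G x = 0" using elim(2,3) x by (auto simp: abs_if split: if_splits)
          then have dv0: "(v has_derivative (\<lambda>h. 0)) (at x)" using dv by simp
          have "(F has_derivative (\<lambda>h. 0)) (at x)"
            unfolding has_derivative_at_alt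
          proof (intro conjI allI impI)
            fix e :: real assume "0 < e"
            then obtain d where d: "d > 0" "\<And>y. norm (y - x) < d \<Longrightarrow> norm (v y - v x - 0) \<le> e * norm (y - x)"
              using dv0 unfolding has_derivative_at_alt by blast
            show "\<exists>d>0. \<forall>y. norm (y - x) < d \<longrightarrow> norm (F y - F x - 0) \<le> e * norm (y - x)"
            proof (intro exI[of _ d] conjI allI impI d(1))
              fix y assume "norm (y - x) < d"
              then have "\<bar>v y - v x\<bar> \<le> e * norm (y - x)" using d(2)[of y] by simp
              then show "norm (F y - F x - 0) \<le> e * norm (y - x)" using plip[of "v y" "v x"] by (simp add: F_def)
            qed
          qed simp
          then show ?thesis using 4 by (simp add: F'_def)
        qed
      qed
    qed
  qed
  have cF: "continuous_on UNIV F" by (rule lipschitz_on_continuous_on[OF lF])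
  have msp: "0 \<le> measure M\<^sub>\<Omega> (space M\<^sub>\<Omega>)" "0 \<le> measure M\<^sub>\<Gamma> (space M\<^sub>\<Gamma>)" by simp_all
  have cd: "continuous_on UNIV (\<lambda>x. F x - v x)" by (intro continuous_intros cF cv)
  have b1: "sqn M\<^sub>\<Omega> (\<lambda>x. F x - v x) \<le> t\<^sup>2 * measure M\<^sub>\<Omega> (space M\<^sub>\<Omega>)"
    using pt t measurable_restrict_space1[OF borel_measurable_lebesgue_continuous[OF cd]]
    by (intro square_integrable_bounded(2)[OF finite_dom]) (auto simp: F_def)
  have b2: "sqn M\<^sub>\<Gamma> (\<lambda>x. F x - v x) \<le> t\<^sup>2 * measure M\<^sub>\<Gamma> (space M\<^sub>\<Gamma>)"
    using pt t continuous_interface_measurable[OF continuous_on_subset[OF cd]]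
    by (intro square_integrable_bounded(2)[OF finite_arc_length]) (auto simp: F_def)
  have n2: "t\<^sup>2 * measure M\<^sub>\<Omega> (space M\<^sub>\<Omega>) + t\<^sup>2 * measure M\<^sub>\<Gamma> (space M\<^sub>\<Gamma>) < e"
    using n(2) by (simp only: t_def distrib_left)
  have t2: "0 \<le> t\<^sup>2 * measure M\<^sub>\<Omega> (space M\<^sub>\<Omega>)" "0 \<le> t\<^sup>2 * measure M\<^sub>\<Gamma> (space M\<^sub>\<Gamma>)" by simp_all
  have e1: "sqn M\<^sub>\<Omega> (\<lambda>x. F x - v x) \<le> e" "sqn M\<^sub>\<Gamma> (\<lambda>x. F x - v x) \<le> e" using b1 b2 n2 t2 by linarith+
  have "(\<lambda>x. norm (F' x - G x)) = (\<lambda>x. norm (I t x))" by (auto simp: F'_def I_def fun_eq_iff)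
  then have e2: "sqn M\<^sub>\<Omega> (\<lambda>x. F' x - G x) \<le> e"
    using n(1) unfolding sqn_def t_def by (simp add: fun_eq_iff)
  show "\<exists>F G' K B. compact K \<and> K \<subseteq> \<Omega> \<and> continuous_on UNIV F \<and> (\<forall>x. x \<notin> K \<longrightarrow> F x = 0) \<and>
      weak_gradient \<Omega> F G' \<and> (AE x in lebesgue. norm (G' x) \<le> B) \<and> (\<forall>x. x \<notin> K \<longrightarrow> G' x = 0) \<and> 0 \<le> B \<and>
      sqn M\<^sub>\<Omega> (\<lambda>x. F x - v x) \<le> e \<and> sqn M\<^sub>\<Omega> (\<lambda>x. G' x - G x) \<le> e \<and> sqn M\<^sub>\<Gamma> (\<lambda>x. F x - v x) \<le> e"
    by (rule exI[of _ F], rule exI[of _ F'], rule exI[of _ C], rule exI[of _ B], intro conjI)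
      (use cC C\<Omega> cF wF nF' B0 e1 e2 p0 in \<open>auto simp: F_def F'_def C_def\<close>)
qed

end

section \<open>Geometry of the mesh\<close>

text \<open>The mesh determines only the closure of the domain;
  \<open>interior (closure \<Omega>) = \<Omega>\<close> is what places the interiors of the
  triangles in \<open>\<Omega>\<close>.\<close>

locale mesh_domain = domain_interface +
  fixes \<gamma> H :: real and \<T> :: "(real^2) set set"
  assumes regular_dom: "interior (closure \<Omega>) = \<Omega>" and mesh: "mesh \<Omega> \<gamma> H \<T>"
begin

lemma H_pos: "0 < H" using mesh by (simp add: mesh_def)

lemma finite_mesh: "finite \<T>" using mesh by (simp add: mesh_def triangulation_def)

lemma Union_mesh: "\<Union>\<T> = closure \<Omega>" using mesh by (simp add: mesh_def)

lemma triangle: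
  assumes "T \<in> \<T>"
  shows "2 simplex T" "compact T" "closed T" "convex T" "interior T \<noteq> {}" "closure (interior T) = T"
    "T \<subseteq> closure \<Omega>" "interior T \<subseteq> \<Omega>" "negligible (frontier T)"
proof -
  show s: "2 simplex T" using mesh assms by (simp add: mesh_def)
  show "compact T" "closed T" "convex T" by (rule compact_simplex[OF s] closed_simplex[OF s] convex_simplex[OF s])+
  have "aff_dim T = int (DIM(real^2))" using aff_dim_simplex[OF s] by simp
  then have "affine hull T = UNIV" by (rule aff_dim_eq_full[THEN iffD1])
  then have "rel_interior T = interior T" by (rule rel_interior_interior)
  moreover have "T \<noteq> {}" using s by auto
  ultimately show i: "interior T \<noteq> {}" using rel_interior_eq_empty[OF \<open>convex T\<close>] by simp
  show "closure (interior T) = T" using convex_closure_interior[OF \<open>convex T\<close> i] \<open>closed T\<close> by simp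
  show sub: "T \<subseteq> closure \<Omega>" using assms Union_mesh by blast
  then show "interior T \<subseteq> \<Omega>" using interior_mono[OF sub] regular_dom by simp
  show "negligible (frontier T)" by (rule negligible_convex_frontier[OF \<open>convex T\<close>])
qed

text \<open>A proper face misses the interior. If the common face is all of \<open>T\<close>, then
  it is a proper face of \<open>T'\<close>, hence misses the interior of \<open>T'\<close>, which
  contains that of \<open>T\<close>.\<close>

lemma interior_disjoint:
  assumes "T \<in> \<T>" "T' \<in> \<T>" "T \<noteq> T'"
  shows "interior T \<inter> T' = {}"
proof -
  have f: "(T \<inter> T') face_of T" "(T' \<inter> T) face_of T'"
    using mesh assms by (auto simp: mesh_def triangulation_def)
  show ?thesis
  proof (cases "T \<inter> T' = T")
    case False
    have "(T \<inter> T') \<inter> interior T = {}" by (rule face_of_disjoint_interior[OF f(1) False])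
    then show ?thesis using interior_subset[of T] by blast
  next
    case True
    then have "T' \<inter> T \<noteq> T'" using assms(3) by blast
    then have "(T' \<inter> T) \<inter> interior T' = {}" by (rule face_of_disjoint_interior[OF f(2)])
    moreover have "interior T \<subseteq> interior T'" using True by (intro interior_mono) blast
    moreover have "interior T \<subseteq> T' \<inter> T" using True interior_subset[of T] by blast
    ultimately have "interior T = {}" by blast
    then show ?thesis using triangle(5)[OF assms(1)] by simp
  qed
qed

lemma triangle_dist:
  assumes "T \<in> \<T>" "x \<in> T" "y \<in> T"
  shows "dist x y \<le> H"
proof -
  have "dist x y \<le> diameter T"
    using assms triangle(2)[OF assms(1)] by (intro diameter_bounded_bound) (auto simp: compact_imp_bounded)
  also have "\<dots> \<le> H" using mesh assms(1) by (simp add: mesh_def)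
  finally show ?thesis .
qed

text \<open>The incircle diameter is at least \<open>H / \<gamma>\<close>. One factor 2 stays
  strictly below the supremum that defines it, the other passes from diameter to radius.\<close>

lemma inscribed_ball:
  assumes T: "T \<in> \<T>"
  obtains x where "ball x (H / (4 * \<gamma>)) \<subseteq> interior T" "0 < \<gamma>"
proof -
  let ?S = "{2 * r |r x. 0 \<le> r \<and> cball x r \<subseteq> T}"
  obtain x0 where "x0 \<in> interior T" using triangle(5)[OF T] by blast
  then obtain r0 where r0: "r0 > 0" "cball x0 r0 \<subseteq> T" unfolding mem_interior_cball by blast
  \<comment> \<open>A disc of radius \<open>r\<close> in \<open>T\<close> contains two points at
    distance \<open>r\<close>, so the mesh size bounds the set and its supremum is
    meaningful.\<close>
  have bdd: "bdd_above ?S"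
  proof (rule bdd_aboveI)
    fix s assume "s \<in> ?S"
    then obtain r x where s: "s = 2 * r" "0 \<le> r" "cball x r \<subseteq> T" by blast
    obtain b :: "real^2" where b: "b \<in> Basis" using nonempty_Basis by blast
    have "x \<in> T" "x + r *\<^sub>R b \<in> T" using s b by (auto simp: dist_norm subset_iff)
    then have "r \<le> H" using triangle_dist[OF T, of x "x + r *\<^sub>R b"] s(2) b by (simp add: dist_norm)
    then show "s \<le> 2 * H" using s(1) by simp
  qed
  have "2 * r0 \<le> Sup ?S" using r0 by (intro cSup_upper bdd) auto
  then have pos: "0 < incircle_diameter T" using r0(1) by (simp add: incircle_diameter_def)
  have le: "H / incircle_diameter T \<le> \<gamma>" using mesh T by (simp add: mesh_def)
  moreover have "0 < H / incircle_diameter T" using pos H_pos by simp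
  ultimately have \<gamma>: "0 < \<gamma>" by linarith
  have "H / \<gamma> \<le> incircle_diameter T" using le pos \<gamma> by (simp add: field_simps)
  moreover have "H / (2 * \<gamma>) < H / \<gamma>" using H_pos \<gamma> by (simp add: field_simps)
  ultimately have "H / (2 * \<gamma>) < Sup ?S" by (simp add: incircle_diameter_def)
  moreover have "?S \<noteq> {}" using r0 by (intro notI) (auto dest: less_imp_le)
  ultimately obtain s where "s \<in> ?S" "H / (2 * \<gamma>) < s" using less_cSup_iff[OF _ bdd] by blast
  then obtain r x where r: "H / (2 * \<gamma>) < 2 * r" "cball x r \<subseteq> T" by blast
  have "H / (4 * \<gamma>) = H / (2 * \<gamma>) / 2" by simp
  then have "H / (4 * \<gamma>) \<le> r" using r(1) by linarith
  then have "ball x (H / (4 * \<gamma>)) \<subseteq> T" using r(2) by (auto simp: subset_iff)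
  then have "ball x (H / (4 * \<gamma>)) \<subseteq> interior T" by (intro interior_maximal) auto
  then show ?thesis using that \<gamma> by blast
qed

text \<open>Comparison of areas: the neighbours contain disjoint discs of radius
  \<open>H / (4 * \<gamma>)\<close>, all inside one disc of radius \<open>2 * H\<close>. The ratio
  of the areas is \<open>(8 * \<gamma>)^2\<close>.\<close>

lemma card_neighbours:
  assumes T: "T \<in> \<T>"
  shows "real (card {T' \<in> \<T>. T' \<inter> T \<noteq> {}}) \<le> 64 * \<gamma>\<^sup>2"
proof -
  let ?N = "{T' \<in> \<T>. T' \<inter> T \<noteq> {}}"
  have fin: "finite ?N" using finite_mesh by simp
  have \<gamma>: "0 < \<gamma>" by (rule inscribed_ball[OF T])
  define \<rho> where "\<rho> = H / (4 * \<gamma>)"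
  have \<rho>: "0 < \<rho>" using H_pos \<gamma> by (simp add: \<rho>_def)
  have "\<forall>T'. \<exists>x. T' \<in> \<T> \<longrightarrow> ball x \<rho> \<subseteq> interior T'"
    using inscribed_ball unfolding \<rho>_def by metis
  from choice[OF this] obtain c where c: "\<And>T'. T' \<in> \<T> \<Longrightarrow> ball (c T') \<rho> \<subseteq> interior T'" by blast
  obtain z where z: "z \<in> T" using triangle(5)[OF T] interior_subset by blast
  have sub: "ball (c T') \<rho> \<subseteq> cball z (2 * H)" if T': "T' \<in> ?N" for T'
  proof
    fix w assume "w \<in> ball (c T') \<rho>"
    then have w: "w \<in> T'" using c[of T'] T' interior_subset by blast
    obtain y where y: "y \<in> T'" "y \<in> T" using T' by blast
    have "dist z w \<le> dist z y + dist y w" by (rule dist_triangle)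
    also have "\<dots> \<le> H + H" using triangle_dist[OF T z y(2)] triangle_dist[OF _ y(1) w] T' by (intro add_mono) auto
    finally show "w \<in> cball z (2 * H)" by simp
  qed
  have dis: "pairwise (\<lambda>T1 T2. disjnt (ball (c T1) \<rho>) (ball (c T2) \<rho>)) ?N"
    unfolding pairwise_def disjnt_def
  proof (intro ballI impI)
    fix T1 T2 assume "T1 \<in> ?N" "T2 \<in> ?N" "T1 \<noteq> T2"
    then show "ball (c T1) \<rho> \<inter> ball (c T2) \<rho> = {}"
      using interior_disjoint[of T1 T2] c[of T1] c[of T2] interior_subset[of T2] by blast
  qed
  have "measure lebesgue (\<Union>T'\<in>?N. ball (c T') \<rho>) = (\<Sum>T'\<in>?N. measure lebesgue (ball (c T') \<rho>))"
    by (rule measure_UNION'[OF fin _ dis]) simp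
  also have "\<dots> = real (card ?N) * (unit_ball_vol 2 * \<rho>\<^sup>2)"
    using \<rho> by (simp add: content_ball)
  finally have eq: "measure lebesgue (\<Union>T'\<in>?N. ball (c T') \<rho>) = real (card ?N) * (unit_ball_vol 2 * \<rho>\<^sup>2)" .
  have "measure lebesgue (\<Union>T'\<in>?N. ball (c T') \<rho>) \<le> measure lebesgue (cball z (2 * H))"
    using sub fin by (intro measure_mono_fmeasurable) (auto intro!: sets.finite_UN)
  also have "\<dots> = unit_ball_vol 2 * (2 * H)\<^sup>2" using H_pos by (simp add: content_cball)
  finally have "unit_ball_vol 2 * (real (card ?N) * \<rho>\<^sup>2) \<le> unit_ball_vol 2 * (2 * H)\<^sup>2"
    by (simp only: eq mult.left_commute)
  then have "real (card ?N) * \<rho>\<^sup>2 \<le> (2 * H)\<^sup>2"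
    using unit_ball_vol_pos[of 2] by (simp add: mult_le_cancel_left_pos)
  then have "real (card ?N) * H\<^sup>2 \<le> (64 * \<gamma>\<^sup>2) * H\<^sup>2"
    using \<gamma> unfolding \<rho>_def by (simp add: power_divide power_mult_distrib field_simps)
  then show ?thesis using H_pos by (simp add: mult_le_cancel_right)
qed

section \<open>Layers of triangles around a given one\<close>

abbreviation P :: "(real^2) set \<Rightarrow> nat \<Rightarrow> (real^2) set" where "P T k \<equiv> patch_iter \<T> k T"

lemma P_0 [simp]: "P T 0 = T" by (simp add: patch_iter_def)

lemma P_Suc: "P T (Suc k) = \<Union>{T' \<in> \<T>. T' \<inter> P T k \<noteq> {}}" by (simp add: patch_iter_def patch_def)

lemma subset_P_Suc: "T' \<in> \<T> \<Longrightarrow> T' \<inter> P T k \<noteq> {} \<Longrightarrow> T' \<subseteq> P T (Suc k)"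
  unfolding P_Suc by blast

lemma P_closure: "T \<in> \<T> \<Longrightarrow> P T k \<subseteq> closure \<Omega>"
  using triangle(7) by (cases k) (auto simp: P_Suc)

lemma triangle_of_point:
  assumes "x \<in> closure \<Omega>"
  obtains T where "T \<in> \<T>" "x \<in> T"
  using assms unfolding Union_mesh[symmetric] by blast

lemma P_mono_Suc:
  assumes "T \<in> \<T>"
  shows "P T k \<subseteq> P T (Suc k)"
proof
  fix x assume x: "x \<in> P T k"
  then have "x \<in> closure \<Omega>" using P_closure[OF assms] by blast
  then obtain T' where "T' \<in> \<T>" "x \<in> T'" by (rule triangle_of_point)
  then show "x \<in> P T (Suc k)" using x subset_P_Suc[of T' k T] by blast
qed

lemma P_mono:
  assumes "T \<in> \<T>" "j \<le> k"
  shows "P T j \<subseteq> P T k"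
  using assms(2) by (induction k rule: dec_induct) (use P_mono_Suc[OF assms(1)] in blast)+

lemma closed_P: "T \<in> \<T> \<Longrightarrow> closed (P T k)"
  using triangle(3) finite_mesh by (cases k) (auto simp: P_Suc intro!: closed_Union)

text \<open>The triangles that do not contain \<open>x\<close> are finitely many closed sets, so
  near \<open>x\<close> only triangles through \<open>x\<close> occur, and these belong to the next
  layer. \<open>x\<close> has to lie in \<open>\<Omega>\<close>, since on the boundary the triangles
  do not form a neighbourhood.\<close>

lemma P_nbhd:
  assumes T: "T \<in> \<T>" and x: "x \<in> \<Omega>" "x \<in> P T k"
  shows "x \<in> interior (P T (Suc k))"
proof -
  let ?D = "\<Union>{T' \<in> \<T>. x \<notin> T'}"
  have "closed ?D" using finite_mesh triangle(3) by (intro closed_Union) auto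
  then have "open (\<Omega> - ?D)" using open_dom by (rule open_Diff[rotated])
  moreover have "\<Omega> - ?D \<subseteq> P T (Suc k)"
  proof
    fix y assume y: "y \<in> \<Omega> - ?D"
    then have "y \<in> closure \<Omega>" using closure_subset by blast
    then obtain T' where T': "T' \<in> \<T>" "y \<in> T'" by (rule triangle_of_point)
    then have "x \<in> T'" using y by blast
    then show "y \<in> P T (Suc k)" using T' x(2) subset_P_Suc[of T' k T] by blast
  qed
  ultimately show ?thesis using x(1) by (intro interiorI[of "\<Omega> - ?D"]) auto
qed

text \<open>A triangle through a point outside layer \<open>k + 1\<close> cannot meet layer
  \<open>k\<close>. The union of such triangles is closed, so it absorbs the closure in
  \<open>far\<close>, at the price of one layer.\<close>

lemma far_subset: "far \<Omega> \<T> (Suc k) T \<subseteq> \<Union>{T' \<in> \<T>. T' \<inter> P T k = {}}"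
proof -
  have "\<Omega> - P T (Suc k) \<subseteq> \<Union>{T' \<in> \<T>. T' \<inter> P T k = {}}"
  proof
    fix x assume x: "x \<in> \<Omega> - P T (Suc k)"
    then have "x \<in> closure \<Omega>" using closure_subset by blast
    then obtain T' where T': "T' \<in> \<T>" "x \<in> T'" by (rule triangle_of_point)
    then have "T' \<inter> P T k = {}" using x subset_P_Suc[of T' k T] by blast
    then show "x \<in> \<Union>{T' \<in> \<T>. T' \<inter> P T k = {}}" using T' by blast
  qed
  then show ?thesis
    unfolding far_def using finite_mesh triangle(3) by (intro closure_minimal closed_Union) auto
qed

text \<open>Only the interior of \<open>T'\<close> is sure to lie in \<open>\<Omega>\<close>; the
  rest of \<open>T'\<close> is reached by the closure in \<open>far\<close>.\<close>

lemma subset_far: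
  assumes "T' \<in> \<T>" "T' \<inter> P T k = {}"
  shows "T' \<subseteq> far \<Omega> \<T> k T"
proof -
  have "interior T' \<subseteq> \<Omega> - P T k" using triangle(8)[OF assms(1)] assms(2) interior_subset by blast
  then have "closure (interior T') \<subseteq> closure (\<Omega> - P T k)" by (rule closure_mono)
  then show ?thesis using triangle(6)[OF assms(1)] by (simp add: far_def)
qed

lemma far_mono: "T \<in> \<T> \<Longrightarrow> j \<le> k \<Longrightarrow> far \<Omega> \<T> k T \<subseteq> far \<Omega> \<T> j T"
  unfolding far_def by (rule closure_mono, rule Diff_mono[OF order_refl], rule P_mono)

lemma closed_far: "closed (far \<Omega> \<T> k T)" by (simp add: far_def)

text \<open>The segment between two points may cross many triangles and leave
  \<open>\<Omega>\<close>. Its parameter interval is covered by finitely many closed sets, the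
  preimages of the triangles and of the complement of \<open>\<Omega>\<close>, and a Lipschitz bound
  on each of them passes to the interval.\<close>

lemma VH_lipschitz:
  assumes v: "v \<in> VH \<Omega> \<T>" and ab: "\<And>T x. T \<in> \<T> \<Longrightarrow> x \<in> T \<Longrightarrow> v x = a T \<bullet> x + b T"
  defines "L \<equiv> \<Sum>T\<in>\<T>. norm (a T)"
  shows "L-lipschitz_on UNIV v"
proof (rule lipschitz_onI)
  show L0: "0 \<le> L" by (simp add: L_def sum_nonneg)
  have out: "\<And>x. x \<notin> \<Omega> \<Longrightarrow> v x = 0" using v by (auto simp: VH_def)
  have La: "norm (a T) \<le> L" if "T \<in> \<T>" for T
    unfolding L_def by (rule member_le_sum[OF that _ finite_mesh]) simp
  fix x y :: "real^2"
  define p where "p t = x + t *\<^sub>R (y - x)" for t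
  have cp: "continuous_on UNIV p" unfolding p_def by (intro continuous_intros)
  have pd: "p s - p t = (s - t) *\<^sub>R (y - x)" for s t by (simp add: p_def algebra_simps)
  define U where "U T = p -` T" for T
  have "(L * dist x y)-lipschitz_on {0..1} (\<lambda>t. v (p t))"
  proof (rule lipschitz_on_closed_Union[where I = "insert (- \<Omega>) \<T>" and U = U])
    fix T assume T: "T \<in> insert (- \<Omega>) \<T>"
    have "closed T" using T triangle(3) open_dom by auto
    then show "closed (U T)" unfolding U_def using cp by (intro closed_vimage) auto
    show "(L * dist x y)-lipschitz_on (U T) (\<lambda>t. v (p t))"
    proof (rule lipschitz_onI)
      fix s t assume st: "s \<in> U T" "t \<in> U T"
      show "dist (v (p s)) (v (p t)) \<le> L * dist x y * dist s t"
      proof (cases "T \<in> \<T>")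
        case True
        have "v (p s) - v (p t) = a T \<bullet> (p s - p t)"
          using st ab[OF True] by (simp add: U_def inner_diff_right)
        then have "\<bar>v (p s) - v (p t)\<bar> \<le> norm (a T) * norm (p s - p t)" by (simp add: Cauchy_Schwarz_ineq2)
        also have "\<dots> \<le> L * norm (p s - p t)" using La[OF True] by (intro mult_right_mono) auto
        also have "\<dots> = L * dist x y * dist s t" by (simp add: pd dist_norm norm_minus_commute)
        finally show ?thesis by (simp add: dist_real_def)
      next
        case False
        then have "T = - \<Omega>" using T by blast
        then have "v (p s) = 0" "v (p t) = 0" using st out by (auto simp: U_def)
        then show ?thesis using L0 by simp
      qed
    qed (use L0 in simp)
  next
    show "finite (insert (- \<Omega>) \<T>)" using finite_mesh by simp
    show "0 \<le> L * dist x y" using L0 by simp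
    have "UNIV \<subseteq> - \<Omega> \<union> \<Union>\<T>" unfolding Union_mesh using closure_subset by blast
    then show "{0..1} \<subseteq> (\<Union>i\<in>insert (- \<Omega>) \<T>. U i)" unfolding U_def by blast
  qed
  from lipschitz_onD[OF this, of 0 1] show "dist (v x) (v y) \<le> L * dist x y" by (simp add: p_def)
qed

text \<open>Off the triangle boundaries, a null set, \<open>v\<close> is locally affine, which gives
  an explicit gradient. The level set condition of \<open>lipschitz_in_V\<close> holds because a
  level set of an affine function with nonzero slope is a line.\<close>

lemma VH_subset_V: "VH \<Omega> \<T> \<subseteq> V \<Omega> \<Gamma>"
proof
  fix v assume v: "v \<in> VH \<Omega> \<T>"
  then have "\<forall>T. \<exists>ab. T \<in> \<T> \<longrightarrow> (\<forall>x\<in>T. v x = fst ab \<bullet> x + snd ab)"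
    by (auto simp: VH_def)
  from choice[OF this] obtain ab where "\<And>T x. T \<in> \<T> \<Longrightarrow> x \<in> T \<Longrightarrow> v x = fst (ab T) \<bullet> x + snd (ab T)" by blast
  then obtain a b where ab: "\<And>T x. T \<in> \<T> \<Longrightarrow> x \<in> T \<Longrightarrow> v x = a T \<bullet> x + b T"
    by (intro that[of "fst \<circ> ab" "snd \<circ> ab"]) simp
  define L where "L = (\<Sum>T\<in>\<T>. norm (a T))"
  have lip: "L-lipschitz_on UNIV v" unfolding L_def by (rule VH_lipschitz[OF v ab])
  define G where "G x = (\<Sum>T\<in>\<T>. indicator (interior T) x *\<^sub>R a T)" for x
  have Gm: "G \<in> borel_measurable lebesgue"
    unfolding G_def by (intro borel_measurable_sum borel_measurable_scaleR borel_measurable_indicator) auto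
  have GL: "norm (G x) \<le> L" for x
    unfolding G_def L_def by (intro sum_norm_le) (auto simp: indicator_def)
  have GT: "G x = a T" if "T \<in> \<T>" "x \<in> interior T" for x T
  proof -
    have "indicator (interior T') x *\<^sub>R a T' = (if T' = T then a T' else 0)" if "T' \<in> \<T>" for T'
      using that interior_disjoint[OF that \<open>T \<in> \<T>\<close>] \<open>x \<in> interior T\<close> interior_subset[of T] by (auto simp: indicator_def)
    then have "G x = (\<Sum>T'\<in>\<T>. if T' = T then a T' else 0)" unfolding G_def by (intro sum.cong) auto
    then show ?thesis using finite_mesh that(1) by simp
  qed
  have neg: "(\<Union>T\<in>\<T>. frontier T) \<in> null_sets lebesgue"
  proof -
    have "negligible (\<Union>T\<in>\<T>. frontier T)"
      by (rule negligible_Union) (use triangle(9) finite_mesh in auto)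
    then show ?thesis by (simp only: negligible_iff_null_sets)
  qed
  have ae: "AE x in lebesgue. x \<in> \<Omega> \<longrightarrow> (\<exists>T\<in>\<T>. x \<in> interior T)"
    using AE_not_in[OF neg]
  proof eventually_elim
    case (elim x)
    show ?case
    proof
      assume "x \<in> \<Omega>"
      then obtain T where "T \<in> \<T>" "x \<in> T" using Union_mesh closure_subset by blast
      then show "\<exists>T\<in>\<T>. x \<in> interior T" using elim triangle(3)[of T] by (auto simp: frontier_def)
    qed
  qed
  show "v \<in> V \<Omega> \<Gamma>"
  proof (rule lipschitz_in_V[OF lip _ Gm GL])
    show "v x = 0" if "x \<notin> \<Omega>" for x using v that by (auto simp: VH_def)
    show "AE x in lebesgue. x \<in> \<Omega> \<longrightarrow> (v has_derivative (\<lambda>h. G x \<bullet> h)) (at x)"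
      using ae
    proof eventually_elim
      case (elim x)
      show ?case
      proof
        assume "x \<in> \<Omega>"
        then obtain T where T: "T \<in> \<T>" "x \<in> interior T" using elim by blast
        have "((\<lambda>x. a T \<bullet> x + b T) has_derivative (\<lambda>h. a T \<bullet> h)) (at x)" by (auto intro!: derivative_eq_intros)
        moreover have "a T \<bullet> y + b T = v y" if "y \<in> interior T" for y using ab[OF T(1), of y] subsetD[OF interior_subset that] by simp
        ultimately have "(v has_derivative (\<lambda>h. a T \<bullet> h)) (at x)"
          by (rule has_derivative_transform_within_open[OF _ open_interior T(2)])
        then show "(v has_derivative (\<lambda>h. G x \<bullet> h)) (at x)" using GT[OF T] by simp
      qed
    qed
    fix t
    have "negligible (\<Union>T\<in>{T\<in>\<T>. a T \<noteq> 0}. {x. a T \<bullet> x = t - b T})"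
    proof (rule negligible_Union)
      show "finite ((\<lambda>T. {x. a T \<bullet> x = t - b T}) ` {T \<in> \<T>. a T \<noteq> 0})" using finite_mesh by simp
      fix S assume "S \<in> (\<lambda>T. {x. a T \<bullet> x = t - b T}) ` {T \<in> \<T>. a T \<noteq> 0}"
      then obtain T where "a T \<noteq> 0" "S = {x. a T \<bullet> x = t - b T}" by blast
      then show "negligible S" using negligible_hyperplane[of "a T" "t - b T"] by simp
    qed
    then have n: "(\<Union>T\<in>{T\<in>\<T>. a T \<noteq> 0}. {x. a T \<bullet> x = t - b T}) \<in> null_sets lebesgue"
      by (simp only: negligible_iff_null_sets)
    show "AE x in lebesgue. x \<in> \<Omega> \<longrightarrow> v x = t \<longrightarrow> G x = 0"
      using ae AE_not_in[OF n]
    proof eventually_elim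
      case (elim x)
      show ?case
      proof (intro impI)
        assume "x \<in> \<Omega>" "v x = t"
        then obtain T where T: "T \<in> \<T>" "x \<in> interior T" using elim(1) by blast
        have "v x = a T \<bullet> x + b T" using ab[OF T(1), of x] subsetD[OF interior_subset T(2)] by simp
        then have "a T \<bullet> x = t - b T" using \<open>v x = t\<close> by simp
        then have "a T = 0" using elim(2) T(1) by auto
        then show "G x = 0" using GT[OF T] by simp
      qed
    qed
  qed
qed

end

section \<open>Energies\<close>

text \<open>The set enters through an indicator, so one measure serves for all sets and coverings
  become pointwise inequalities between indicators.\<close>

definition sqn_on :: "'a measure \<Rightarrow> ('a \<Rightarrow> 'b::euclidean_space) \<Rightarrow> 'a set \<Rightarrow> real" where
  "sqn_on M f S = (LINT x|M. indicator S x * (norm (f x))\<^sup>2)"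

lemma sqn_on_integrable:
  fixes f :: "'a \<Rightarrow> 'b::euclidean_space"
  assumes f: "square_integrable M f" and S: "(indicator S :: 'a \<Rightarrow> real) \<in> borel_measurable M"
  shows "integrable M (\<lambda>x. indicator S x * (norm (f x))\<^sup>2)"
proof (rule Bochner_Integration.integrable_bound)
  show "integrable M (\<lambda>x. (norm (f x))\<^sup>2)" using f by (simp add: square_integrable_def)
  show "(\<lambda>x. indicator S x * (norm (f x))\<^sup>2) \<in> borel_measurable M"
    using f S by (intro borel_measurable_times borel_measurable_power borel_measurable_norm) (auto simp: square_integrable_def)
qed (intro AE_I2, auto simp: indicator_def)

lemma sqn_on_nonneg: "0 \<le> sqn_on M f S"
  unfolding sqn_on_def by (intro Bochner_Integration.integral_nonneg) simp

lemma sqn_on_mono: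
  fixes f :: "'a \<Rightarrow> 'b::euclidean_space"
  assumes "square_integrable M f" "(indicator S :: 'a \<Rightarrow> real) \<in> borel_measurable M"
    "(indicator S' :: 'a \<Rightarrow> real) \<in> borel_measurable M" "S \<subseteq> S'"
  shows "sqn_on M f S \<le> sqn_on M f S'"
  unfolding sqn_on_def using assms(4)
  by (intro integral_mono sqn_on_integrable assms(1-3)) (auto simp: indicator_def)

lemma sqn_on_cover:
  fixes f :: "'a \<Rightarrow> 'b::euclidean_space"
  assumes f: "square_integrable M f" and S: "(indicator S :: 'a \<Rightarrow> real) \<in> borel_measurable M"
    and J: "finite J" and B: "\<And>i. i \<in> J \<Longrightarrow> (indicator (B i) :: 'a \<Rightarrow> real) \<in> borel_measurable M"
    and sub: "S \<subseteq> (\<Union>i\<in>J. B i)"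
  shows "sqn_on M f S \<le> (\<Sum>i\<in>J. sqn_on M f (B i))"
proof -
  have "sqn_on M f S \<le> (LINT x|M. (\<Sum>i\<in>J. indicator (B i) x * (norm (f x))\<^sup>2))"
    unfolding sqn_on_def
  proof (rule integral_mono[OF sqn_on_integrable[OF f S]])
    show "integrable M (\<lambda>x. \<Sum>i\<in>J. indicator (B i) x * (norm (f x))\<^sup>2)"
      by (intro Bochner_Integration.integrable_sum sqn_on_integrable[OF f B])
    fix x
    have "(indicator S x :: real) \<le> (\<Sum>i\<in>J. indicator (B i) x)"
    proof (cases "x \<in> S")
      case True
      then obtain i where i: "i \<in> J" "x \<in> B i" using sub by blast
      then have "(1::real) \<le> (\<Sum>i\<in>J. indicator (B i) x)"
        using member_le_sum[OF i(1) _ J, of "\<lambda>i. indicator (B i) x :: real"] by simp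
      then show ?thesis using True by simp
    qed (simp add: sum_nonneg)
    then show "indicator S x * (norm (f x))\<^sup>2 \<le> (\<Sum>i\<in>J. indicator (B i) x * (norm (f x))\<^sup>2)"
      unfolding sum_distrib_right[symmetric] by (rule mult_right_mono) simp
  qed
  also have "\<dots> = (\<Sum>i\<in>J. sqn_on M f (B i))"
    unfolding sqn_on_def by (rule Bochner_Integration.integral_sum[OF sqn_on_integrable[OF f B]])
  finally show ?thesis .
qed

lemma sqn_on_overlap:
  fixes f :: "'a \<Rightarrow> 'b::euclidean_space"
  assumes f: "square_integrable M f" and S: "(indicator S :: 'a \<Rightarrow> real) \<in> borel_measurable M"
    and J: "finite J" and B: "\<And>i. i \<in> J \<Longrightarrow> (indicator (B i) :: 'a \<Rightarrow> real) \<in> borel_measurable M"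
    and N: "\<And>x. real (card {i \<in> J. x \<in> B i}) \<le> N * indicator S x"
  shows "(\<Sum>i\<in>J. sqn_on M f (B i)) \<le> N * sqn_on M f S"
proof -
  have "(\<Sum>i\<in>J. sqn_on M f (B i)) = (LINT x|M. (\<Sum>i\<in>J. indicator (B i) x * (norm (f x))\<^sup>2))"
    unfolding sqn_on_def by (rule Bochner_Integration.integral_sum[OF sqn_on_integrable[OF f B], symmetric])
  also have "\<dots> \<le> (LINT x|M. N * (indicator S x * (norm (f x))\<^sup>2))"
  proof (rule integral_mono)
    show "integrable M (\<lambda>x. \<Sum>i\<in>J. indicator (B i) x * (norm (f x))\<^sup>2)"
      by (intro Bochner_Integration.integrable_sum sqn_on_integrable[OF f B])
    show "integrable M (\<lambda>x. N * (indicator S x * (norm (f x))\<^sup>2))"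
      using sqn_on_integrable[OF f S] by simp
    fix x
    have "(\<Sum>i\<in>J. indicator (B i) x :: real) = real (card {i \<in> J. x \<in> B i})"
      using J by (simp add: indicator_def sum.If_cases Int_def)
    then have "(\<Sum>i\<in>J. indicator (B i) x :: real) \<le> N * indicator S x" using N[of x] by simp
    then show "(\<Sum>i\<in>J. indicator (B i) x * (norm (f x))\<^sup>2) \<le> N * (indicator S x * (norm (f x))\<^sup>2)"
      unfolding sum_distrib_right[symmetric] mult.assoc[symmetric] by (rule mult_right_mono) simp
  qed
  finally show ?thesis by (simp add: sqn_on_def)
qed

lemma sqn_on_disjoint:
  fixes f :: "'a \<Rightarrow> 'b::euclidean_space"
  assumes f: "square_integrable M f" and S: "(indicator S :: 'a \<Rightarrow> real) \<in> borel_measurable M"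
    "(indicator S1 :: 'a \<Rightarrow> real) \<in> borel_measurable M" "(indicator S2 :: 'a \<Rightarrow> real) \<in> borel_measurable M"
    and "S1 \<inter> S2 = {}" "S1 \<union> S2 \<subseteq> S"
  shows "sqn_on M f S1 + sqn_on M f S2 \<le> sqn_on M f S"
proof -
  note i = sqn_on_integrable[OF f S(1)] sqn_on_integrable[OF f S(2)] sqn_on_integrable[OF f S(3)]
  have "(LINT x|M. indicator S1 x * (norm (f x))\<^sup>2 + indicator S2 x * (norm (f x))\<^sup>2) \<le> sqn_on M f S"
    unfolding sqn_on_def
  proof (rule integral_mono)
    fix x show "indicator S1 x * (norm (f x))\<^sup>2 + indicator S2 x * (norm (f x))\<^sup>2 \<le> indicator S x * (norm (f x))\<^sup>2"
      using assms(5,6) by (auto simp: indicator_def)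
  qed (use i in auto)
  then show ?thesis using i by (simp add: sqn_on_def)
qed

lemma sqn_on_eq_0_AE:
  fixes f :: "'a \<Rightarrow> 'b::euclidean_space"
  assumes f: "square_integrable M f" and S: "(indicator S :: 'a \<Rightarrow> real) \<in> borel_measurable M" and z: "sqn_on M f S = 0"
  shows "AE x in M. x \<in> S \<longrightarrow> f x = 0"
proof -
  have "AE x in M. indicator S x * (norm (f x))\<^sup>2 = 0"
    using z integral_nonneg_eq_0_iff_AE[OF sqn_on_integrable[OF f S]] unfolding sqn_on_def by simp
  then show ?thesis by eventually_elim (auto simp: indicator_def)
qed

lemma weighted_inner_integrable:
  fixes D W :: "'a \<Rightarrow> 'b::euclidean_space" and a :: "'a \<Rightarrow> real"
  assumes sq: "square_integrable M D" "square_integrable M W"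
    and a: "a \<in> borel_measurable M" "AE x in M. \<alpha> \<le> a x \<and> a x \<le> \<beta>" "0 < \<alpha>"
  shows "integrable M (\<lambda>x. a x * (D x \<bullet> W x))"
proof (rule Bochner_Integration.integrable_bound)
  show "integrable M (\<lambda>x. \<beta> * ((norm (D x))\<^sup>2 + (norm (W x))\<^sup>2))" using sq by (simp add: square_integrable_def)
  show "(\<lambda>x. a x * (D x \<bullet> W x)) \<in> borel_measurable M"
    using a(1) sq by (intro borel_measurable_times borel_measurable_inner) (auto simp: square_integrable_def)
  show "AE x in M. norm (a x * (D x \<bullet> W x)) \<le> norm (\<beta> * ((norm (D x))\<^sup>2 + (norm (W x))\<^sup>2))"
    using a(2)
  proof eventually_elim
    case (elim x)
    have "\<bar>D x \<bullet> W x\<bar> \<le> norm (D x) * norm (W x)" by (rule Cauchy_Schwarz_ineq2)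
    moreover have "2 * (norm (D x) * norm (W x)) \<le> (norm (D x))\<^sup>2 + (norm (W x))\<^sup>2"
      using sum_squares_bound[of "norm (D x)" "norm (W x)"] by (simp only: mult.assoc)
    moreover have "0 \<le> norm (D x) * norm (W x)" by simp
    ultimately have "\<bar>D x \<bullet> W x\<bar> \<le> (norm (D x))\<^sup>2 + (norm (W x))\<^sup>2" by linarith
    moreover have "\<bar>a x\<bar> \<le> \<beta>" using elim a(3) by auto
    ultimately have "\<bar>a x\<bar> * \<bar>D x \<bullet> W x\<bar> \<le> \<beta> * ((norm (D x))\<^sup>2 + (norm (W x))\<^sup>2)"
      by (intro mult_mono) auto
    then show ?case unfolding real_norm_def abs_mult[of "a x"] by (rule order_trans[OF _ abs_ge_self])
  qed
qed

lemma sqn_on_AE_0: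
  fixes f :: "'a \<Rightarrow> 'b::euclidean_space"
  assumes "AE x in M. x \<in> S \<longrightarrow> f x = 0"
  shows "sqn_on M f S = 0"
  unfolding sqn_on_def
proof (rule integral_eq_zero_AE)
  show "AE x in M. indicator S x * (norm (f x))\<^sup>2 = 0"
    using assms by eventually_elim (auto simp: indicator_def)
qed

lemma sqn_on_add_bound:
  fixes f g :: "'a \<Rightarrow> 'b::euclidean_space" and p :: "'a \<Rightarrow> real"
  assumes f: "square_integrable M f" and g: "square_integrable M g" and p: "square_integrable M p"
    and S: "(indicator S :: 'a \<Rightarrow> real) \<in> borel_measurable M"
    and le: "AE x in M. norm (f x) \<le> norm (g x) + c * \<bar>p x\<bar>"
  shows "sqn_on M f S \<le> 2 * sqn_on M g S + 2 * c\<^sup>2 * sqn_on M p S"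
proof -
  note i = sqn_on_integrable[OF f S] sqn_on_integrable[OF g S] sqn_on_integrable[OF p S]
  have "sqn_on M f S \<le> (LINT x|M. 2 * (indicator S x * (norm (g x))\<^sup>2) + 2 * c\<^sup>2 * (indicator S x * (norm (p x))\<^sup>2))"
    unfolding sqn_on_def
  proof (rule integral_mono_AE[OF i(1)])
    show "integrable M (\<lambda>x. 2 * (indicator S x * (norm (g x))\<^sup>2) + 2 * c\<^sup>2 * (indicator S x * (norm (p x))\<^sup>2))"
      by (intro Bochner_Integration.integrable_add integrable_mult_right i)
    show "AE x in M. indicator S x * (norm (f x))\<^sup>2 \<le> 2 * (indicator S x * (norm (g x))\<^sup>2) + 2 * c\<^sup>2 * (indicator S x * (norm (p x))\<^sup>2)"
      using le
    proof eventually_elim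
      case (elim x)
      have "(norm (f x))\<^sup>2 \<le> (norm (g x) + c * \<bar>p x\<bar>)\<^sup>2" using elim by (intro power_mono) auto
      also have "\<dots> \<le> 2 * (norm (g x))\<^sup>2 + 2 * (c * \<bar>p x\<bar>)\<^sup>2"
        using sum_squares_bound[of "norm (g x)" "c * \<bar>p x\<bar>"] unfolding power2_sum by linarith
      finally show ?case by (simp add: indicator_def power_mult_distrib)
    qed
  qed
  then show ?thesis using i by (simp add: sqn_on_def)
qed

text \<open>Testing the equation for \<open>D\<close> with \<open>W = \<eta> D + e - V\<close>: the term \<open>\<eta> D\<close> controls the energy on
  \<open>F\<close>, the other two live on \<open>S\<close> and are absorbed by Young's inequality.\<close>

lemma tested_energy_bound:
  fixes D V W :: "'a \<Rightarrow> 'b::euclidean_space" and a \<eta> p :: "'a \<Rightarrow> real"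
  assumes sq: "square_integrable M D" "square_integrable M p" "square_integrable M V" "square_integrable M W"
    and a: "a \<in> borel_measurable M" "AE x in M. \<alpha> \<le> a x \<and> a x \<le> \<beta>" "0 < \<alpha>"
    and S: "(indicator S :: 'a \<Rightarrow> real) \<in> borel_measurable M" and F: "(indicator F :: 'a \<Rightarrow> real) \<in> borel_measurable M"
    and W: "AE x in M. \<exists>e. W x = \<eta> x *\<^sub>R D x + e - V x \<and> norm e \<le> c * \<bar>p x\<bar> \<and> (x \<notin> S \<longrightarrow> e = 0)"
    and \<eta>: "AE x in M. 0 \<le> \<eta> x \<and> (x \<in> F \<longrightarrow> \<eta> x = 1)"
    and supp: "AE x in M. x \<notin> S \<longrightarrow> V x = 0"
  shows "\<alpha> * sqn_on M D F - \<beta> * (sqn_on M D S + sqn_on M V S + c\<^sup>2 * sqn_on M p S) \<le> (LINT x|M. a x * (D x \<bullet> W x))"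
proof -
  note i = weighted_inner_integrable[OF sq(1,4) a]
  note iD = sqn_on_integrable[OF sq(1) S] sqn_on_integrable[OF sq(2) S] sqn_on_integrable[OF sq(3) S] sqn_on_integrable[OF sq(1) F]
  have "(LINT x|M. \<alpha> * (indicator F x * (norm (D x))\<^sup>2) - \<beta> * (indicator S x * (norm (D x))\<^sup>2 + indicator S x * (norm (V x))\<^sup>2 + c\<^sup>2 * (indicator S x * (norm (p x))\<^sup>2)))
      \<le> (LINT x|M. a x * (D x \<bullet> W x))"
  proof (rule integral_mono_AE[OF _ i])
    show "integrable M (\<lambda>x. \<alpha> * (indicator F x * (norm (D x))\<^sup>2) - \<beta> * (indicator S x * (norm (D x))\<^sup>2 + indicator S x * (norm (V x))\<^sup>2 + c\<^sup>2 * (indicator S x * (norm (p x))\<^sup>2)))"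
      by (intro Bochner_Integration.integrable_diff Bochner_Integration.integrable_add integrable_mult_right iD)
    show "AE x in M. \<alpha> * (indicator F x * (norm (D x))\<^sup>2) - \<beta> * (indicator S x * (norm (D x))\<^sup>2 + indicator S x * (norm (V x))\<^sup>2 + c\<^sup>2 * (indicator S x * (norm (p x))\<^sup>2)) \<le> a x * (D x \<bullet> W x)"
      using a(2) W \<eta> supp
    proof eventually_elim
      case (elim x)
      obtain e where e: "W x = \<eta> x *\<^sub>R D x + e - V x" "norm e \<le> c * \<bar>p x\<bar>" "x \<notin> S \<longrightarrow> e = 0" using elim(2) by blast
      have ax: "0 \<le> a x" "a x \<le> \<beta>" "\<alpha> \<le> a x" using elim(1) a(3) by auto
      have eq: "a x * (D x \<bullet> W x) = a x * (\<eta> x * (norm (D x))\<^sup>2) + a x * (D x \<bullet> e - D x \<bullet> V x)"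
        unfolding e(1) power2_norm_eq_inner by (simp add: inner_add_right inner_diff_right algebra_simps)
      have 1: "\<alpha> * (indicator F x * (norm (D x))\<^sup>2) \<le> a x * (\<eta> x * (norm (D x))\<^sup>2)"
        using ax elim(3) by (cases "x \<in> F") (auto intro: mult_right_mono)
      have 2: "- (\<beta> * (indicator S x * (norm (D x))\<^sup>2 + indicator S x * (norm (V x))\<^sup>2 + c\<^sup>2 * (indicator S x * (norm (p x))\<^sup>2)))
          \<le> a x * (D x \<bullet> e - D x \<bullet> V x)"
      proof (cases "x \<in> S")
        case True
        have ep: "(norm e)\<^sup>2 \<le> c\<^sup>2 * (norm (p x))\<^sup>2"
          using power_mono[OF e(2) norm_ge_zero, of 2] by (simp add: power_mult_distrib)
        have "\<bar>D x \<bullet> e\<bar> \<le> norm (D x) * norm e" "\<bar>D x \<bullet> V x\<bar> \<le> norm (D x) * norm (V x)"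
          by (rule Cauchy_Schwarz_ineq2)+
        moreover have "2 * (norm (D x) * norm e) \<le> (norm (D x))\<^sup>2 + (norm e)\<^sup>2"
            "2 * (norm (D x) * norm (V x)) \<le> (norm (D x))\<^sup>2 + (norm (V x))\<^sup>2"
          using sum_squares_bound[of "norm (D x)" "norm e"] sum_squares_bound[of "norm (D x)" "norm (V x)"]
          by (simp_all only: mult.assoc)
        moreover have "0 \<le> (norm (D x))\<^sup>2" "0 \<le> (norm (V x))\<^sup>2" "0 \<le> (norm e)\<^sup>2" by simp_all
        ultimately have b: "\<bar>D x \<bullet> e - D x \<bullet> V x\<bar> \<le> (norm (D x))\<^sup>2 + (norm (V x))\<^sup>2 + c\<^sup>2 * (norm (p x))\<^sup>2"
          using ep by linarith
        have "\<bar>a x * (D x \<bullet> e - D x \<bullet> V x)\<bar> = a x * \<bar>D x \<bullet> e - D x \<bullet> V x\<bar>" using ax(1) by (simp add: abs_mult)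
        also have "\<dots> \<le> \<beta> * ((norm (D x))\<^sup>2 + (norm (V x))\<^sup>2 + c\<^sup>2 * (norm (p x))\<^sup>2)" using ax b by (intro mult_mono) auto
        finally show ?thesis using True by simp
      next
        case False
        then show ?thesis using elim(4) e(3) by simp
      qed
      show ?case using 1 2 unfolding eq by linarith
    qed
  qed
  then show ?thesis
    unfolding sqn_on_def using iD by simp
qed

text \<open>Young's inequality with a weight that gives \<open>D\<close> half of the coercivity
  constant. The statement concerns one measure and keeps both forms, because the corrector equation
  relates only their sums over the plane and the interface.\<close>

lemma energy_of_solution:
  fixes D D0 :: "'a \<Rightarrow> 'b::euclidean_space" and a :: "'a \<Rightarrow> real"
  assumes sq: "square_integrable M D" "square_integrable M D0"
    and a: "a \<in> borel_measurable M" "AE x in M. \<alpha> \<le> a x \<and> a x \<le> \<beta>" "0 < \<alpha>"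
    and S: "(indicator S :: 'a \<Rightarrow> real) \<in> borel_measurable M"
  shows "\<alpha> / 2 * sqn_on M D UNIV + (LINT x|M. indicator S x * (a x * (D0 x \<bullet> D x)))
    \<le> (LINT x|M. a x * (D x \<bullet> D x)) + \<beta>\<^sup>2 / (2 * \<alpha>) * sqn_on M D0 S"
proof -
  have U: "(indicator UNIV :: 'a \<Rightarrow> real) \<in> borel_measurable M" by simp
  note i = weighted_inner_integrable[OF sq(1,1) a] weighted_inner_integrable[OF sq(2,1) a]
    and j = sqn_on_integrable[OF sq(1) U] sqn_on_integrable[OF sq(2) S]
  have k: "integrable M (\<lambda>x. indicator S x * (a x * (D0 x \<bullet> D x)))"
  proof (rule Bochner_Integration.integrable_bound[OF i(2)])
    show "(\<lambda>x. indicator S x * (a x * (D0 x \<bullet> D x))) \<in> borel_measurable M"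
      using S borel_measurable_integrable[OF i(2)] by (rule borel_measurable_times)
  qed (intro AE_I2, auto simp: indicator_def)
  have "(LINT x|M. \<alpha> / 2 * (indicator UNIV x * (norm (D x))\<^sup>2) + indicator S x * (a x * (D0 x \<bullet> D x)))
      \<le> (LINT x|M. a x * (D x \<bullet> D x) + \<beta>\<^sup>2 / (2 * \<alpha>) * (indicator S x * (norm (D0 x))\<^sup>2))"
  proof (rule integral_mono_AE)
    show "integrable M (\<lambda>x. \<alpha> / 2 * (indicator UNIV x * (norm (D x))\<^sup>2) + indicator S x * (a x * (D0 x \<bullet> D x)))"
      by (intro Bochner_Integration.integrable_add integrable_mult_right j k)
    show "integrable M (\<lambda>x. a x * (D x \<bullet> D x) + \<beta>\<^sup>2 / (2 * \<alpha>) * (indicator S x * (norm (D0 x))\<^sup>2))"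
      by (intro Bochner_Integration.integrable_add integrable_mult_right i j)
    show "AE x in M. \<alpha> / 2 * (indicator UNIV x * (norm (D x))\<^sup>2) + indicator S x * (a x * (D0 x \<bullet> D x))
        \<le> a x * (D x \<bullet> D x) + \<beta>\<^sup>2 / (2 * \<alpha>) * (indicator S x * (norm (D0 x))\<^sup>2)"
      using a(2)
    proof eventually_elim
      case (elim x)
      have ax: "0 \<le> a x" "a x \<le> \<beta>" "\<alpha> \<le> a x" using elim a(3) by auto
      have 1: "\<alpha> * (norm (D x))\<^sup>2 \<le> a x * (D x \<bullet> D x)"
        unfolding power2_norm_eq_inner using ax by (intro mult_right_mono) auto
      have "a x * (D0 x \<bullet> D x) \<le> a x * (norm (D0 x) * norm (D x))"
        using ax norm_cauchy_schwarz by (intro mult_left_mono) auto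
      also have "\<dots> \<le> \<beta> * (norm (D0 x) * norm (D x))" using ax by (intro mult_right_mono) auto
      also have "\<dots> \<le> \<alpha> / 2 * (norm (D x))\<^sup>2 + \<beta>\<^sup>2 / (2 * \<alpha>) * (norm (D0 x))\<^sup>2"
      proof -
        have "0 \<le> (\<alpha> * norm (D x) - \<beta> * norm (D0 x))\<^sup>2" by simp
        then have "2 * \<alpha> * (\<beta> * (norm (D0 x) * norm (D x))) \<le> \<alpha>\<^sup>2 * (norm (D x))\<^sup>2 + \<beta>\<^sup>2 * (norm (D0 x))\<^sup>2"
          by (simp add: power2_diff power_mult_distrib mult_ac)
        also have "\<dots> = 2 * \<alpha> * (\<alpha> / 2 * (norm (D x))\<^sup>2 + \<beta>\<^sup>2 / (2 * \<alpha>) * (norm (D0 x))\<^sup>2)"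
          using a(3) by (simp add: field_simps power2_eq_square)
        finally show ?thesis using a(3) by (simp add: mult_le_cancel_left_pos)
      qed
      finally have 2: "a x * (D0 x \<bullet> D x) \<le> \<alpha> / 2 * (norm (D x))\<^sup>2 + \<beta>\<^sup>2 / (2 * \<alpha>) * (norm (D0 x))\<^sup>2" .
      have "0 \<le> \<alpha> / 2 * (norm (D x))\<^sup>2" using a(3) by simp
      then show ?case using 1 2 by (cases "x \<in> S") (simp_all del: dot_square_norm)
    qed
  qed
  then show ?thesis
    unfolding sqn_on_def using i j k by simp
qed

section \<open>Energies on parts of the domain and of the interface\<close>

context domain_interface
begin

lemma indicator_borel:
  assumes "S \<in> sets borel"
  shows "(indicator S :: real^2 \<Rightarrow> real) \<in> borel_measurable M\<^sub>\<Omega>" "(indicator S :: real^2 \<Rightarrow> real) \<in> borel_measurable M\<^sub>\<Gamma>"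
proof -
  have "(indicator S :: real^2 \<Rightarrow> real) \<in> borel_measurable lebesgue" using assms by (intro borel_measurable_indicator) simp
  then show "(indicator S :: real^2 \<Rightarrow> real) \<in> borel_measurable M\<^sub>\<Omega>" by (rule measurable_restrict_space1)
  show "(indicator S :: real^2 \<Rightarrow> real) \<in> borel_measurable M\<^sub>\<Gamma>"
    by (rule borel_measurable_indicator[OF borel_arc_sets[OF assms]])
qed

lemma integral_dom:
  fixes f :: "real^2 \<Rightarrow> real"
  assumes "S \<in> sets borel"
  shows "(LINT x|lebesgue_on (\<Omega> \<inter> S). f x) = (LINT x|M\<^sub>\<Omega>. indicator S x * f x)"
proof -
  have "S \<in> sets lebesgue" using assms by simp
  then have "\<Omega> \<inter> S \<in> sets lebesgue" using dom_sets by (rule sets.Int[rotated])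
  then have "(LINT x|lebesgue_on (\<Omega> \<inter> S). f x) = (LINT x|lebesgue. indicator (\<Omega> \<inter> S) x *\<^sub>R f x)"
    by (subst integral_restrict_space) auto
  also have "\<dots> = (LINT x|lebesgue. indicator \<Omega> x *\<^sub>R (indicator S x * f x))"
    by (intro Bochner_Integration.integral_cong refl) (auto simp: indicator_def)
  also have "\<dots> = (LINT x|M\<^sub>\<Omega>. indicator S x * f x)"
    using dom_sets by (subst integral_restrict_space) auto
  finally show ?thesis .
qed

lemma integral_arc:
  fixes f :: "real^2 \<Rightarrow> real"
  assumes S: "S \<in> sets borel" and f: "f \<in> borel_measurable M\<^sub>\<Gamma>"
  shows "(LINT x|restrict_space M\<^sub>\<Gamma> (interface \<Gamma> \<inter> S). f x) = (LINT x|M\<^sub>\<Gamma>. indicator S x * f x)"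
proof -
  have b: "interface \<Gamma> \<inter> S \<in> sets borel"
    using S borel_closed[OF compact_imp_closed[OF compact_interface[OF smooth_curves]]] by (rule sets.Int[rotated])
  have "(LINT x|restrict_space M\<^sub>\<Gamma> (interface \<Gamma> \<inter> S). f x) = (LINT x|M\<^sub>\<Gamma>. indicator (interface \<Gamma> \<inter> S) x *\<^sub>R f x)"
    using borel_arc_sets[OF b] by (subst integral_restrict_space) auto
  also have "\<dots> = (LINT x|M\<^sub>\<Gamma>. indicator S x * f x)"
  proof (rule integral_cong_AE)
    show "(\<lambda>x. indicator (interface \<Gamma> \<inter> S) x *\<^sub>R f x) \<in> borel_measurable M\<^sub>\<Gamma>"
      using indicator_borel(2)[OF b] f by (rule borel_measurable_scaleR)
    show "(\<lambda>x. indicator S x * f x) \<in> borel_measurable M\<^sub>\<Gamma>"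
      using indicator_borel(2)[OF S] f by (rule borel_measurable_times)
    show "AE x in M\<^sub>\<Gamma>. indicator (interface \<Gamma> \<inter> S) x *\<^sub>R f x = indicator S x * f x"
      using AE_interface by eventually_elim (auto simp: indicator_def)
  qed
  finally show ?thesis .
qed

lemma dnorm_sq:
  assumes "S \<in> sets borel"
  shows "(dnorm \<Omega> S f)\<^sup>2 = sqn_on M\<^sub>\<Omega> f S"
  unfolding dnorm_def L2_norm_def using integral_dom[OF assms, of "\<lambda>x. (norm (f x))\<^sup>2"]
  by (simp add: sqn_on_def Bochner_Integration.integral_nonneg)

lemma gnorm_sq:
  assumes "S \<in> sets borel" "f \<in> borel_measurable M\<^sub>\<Gamma>"
  shows "(gnorm \<Gamma> S f)\<^sup>2 = sqn_on M\<^sub>\<Gamma> f S"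
  unfolding gnorm_def L2_norm_def using integral_arc[OF assms(1), of "\<lambda>x. (norm (f x))\<^sup>2"] assms(2)
  by (simp add: sqn_on_def Bochner_Integration.integral_nonneg)

lemma norm_nonneg: "0 \<le> dnorm \<Omega> S f" "0 \<le> gnorm \<Gamma> S g"
  by (simp_all add: dnorm_def gnorm_def L2_norm_def Bochner_Integration.integral_nonneg)

text \<open>Squares are summed so that the pieces of a mesh can be added up; norms return only in
  the theorem.\<close>

definition energy :: "(real^2 \<Rightarrow> real) \<Rightarrow> (real^2) set \<Rightarrow> real" where
  "energy u S = sqn_on M\<^sub>\<Omega> (grad \<Omega> u) S + sqn_on M\<^sub>\<Gamma> (tgrad \<Gamma> u) S"

definition mass :: "(real^2 \<Rightarrow> real) \<Rightarrow> (real^2) set \<Rightarrow> real" where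
  "mass u S = sqn_on M\<^sub>\<Omega> u S + sqn_on M\<^sub>\<Gamma> u S"

lemma energy_nonneg: "0 \<le> energy u S" and mass_nonneg: "0 \<le> mass u S"
  by (simp_all add: energy_def mass_def sqn_on_nonneg)

lemma energy_norms:
  assumes "u \<in> V \<Omega> \<Gamma>" "S \<in> sets borel"
  shows "energy u S = (dnorm \<Omega> S (grad \<Omega> u))\<^sup>2 + (gnorm \<Gamma> S (tgrad \<Gamma> u))\<^sup>2"
    "mass u S = (dnorm \<Omega> S u)\<^sup>2 + (gnorm \<Gamma> S u)\<^sup>2"
  using H1_grad_V(4,5)[OF assms(1)] assms(2)
  by (simp_all add: energy_def mass_def dnorm_sq gnorm_sq square_integrable_def)

lemma energy_mono:
  assumes "u \<in> V \<Omega> \<Gamma>" "S \<in> sets borel" "S' \<in> sets borel" "S \<subseteq> S'"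
  shows "energy u S \<le> energy u S'"
  unfolding energy_def
  by (intro add_mono sqn_on_mono indicator_borel H1_grad_V[OF assms(1)] assms)

lemma energy_cover:
  assumes "u \<in> V \<Omega> \<Gamma>" "S \<in> sets borel" "finite J" "\<And>i. i \<in> J \<Longrightarrow> B i \<in> sets borel" "S \<subseteq> (\<Union>i\<in>J. B i)"
  shows "energy u S \<le> (\<Sum>i\<in>J. energy u (B i))" "mass u S \<le> (\<Sum>i\<in>J. mass u (B i))"
  unfolding energy_def mass_def sum.distrib
  by (intro add_mono sqn_on_cover indicator_borel H1_grad_V[OF assms(1)] assms; assumption?)+

lemma energy_overlap:
  assumes "u \<in> V \<Omega> \<Gamma>" "S \<in> sets borel" "finite J" "\<And>i. i \<in> J \<Longrightarrow> B i \<in> sets borel"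
    "\<And>x. real (card {i \<in> J. x \<in> B i}) \<le> N * indicator S x"
  shows "(\<Sum>i\<in>J. energy u (B i)) \<le> N * energy u S"
  unfolding energy_def sum.distrib distrib_left
  by (intro add_mono sqn_on_overlap indicator_borel H1_grad_V[OF assms(1)] assms)

lemma energy_disjoint:
  assumes "u \<in> V \<Omega> \<Gamma>" "S \<in> sets borel" "S1 \<in> sets borel" "S2 \<in> sets borel" "S1 \<inter> S2 = {}" "S1 \<union> S2 \<subseteq> S"
  shows "energy u S1 + energy u S2 \<le> energy u S"
proof -
  have "sqn_on M\<^sub>\<Omega> (grad \<Omega> u) S1 + sqn_on M\<^sub>\<Omega> (grad \<Omega> u) S2 \<le> sqn_on M\<^sub>\<Omega> (grad \<Omega> u) S"
    by (rule sqn_on_disjoint[OF _ _ _ _ assms(5,6)]) (rule indicator_borel H1_grad_V[OF assms(1)] assms)+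
  moreover have "sqn_on M\<^sub>\<Gamma> (tgrad \<Gamma> u) S1 + sqn_on M\<^sub>\<Gamma> (tgrad \<Gamma> u) S2 \<le> sqn_on M\<^sub>\<Gamma> (tgrad \<Gamma> u) S"
    by (rule sqn_on_disjoint[OF _ _ _ _ assms(5,6)]) (rule indicator_borel H1_grad_V[OF assms(1)] assms)+
  ultimately show ?thesis unfolding energy_def by linarith
qed

lemma grad_add_AE:
  assumes u: "u \<in> V \<Omega> \<Gamma>" and v: "v \<in> V \<Omega> \<Gamma>"
  shows "AE x in M\<^sub>\<Omega>. grad \<Omega> (\<lambda>x. u x + c * v x) x = grad \<Omega> u x + c *\<^sub>R grad \<Omega> v x"
    "AE x in M\<^sub>\<Gamma>. tgrad \<Gamma> (\<lambda>x. u x + c * v x) x = tgrad \<Gamma> u x + c *\<^sub>R tgrad \<Gamma> v x"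
proof -
  note hu = H1_grad_V[OF u] and hv = H1_grad_V[OF v]
  show "AE x in M\<^sub>\<Omega>. grad \<Omega> (\<lambda>x. u x + c * v x) x = grad \<Omega> u x + c *\<^sub>R grad \<Omega> v x"
    unfolding AE_lebesgue_on[OF dom_sets]
    by (rule grad_AE[OF weak_gradient_add[OF hu(1) weak_gradient_scale[OF hv(1) open_dom] open_dom] open_dom])
  show "AE x in M\<^sub>\<Gamma>. tgrad \<Gamma> (\<lambda>x. u x + c * v x) x = tgrad \<Gamma> u x + c *\<^sub>R tgrad \<Gamma> v x"
  proof (rule AE_arc_length)
    fix i assume i: "i < length \<Gamma>"
    note wu = H1_grad(1)[OF hu(7)[OF i] open_greaterThanLessThan] and wv = H1_grad(1)[OF hv(7)[OF i] open_greaterThanLessThan]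
    note w = weak_gradient_add[OF wu weak_gradient_scale[OF wv open_greaterThanLessThan, of c] open_greaterThanLessThan]
    have w': "weak_gradient {0<..<arc_len \<Gamma> i} ((\<lambda>x. u x + c * v x) \<circ> arc_map \<Gamma> i)
        (\<lambda>s. grad {0<..<arc_len \<Gamma> i} (u \<circ> arc_map \<Gamma> i) s + c *\<^sub>R grad {0<..<arc_len \<Gamma> i} (v \<circ> arc_map \<Gamma> i) s)"
      by (rule weak_gradient_cong[OF w]) auto
    show "AE s in lebesgue. s \<in> arc_dom \<Gamma> i \<longrightarrow> tgrad \<Gamma> (\<lambda>x. u x + c * v x) (arc_map \<Gamma> i s) =
        tgrad \<Gamma> u (arc_map \<Gamma> i s) + c *\<^sub>R tgrad \<Gamma> v (arc_map \<Gamma> i s)"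
      using tgrad_AE[OF i w'] tgrad_AE[OF i wu] tgrad_AE[OF i wv]
      by eventually_elim (simp add: scaleR_add_left)
  qed
qed

end

text \<open>Turns the interpolation estimates, which bound sums of norms, into estimates of energies
  and masses; the factor 2 is that of \<open>(a + b)^2 \<le> 2 * (a^2 + b^2)\<close>.\<close>

lemma square_sum_bound:
  fixes x y a b C :: real
  assumes "0 \<le> x" "0 \<le> y" "x + y \<le> C * (a + b)"
  shows "x\<^sup>2 + y\<^sup>2 \<le> 2 * C\<^sup>2 * (a\<^sup>2 + b\<^sup>2)"
proof -
  have "0 \<le> x * y" using assms by simp
  then have "x\<^sup>2 + y\<^sup>2 \<le> (x + y)\<^sup>2" unfolding power2_sum by linarith
  also have "\<dots> \<le> (C * (a + b))\<^sup>2" using assms by (intro power_mono) auto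
  also have "\<dots> = C\<^sup>2 * (a + b)\<^sup>2" by (simp add: power_mult_distrib)
  also have "\<dots> \<le> C\<^sup>2 * (2 * (a\<^sup>2 + b\<^sup>2))"
  proof (rule mult_left_mono)
    show "(a + b)\<^sup>2 \<le> 2 * (a\<^sup>2 + b\<^sup>2)" using sum_squares_bound[of a b] unfolding power2_sum distrib_left by linarith
  qed simp
  finally show ?thesis by (simp add: algebra_simps)
qed

lemma weak_gradient_locally_constant:
  fixes u :: "'a::euclidean_space \<Rightarrow> real"
  assumes w: "weak_gradient \<Omega> u g" "open \<Omega>" and S: "open S" "S \<subseteq> \<Omega>" "\<And>x. x \<in> S \<Longrightarrow> u x = c"
  shows "AE x in lebesgue. x \<in> S \<longrightarrow> g x = 0"
proof -
  have 1: "weak_gradient S u g" by (rule weak_gradient_mono[OF w S(1,2)])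
  have "weak_gradient S (\<lambda>x. c) (\<lambda>x. 0 :: 'a)"
    by (rule weak_gradient_lipschitz[of 0 _ _ _ 0]) (auto intro!: lipschitz_onI S)
  then have 2: "weak_gradient S u (\<lambda>x. 0)" by (rule weak_gradient_cong) (use S in auto)
  show ?thesis by (rule weak_gradient_unique[OF 1 2 S(1)])
qed

context domain_interface
begin

lemma energy_add_bound:
  assumes u: "u \<in> V \<Omega> \<Gamma>" and \<phi>: "\<phi> \<in> V \<Omega> \<Gamma>" and S: "S \<in> sets borel"
    and "AE x in M\<^sub>\<Omega>. norm (grad \<Omega> u x) \<le> norm (grad \<Omega> \<phi> x) + c * \<bar>\<phi> x\<bar>"
    and "AE x in M\<^sub>\<Gamma>. norm (tgrad \<Gamma> u x) \<le> norm (tgrad \<Gamma> \<phi> x) + c * \<bar>\<phi> x\<bar>"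
  shows "energy u S \<le> 2 * energy \<phi> S + 2 * c\<^sup>2 * mass \<phi> S"
  using sqn_on_add_bound[OF H1_grad_V(2)[OF u] H1_grad_V(2)[OF \<phi>] H1_grad_V(3)[OF \<phi>] indicator_borel(1)[OF S] assms(4)]
    sqn_on_add_bound[OF H1_grad_V(4)[OF u] H1_grad_V(4)[OF \<phi>] H1_grad_V(5)[OF \<phi>] indicator_borel(2)[OF S] assms(5)]
  unfolding energy_def mass_def distrib_left by linarith

lemma energy_0:
  assumes "AE x in M\<^sub>\<Omega>. x \<in> S \<longrightarrow> grad \<Omega> u x = 0" "AE x in M\<^sub>\<Gamma>. x \<in> S \<longrightarrow> tgrad \<Gamma> u x = 0"
  shows "energy u S = 0"
  unfolding energy_def by (simp only: sqn_on_AE_0[OF assms(1)] sqn_on_AE_0[OF assms(2)])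

lemma energy_0_AE:
  assumes u: "u \<in> V \<Omega> \<Gamma>" and S: "S \<in> sets borel" and 0: "energy u S = 0"
  shows "AE x in M\<^sub>\<Omega>. x \<in> S \<longrightarrow> grad \<Omega> u x = 0" "AE x in M\<^sub>\<Gamma>. x \<in> S \<longrightarrow> tgrad \<Gamma> u x = 0"
proof -
  have z: "sqn_on M\<^sub>\<Omega> (grad \<Omega> u) S = 0" "sqn_on M\<^sub>\<Gamma> (tgrad \<Gamma> u) S = 0"
    using 0 sqn_on_nonneg[of M\<^sub>\<Omega> "grad \<Omega> u" S] sqn_on_nonneg[of M\<^sub>\<Gamma> "tgrad \<Gamma> u" S] unfolding energy_def by linarith+
  show "AE x in M\<^sub>\<Omega>. x \<in> S \<longrightarrow> grad \<Omega> u x = 0"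
    by (rule sqn_on_eq_0_AE[OF H1_grad_V(2)[OF u] indicator_borel(1)[OF S] z(1)])
  show "AE x in M\<^sub>\<Gamma>. x \<in> S \<longrightarrow> tgrad \<Gamma> u x = 0"
    by (rule sqn_on_eq_0_AE[OF H1_grad_V(4)[OF u] indicator_borel(2)[OF S] z(2)])
qed

lemma form_measurable:
  assumes "coefficients \<Omega> \<Gamma> \<alpha> \<beta> A A\<^sub>\<Gamma>" "u \<in> V \<Omega> \<Gamma>" "w \<in> V \<Omega> \<Gamma>"
  shows "(\<lambda>x. A\<^sub>\<Gamma> x * (tgrad \<Gamma> u x \<bullet> tgrad \<Gamma> w x)) \<in> borel_measurable M\<^sub>\<Gamma>"
  using assms(1) H1_grad_V(4)[OF assms(2)] H1_grad_V(4)[OF assms(3)]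
  by (intro borel_measurable_times borel_measurable_inner) (auto simp: coefficients_def square_integrable_def)

lemma form_on_eq:
  assumes "coefficients \<Omega> \<Gamma> \<alpha> \<beta> A A\<^sub>\<Gamma>" "u \<in> V \<Omega> \<Gamma>" "w \<in> V \<Omega> \<Gamma>" "S \<in> sets borel"
  shows "form_on \<Omega> \<Gamma> A A\<^sub>\<Gamma> S u w =
    (LINT x|M\<^sub>\<Omega>. indicator S x * (A x * (grad \<Omega> u x \<bullet> grad \<Omega> w x))) +
    (LINT x|M\<^sub>\<Gamma>. indicator S x * (A\<^sub>\<Gamma> x * (tgrad \<Gamma> u x \<bullet> tgrad \<Gamma> w x)))"
  unfolding form_on_def
  by (simp only: integral_dom[OF assms(4)] integral_arc[OF assms(4) form_measurable[OF assms(1-3)]])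

lemma bilinear_form_eq:
  assumes "coefficients \<Omega> \<Gamma> \<alpha> \<beta> A A\<^sub>\<Gamma>" "u \<in> V \<Omega> \<Gamma>" "w \<in> V \<Omega> \<Gamma>"
  shows "bilinear_form \<Omega> \<Gamma> A A\<^sub>\<Gamma> u w =
    (LINT x|M\<^sub>\<Omega>. A x * (grad \<Omega> u x \<bullet> grad \<Omega> w x)) + (LINT x|M\<^sub>\<Gamma>. A\<^sub>\<Gamma> x * (tgrad \<Gamma> u x \<bullet> tgrad \<Gamma> w x))"
proof -
  have b: "closure \<Omega> \<in> sets borel" by simp
  have 1: "(LINT x|M\<^sub>\<Omega>. indicator (closure \<Omega>) x * (A x * (grad \<Omega> u x \<bullet> grad \<Omega> w x))) =
      (LINT x|M\<^sub>\<Omega>. A x * (grad \<Omega> u x \<bullet> grad \<Omega> w x))"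
    by (rule Bochner_Integration.integral_cong[OF refl])
      (use closure_subset[of \<Omega>] in \<open>auto simp: space_restrict_space indicator_def\<close>)
  have 2: "(LINT x|M\<^sub>\<Gamma>. indicator (closure \<Omega>) x * (A\<^sub>\<Gamma> x * (tgrad \<Gamma> u x \<bullet> tgrad \<Gamma> w x))) =
      (LINT x|M\<^sub>\<Gamma>. A\<^sub>\<Gamma> x * (tgrad \<Gamma> u x \<bullet> tgrad \<Gamma> w x))"
  proof (rule integral_cong_AE)
    show "(\<lambda>x. indicator (closure \<Omega>) x * (A\<^sub>\<Gamma> x * (tgrad \<Gamma> u x \<bullet> tgrad \<Gamma> w x))) \<in> borel_measurable M\<^sub>\<Gamma>"
      using indicator_borel(2)[OF b] form_measurable[OF assms] by (rule borel_measurable_times)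
    show "AE x in M\<^sub>\<Gamma>. indicator (closure \<Omega>) x * (A\<^sub>\<Gamma> x * (tgrad \<Gamma> u x \<bullet> tgrad \<Gamma> w x)) = A\<^sub>\<Gamma> x * (tgrad \<Gamma> u x \<bullet> tgrad \<Gamma> w x)"
      using AE_interface by eventually_elim (use interface_closure in \<open>auto simp: indicator_def\<close>)
  qed (rule form_measurable[OF assms])
  show ?thesis unfolding bilinear_form_def form_on_eq[OF assms b] by (simp only: 1 2)
qed

end

section \<open>Rings of triangles and the product with the cutoff\<close>

context mesh_domain
begin

abbreviation nb where "nb T \<equiv> {T' \<in> \<T>. T' \<inter> T \<noteq> {}}"

text \<open>A triangle that meets layer \<open>b\<close> may reach into the next one, so the union
  of a ring is contained in \<open>P T (b + 1)\<close> only.\<close>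

definition ring where "ring T a b = {T' \<in> \<T>. T' \<inter> P T a = {} \<and> T' \<inter> P T b \<noteq> {}}"

lemma borel_triangle: "T \<in> \<T> \<Longrightarrow> T \<in> sets borel" by (rule borel_closed[OF triangle(3)])

lemma borel_Union: "\<A> \<subseteq> \<T> \<Longrightarrow> \<Union>\<A> \<in> sets borel"
  using finite_mesh triangle(3) by (intro borel_closed closed_Union) (auto intro: finite_subset)

lemma subset_P: "T' \<in> \<T> \<Longrightarrow> T' \<inter> P T a \<noteq> {} \<Longrightarrow> b = a + 1 \<Longrightarrow> T' \<subseteq> P T b"
  using subset_P_Suc[of T' a T] by simp

text \<open>Passing to neighbours costs one layer on each side. The indices are linked by equations
  so that sums such as \<open>j + 7\<close> and \<open>j + 8\<close> can be matched
  directly.\<close>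

lemma ring_nb:
  assumes "T' \<in> ring T a b" "a = a' + 1" "b' = b + 1"
  shows "nb T' \<subseteq> ring T a' b'"
proof
  fix T'' assume T'': "T'' \<in> nb T'"
  have "T' \<subseteq> P T b'" using assms by (intro subset_P[of T' b T b']) (auto simp: ring_def)
  moreover have "T'' \<inter> P T a' = {}"
  proof (rule ccontr)
    assume "T'' \<inter> P T a' \<noteq> {}"
    then have "T'' \<subseteq> P T a" using T'' assms(2) by (intro subset_P[of T'' a' T a]) auto
    then show False using T'' assms(1) by (auto simp: ring_def)
  qed
  ultimately show "T'' \<in> ring T a' b'" using T'' by (auto simp: ring_def)
qed

lemma ring_subset: "ring T a b \<subseteq> \<T>" by (auto simp: ring_def)

lemma ring_far: "\<Union>(ring T a b) \<subseteq> far \<Omega> \<T> a T"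
  using subset_far by (force simp: ring_def)

text \<open>One of the two layers is needed because the ring reaches into layer
  \<open>b + 1\<close>, the other because of the closure in \<open>far\<close>, see
  \<open>far_subset\<close>.\<close>

lemma ring_far_disjoint:
  assumes "c = b + 2"
  shows "\<Union>(ring T a b) \<inter> far \<Omega> \<T> c T = {}"
proof -
  have "\<Union>(ring T a b) \<subseteq> P T (b + 1)" using subset_P[of _ b T "b + 1"] by (fastforce simp: ring_def)
  moreover have "far \<Omega> \<T> c T \<inter> P T (b + 1) = {}" using far_subset[of "b + 1" T] assms by auto
  ultimately show ?thesis by blast
qed

text \<open>After exchanging the sums, each triangle is counted once for each of its neighbours, at
  most \<open>64 * \<gamma>\<^sup>2\<close> times by \<open>card_neighbours\<close>.\<close>

lemma sum_neighbours:
  fixes f :: "(real^2) set \<Rightarrow> real"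
  assumes A: "\<A> \<subseteq> \<T>" and B: "\<B> \<subseteq> \<T>" and nb: "\<And>T'. T' \<in> \<A> \<Longrightarrow> nb T' \<subseteq> \<B>" and f: "\<And>T'. T' \<in> \<T> \<Longrightarrow> 0 \<le> f T'"
  shows "(\<Sum>T'\<in>\<A>. \<Sum>T''\<in>nb T'. f T'') \<le> 64 * \<gamma>\<^sup>2 * (\<Sum>T''\<in>\<B>. f T'')"
proof -
  have fin: "finite \<A>" "finite \<B>" using A B finite_mesh by (auto intro: finite_subset)
  have eq: "(\<Sum>T''\<in>nb T'. f T'') = (\<Sum>T''\<in>\<B>. if T'' \<inter> T' \<noteq> {} then f T'' else 0)" if "T' \<in> \<A>" for T'
  proof -
    have "nb T' = {T'' \<in> \<B>. T'' \<inter> T' \<noteq> {}}" using nb[OF that] B by blast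
    then show ?thesis using fin(2) by (simp only: sum.inter_filter)
  qed
  have "(\<Sum>T'\<in>\<A>. \<Sum>T''\<in>nb T'. f T'') = (\<Sum>T'\<in>\<A>. \<Sum>T''\<in>\<B>. if T'' \<inter> T' \<noteq> {} then f T'' else 0)"
    by (rule sum.cong[OF refl]) (rule eq)
  also have "\<dots> = (\<Sum>T''\<in>\<B>. \<Sum>T'\<in>\<A>. if T'' \<inter> T' \<noteq> {} then f T'' else 0)" by (rule sum.swap)
  also have "\<dots> \<le> (\<Sum>T''\<in>\<B>. 64 * \<gamma>\<^sup>2 * f T'')"
  proof (rule sum_mono)
    fix T'' assume T'': "T'' \<in> \<B>"
    have "(\<Sum>T'\<in>\<A>. if T'' \<inter> T' \<noteq> {} then f T'' else 0) = (\<Sum>T'\<in>{T' \<in> \<A>. T'' \<inter> T' \<noteq> {}}. f T'')"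
      using fin(1) by (simp only: sum.inter_filter)
    also have "\<dots> = real (card {T' \<in> \<A>. T'' \<inter> T' \<noteq> {}}) * f T''" by simp
    also have "\<dots> \<le> 64 * \<gamma>\<^sup>2 * f T''"
    proof (rule mult_right_mono)
      have "card {T' \<in> \<A>. T'' \<inter> T' \<noteq> {}} \<le> card (nb T'')" using A finite_mesh by (intro card_mono) auto
      then show "real (card {T' \<in> \<A>. T'' \<inter> T' \<noteq> {}}) \<le> 64 * \<gamma>\<^sup>2"
        using card_neighbours[of T''] T'' B by (meson of_nat_mono order_trans subsetD)
    qed (use f T'' B in blast)
    finally show "(\<Sum>T'\<in>\<A>. if T'' \<inter> T' \<noteq> {} then f T'' else 0) \<le> 64 * \<gamma>\<^sup>2 * f T''" .
  qed
  finally show ?thesis by (simp only: sum_distrib_left)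
qed

text \<open>Triangles overlap in edges, which are null sets of the plane but not of the interface: a
  curve may run along an edge. Hence the multiplicity is bounded by the number of neighbours instead
  of being neglected.\<close>

lemma sum_energy:
  assumes u: "u \<in> V \<Omega> \<Gamma>" and A: "\<A> \<subseteq> \<T>"
  shows "(\<Sum>T'\<in>\<A>. energy u T') \<le> 64 * \<gamma>\<^sup>2 * energy u (\<Union>\<A>)"
proof (rule energy_overlap[OF u borel_Union[OF A]])
  show "finite \<A>" using A finite_mesh by (rule finite_subset)
  fix x
  show "real (card {T' \<in> \<A>. x \<in> T'}) \<le> 64 * \<gamma>\<^sup>2 * indicator (\<Union>\<A>) x"
  proof (cases "x \<in> \<Union>\<A>")
    case True
    then obtain T0 where T0: "T0 \<in> \<A>" "x \<in> T0" by blast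
    then have "{T' \<in> \<A>. x \<in> T'} \<subseteq> nb T0" using A by blast
    then have "card {T' \<in> \<A>. x \<in> T'} \<le> card (nb T0)" using finite_mesh by (intro card_mono) auto
    then show ?thesis using True card_neighbours[of T0] T0 A by (auto simp: indicator_def)
  next
    case False
    then have e: "{T' \<in> \<A>. x \<in> T'} = {}" by blast
    show ?thesis using False unfolding e by simp
  qed
qed (use A borel_triangle in auto)

lemma patch_cover:
  assumes "u \<in> V \<Omega> \<Gamma>"
  shows "energy u (patch \<T> T') \<le> (\<Sum>T''\<in>nb T'. energy u T'')" "mass u (patch \<T> T') \<le> (\<Sum>T''\<in>nb T'. mass u T'')"
proof -
  have f: "finite (nb T')" and b: "patch \<T> T' \<in> sets borel" and s: "patch \<T> T' \<subseteq> (\<Union>T''\<in>nb T'. T'')"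
    using finite_mesh borel_Union[of "nb T'"] by (auto simp: patch_def)
  have t: "T'' \<in> sets borel" if "T'' \<in> nb T'" for T'' using that borel_triangle by simp
  show "energy u (patch \<T> T') \<le> (\<Sum>T''\<in>nb T'. energy u T'')"
    by (rule energy_cover(1)[OF assms(1) b f _ s]) (rule t)
  show "mass u (patch \<T> T') \<le> (\<Sum>T''\<in>nb T'. mass u T'')"
    by (rule energy_cover(2)[OF assms(1) b f _ s]) (rule t)
qed

lemma patch_subset: "T' \<in> \<T> \<Longrightarrow> T' \<subseteq> patch \<T> T'"
  using triangle(5)[of T'] interior_subset[of T'] by (auto simp: patch_def)

text \<open>The three powers come from the sum over neighbours, from covering each patch by the
  neighbours of its triangle, and from the overlap of triangles. The first two widen the ring by one
  layer each.\<close>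

lemma ring_chain:
  assumes u: "u \<in> V \<Omega> \<Gamma>"
  shows "(\<Sum>T'\<in>ring T (j + 2) (j + 7). \<Sum>T''\<in>nb T'. energy u (patch \<T> T'')) \<le> (64 * \<gamma>\<^sup>2) ^ 3 * energy u (\<Union>(ring T j (j + 9)))"
proof -
  have N: "0 \<le> 64 * \<gamma>\<^sup>2" by simp
  have nb1: "nb T' \<subseteq> ring T (j + 1) (j + 8)" if "T' \<in> ring T (j + 2) (j + 7)" for T'
    by (rule ring_nb[OF that]) auto
  have nb2: "nb T' \<subseteq> ring T j (j + 9)" if "T' \<in> ring T (j + 1) (j + 8)" for T'
    by (rule ring_nb[OF that]) auto
  have "(\<Sum>T'\<in>ring T (j + 2) (j + 7). \<Sum>T''\<in>nb T'. energy u (patch \<T> T'')) \<le> 64 * \<gamma>\<^sup>2 * (\<Sum>T''\<in>ring T (j + 1) (j + 8). energy u (patch \<T> T''))"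
    by (rule sum_neighbours[OF ring_subset ring_subset _ energy_nonneg]) (rule nb1)
  also have "\<dots> \<le> 64 * \<gamma>\<^sup>2 * (\<Sum>T''\<in>ring T (j + 1) (j + 8). \<Sum>T'''\<in>nb T''. energy u T''')"
    by (intro mult_left_mono[OF _ N] sum_mono patch_cover(1)[OF u])
  also have "\<dots> \<le> 64 * \<gamma>\<^sup>2 * (64 * \<gamma>\<^sup>2 * (\<Sum>T'''\<in>ring T j (j + 9). energy u T'''))"
    by (rule mult_left_mono[OF sum_neighbours[OF ring_subset ring_subset _ energy_nonneg] N]) (rule nb2)
  also have "\<dots> \<le> 64 * \<gamma>\<^sup>2 * (64 * \<gamma>\<^sup>2 * (64 * \<gamma>\<^sup>2 * energy u (\<Union>(ring T j (j + 9)))))"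
    by (intro mult_left_mono N sum_energy[OF u ring_subset])
  finally show ?thesis by (simp only: power3_eq_cube mult.assoc)
qed

text \<open>\<open>cutoff\<close> constrains \<open>\<eta>\<close> on \<open>\<Omega>\<close> only, while the product must make sense on the part of the
  interface that lies on the boundary: \<open>\<eta>\<close> is replaced by its continuous extension.\<close>

lemma cutoff_extension:
  assumes T: "T \<in> \<T>" and cut: "cutoff \<Omega> C\<^sub>\<eta> H \<T> T k \<eta>" and k: "k' = k + 1"
  obtains \<eta>' K g where "K-lipschitz_on (closure \<Omega>) \<eta>'" "weak_gradient \<Omega> \<eta>' g"
    "AE x in lebesgue. x \<in> \<Omega> \<longrightarrow> norm (g x) \<le> \<bar>C\<^sub>\<eta>\<bar> / H"
    "\<And>x. x \<in> closure \<Omega> \<Longrightarrow> 0 \<le> \<eta>' x \<and> \<eta>' x \<le> 1"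
    "\<And>x. x \<in> P T k \<Longrightarrow> \<eta>' x = 0" "\<And>x. x \<in> far \<Omega> \<T> k' T \<Longrightarrow> \<eta>' x = 1"
proof -
  obtain K where K: "K-lipschitz_on \<Omega> \<eta>" using cut by (auto simp: cutoff_def)
  obtain g where g: "weak_gradient \<Omega> \<eta> g" "AE x in M\<^sub>\<Omega>. norm (g x) \<le> C\<^sub>\<eta> / H" using cut by (auto simp: cutoff_def)
  obtain \<eta>' where e: "K-lipschitz_on (closure \<Omega>) \<eta>'" "\<And>x. x \<in> \<Omega> \<Longrightarrow> \<eta>' x = \<eta> x"
    using lipschitz_extend_closure[OF K] by blast
  have c: "continuous_on (closure \<Omega>) \<eta>'" by (rule lipschitz_on_continuous_on[OF e(1)])
  show ?thesis
  proof (rule that[OF e(1)])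
    show "weak_gradient \<Omega> \<eta>' g" by (rule weak_gradient_cong[OF g(1)]) (use e(2) open_dom in auto)
    have le: "C\<^sub>\<eta> / H \<le> \<bar>C\<^sub>\<eta>\<bar> / H" using H_pos by (intro divide_right_mono) auto
    show "AE x in lebesgue. x \<in> \<Omega> \<longrightarrow> norm (g x) \<le> \<bar>C\<^sub>\<eta>\<bar> / H"
      using g(2)[unfolded AE_lebesgue_on[OF dom_sets]]
    proof eventually_elim
      case (elim x)
      then show ?case using order_trans[OF _ le] by blast
    qed
    fix x
    show "0 \<le> \<eta>' x \<and> \<eta>' x \<le> 1" if x: "x \<in> closure \<Omega>"
      using continuous_ge_on_closure[OF c x, of 0] continuous_le_on_closure[OF c x, of 1] e(2) cut
      by (auto simp: cutoff_def)
    show "\<eta>' x = 0" if x: "x \<in> P T k"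
    proof -
      \<comment> \<open>\<open>\<eta>\<close> vanishes by assumption only on points of
        \<open>\<Omega>\<close>. A point of the layer on the boundary is a limit of interior points
        of a triangle of the layer, and continuity gives the value there.\<close>
      obtain T' where T': "T' \<in> \<T>" "x \<in> T'" "T' \<subseteq> P T k"
      proof (cases k)
        case 0
        then show ?thesis using that[of T] T x by simp
      next
        case (Suc n)
        then show ?thesis using that x unfolding Suc P_Suc by blast
      qed
      have x': "x \<in> closure (interior T')" using triangle(6)[OF T'(1)] T'(2) by simp
      have c': "continuous_on (closure (interior T')) \<eta>'"
        by (rule continuous_on_subset[OF c]) (use triangle(6,7)[OF T'(1)] in simp)
      show ?thesis
      proof (rule continuous_constant_on_closure[OF c' _ x'])
        fix y assume y: "y \<in> interior T'"
        then have "y \<in> \<Omega>" "y \<in> P T k" using triangle(8)[OF T'(1)] T'(3) interior_subset[of T'] by blast+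
        then show "\<eta>' y = 0" using e(2)[of y] cut by (simp add: cutoff_def)
      qed
    qed
    show "\<eta>' x = 1" if x: "x \<in> far \<Omega> \<T> k' T"
    proof -
      have x': "x \<in> closure (\<Omega> - P T k')" using x by (simp add: far_def)
      have "closure (\<Omega> - P T k') \<subseteq> closure \<Omega>" by (intro closure_mono) blast
      then have c': "continuous_on (closure (\<Omega> - P T k')) \<eta>'" by (rule continuous_on_subset[OF c])
      show ?thesis
      proof (rule continuous_constant_on_closure[OF c' _ x'])
        fix y assume y: "y \<in> \<Omega> - P T k'"
        then have "y \<in> far \<Omega> \<T> (k + 1) T" using subsetD[OF closure_subset y] by (simp only: far_def k)
        then show "\<eta>' y = 1" using y e(2)[of y] cut by (simp add: cutoff_def)
      qed
    qed
  qed
qed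

text \<open>\<open>R\<close> is the strip in which the cutoff may vary. Only the gradients of
  \<open>u\<close> are described, not \<open>u\<close> as a product, since the interpolation
  estimates see gradients alone.\<close>

lemma cutoff_product:
  assumes T: "T \<in> \<T>" and cut: "cutoff \<Omega> C\<^sub>\<eta> H \<T> T k \<eta>" and k: "k' = k + 1" and \<phi>: "\<phi> \<in> V \<Omega> \<Gamma>"
  defines "R \<equiv> \<Omega> \<inter> P T k' - interior (P T k)"
  obtains u \<eta>' where "u \<in> V \<Omega> \<Gamma>" "\<And>x. x \<in> closure \<Omega> \<Longrightarrow> 0 \<le> \<eta>' x \<and> \<eta>' x \<le> 1"
    "\<And>x. x \<in> P T k \<Longrightarrow> \<eta>' x = 0" "\<And>x. x \<in> far \<Omega> \<T> k' T \<Longrightarrow> \<eta>' x = 1"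
    "AE x in M\<^sub>\<Omega>. norm (grad \<Omega> u x - \<eta>' x *\<^sub>R grad \<Omega> \<phi> x) \<le> \<bar>C\<^sub>\<eta>\<bar> / H * \<bar>\<phi> x\<bar> \<and>
      (x \<notin> R \<longrightarrow> grad \<Omega> u x = \<eta>' x *\<^sub>R grad \<Omega> \<phi> x)"
    "AE x in M\<^sub>\<Gamma>. norm (tgrad \<Gamma> u x - \<eta>' x *\<^sub>R tgrad \<Gamma> \<phi> x) \<le> \<bar>C\<^sub>\<eta>\<bar> / H * \<bar>\<phi> x\<bar> \<and>
      (x \<notin> R \<longrightarrow> tgrad \<Gamma> u x = \<eta>' x *\<^sub>R tgrad \<Gamma> \<phi> x)"
proof -
  obtain \<eta>' K g where e: "K-lipschitz_on (closure \<Omega>) \<eta>'" and g: "weak_gradient \<Omega> \<eta>' g"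
    "AE x in lebesgue. x \<in> \<Omega> \<longrightarrow> norm (g x) \<le> \<bar>C\<^sub>\<eta>\<bar> / H"
    and r: "\<And>x. x \<in> closure \<Omega> \<Longrightarrow> 0 \<le> \<eta>' x \<and> \<eta>' x \<le> 1"
    and z: "\<And>x. x \<in> P T k \<Longrightarrow> \<eta>' x = 0" and o: "\<And>x. x \<in> far \<Omega> \<T> k' T \<Longrightarrow> \<eta>' x = 1"
    by (rule cutoff_extension[OF T cut k]) blast
  have M0: "0 \<le> \<bar>C\<^sub>\<eta>\<bar> / H" using H_pos by simp
  \<comment> \<open>\<open>\<eta>'\<close> is constant on the two sets. They have to be open: only
    then is the weak gradient determined there, and only then does an interface point have a ball on
    which the cutoff is constant.\<close>
  define O0 where "O0 = \<Omega> \<inter> interior (P T k)"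
  define O1 where "O1 = \<Omega> - P T k'"
  have op: "open O0" "open O1" unfolding O0_def O1_def using open_dom closed_P[OF T] by auto
  have sub: "O0 \<subseteq> \<Omega>" "O1 \<subseteq> \<Omega>" by (auto simp: O0_def O1_def)
  have z0: "\<eta>' x = 0" if "x \<in> O0" for x using that interior_subset[of "P T k"] by (intro z) (auto simp: O0_def)
  have o1: "\<eta>' x = 1" if "x \<in> O1" for x
    using that closure_subset[of "\<Omega> - P T k'"] by (intro o) (auto simp: O1_def far_def)
  have out: "x \<in> O0 \<or> x \<in> O1" if "x \<in> \<Omega>" "x \<notin> R" for x using that by (auto simp: R_def O0_def O1_def)
  have w: "weak_gradient \<Omega> (\<lambda>x. \<eta>' x * \<phi> x) (\<lambda>x. \<eta>' x *\<^sub>R grad \<Omega> \<phi> x + \<phi> x *\<^sub>R g x)"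
    by (rule product_weak_gradient[OF \<phi> e g M0])
  have g0: "AE x in lebesgue. x \<in> O0 \<longrightarrow> g x = 0"
    by (rule weak_gradient_locally_constant[OF g(1) open_dom op(1) sub(1)]) (rule z0)
  have g1: "AE x in lebesgue. x \<in> O1 \<longrightarrow> g x = 0"
    by (rule weak_gradient_locally_constant[OF g(1) open_dom op(2) sub(2)]) (rule o1)
  show ?thesis
  proof (rule that[OF _ r z o])
    show "(\<lambda>x. \<eta>' x * \<phi> x) \<in> V \<Omega> \<Gamma>"
      by (rule product_in_V[OF \<phi> e _ g M0]) (use r in force)
    show "AE x in M\<^sub>\<Omega>. norm (grad \<Omega> (\<lambda>x. \<eta>' x * \<phi> x) x - \<eta>' x *\<^sub>R grad \<Omega> \<phi> x) \<le> \<bar>C\<^sub>\<eta>\<bar> / H * \<bar>\<phi> x\<bar> \<and>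
      (x \<notin> R \<longrightarrow> grad \<Omega> (\<lambda>x. \<eta>' x * \<phi> x) x = \<eta>' x *\<^sub>R grad \<Omega> \<phi> x)"
      unfolding AE_lebesgue_on[OF dom_sets]
      using grad_AE[OF w open_dom] g(2) g0 g1
    proof eventually_elim
      case (elim x)
      show ?case
      proof
        assume x: "x \<in> \<Omega>"
        have eq: "grad \<Omega> (\<lambda>x. \<eta>' x * \<phi> x) x = \<eta>' x *\<^sub>R grad \<Omega> \<phi> x + \<phi> x *\<^sub>R g x" using elim(1) x by blast
        have "\<bar>\<phi> x\<bar> * norm (g x) \<le> \<bar>\<phi> x\<bar> * (\<bar>C\<^sub>\<eta>\<bar> / H)" using elim(2) x by (intro mult_left_mono) auto
        moreover have "g x = 0" if "x \<notin> R" using out[OF x that] elim(3,4) by blast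
        ultimately show "norm (grad \<Omega> (\<lambda>x. \<eta>' x * \<phi> x) x - \<eta>' x *\<^sub>R grad \<Omega> \<phi> x) \<le> \<bar>C\<^sub>\<eta>\<bar> / H * \<bar>\<phi> x\<bar> \<and>
            (x \<notin> R \<longrightarrow> grad \<Omega> (\<lambda>x. \<eta>' x * \<phi> x) x = \<eta>' x *\<^sub>R grad \<Omega> \<phi> x)"
          unfolding eq by (simp add: mult.commute[of "\<bar>\<phi> x\<bar>"])
      qed
    qed
    \<comment> \<open>A locally constant function is locally Lipschitz with constant 0, so
      \<open>product_tgrad\<close> leaves no error on these sets.\<close>
    have loc: "\<exists>s>0. 0-lipschitz_on (ball x s) \<eta>'" if "x \<in> O0 \<union> O1" for x
    proof -
      obtain S c where S: "open S" "x \<in> S" "\<And>y. y \<in> S \<Longrightarrow> \<eta>' y = c" using \<open>x \<in> O0 \<union> O1\<close> op z0 o1 by blast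
      then obtain s where s: "s > 0" "ball x s \<subseteq> S" using open_contains_ball by blast
      have "0-lipschitz_on (ball x s) \<eta>'"
      proof (rule lipschitz_onI)
        fix y y' assume "y \<in> ball x s" "y' \<in> ball x s"
        then have "\<eta>' y = c" "\<eta>' y' = c" using s(2) S(3) by blast+
        then show "dist (\<eta>' y) (\<eta>' y') \<le> 0 * dist y y'" by simp
      qed simp
      then show ?thesis using s(1) by blast
    qed
    have t: "AE x in M\<^sub>\<Gamma>. x \<in> O0 \<union> O1 \<longrightarrow>
        norm (tgrad \<Gamma> (\<lambda>x. \<eta>' x * \<phi> x) x - \<eta>' x *\<^sub>R tgrad \<Gamma> \<phi> x) \<le> 0 * \<bar>\<phi> x\<bar>"
      by (rule product_tgrad(2)[OF \<phi> e]) (rule loc)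
    show "AE x in M\<^sub>\<Gamma>. norm (tgrad \<Gamma> (\<lambda>x. \<eta>' x * \<phi> x) x - \<eta>' x *\<^sub>R tgrad \<Gamma> \<phi> x) \<le> \<bar>C\<^sub>\<eta>\<bar> / H * \<bar>\<phi> x\<bar> \<and>
      (x \<notin> R \<longrightarrow> tgrad \<Gamma> (\<lambda>x. \<eta>' x * \<phi> x) x = \<eta>' x *\<^sub>R tgrad \<Gamma> \<phi> x)"
      using t product_tgrad_bound[OF \<phi> e g M0] V_boundary[OF \<phi>]
    proof eventually_elim
      case (elim x)
      \<comment> \<open>\<open>R\<close> lies in \<open>\<Omega>\<close>. At interface points on the
        boundary the exact identity holds for another reason: there \<open>\<phi>\<close> is zero
        almost everywhere.\<close>
      have "norm (tgrad \<Gamma> (\<lambda>x. \<eta>' x * \<phi> x) x - \<eta>' x *\<^sub>R tgrad \<Gamma> \<phi> x) \<le> 0" if "x \<notin> R"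
      proof (cases "x \<in> \<Omega>")
        case True
        then show ?thesis using out[OF True that] elim(1) by auto
      next
        case False
        then show ?thesis using elim(2,3) by simp
      qed
      then show ?case using elim(2) by simp
    qed
  qed
qed

end

section \<open>Exponential decay\<close>

text \<open>The summands bound, in this order, the energies of \<open>\<phi>\<close> and of
  \<open>I u\<close> and the mass of \<open>\<phi>\<close> scaled by the square of the cutoff slope,
  all by energies of \<open>\<phi>\<close> on patches. The inner bracket is the constant for the
  energy of \<open>u\<close>.\<close>

definition local_const :: "real \<Rightarrow> real \<Rightarrow> real" where
  "local_const C\<^sub>I C\<^sub>\<eta> = 1 + 2 * C\<^sub>I\<^sup>2 * (2 + 4 * C\<^sub>\<eta>\<^sup>2 * C\<^sub>I\<^sup>2) + 2 * C\<^sub>\<eta>\<^sup>2 * C\<^sub>I\<^sup>2"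

locale interpolated_mesh = mesh_domain +
  fixes C\<^sub>I :: real and I :: "(real^2 \<Rightarrow> real) \<Rightarrow> real^2 \<Rightarrow> real"
  assumes interpolation: "interpolation \<Omega> \<Gamma> C\<^sub>I H \<T> I"
begin

lemma I_VH: "v \<in> V \<Omega> \<Gamma> \<Longrightarrow> I v \<in> VH \<Omega> \<T>" using interpolation by (simp add: interpolation_def)

lemma I_V: "v \<in> V \<Omega> \<Gamma> \<Longrightarrow> I v \<in> V \<Omega> \<Gamma>" using I_VH VH_subset_V by blast

lemma I_lin:
  assumes "u \<in> V \<Omega> \<Gamma>" "v \<in> V \<Omega> \<Gamma>"
  shows "I (\<lambda>x. u x + c * v x) = (\<lambda>x. I u x + c * I v x)"
proof -
  have "I (\<lambda>x. u x + c * v x) = (\<lambda>x. I u x + I (\<lambda>x. c * v x) x)"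
    using interpolation assms V_scale[OF assms(2), of c] by (simp add: interpolation_def)
  moreover have "I (\<lambda>x. c * v x) = (\<lambda>x. c * I v x)" using interpolation assms(2) by (simp add: interpolation_def)
  ultimately show ?thesis by simp
qed

lemma V_lin: "u \<in> V \<Omega> \<Gamma> \<Longrightarrow> v \<in> V \<Omega> \<Gamma> \<Longrightarrow> (\<lambda>x. u x + c * v x) \<in> V \<Omega> \<Gamma>"
  by (rule V_add[OF _ V_scale])

lemma borel_patch: "patch \<T> S \<in> sets borel"
  unfolding patch_def by (rule borel_Union) blast

lemma interpolation_energy:
  assumes v: "v \<in> V \<Omega> \<Gamma>" and T: "T' \<in> \<T>"
  shows "energy (I v) T' \<le> 2 * C\<^sub>I\<^sup>2 * energy v (patch \<T> T')"
    "mass (\<lambda>x. v x - I v x) T' \<le> 2 * (C\<^sub>I * H)\<^sup>2 * energy v (patch \<T> T')"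
proof -
  note b = borel_triangle[OF T]
  have d: "(\<lambda>x. v x - I v x) \<in> V \<Omega> \<Gamma>" using V_lin[OF v I_V[OF v], of "-1"] by simp
  have i: "dnorm \<Omega> T' (\<lambda>x. v x - I v x) + gnorm \<Gamma> T' (\<lambda>x. v x - I v x)
       \<le> C\<^sub>I * H * (dnorm \<Omega> (patch \<T> T') (grad \<Omega> v) + gnorm \<Gamma> (patch \<T> T') (tgrad \<Gamma> v))"
    "dnorm \<Omega> T' (grad \<Omega> (I v)) + gnorm \<Gamma> T' (tgrad \<Gamma> (I v))
       \<le> C\<^sub>I * (dnorm \<Omega> (patch \<T> T') (grad \<Omega> v) + gnorm \<Gamma> (patch \<T> T') (tgrad \<Gamma> v))"
    using interpolation v T unfolding interpolation_def by blast+
  show "energy (I v) T' \<le> 2 * C\<^sub>I\<^sup>2 * energy v (patch \<T> T')"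
    unfolding energy_norms(1)[OF I_V[OF v] b] energy_norms(1)[OF v borel_patch]
    by (rule square_sum_bound[OF norm_nonneg i(2)])
  show "mass (\<lambda>x. v x - I v x) T' \<le> 2 * (C\<^sub>I * H)\<^sup>2 * energy v (patch \<T> T')"
    unfolding energy_norms(2)[OF d b] energy_norms(1)[OF v borel_patch]
    by (rule square_sum_bound[OF norm_nonneg i(1)])
qed

lemma VfD:
  assumes "\<phi> \<in> Vf \<Omega> \<Gamma> I"
  shows "\<phi> \<in> V \<Omega> \<Gamma>" "I \<phi> = (\<lambda>x. 0)"
  using assms by (simp_all add: Vf_def)

text \<open>On a triangle, \<open>I u\<close> is controlled by \<open>u\<close> on the patch, which
  contains the mass of \<open>\<phi>\<close>; this mass is controlled by energies on the patches of
  all neighbours, because \<open>\<phi> - I \<phi>\<close> is \<open>\<phi>\<close>. The factor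
  \<open>H\<close> gained there cancels the slope of the cutoff.\<close>

lemma local_bounds:
  assumes \<phi>: "\<phi> \<in> Vf \<Omega> \<Gamma> I" and u: "u \<in> V \<Omega> \<Gamma>" and T: "T' \<in> \<T>"
    and g: "AE x in M\<^sub>\<Omega>. norm (grad \<Omega> u x) \<le> norm (grad \<Omega> \<phi> x) + \<bar>C\<^sub>\<eta>\<bar> / H * \<bar>\<phi> x\<bar>"
    and t: "AE x in M\<^sub>\<Gamma>. norm (tgrad \<Gamma> u x) \<le> norm (tgrad \<Gamma> \<phi> x) + \<bar>C\<^sub>\<eta>\<bar> / H * \<bar>\<phi> x\<bar>"
  shows "energy \<phi> T' + energy (I u) T' + (\<bar>C\<^sub>\<eta>\<bar> / H)\<^sup>2 * mass \<phi> T'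
    \<le> local_const C\<^sub>I C\<^sub>\<eta> * (\<Sum>T''\<in>nb T'. energy \<phi> (patch \<T> T''))"
proof -
  define M where "M = \<bar>C\<^sub>\<eta>\<bar> / H"
  define Y where "Y = (\<Sum>T''\<in>nb T'. energy \<phi> (patch \<T> T''))"
  note \<phi>V = VfD(1)[OF \<phi>]
  have fin: "finite (nb T')" using finite_mesh by simp
  have self: "T' \<in> nb T'" using T triangle(5)[OF T] interior_subset[of T'] by auto
  have Y1: "energy \<phi> (patch \<T> T') \<le> Y"
    unfolding Y_def by (rule member_le_sum[OF self energy_nonneg fin])
  have e1: "energy \<phi> T' \<le> Y"
    by (rule order_trans[OF energy_mono[OF \<phi>V borel_triangle[OF T] borel_patch patch_subset[OF T]] Y1])
  have MH: "M * H = \<bar>C\<^sub>\<eta>\<bar>" using H_pos by (simp add: M_def)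
  have m: "M\<^sup>2 * mass \<phi> T'' \<le> 2 * C\<^sub>\<eta>\<^sup>2 * C\<^sub>I\<^sup>2 * energy \<phi> (patch \<T> T'')" if "T'' \<in> \<T>" for T''
  proof -
    have "mass \<phi> T'' \<le> 2 * (C\<^sub>I * H)\<^sup>2 * energy \<phi> (patch \<T> T'')"
      using interpolation_energy(2)[OF \<phi>V that] by (simp add: VfD(2)[OF \<phi>])
    then have "M\<^sup>2 * mass \<phi> T'' \<le> M\<^sup>2 * (2 * (C\<^sub>I * H)\<^sup>2 * energy \<phi> (patch \<T> T''))" by (rule mult_left_mono) simp
    also have "\<dots> = 2 * (M * H)\<^sup>2 * C\<^sub>I\<^sup>2 * energy \<phi> (patch \<T> T'')" by (simp add: power_mult_distrib mult_ac)
    finally show ?thesis by (simp add: MH)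
  qed
  have c0: "0 \<le> 2 * C\<^sub>\<eta>\<^sup>2 * C\<^sub>I\<^sup>2" by simp
  have m1: "M\<^sup>2 * mass \<phi> T' \<le> 2 * C\<^sub>\<eta>\<^sup>2 * C\<^sub>I\<^sup>2 * Y"
    by (rule order_trans[OF m[OF T] mult_left_mono[OF Y1 c0]])
  have "M\<^sup>2 * mass \<phi> (patch \<T> T') \<le> M\<^sup>2 * (\<Sum>T''\<in>nb T'. mass \<phi> T'')"
    by (rule mult_left_mono[OF patch_cover(2)[OF \<phi>V]]) simp
  also have "\<dots> \<le> 2 * C\<^sub>\<eta>\<^sup>2 * C\<^sub>I\<^sup>2 * Y"
    unfolding Y_def sum_distrib_left by (rule sum_mono[OF m]) simp
  finally have m2: "M\<^sup>2 * mass \<phi> (patch \<T> T') \<le> 2 * C\<^sub>\<eta>\<^sup>2 * C\<^sub>I\<^sup>2 * Y" .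
  have "energy u (patch \<T> T') \<le> 2 * energy \<phi> (patch \<T> T') + 2 * M\<^sup>2 * mass \<phi> (patch \<T> T')"
    by (rule energy_add_bound[OF u \<phi>V borel_patch g[folded M_def] t[folded M_def]])
  also have "\<dots> \<le> 2 * Y + 2 * (2 * C\<^sub>\<eta>\<^sup>2 * C\<^sub>I\<^sup>2 * Y)" using Y1 m2 by linarith
  also have "\<dots> = (2 + 4 * C\<^sub>\<eta>\<^sup>2 * C\<^sub>I\<^sup>2) * Y" by (simp add: algebra_simps)
  finally have eu: "energy u (patch \<T> T') \<le> (2 + 4 * C\<^sub>\<eta>\<^sup>2 * C\<^sub>I\<^sup>2) * Y" .
  have "energy (I u) T' \<le> 2 * C\<^sub>I\<^sup>2 * ((2 + 4 * C\<^sub>\<eta>\<^sup>2 * C\<^sub>I\<^sup>2) * Y)"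
    by (rule order_trans[OF interpolation_energy(1)[OF u T] mult_left_mono[OF eu]]) simp
  then have "energy \<phi> T' + energy (I u) T' + M\<^sup>2 * mass \<phi> T' \<le> Y + 2 * C\<^sub>I\<^sup>2 * ((2 + 4 * C\<^sub>\<eta>\<^sup>2 * C\<^sub>I\<^sup>2) * Y) + 2 * C\<^sub>\<eta>\<^sup>2 * C\<^sub>I\<^sup>2 * Y"
    using e1 m1 by linarith
  also have "\<dots> = local_const C\<^sub>I C\<^sub>\<eta> * Y" by (simp add: local_const_def algebra_simps)
  finally show ?thesis by (simp add: Y_def M_def)
qed

text \<open>This is the locality of \<open>I\<close>. Applied to \<open>u\<close> it works inside
  the cutoff region, applied to \<open>u - \<phi>\<close> outside of it.\<close>

lemma interpolation_energy_0:
  assumes v: "v \<in> V \<Omega> \<Gamma>" and T: "T' \<in> \<T>"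
    and "AE x in M\<^sub>\<Omega>. x \<in> patch \<T> T' \<longrightarrow> grad \<Omega> v x = 0" "AE x in M\<^sub>\<Gamma>. x \<in> patch \<T> T' \<longrightarrow> tgrad \<Gamma> v x = 0"
  shows "energy (I v) T' = 0"
  using interpolation_energy(1)[OF v T] energy_nonneg[of "I v" T'] by (simp add: energy_0[OF assms(3,4)])

text \<open>The layers: the cutoff varies between j + 5 and j + 6, \<open>u\<close> has no gradient
  on layer j + 4, and \<open>v = I u\<close> has none on triangles that meet layer j + 2 or miss
  layer j + 7. The estimates on the remaining ring are summed with
  \<open>ring_chain\<close>.\<close>

lemma corrector_step:
  assumes T: "T \<in> \<T>" and coef: "coefficients \<Omega> \<Gamma> \<alpha> \<beta> A A\<^sub>\<Gamma>" "0 < \<alpha>" "0 \<le> \<beta>"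
    and cut: "cutoff \<Omega> C\<^sub>\<eta> H \<T> T (j + 5) \<eta>" and v0: "v0 \<in> VH \<Omega> \<T>" and cor: "corrector \<Omega> \<Gamma> A A\<^sub>\<Gamma> I v0 T \<phi>"
  shows "\<alpha> * energy \<phi> (far \<Omega> \<T> (j + 6) T)
    \<le> \<beta> * (local_const C\<^sub>I C\<^sub>\<eta> * ((64 * \<gamma>\<^sup>2) ^ 3 * energy \<phi> (\<Union>(ring T j (j + 9)))))"
proof -
  define M where "M = \<bar>C\<^sub>\<eta>\<bar> / H"
  have \<phi>f: "\<phi> \<in> Vf \<Omega> \<Gamma> I" using cor by (simp add: corrector_def)
  note \<phi>V = VfD(1)[OF \<phi>f] and I\<phi> = VfD(2)[OF \<phi>f]
  have v0V: "v0 \<in> V \<Omega> \<Gamma>" using v0 VH_subset_V by blast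
  have k56: "j + 6 = j + 5 + 1" by simp
  define R where "R = \<Omega> \<inter> P T (j + 6) - interior (P T (j + 5))"
  obtain u \<eta>' where uV: "u \<in> V \<Omega> \<Gamma>" and r: "\<And>x. x \<in> closure \<Omega> \<Longrightarrow> 0 \<le> \<eta>' x \<and> \<eta>' x \<le> 1"
    and z: "\<And>x. x \<in> P T (j + 5) \<Longrightarrow> \<eta>' x = 0" and o: "\<And>x. x \<in> far \<Omega> \<T> (j + 6) T \<Longrightarrow> \<eta>' x = 1"
    and g: "AE x in M\<^sub>\<Omega>. norm (grad \<Omega> u x - \<eta>' x *\<^sub>R grad \<Omega> \<phi> x) \<le> M * \<bar>\<phi> x\<bar> \<and>
      (x \<notin> R \<longrightarrow> grad \<Omega> u x = \<eta>' x *\<^sub>R grad \<Omega> \<phi> x)"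
    and t: "AE x in M\<^sub>\<Gamma>. norm (tgrad \<Gamma> u x - \<eta>' x *\<^sub>R tgrad \<Gamma> \<phi> x) \<le> M * \<bar>\<phi> x\<bar> \<and>
      (x \<notin> R \<longrightarrow> tgrad \<Gamma> u x = \<eta>' x *\<^sub>R tgrad \<Gamma> \<phi> x)"
    unfolding M_def R_def by (rule cutoff_product[OF T cut k56 \<phi>V]) blast
  have AEc: "AE x in M\<^sub>\<Omega>. x \<in> \<Omega>" by (simp add: AE_lebesgue_on[OF dom_sets])
  have cl: "\<Omega> \<subseteq> closure \<Omega>" by (rule closure_subset)
  have \<eta>\<Omega>: "AE x in M\<^sub>\<Omega>. x \<in> closure \<Omega>" using AEc by eventually_elim (use cl in blast)
  have \<eta>\<Gamma>: "AE x in M\<^sub>\<Gamma>. x \<in> closure \<Omega>" using AE_interface by eventually_elim (use interface_closure in blast)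
  define v where "v = I u"
  have vV: "v \<in> V \<Omega> \<Gamma>" unfolding v_def by (rule I_V[OF uV])
  have Iv: "I v = v" using interpolation I_VH[OF uV] by (simp add: interpolation_def v_def)
  \<comment> \<open>\<open>I\<close> is a projection, so it maps both \<open>u\<close> and
    \<open>v\<close> to \<open>v\<close> and annihilates \<open>w\<close>.\<close>
  define w where "w = (\<lambda>x. u x + (- 1) * v x)"
  have wV: "w \<in> V \<Omega> \<Gamma>" unfolding w_def by (rule V_lin[OF uV vV])
  have "I w = (\<lambda>x. 0)" unfolding w_def I_lin[OF uV vV] Iv by (simp add: v_def)
  then have wf: "w \<in> Vf \<Omega> \<Gamma> I" using wV by (simp add: Vf_def)
  have gw: "AE x in M\<^sub>\<Omega>. grad \<Omega> w x = grad \<Omega> u x - grad \<Omega> v x"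
    using grad_add_AE(1)[OF uV vV, of "- 1"] unfolding w_def by simp
  have tw: "AE x in M\<^sub>\<Gamma>. tgrad \<Gamma> w x = tgrad \<Gamma> u x - tgrad \<Gamma> v x"
    using grad_add_AE(2)[OF uV vV, of "- 1"] unfolding w_def by simp
  \<comment> \<open>The only triangles on which the gradient of \<open>v\<close> may differ from
    zero; \<open>near\<close> and \<open>far\<close> below exclude all others.\<close>
  define S where "S = \<Union>(ring T (j + 2) (j + 7))"
  have bS: "S \<in> sets borel" unfolding S_def by (rule borel_Union[OF ring_subset])
  \<comment> \<open>The strip \<open>R\<close> may contain points of layer j + 5 that are not
    interior to it. Giving away one layer avoids them, since by \<open>P_nbhd\<close> the points of
    layer j + 4 in \<open>\<Omega>\<close> are interior.\<close>
  have inner: "\<eta>' x = 0 \<and> x \<notin> R" if x: "x \<in> P T (j + 4)" for x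
  proof
    show "\<eta>' x = 0" using P_mono[OF T, of "j + 4" "j + 5"] x by (intro z) auto
    show "x \<notin> R"
    proof
      assume "x \<in> R"
      then have x': "x \<in> \<Omega>" "x \<notin> interior (P T (j + 5))" by (auto simp: R_def)
      have "Suc (j + 4) = j + 5" by simp
      then show False using P_nbhd[OF T x'(1) x] x'(2) by (simp only:)
    qed
  qed
  have zg: "AE x in M\<^sub>\<Omega>. x \<in> P T (j + 4) \<longrightarrow> grad \<Omega> u x = 0"
    using g by eventually_elim (use inner in simp)
  have zt: "AE x in M\<^sub>\<Gamma>. x \<in> P T (j + 4) \<longrightarrow> tgrad \<Gamma> u x = 0"
    using t by eventually_elim (use inner in simp)
  have near: "energy v T' = 0" if T': "T' \<in> \<T>" "T' \<inter> P T (j + 2) \<noteq> {}" for T'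
  proof -
    have "T' \<subseteq> P T (j + 3)" by (rule subset_P[OF T']) simp
    then have "patch \<T> T' \<subseteq> P T (j + 4)" using subset_P[of _ "j + 3" T "j + 4"] unfolding patch_def by fastforce
    then show ?thesis
      unfolding v_def using zg zt by (intro interpolation_energy_0[OF uV T'(1)]) (auto elim!: eventually_mono)
  qed
  have far: "energy v T' = 0" if T': "T' \<in> \<T>" "T' \<inter> P T (j + 7) = {}" for T'
  proof -
    \<comment> \<open>\<open>u\<close> and \<open>\<phi>\<close> have the same gradient on the
      patch, and subtracting \<open>\<phi>\<close> does not change the interpolant because
      \<open>I \<phi>\<close> is zero.\<close>
    define y where "y = (\<lambda>x. u x + (- 1) * \<phi> x)"
    have yV: "y \<in> V \<Omega> \<Gamma>" unfolding y_def by (rule V_lin[OF uV \<phi>V])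
    have Iy: "I y = v" unfolding y_def I_lin[OF uV \<phi>V] I\<phi> v_def by simp
    have out: "\<eta>' x = 1 \<and> x \<notin> R" if x: "x \<in> patch \<T> T'" for x
    proof -
      obtain T'' where T'': "T'' \<in> \<T>" "T'' \<inter> T' \<noteq> {}" "x \<in> T''" using x by (auto simp: patch_def)
      have d: "T'' \<inter> P T (j + 6) = {}"
      proof (rule ccontr)
        assume "T'' \<inter> P T (j + 6) \<noteq> {}"
        then have "T'' \<subseteq> P T (j + 7)" by (rule subset_P[OF T''(1)]) simp
        then show False using T''(2) T'(2) by blast
      qed
      have "\<eta>' x = 1" using subset_far[OF T''(1) d] T''(3) by (intro o) blast
      moreover have "x \<notin> R" using d T''(3) by (auto simp: R_def)
      ultimately show ?thesis ..
    qed
    have "AE x in M\<^sub>\<Omega>. x \<in> patch \<T> T' \<longrightarrow> grad \<Omega> y x = 0"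
      using grad_add_AE(1)[OF uV \<phi>V, of "- 1", folded y_def] g by eventually_elim (use out in simp)
    moreover have "AE x in M\<^sub>\<Gamma>. x \<in> patch \<T> T' \<longrightarrow> tgrad \<Gamma> y x = 0"
      using grad_add_AE(2)[OF uV \<phi>V, of "- 1", folded y_def] t by eventually_elim (use out in simp)
    ultimately show ?thesis using interpolation_energy_0[OF yV T'(1)] unfolding Iy by blast
  qed
  have zero: "energy v T' = 0" if "T' \<in> \<T> - ring T (j + 2) (j + 7)" for T'
    using that near[of T'] far[of T'] unfolding ring_def by blast
  have fin: "finite (\<T> - ring T (j + 2) (j + 7))" using finite_mesh by simp
  have off: "\<exists>T'\<in>\<T> - ring T (j + 2) (j + 7). x \<in> T'" if "x \<in> closure \<Omega>" "x \<notin> S" for x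
    using triangle_of_point[OF that(1)] that(2) unfolding S_def by blast
  have "AE x in M\<^sub>\<Omega>. \<forall>T'\<in>\<T> - ring T (j + 2) (j + 7). x \<in> T' \<longrightarrow> grad \<Omega> v x = 0"
    unfolding AE_finite_all[OF fin] using energy_0_AE(1)[OF vV borel_triangle zero] by blast
  then have vg: "AE x in M\<^sub>\<Omega>. x \<notin> S \<longrightarrow> grad \<Omega> v x = 0"
    using \<eta>\<Omega> by eventually_elim (use off in blast)
  have "AE x in M\<^sub>\<Gamma>. \<forall>T'\<in>\<T> - ring T (j + 2) (j + 7). x \<in> T' \<longrightarrow> tgrad \<Gamma> v x = 0"
    unfolding AE_finite_all[OF fin] using energy_0_AE(2)[OF vV borel_triangle zero] by blast
  then have vt: "AE x in M\<^sub>\<Gamma>. x \<notin> S \<longrightarrow> tgrad \<Gamma> v x = 0"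
    using \<eta>\<Gamma> by eventually_elim (use off in blast)
  have RS: "x \<in> S" if x: "x \<in> R" for x
  proof -
    have x': "x \<in> \<Omega>" "x \<in> P T (j + 6)" "x \<notin> interior (P T (j + 5))" using x by (auto simp: R_def)
    obtain T' where T': "T' \<in> \<T>" "x \<in> T'" using triangle_of_point cl x'(1) by blast
    have "T' \<inter> P T (j + 2) = {}"
    proof (rule ccontr)
      assume "T' \<inter> P T (j + 2) \<noteq> {}"
      then have "T' \<subseteq> P T (j + 3)" by (rule subset_P[OF T'(1)]) simp
      then have "x \<in> P T (j + 4)" using T'(2) P_mono[OF T, of "j + 3" "j + 4"] by auto
      then show False using inner x by blast
    qed
    moreover have "x \<in> P T (j + 7)" using x'(2) P_mono[OF T, of "j + 6" "j + 7"] by auto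
    ultimately show ?thesis using T' by (auto simp: S_def ring_def)
  qed
  have TP: "T \<subseteq> P T (j + 4)" using P_mono[OF T, of 0 "j + 4"] by simp
  have "x \<notin> S" if "x \<in> T" for x
    using P_mono[OF T, of 0 "j + 2"] that by (auto simp: S_def ring_def)
  note TS = this
  \<comment> \<open>\<open>T\<close> is contained in layer j + 4, where \<open>u\<close> has no
    gradient, and avoids \<open>S\<close>, outside of which \<open>v\<close> has none. The
    right-hand side of the corrector equation thus vanishes for \<open>w\<close>.\<close>
  have "form_on \<Omega> \<Gamma> A A\<^sub>\<Gamma> T v0 w = 0"
  proof -
    have "AE x in M\<^sub>\<Omega>. indicator T x * (A x * (grad \<Omega> v0 x \<bullet> grad \<Omega> w x)) = 0"
      using gw zg vg by eventually_elim (use TP TS in \<open>auto simp: indicator_def\<close>)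
    moreover have "AE x in M\<^sub>\<Gamma>. indicator T x * (A\<^sub>\<Gamma> x * (tgrad \<Gamma> v0 x \<bullet> tgrad \<Gamma> w x)) = 0"
      using tw zt vt by eventually_elim (use TP TS in \<open>auto simp: indicator_def\<close>)
    ultimately show ?thesis
      unfolding form_on_eq[OF coef(1) v0V wV borel_triangle[OF T]] by (simp add: integral_eq_zero_AE)
  qed
  then have "bilinear_form \<Omega> \<Gamma> A A\<^sub>\<Gamma> \<phi> w = 0" using cor wf by (simp add: corrector_def)
  then have eq: "(LINT x|M\<^sub>\<Omega>. A x * (grad \<Omega> \<phi> x \<bullet> grad \<Omega> w x)) + (LINT x|M\<^sub>\<Gamma>. A\<^sub>\<Gamma> x * (tgrad \<Gamma> \<phi> x \<bullet> tgrad \<Gamma> w x)) = 0"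
    unfolding bilinear_form_eq[OF coef(1) \<phi>V wV] .
  define F where "F = far \<Omega> \<T> (j + 6) T"
  have bF: "F \<in> sets borel" unfolding F_def by (rule borel_closed[OF closed_far])
  note hs = H1_grad_V[OF \<phi>V] and hv = H1_grad_V[OF vV] and hw = H1_grad_V[OF wV]
  have A: "A \<in> borel_measurable M\<^sub>\<Omega>" "AE x in M\<^sub>\<Omega>. \<alpha> \<le> A x \<and> A x \<le> \<beta>"
    "A\<^sub>\<Gamma> \<in> borel_measurable M\<^sub>\<Gamma>" "AE x in M\<^sub>\<Gamma>. \<alpha> \<le> A\<^sub>\<Gamma> x \<and> A\<^sub>\<Gamma> x \<le> \<beta>"
    using coef(1) by (auto simp: coefficients_def)
  \<comment> \<open>Plane and interface are estimated separately, with their own coefficients; only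
    the sum of the two integrals on the right is known to be zero.\<close>
  have b1: "\<alpha> * sqn_on M\<^sub>\<Omega> (grad \<Omega> \<phi>) F - \<beta> * (sqn_on M\<^sub>\<Omega> (grad \<Omega> \<phi>) S + sqn_on M\<^sub>\<Omega> (grad \<Omega> v) S + M\<^sup>2 * sqn_on M\<^sub>\<Omega> \<phi> S)
      \<le> (LINT x|M\<^sub>\<Omega>. A x * (grad \<Omega> \<phi> x \<bullet> grad \<Omega> w x))"
  proof (rule tested_energy_bound[OF hs(2) hs(3) hv(2) hw(2) A(1,2) coef(2) indicator_borel(1)[OF bS] indicator_borel(1)[OF bF] _ _ vg, where \<eta> = \<eta>'])
    show "AE x in M\<^sub>\<Omega>. \<exists>e. grad \<Omega> w x = \<eta>' x *\<^sub>R grad \<Omega> \<phi> x + e - grad \<Omega> v x \<and> norm e \<le> M * \<bar>\<phi> x\<bar> \<and> (x \<notin> S \<longrightarrow> e = 0)"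
      using gw g
    proof eventually_elim
      case (elim x)
      then show ?case using RS[of x] by (intro exI[of _ "grad \<Omega> u x - \<eta>' x *\<^sub>R grad \<Omega> \<phi> x"]) auto
    qed
    show "AE x in M\<^sub>\<Omega>. 0 \<le> \<eta>' x \<and> (x \<in> F \<longrightarrow> \<eta>' x = 1)"
      using \<eta>\<Omega> by eventually_elim (use r o in \<open>simp add: F_def\<close>)
  qed
  have b2: "\<alpha> * sqn_on M\<^sub>\<Gamma> (tgrad \<Gamma> \<phi>) F - \<beta> * (sqn_on M\<^sub>\<Gamma> (tgrad \<Gamma> \<phi>) S + sqn_on M\<^sub>\<Gamma> (tgrad \<Gamma> v) S + M\<^sup>2 * sqn_on M\<^sub>\<Gamma> \<phi> S)
      \<le> (LINT x|M\<^sub>\<Gamma>. A\<^sub>\<Gamma> x * (tgrad \<Gamma> \<phi> x \<bullet> tgrad \<Gamma> w x))"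
  proof (rule tested_energy_bound[OF hs(4) hs(5) hv(4) hw(4) A(3,4) coef(2) indicator_borel(2)[OF bS] indicator_borel(2)[OF bF] _ _ vt, where \<eta> = \<eta>'])
    show "AE x in M\<^sub>\<Gamma>. \<exists>e. tgrad \<Gamma> w x = \<eta>' x *\<^sub>R tgrad \<Gamma> \<phi> x + e - tgrad \<Gamma> v x \<and> norm e \<le> M * \<bar>\<phi> x\<bar> \<and> (x \<notin> S \<longrightarrow> e = 0)"
      using tw t
    proof eventually_elim
      case (elim x)
      then show ?case using RS[of x] by (intro exI[of _ "tgrad \<Gamma> u x - \<eta>' x *\<^sub>R tgrad \<Gamma> \<phi> x"]) auto
    qed
    show "AE x in M\<^sub>\<Gamma>. 0 \<le> \<eta>' x \<and> (x \<in> F \<longrightarrow> \<eta>' x = 1)"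
      using \<eta>\<Gamma> by eventually_elim (use r o in \<open>simp add: F_def\<close>)
  qed
  have gb: "AE x in M\<^sub>\<Omega>. norm (grad \<Omega> u x) \<le> norm (grad \<Omega> \<phi> x) + \<bar>C\<^sub>\<eta>\<bar> / H * \<bar>\<phi> x\<bar>"
    using g \<eta>\<Omega>
  proof eventually_elim
    case (elim x)
    have "\<bar>\<eta>' x\<bar> * norm (grad \<Omega> \<phi> x) \<le> 1 * norm (grad \<Omega> \<phi> x)" using r[OF elim(2)] by (intro mult_right_mono) auto
    then show ?case
      using elim(1) norm_triangle_sub[of "grad \<Omega> u x" "\<eta>' x *\<^sub>R grad \<Omega> \<phi> x"] unfolding norm_scaleR M_def by linarith
  qed
  have tb: "AE x in M\<^sub>\<Gamma>. norm (tgrad \<Gamma> u x) \<le> norm (tgrad \<Gamma> \<phi> x) + \<bar>C\<^sub>\<eta>\<bar> / H * \<bar>\<phi> x\<bar>"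
    using t \<eta>\<Gamma>
  proof eventually_elim
    case (elim x)
    have "\<bar>\<eta>' x\<bar> * norm (tgrad \<Gamma> \<phi> x) \<le> 1 * norm (tgrad \<Gamma> \<phi> x)" using r[OF elim(2)] by (intro mult_right_mono) auto
    then show ?case
      using elim(1) norm_triangle_sub[of "tgrad \<Gamma> u x" "\<eta>' x *\<^sub>R tgrad \<Gamma> \<phi> x"] unfolding norm_scaleR M_def by linarith
  qed
  have finr: "finite (ring T (j + 2) (j + 7))" by (rule finite_subset[OF ring_subset finite_mesh])
  have br: "T' \<in> sets borel" if "T' \<in> ring T (j + 2) (j + 7)" for T' using that ring_subset borel_triangle by blast
  have sr: "S \<subseteq> (\<Union>T'\<in>ring T (j + 2) (j + 7). T')" by (simp add: S_def)
  have M2: "0 \<le> M\<^sup>2" by simp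
  have cE: "energy \<phi> S \<le> (\<Sum>T'\<in>ring T (j + 2) (j + 7). energy \<phi> T')" by (rule energy_cover(1)[OF \<phi>V bS finr _ sr]) (rule br)
  have cv: "energy v S \<le> (\<Sum>T'\<in>ring T (j + 2) (j + 7). energy v T')" by (rule energy_cover(1)[OF vV bS finr _ sr]) (rule br)
  have "mass \<phi> S \<le> (\<Sum>T'\<in>ring T (j + 2) (j + 7). mass \<phi> T')" by (rule energy_cover(2)[OF \<phi>V bS finr _ sr]) (rule br)
  from mult_left_mono[OF this M2]
  have cm: "M\<^sup>2 * mass \<phi> S \<le> (\<Sum>T'\<in>ring T (j + 2) (j + 7). M\<^sup>2 * mass \<phi> T')" unfolding sum_distrib_left .
  \<comment> \<open>From here on the estimate is local: one triangle of the ring at a time by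
    \<open>local_bounds\<close>, then a count of how often each triangle of the wider ring is
    used.\<close>
  have "energy \<phi> S + energy v S + M\<^sup>2 * mass \<phi> S \<le> (\<Sum>T'\<in>ring T (j + 2) (j + 7). energy \<phi> T' + energy v T' + M\<^sup>2 * mass \<phi> T')"
    unfolding sum.distrib using cE cv cm by linarith
  also have "\<dots> \<le> (\<Sum>T'\<in>ring T (j + 2) (j + 7). local_const C\<^sub>I C\<^sub>\<eta> * (\<Sum>T''\<in>nb T'. energy \<phi> (patch \<T> T'')))"
    unfolding M_def v_def using ring_subset by (intro sum_mono local_bounds[OF \<phi>f uV _ gb tb]) blast
  also have "\<dots> = local_const C\<^sub>I C\<^sub>\<eta> * (\<Sum>T'\<in>ring T (j + 2) (j + 7). \<Sum>T''\<in>nb T'. energy \<phi> (patch \<T> T''))"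
    by (rule sum_distrib_left[symmetric])
  also have "\<dots> \<le> local_const C\<^sub>I C\<^sub>\<eta> * ((64 * \<gamma>\<^sup>2) ^ 3 * energy \<phi> (\<Union>(ring T j (j + 9))))"
    by (rule mult_left_mono[OF ring_chain[OF \<phi>V]]) (simp add: local_const_def)
  finally have fin_bound: "energy \<phi> S + energy v S + M\<^sup>2 * mass \<phi> S \<le> local_const C\<^sub>I C\<^sub>\<eta> * ((64 * \<gamma>\<^sup>2) ^ 3 * energy \<phi> (\<Union>(ring T j (j + 9))))" .
  have "\<alpha> * energy \<phi> F \<le> \<beta> * (energy \<phi> S + energy v S + M\<^sup>2 * mass \<phi> S)"
    using b1 b2 eq unfolding energy_def mass_def distrib_left by linarith
  also have "\<dots> \<le> \<beta> * (local_const C\<^sub>I C\<^sub>\<eta> * ((64 * \<gamma>\<^sup>2) ^ 3 * energy \<phi> (\<Union>(ring T j (j + 9)))))"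
    by (rule mult_left_mono[OF fin_bound coef(3)])
  finally show ?thesis unfolding F_def .
qed

text \<open>\<open>\<phi>\<close> itself is admissible in its own equation. After Young's inequality
  the factor is \<open>2 / \<alpha>\<close> times
  \<open>\<beta>\<^sup>2 / (2 * \<alpha>)\<close>.\<close>

lemma corrector_energy:
  assumes T: "T \<in> \<T>" and coef: "coefficients \<Omega> \<Gamma> \<alpha> \<beta> A A\<^sub>\<Gamma>" "0 < \<alpha>"
    and v0: "v0 \<in> VH \<Omega> \<T>" and cor: "corrector \<Omega> \<Gamma> A A\<^sub>\<Gamma> I v0 T \<phi>"
  shows "energy \<phi> UNIV \<le> (\<beta> / \<alpha>)\<^sup>2 * energy v0 T"
proof -
  have \<phi>f: "\<phi> \<in> Vf \<Omega> \<Gamma> I" using cor by (simp add: corrector_def)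
  note \<phi>V = VfD(1)[OF \<phi>f]
  have v0V: "v0 \<in> V \<Omega> \<Gamma>" using v0 VH_subset_V by blast
  note bT = borel_triangle[OF T]
  have A: "A \<in> borel_measurable M\<^sub>\<Omega>" "AE x in M\<^sub>\<Omega>. \<alpha> \<le> A x \<and> A x \<le> \<beta>"
    "A\<^sub>\<Gamma> \<in> borel_measurable M\<^sub>\<Gamma>" "AE x in M\<^sub>\<Gamma>. \<alpha> \<le> A\<^sub>\<Gamma> x \<and> A\<^sub>\<Gamma> x \<le> \<beta>"
    using coef(1) by (auto simp: coefficients_def)
  have "bilinear_form \<Omega> \<Gamma> A A\<^sub>\<Gamma> \<phi> \<phi> = form_on \<Omega> \<Gamma> A A\<^sub>\<Gamma> T v0 \<phi>" using cor \<phi>f by (simp add: corrector_def)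
  then have eq: "(LINT x|M\<^sub>\<Omega>. A x * (grad \<Omega> \<phi> x \<bullet> grad \<Omega> \<phi> x)) + (LINT x|M\<^sub>\<Gamma>. A\<^sub>\<Gamma> x * (tgrad \<Gamma> \<phi> x \<bullet> tgrad \<Gamma> \<phi> x)) =
      (LINT x|M\<^sub>\<Omega>. indicator T x * (A x * (grad \<Omega> v0 x \<bullet> grad \<Omega> \<phi> x))) +
      (LINT x|M\<^sub>\<Gamma>. indicator T x * (A\<^sub>\<Gamma> x * (tgrad \<Gamma> v0 x \<bullet> tgrad \<Gamma> \<phi> x)))"
    unfolding bilinear_form_eq[OF coef(1) \<phi>V \<phi>V] form_on_eq[OF coef(1) v0V \<phi>V bT] .
  note 1 = energy_of_solution[OF H1_grad_V(2)[OF \<phi>V] H1_grad_V(2)[OF v0V] A(1,2) coef(2) indicator_borel(1)[OF bT]]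
    and 2 = energy_of_solution[OF H1_grad_V(4)[OF \<phi>V] H1_grad_V(4)[OF v0V] A(3,4) coef(2) indicator_borel(2)[OF bT]]
  have "\<alpha> / 2 * energy \<phi> UNIV \<le> \<beta>\<^sup>2 / (2 * \<alpha>) * energy v0 T"
    using 1 2 eq unfolding energy_def distrib_left by linarith
  then have "2 / \<alpha> * (\<alpha> / 2 * energy \<phi> UNIV) \<le> 2 / \<alpha> * (\<beta>\<^sup>2 / (2 * \<alpha>) * energy v0 T)"
    using coef(2) by (intro mult_left_mono) auto
  then show ?thesis using coef(2) by (simp add: power_divide power2_eq_square)
qed

end

text \<open>Hole filling: adding \<open>c * e (j + m)\<close> to both sides of the step turns the
  bound by a difference into a contraction with factor \<open>c / (1 + c)\<close>. Indices between
  multiples of \<open>m\<close> are covered by monotonicity.\<close>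

lemma geometric_decay:
  fixes e :: "nat \<Rightarrow> real"
  assumes "0 < c" and step: "\<And>j. e (j + m) \<le> c * (e j - e (j + m))" and mono: "\<And>i j. i \<le> j \<Longrightarrow> e j \<le> e i"
  shows "e k \<le> (c / (1 + c)) ^ (k div m) * e 0"
proof -
  let ?q = "c / (1 + c)"
  have q: "0 \<le> ?q" using assms(1) by simp
  have s: "e (j + m) \<le> ?q * e j" for j
    using step[of j] assms(1) by (simp add: field_simps)
  have "e (m * n) \<le> ?q ^ n * e 0" for n
  proof (induction n)
    case (Suc n)
    have "e (m * Suc n) \<le> ?q * e (m * n)" using s[of "m * n"] by (simp add: add.commute)
    also have "\<dots> \<le> ?q * (?q ^ n * e 0)" by (rule mult_left_mono[OF Suc q])
    finally show ?case by (simp only: power_Suc mult.assoc)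
  qed simp
  moreover have "e k \<le> e (m * (k div m))" by (rule mono) simp
  ultimately show ?thesis by (meson order_trans)
qed

theorem theorem1:
  fixes \<Omega> :: "(real^2) set" and \<Gamma> :: "curve list" and \<alpha> \<beta> \<gamma> C\<^sub>\<eta> C\<^sub>I :: real
  assumes "polygonal_domain \<Omega>"
    and "\<forall>\<C>\<in>set \<Gamma>. smooth_curve \<C>"
    and "interface \<Gamma> \<subseteq> closure \<Omega>"
    and "0 < \<alpha>"
  shows "\<exists>C\<^sub>0>0. \<exists>C>0. \<forall>A A\<^sub>\<Gamma> H \<T> I \<eta>.
    coefficients \<Omega> \<Gamma> \<alpha> \<beta> A A\<^sub>\<Gamma> \<longrightarrow>
    mesh \<Omega> \<gamma> H \<T> \<longrightarrow>
    interpolation \<Omega> \<Gamma> C\<^sub>I H \<T> I \<longrightarrow>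
    (\<forall>T\<in>\<T>. \<forall>k. cutoff \<Omega> C\<^sub>\<eta> H \<T> T k (\<eta> T k)) \<longrightarrow>
    (\<forall>T\<in>\<T>. \<forall>v\<in>VH \<Omega> \<T>. \<forall>k\<ge>5. \<forall>\<phi>. corrector \<Omega> \<Gamma> A A\<^sub>\<Gamma> I v T \<phi> \<longrightarrow>
      dnorm \<Omega> (far \<Omega> \<T> k T) (grad \<Omega> \<phi>) + gnorm \<Gamma> (far \<Omega> \<T> k T) (tgrad \<Gamma> \<phi>)
        \<le> C\<^sub>0 * exp (- C * real k) * (dnorm \<Omega> T (grad \<Omega> v) + gnorm \<Gamma> T (tgrad \<Gamma> v)))"
proof -
  \<comment> \<open>The constants are fixed before any coefficients are given, when nothing relates
    \<open>\<beta>\<close> to \<open>\<alpha>\<close>; the maximum keeps them positive.\<close>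
  define b where "b = max \<alpha> \<beta>"
  \<comment> \<open>The first summand is the constant of \<open>corrector_step\<close> after
    division by \<open>\<alpha>\<close>; 1 is added so that \<open>c\<close> is positive in every
    case.\<close>
  define c where "c = b / \<alpha> * (local_const C\<^sub>I C\<^sub>\<eta> * (64 * \<gamma>\<^sup>2) ^ 3) + 1"
  define q where "q = c / (1 + c)"
  \<comment> \<open>In \<open>C\<^sub>0\<close> the 2 stems from squaring a sum of two norms,
    \<open>1 / q\<close> from rounding \<open>k / 11\<close> down, and \<open>b / \<alpha>\<close>
    from \<open>corrector_energy\<close>. In \<open>C\<close> the 22 is 11 layers per contraction,
    doubled by the square root of the energy.\<close>
  define C\<^sub>0 where "C\<^sub>0 = sqrt (2 / q) * (b / \<alpha>)"
  define C where "C = - ln q / 22"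
  have b: "0 < b" "\<beta> \<le> b" using assms(4) by (auto simp: b_def)
  have L0: "0 \<le> local_const C\<^sub>I C\<^sub>\<eta> * (64 * \<gamma>\<^sup>2) ^ 3" by (simp add: local_const_def)
  then have "0 \<le> b / \<alpha> * (local_const C\<^sub>I C\<^sub>\<eta> * (64 * \<gamma>\<^sup>2) ^ 3)" using b(1) assms(4) by (intro mult_nonneg_nonneg[OF _ L0]) auto
  then have c: "0 < c" by (simp add: c_def)
  then have q: "0 < q" "q < 1" by (simp_all add: q_def)
  have C: "0 < C" "0 < C\<^sub>0" using q b(1) assms(4) by (simp_all add: C_def C\<^sub>0_def)
  have main: "dnorm \<Omega> (far \<Omega> \<T> k T) (grad \<Omega> \<phi>) + gnorm \<Gamma> (far \<Omega> \<T> k T) (tgrad \<Gamma> \<phi>)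
      \<le> C\<^sub>0 * exp (- C * real k) * (dnorm \<Omega> T (grad \<Omega> v) + gnorm \<Gamma> T (tgrad \<Gamma> v))"
    if coef: "coefficients \<Omega> \<Gamma> \<alpha> \<beta> A A\<^sub>\<Gamma>" and mesh: "mesh \<Omega> \<gamma> H \<T>" and interp: "interpolation \<Omega> \<Gamma> C\<^sub>I H \<T> I"
      and cut: "\<forall>T\<in>\<T>. \<forall>k. cutoff \<Omega> C\<^sub>\<eta> H \<T> T k (\<eta> T k)" and T: "T \<in> \<T>" and v: "v \<in> VH \<Omega> \<T>"
      and cor: "corrector \<Omega> \<Gamma> A A\<^sub>\<Gamma> I v T \<phi>" for A A\<^sub>\<Gamma> H \<T> I \<eta> T v k \<phi>
  proof -
    interpret interpolated_mesh \<Gamma> \<Omega> \<gamma> H \<T> C\<^sub>I I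
      using assms(1-3) mesh interp by unfold_locales (auto simp: polygonal_domain_def)
    have coef': "coefficients \<Omega> \<Gamma> \<alpha> b A A\<^sub>\<Gamma>"
    proof -
      have A: "A \<in> borel_measurable M\<^sub>\<Omega>" "AE x in M\<^sub>\<Omega>. \<alpha> \<le> A x \<and> A x \<le> \<beta>"
        "A\<^sub>\<Gamma> \<in> borel_measurable M\<^sub>\<Gamma>" "AE x in M\<^sub>\<Gamma>. \<alpha> \<le> A\<^sub>\<Gamma> x \<and> A\<^sub>\<Gamma> x \<le> \<beta>"
        using coef by (auto simp: coefficients_def)
      have 1: "AE x in M\<^sub>\<Omega>. \<alpha> \<le> A x \<and> A x \<le> b" using A(2) by eventually_elim (use b(2) in auto)
      have 2: "AE x in M\<^sub>\<Gamma>. \<alpha> \<le> A\<^sub>\<Gamma> x \<and> A\<^sub>\<Gamma> x \<le> b" using A(4) by eventually_elim (use b(2) in auto)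
      show ?thesis unfolding coefficients_def by (intro conjI A(1,3) 1 2)
    qed
    have \<phi>V: "\<phi> \<in> V \<Omega> \<Gamma>" using cor by (simp add: corrector_def Vf_def)
    have vV: "v \<in> V \<Omega> \<Gamma>" using v VH_subset_V by blast
    have bF: "far \<Omega> \<T> j T \<in> sets borel" for j by (rule borel_closed[OF closed_far])
    define e where "e j = energy \<phi> (far \<Omega> \<T> j T)" for j
    have mono: "e j \<le> e i" if "i \<le> j" for i j
      unfolding e_def by (rule energy_mono[OF \<phi>V bF bF far_mono[OF T that]])
    have step: "e (j + 11) \<le> c * (e j - e (j + 11))" for j
    proof -
      let ?R = "\<Union>(ring T j (j + 9))"
      have "energy \<phi> ?R + energy \<phi> (far \<Omega> \<T> (j + 11) T) \<le> energy \<phi> (far \<Omega> \<T> j T)"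
      proof (rule energy_disjoint[OF \<phi>V bF borel_Union[OF ring_subset] bF])
        show "?R \<inter> far \<Omega> \<T> (j + 11) T = {}" by (rule ring_far_disjoint) simp
        show "?R \<union> far \<Omega> \<T> (j + 11) T \<subseteq> far \<Omega> \<T> j T" using ring_far far_mono[OF T, of j "j + 11"] by simp
      qed
      then have r: "energy \<phi> ?R \<le> e j - e (j + 11)" by (simp add: e_def)
      \<comment> \<open>The cutoff controls the energy from layer j + 6 on, but the far region is
        disjoint from the ring on the right-hand side only from layer j + 11 on.\<close>
      have "\<alpha> * e (j + 11) \<le> \<alpha> * e (j + 6)" using mono[of "j + 6" "j + 11"] assms(4) by (intro mult_left_mono) auto
      also have "\<dots> \<le> b * (local_const C\<^sub>I C\<^sub>\<eta> * ((64 * \<gamma>\<^sup>2) ^ 3 * energy \<phi> ?R))"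
        unfolding e_def using cut T b(1) by (intro corrector_step[OF T coef' assms(4) _ _ v cor]) auto
      also have "\<dots> = b * (local_const C\<^sub>I C\<^sub>\<eta> * (64 * \<gamma>\<^sup>2) ^ 3) * energy \<phi> ?R" by (simp only: mult.assoc)
      also have "\<dots> \<le> b * (local_const C\<^sub>I C\<^sub>\<eta> * (64 * \<gamma>\<^sup>2) ^ 3) * (e j - e (j + 11))"
        by (rule mult_left_mono[OF r mult_nonneg_nonneg[OF less_imp_le[OF b(1)] L0]])
      also have "\<dots> = \<alpha> * ((c - 1) * (e j - e (j + 11)))" using assms(4) by (simp add: c_def)
      finally have "e (j + 11) \<le> (c - 1) * (e j - e (j + 11))" using assms(4) by simp
      also have "\<dots> \<le> c * (e j - e (j + 11))" using mono[of j "j + 11"] by (intro mult_right_mono) auto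
      finally show ?thesis .
    qed
    have "e k \<le> q ^ (k div 11) * e 0" unfolding q_def by (rule geometric_decay[where e = e and m = 11, OF c step mono])
    also have "q ^ (k div 11) * e 0 \<le> exp (ln q * real k / 11) / q * ((b / \<alpha>)\<^sup>2 * energy v T)"
    proof (rule mult_mono)
      \<comment> \<open>\<open>ln q\<close> is negative, so a lower bound for
        \<open>k div 11\<close> is what bounds the power from above.\<close>
      have "real k < real (11 * (k div 11) + 11)" by (simp only: of_nat_less_iff)
      then have "real k / 11 - 1 \<le> real (k div 11)" unfolding of_nat_add of_nat_mult of_nat_numeral by linarith
      then have *: "ln q * real (k div 11) \<le> ln q * (real k / 11 - 1)" using q by (intro mult_left_mono_neg) auto
      have "q ^ (k div 11) = exp (real (k div 11) * ln q)" using q by (simp only: exp_of_nat_mult exp_ln)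
      also have "\<dots> \<le> exp (ln q * (real k / 11 - 1))" using * by (simp only: exp_le_cancel_iff mult.commute[of _ "ln q"])
      also have "\<dots> = exp (ln q * real k / 11) / q" using q by (simp add: right_diff_distrib exp_diff)
      finally show "q ^ (k div 11) \<le> exp (ln q * real k / 11) / q" .
      have "e 0 \<le> energy \<phi> UNIV" unfolding e_def by (rule energy_mono[OF \<phi>V bF]) auto
      also have "\<dots> \<le> (b / \<alpha>)\<^sup>2 * energy v T" by (rule corrector_energy[OF T coef' assms(4) v cor])
      finally show "e 0 \<le> (b / \<alpha>)\<^sup>2 * energy v T" .
    qed (use q in \<open>simp_all add: e_def energy_nonneg\<close>)
    finally have ek: "e k \<le> exp (ln q * real k / 11) / q * ((b / \<alpha>)\<^sup>2 * energy v T)" .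
    let ?d = "dnorm \<Omega> (far \<Omega> \<T> k T) (grad \<Omega> \<phi>)" and ?g = "gnorm \<Gamma> (far \<Omega> \<T> k T) (tgrad \<Gamma> \<phi>)"
    let ?n = "dnorm \<Omega> T (grad \<Omega> v) + gnorm \<Gamma> T (tgrad \<Gamma> v)"
    have "(?d + ?g)\<^sup>2 \<le> 2 * e k"
      unfolding e_def energy_norms(1)[OF \<phi>V bF] power2_sum distrib_left using sum_squares_bound[of ?d ?g] by linarith
    also have "\<dots> \<le> 2 * (exp (ln q * real k / 11) / q * ((b / \<alpha>)\<^sup>2 * ?n\<^sup>2))"
    proof -
      have "0 \<le> dnorm \<Omega> T (grad \<Omega> v) * gnorm \<Gamma> T (tgrad \<Gamma> v)" by (rule mult_nonneg_nonneg[OF norm_nonneg])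
      then have "energy v T \<le> ?n\<^sup>2"
        unfolding energy_norms(1)[OF vV borel_triangle[OF T]] power2_sum by linarith
      then have "exp (ln q * real k / 11) / q * ((b / \<alpha>)\<^sup>2 * energy v T) \<le> exp (ln q * real k / 11) / q * ((b / \<alpha>)\<^sup>2 * ?n\<^sup>2)"
        using q by (intro mult_left_mono) auto
      then show ?thesis using ek by linarith
    qed
    also have "\<dots> = (C\<^sub>0 * exp (- C * real k) * ?n)\<^sup>2"
    proof -
      have 1: "(exp (- C * real k))\<^sup>2 = exp (ln q * real k / 11)"
        unfolding exp_double[symmetric] by (rule arg_cong[of _ _ exp]) (simp add: C_def field_simps)
      have 2: "C\<^sub>0\<^sup>2 = 2 / q * (b / \<alpha>)\<^sup>2" using q unfolding C\<^sub>0_def power_mult_distrib by simp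
      show ?thesis unfolding power_mult_distrib 1 2 by (simp add: mult_ac)
    qed
    finally show ?thesis
      by (rule power2_le_imp_le) (intro mult_nonneg_nonneg add_nonneg_nonneg norm_nonneg less_imp_le[OF C(2)] exp_ge_zero)
  qed
  show ?thesis
    by (rule exI[of _ C\<^sub>0], rule conjI[OF C(2)], rule exI[of _ C], rule conjI[OF C(1)],
        intro allI impI ballI, rule main; assumption)
qed

end
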